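(* Let $\frac32<\alpha<2$, $\frac12<\beta\le 1$, $\nu>0$, $\frac12<H<1$. Suppose $f,g,h$ satisfy condition $(\mathbf A_1)$ (see context) for some $\gamma\ge 0$ and that condition $(\mathbf A_2)$ (see context) holds. Put $\widetilde\gamma=\max\{\gamma,\frac{\beta}{\alpha}\}$ and let the initial data $(a,b)$ be $\mathcal F_0$-measurable with $\|a\|_{L^2(\Omega;\mathbb H^{2\widetilde\gamma}(\mathcal D))}+\|b\|_{L^2(\Omega;\mathbb H^{2\widetilde\gamma-\frac{2\beta}{\alpha}}(\mathcal D))}<\infty$. Let $u\in C([0,T];L^2(\Omega;\mathbb H^{2\widetilde\gamma}(\mathcal D)))$ be the mild solution of problem (P) of the context. Then there is a constant $C$ such that $$\sup_{0\le t\le T}\mathbb E\|\partial_tu(t)\|^2_{\mathbb H^{2\widetilde\gamma-\frac{2\beta}{\alpha}}}\le C.$$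
   Context: **Spaces.** $\mathcal D\subset\mathbb R^d$ ($d=1,2,3$) is a bounded convex polygonal domain, $T>0$, and $(\Omega,\mathcal F,\{\mathcal F_t\}_{t\ge0},\mathbb P)$ is a complete filtered probability space with $\mathcal F_0$ containing all null sets. $\{(\lambda_k,\varphi_k)\}_{k\ge1}$ are the Dirichlet eigenpairs of $-\Delta$ on $\mathcal D$, $0<\lambda_1\le\lambda_2\le\cdots$, with $\{\varphi_k\}$ an orthonormal basis of $\mathbb H:=L^2(\mathcal D)$ (inner product $(\cdot,\cdot)$, norm $\|\cdot\|$). For $s\in\mathbb R$, $\mathbb H^s=\mathbb H^s(\mathcal D)$ is the Hilbert space induced by $\|u\|_{\mathbb H^s}^2=\sum_k\lambda_k^s(u,\varphi_k)^2$, and $(-\Delta)^su=\sum_k\lambda_k^s(u,\varphi_k)\varphi_k$. $L^2(\Omega;\mathbb H^s)$ has norm $(\mathbb E\|\cdot\|_{\mathbb H^s}^2)^{1/2}$. $\mathbb U$ is a separable Hilbert space with Hilbert basis $\{e_k\}_{k\ge1}$; $\mathcal L_2^0=\mathcal L_2^0(\mathbb U,\mathbb H)$ is the space of Hilbert–Schmidt operators with $\|R\|_{\mathcal L_2^0}^2=\sum_k\|R\cdot e_k\|^2$, and $\|(-\Delta)^sR\|_{\mathcal L_2^0}^2=\sum_k\|(-\Delta)^s(R\cdot e_k)\|^2$. **Fractional derivative.** For $1<\alpha<2$, $\nu>0$: ${}_0^c\partial_t^{\alpha,\nu}u(t)=e^{-\nu t}\,{}_0^c\partial_t^\alpha[e^{\nu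 t}u(t)]$, where ${}_0^c\partial_t^\alpha w(t)=\frac1{\Gamma(2-\alpha)}\int_0^t(t-s)^{1-\alpha}w''(s)ds$. **Noise.** $\{\xi_k\}$ are mutually independent one-dimensional standard Brownian motions, $\{\xi_k^H\}$ mutually independent one-dimensional fractional Brownian motions of Hurst index $H$ (centered Gaussian, $\mathbb E[\xi^H(t)\xi^H(s)]=\frac12(|t|^{2H}+|s|^{2H}-|t-s|^{2H})$), $\varsigma_k,\varrho_k$ are continuous functions, and formally $\frac{\partial^2\mathbb W}{\partial t\partial x}=\sum_k\varsigma_k(t)\dot\xi_k(t)e_k(x)$, $\frac{\partial^2\mathbb W^H}{\partial t\partial x}=\sum_k\varrho_k(t)\dot\xi_k^H(t)e_k(x)$. Integrals against $\xi_k$ satisfy the Itô isometry; integrals against $\xi^H$ ($H>\frac12$) of $\phi,\psi\in L^2(\Omega\times[0,T])$ are taken in the sense for which they have mean zero and $\mathbb E[\int_0^T\phi\,d\xi^H\int_0^T\psi\,d\xi^H]=H(2H-1)\int_0^T\int_0^T\mathbb E[\phi(s)\psi(r)]|s-r|^{2H-2}drds$. **Problem (P).** ${}_0^c\partial_t^{\alpha,\nu}u+(-\Delta)^\beta u=f(t,u)+g(t,u)\frac{\partial^2\mathbb W}{\partial t\partial x}+h(t,u)\frac{\partial^2\mathbb W^H}{\partial t\partial x}$ in $(0,T]\times\mathcal D$, $u=0$ on $(0,T]\times\partial\mathcal D$, $u(0)=a$, $\partial_tu|_{t=0}=b$. **Mild solution.** With $E_{\alpha,\mu}(z)=\sum_{k\ge0}z^k/\Gamma(k\alpha+\mu)$,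 $\mathcal T^\nu_{\alpha,\beta}(t,x,y)=e^{-\nu t}\sum_k(E_{\alpha,1}(-\lambda_k^\beta t^\alpha)+\nu tE_{\alpha,2}(-\lambda_k^\beta t^\alpha))\varphi_k(x)\varphi_k(y)$, $\mathcal R^\nu_{\alpha,\beta}(t,x,y)=te^{-\nu t}\sum_kE_{\alpha,2}(-\lambda_k^\beta t^\alpha)\varphi_k(x)\varphi_k(y)$, $\mathcal S^\nu_{\alpha,\beta}(t,x,y)=t^{\alpha-1}e^{-\nu t}\sum_kE_{\alpha,\alpha}(-\lambda_k^\beta t^\alpha)\varphi_k(x)\varphi_k(y)$, the mild solution satisfies, for each $t\in[0,T]$, $\mathbb P$-a.s., $u(t,x)=\int_{\mathcal D}\mathcal T^\nu_{\alpha,\beta}(t,x,y)a(y)dy+\int_{\mathcal D}\mathcal R^\nu_{\alpha,\beta}(t,x,y)b(y)dy+\int_0^t\int_{\mathcal D}\mathcal S^\nu_{\alpha,\beta}(t-s,x,y)f(s,u(s,y))dyds+\int_0^t\int_{\mathcal D}\mathcal S^\nu_{\alpha,\beta}(t-s,x,y)g(s,u(s,y))d\mathbb W(s,y)+\int_0^t\int_{\mathcal D}\mathcal S^\nu_{\alpha,\beta}(t-s,x,y)h(s,u(s,y))d\mathbb W^H(s,y)$. The $d\mathbb W$ term means $\sum_{k,l}\varphi_k(x)\int_0^t(t-s)^{\alpha-1}e^{-\nu(t-s)}E_{\alpha,\alpha}(-\lambda_k^\beta(t-s)^\alpha)(g(s,u(s))\cdot e_l,\varphi_k)\varsigma_l(s)d\xi_l(s)$;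 the $d\mathbb W^H$ term is the same with $h,\varrho_l,\xi_l^H$ in place of $g,\varsigma_l,\xi_l$. **Condition $(\mathbf A_1)$** (with parameter $\gamma$). $f:\mathbb R\times\mathbb H\to\mathbb H$, $g,h:\mathbb R\times\mathbb H\to\mathcal L_2^0$, and there is $l>0$ such that: if $0\le\gamma\le\frac\beta\alpha$: for all $t_1,t_2,t\in\mathbb R$, $u_1,u_2,u\in\mathbb H$, $\|f(t_1,u_1)-f(t_2,u_2)\|+\|g(t_1,u_1)-g(t_2,u_2)\|_{\mathcal L_2^0}+\|h(t_1,u_1)-h(t_2,u_2)\|_{\mathcal L_2^0}\le l(|t_1-t_2|+\|u_1-u_2\|)$ and $\|f(t,u)\|+\|g(t,u)\|_{\mathcal L_2^0}+\|h(t,u)\|_{\mathcal L_2^0}\le l(1+\|u\|)$; if $\gamma>\frac\beta\alpha$: for all $t_1,t_2,t\in\mathbb R$, $u_1,u_2,u\in\mathbb H^{2\gamma-\frac{2\beta}\alpha}$, the same two inequalities hold with $(-\Delta)^{\gamma-\frac\beta\alpha}$ applied inside every norm (to the differences of $f,g,h$ and to $u_1-u_2$, resp. to $f,g,h$ and to $u$). **Condition $(\mathbf A_2)$.** $|\varsigma_k(t)|\le\mu_k$, $|\varrho_k(t)|\le\widetilde\mu_k$, $|\varsigma_k'(t)|\le\gamma_k$, $|\varrho_k'(t)|\le\widetilde\gamma_k$ for all $t\in[0,T]$, where $\{\mu_k\},\{\widetilde\mu_k\},\{\gamma_k\},\{\widetilde\gamma_k\}$ are rapidly decaying as $k$ increases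 (so as to ensure convergence of the series; no explicit rate is specified). *)

theory Defs
  imports "HOL-Probability.Probability"
begin

section \<open>The spaces over the domain\<close>

text \<open>
  Elements of \<open>L\<^sup>2(D)\<close> are represented by square-integrable functions; equality in \<open>L\<^sup>2(D)\<close>
  is equality almost everywhere, \<open>L2_eq\<close>.
\<close>

definition L2 :: "'d::euclidean_space set \<Rightarrow> ('d \<Rightarrow> real) set" where
  "L2 D = {v \<in> borel_measurable (lebesgue_on D). integrable (lebesgue_on D) (\<lambda>x. (v x)\<^sup>2)}"

definition L2_inner :: "'d::euclidean_space set \<Rightarrow> ('d \<Rightarrow> real) \<Rightarrow> ('d \<Rightarrow> real) \<Rightarrow> real" where
  "L2_inner D v w = (LINT x|lebesgue_on D. v x * w x)"

definition L2_norm :: "'d::euclidean_space set \<Rightarrow> ('d \<Rightarrow> real) \<Rightarrow> real" where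
  "L2_norm D v = sqrt (L2_inner D v v)"

definition L2_eq :: "'d::euclidean_space set \<Rightarrow> ('d \<Rightarrow> real) \<Rightarrow> ('d \<Rightarrow> real) \<Rightarrow> bool" where
  "L2_eq D v w \<longleftrightarrow> (AE x in lebesgue_on D. v x = w x)"

definition convex_polygonal_domain :: "'d::euclidean_space set \<Rightarrow> bool" where
  "convex_polygonal_domain D \<longleftrightarrow> D \<noteq> {} \<and> (\<exists>P. polytope P \<and> D = interior P)"

text \<open>\<open>H\<^sub>0\<^sup>1(D)\<close> is the closure of \<open>C\<^sub>c\<^sup>1(D)\<close> in the \<open>H\<^sup>1\<close>-norm; each function is paired with
  its (weak) gradient.\<close>

definition C1_compact :: "'d::euclidean_space set \<Rightarrow> ('d \<Rightarrow> real) \<Rightarrow> ('d \<Rightarrow> 'd) \<Rightarrow> bool" where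
  "C1_compact D v G \<longleftrightarrow>
     (\<exists>K. compact K \<and> K \<subseteq> D \<and> (\<forall>x. x \<notin> K \<longrightarrow> v x = 0)) \<and>
     (\<forall>x. GDERIV v x :> G x) \<and> continuous_on UNIV G"

definition H10_grad :: "'d::euclidean_space set \<Rightarrow> ('d \<Rightarrow> real) \<Rightarrow> ('d \<Rightarrow> 'd) \<Rightarrow> bool" where
  "H10_grad D v G \<longleftrightarrow> v \<in> L2 D \<and>
     G \<in> borel_measurable (lebesgue_on D) \<and>
     integrable (lebesgue_on D) (\<lambda>x. (norm (G x))\<^sup>2) \<and>
     (\<exists>w Gw. (\<forall>n. C1_compact D (w n) (Gw n)) \<and>
        (\<lambda>n. LINT x|lebesgue_on D. (w n x - v x)\<^sup>2) \<longlonglongrightarrow> 0 \<and>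
        (\<lambda>n. LINT x|lebesgue_on D. (norm (Gw n x - G x))\<^sup>2) \<longlonglongrightarrow> 0)"

definition dirichlet_eigenpair :: "'d::euclidean_space set \<Rightarrow> real \<Rightarrow> ('d \<Rightarrow> real) \<Rightarrow> bool" where
  "dirichlet_eigenpair D c p \<longleftrightarrow> \<not> L2_eq D p (\<lambda>x. 0) \<and>
     (\<exists>G. H10_grad D p G \<and>
        (\<forall>v Gv. C1_compact D v Gv \<longrightarrow>
           (LINT x|lebesgue_on D. G x \<bullet> Gv x) = c * L2_inner D p v))"

text \<open>\<open>v = \<Sum>\<^sub>k c\<^sub>k \<phi>\<^sub>k\<close> with convergence in \<open>L\<^sup>2(D)\<close>.\<close>

definition L2_sums :: "'d::euclidean_space set \<Rightarrow> (nat \<Rightarrow> 'd \<Rightarrow> real) \<Rightarrow> (nat \<Rightarrow> real) \<Rightarrow> ('d \<Rightarrow> real) \<Rightarrow> bool"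
  where
  "L2_sums D \<phi> c v \<longleftrightarrow> v \<in> L2 D \<and>
     (\<lambda>n. L2_norm D (\<lambda>x. (\<Sum>k<n. c k * \<phi> k x) - v x)) \<longlonglongrightarrow> 0"

text \<open>Sequences indexed by \<open>k \<ge> 1\<close> in the usual notation are indexed from 0 here.\<close>

definition dirichlet_eigenbasis :: "'d::euclidean_space set \<Rightarrow> (nat \<Rightarrow> real) \<Rightarrow> (nat \<Rightarrow> 'd \<Rightarrow> real) \<Rightarrow> bool"
  where
  "dirichlet_eigenbasis D lam \<phi> \<longleftrightarrow> 0 < lam 0 \<and> incseq lam \<and>
     (\<forall>k. dirichlet_eigenpair D (lam k) (\<phi> k)) \<and>
     (\<forall>j k. L2_inner D (\<phi> j) (\<phi> k) = (if j = k then 1 else 0)) \<and>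
     (\<forall>v\<in>L2 D. L2_sums D \<phi> (\<lambda>k. L2_inner D v (\<phi> k)) v)"

text \<open>
  \<open>Hs\<close> is the space \<open>\<^bold>H\<^sup>s\<close> as a subspace of \<open>L\<^sup>2(D)\<close>, so it is only meant for \<open>s \<ge> 0\<close>.
  \<open>Hs_norm2\<close> is the squared norm, with value \<open>\<infinity>\<close> outside of \<open>\<^bold>H\<^sup>s\<close>.
\<close>

definition Hs :: "'d::euclidean_space set \<Rightarrow> (nat \<Rightarrow> real) \<Rightarrow> (nat \<Rightarrow> 'd \<Rightarrow> real) \<Rightarrow> real \<Rightarrow> ('d \<Rightarrow> real) set"
  where
  "Hs D lam \<phi> s = {v \<in> L2 D. summable (\<lambda>k. lam k powr s * (L2_inner D v (\<phi> k))\<^sup>2)}"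

definition Hs_norm2 :: "'d::euclidean_space set \<Rightarrow> (nat \<Rightarrow> real) \<Rightarrow> (nat \<Rightarrow> 'd \<Rightarrow> real) \<Rightarrow> real \<Rightarrow> ('d \<Rightarrow> real) \<Rightarrow> ennreal"
  where
  "Hs_norm2 D lam \<phi> s v = (\<Sum>k. ennreal (lam k powr s * (L2_inner D v (\<phi> k))\<^sup>2))"

definition frac_lap :: "'d::euclidean_space set \<Rightarrow> (nat \<Rightarrow> real) \<Rightarrow> (nat \<Rightarrow> 'd \<Rightarrow> real) \<Rightarrow> real \<Rightarrow> ('d \<Rightarrow> real) \<Rightarrow> ('d \<Rightarrow> real)"
  where
  "frac_lap D lam \<phi> s v = (SOME w. L2_sums D \<phi> (\<lambda>k. lam k powr s * L2_inner D v (\<phi> k)) w)"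


section \<open>Hilbert--Schmidt operators\<close>

definition hilbert_basis :: "(nat \<Rightarrow> 'u::real_inner) \<Rightarrow> bool" where
  "hilbert_basis e \<longleftrightarrow> (\<forall>j k. e j \<bullet> e k = (if j = k then 1 else 0)) \<and>
     closure (span (range e)) = UNIV"

definition hs_norm :: "'d::euclidean_space set \<Rightarrow> (nat \<Rightarrow> 'u) \<Rightarrow> ('u \<Rightarrow> 'd \<Rightarrow> real) \<Rightarrow> real" where
  "hs_norm D e R = sqrt (\<Sum>k. (L2_norm D (R (e k)))\<^sup>2)"

definition hilbert_schmidt :: "'d::euclidean_space set \<Rightarrow> (nat \<Rightarrow> 'u) \<Rightarrow> ('u::real_inner \<Rightarrow> 'd \<Rightarrow> real) \<Rightarrow> bool"
  where
  "hilbert_schmidt D e R \<longleftrightarrow>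
     (\<forall>y. R y \<in> L2 D) \<and>
     (\<forall>y z. L2_eq D (R (y + z)) (\<lambda>x. R y x + R z x)) \<and>
     (\<forall>c y. L2_eq D (R (c *\<^sub>R y)) (\<lambda>x. c * R y x)) \<and>
     (\<exists>B. \<forall>y. L2_norm D (R y) \<le> B * norm y) \<and>
     summable (\<lambda>k. (L2_norm D (R (e k)))\<^sup>2)"


section \<open>Conditions on the coefficients\<close>

text \<open>The two inequalities of the first condition, for arguments from \<open>V\<close> and with an operator
  \<open>\<Lambda>\<close> applied inside every norm.\<close>

definition lipschitz_growth ::
  "'d::euclidean_space set \<Rightarrow> (nat \<Rightarrow> 'u) \<Rightarrow> ('d \<Rightarrow> real) set \<Rightarrow> (('d \<Rightarrow> real) \<Rightarrow> ('d \<Rightarrow> real)) \<Rightarrow>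
   (real \<Rightarrow> ('d \<Rightarrow> real) \<Rightarrow> ('d \<Rightarrow> real)) \<Rightarrow>
   (real \<Rightarrow> ('d \<Rightarrow> real) \<Rightarrow> 'u \<Rightarrow> ('d \<Rightarrow> real)) \<Rightarrow>
   (real \<Rightarrow> ('d \<Rightarrow> real) \<Rightarrow> 'u \<Rightarrow> ('d \<Rightarrow> real)) \<Rightarrow> real \<Rightarrow> bool"
  where
  "lipschitz_growth D e V \<Lambda> f g h l \<longleftrightarrow>
     (\<forall>t1 t2. \<forall>u1\<in>V. \<forall>u2\<in>V.
        L2_norm D (\<Lambda> (\<lambda>x. f t1 u1 x - f t2 u2 x)) +
        hs_norm D e (\<lambda>y. \<Lambda> (\<lambda>x. g t1 u1 y x - g t2 u2 y x)) +
        hs_norm D e (\<lambda>y. \<Lambda> (\<lambda>x. h t1 u1 y x - h t2 u2 y x))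
        \<le> l * (\<bar>t1 - t2\<bar> + L2_norm D (\<Lambda> (\<lambda>x. u1 x - u2 x)))) \<and>
     (\<forall>t. \<forall>u\<in>V.
        L2_norm D (\<Lambda> (f t u)) + hs_norm D e (\<lambda>y. \<Lambda> (g t u y)) + hs_norm D e (\<lambda>y. \<Lambda> (h t u y))
        \<le> l * (1 + L2_norm D (\<Lambda> u)))"

definition H_map :: "'d::euclidean_space set \<Rightarrow> (real \<Rightarrow> ('d \<Rightarrow> real) \<Rightarrow> ('d \<Rightarrow> real)) \<Rightarrow> bool" where
  "H_map D f \<longleftrightarrow> (\<forall>t. \<forall>v\<in>L2 D. f t v \<in> L2 D) \<and>
     (\<forall>t. \<forall>v\<in>L2 D. \<forall>w\<in>L2 D. L2_eq D v w \<longrightarrow> L2_eq D (f t v) (f t w))"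

definition HS_map ::
  "'d::euclidean_space set \<Rightarrow> (nat \<Rightarrow> 'u::real_inner) \<Rightarrow> (real \<Rightarrow> ('d \<Rightarrow> real) \<Rightarrow> 'u \<Rightarrow> ('d \<Rightarrow> real)) \<Rightarrow> bool"
  where
  "HS_map D e g \<longleftrightarrow> (\<forall>t. \<forall>v\<in>L2 D. hilbert_schmidt D e (g t v)) \<and>
     (\<forall>t y. \<forall>v\<in>L2 D. \<forall>w\<in>L2 D. L2_eq D v w \<longrightarrow> L2_eq D (g t v y) (g t w y))"

text \<open>For \<open>\<gamma> > \<beta>/\<alpha>\<close> the inequalities presuppose that the norms on the left are finite;
  \<open>frac_lap_finite\<close> and \<open>frac_lap_hs_finite\<close> make this explicit.\<close>

definition frac_lap_finite ::
  "'d::euclidean_space set \<Rightarrow> (nat \<Rightarrow> real) \<Rightarrow> (nat \<Rightarrow> 'd \<Rightarrow> real) \<Rightarrow> real \<Rightarrow>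
   (real \<Rightarrow> ('d \<Rightarrow> real) \<Rightarrow> ('d \<Rightarrow> real)) \<Rightarrow> bool"
  where
  "frac_lap_finite D lam \<phi> \<sigma> f \<longleftrightarrow>
     (\<forall>t. \<forall>v\<in>Hs D lam \<phi> (2 * \<sigma>). f t v \<in> Hs D lam \<phi> (2 * \<sigma>))"

definition frac_lap_hs_finite ::
  "'d::euclidean_space set \<Rightarrow> (nat \<Rightarrow> real) \<Rightarrow> (nat \<Rightarrow> 'd \<Rightarrow> real) \<Rightarrow> (nat \<Rightarrow> 'u) \<Rightarrow> real \<Rightarrow>
   (real \<Rightarrow> ('d \<Rightarrow> real) \<Rightarrow> 'u \<Rightarrow> ('d \<Rightarrow> real)) \<Rightarrow> bool"
  where
  "frac_lap_hs_finite D lam \<phi> e \<sigma> g \<longleftrightarrow>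
     (\<forall>t. \<forall>v\<in>Hs D lam \<phi> (2 * \<sigma>).
        (\<forall>k. g t v (e k) \<in> Hs D lam \<phi> (2 * \<sigma>)) \<and>
        summable (\<lambda>k. (L2_norm D (frac_lap D lam \<phi> \<sigma> (g t v (e k))))\<^sup>2))"

definition condition_A1 ::
  "'d::euclidean_space set \<Rightarrow> (nat \<Rightarrow> real) \<Rightarrow> (nat \<Rightarrow> 'd \<Rightarrow> real) \<Rightarrow> (nat \<Rightarrow> 'u::real_inner) \<Rightarrow>
   real \<Rightarrow> real \<Rightarrow> real \<Rightarrow>
   (real \<Rightarrow> ('d \<Rightarrow> real) \<Rightarrow> ('d \<Rightarrow> real)) \<Rightarrow>
   (real \<Rightarrow> ('d \<Rightarrow> real) \<Rightarrow> 'u \<Rightarrow> ('d \<Rightarrow> real)) \<Rightarrow>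
   (real \<Rightarrow> ('d \<Rightarrow> real) \<Rightarrow> 'u \<Rightarrow> ('d \<Rightarrow> real)) \<Rightarrow> bool"
  where
  "condition_A1 D lam \<phi> e \<alpha> \<beta> \<gamma> f g h \<longleftrightarrow>
     H_map D f \<and> HS_map D e g \<and> HS_map D e h \<and>
     (\<exists>l>0.
        (0 \<le> \<gamma> \<and> \<gamma> \<le> \<beta> / \<alpha> \<longrightarrow> lipschitz_growth D e (L2 D) (\<lambda>v. v) f g h l) \<and>
        (\<gamma> > \<beta> / \<alpha> \<longrightarrow>
           frac_lap_finite D lam \<phi> (\<gamma> - \<beta> / \<alpha>) f \<and>
           frac_lap_hs_finite D lam \<phi> e (\<gamma> - \<beta> / \<alpha>) g \<and>
           frac_lap_hs_finite D lam \<phi> e (\<gamma> - \<beta> / \<alpha>) h \<and>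
           lipschitz_growth D e (Hs D lam \<phi> (2 * \<gamma> - 2 * \<beta> / \<alpha>))
             (frac_lap D lam \<phi> (\<gamma> - \<beta> / \<alpha>)) f g h l))"

text \<open>No decay rate is prescribed for the bounding sequences; summability is what is needed for
  the noise series to converge.\<close>

definition condition_A2 :: "real \<Rightarrow> (nat \<Rightarrow> real \<Rightarrow> real) \<Rightarrow> (nat \<Rightarrow> real \<Rightarrow> real) \<Rightarrow> bool" where
  "condition_A2 T \<kappa> \<rho> \<longleftrightarrow>
     (\<exists>\<mu> \<mu>' \<delta> \<delta>' \<kappa>' \<rho>'.
        summable \<mu> \<and> summable \<mu>' \<and> summable \<delta> \<and> summable \<delta>' \<and>
        (\<forall>k. continuous_on {0..T} (\<kappa> k) \<and> continuous_on {0..T} (\<rho> k)) \<and>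
        (\<forall>k. \<forall>t\<in>{0..T}.
           (\<kappa> k has_real_derivative \<kappa>' k t) (at t within {0..T}) \<and>
           (\<rho> k has_real_derivative \<rho>' k t) (at t within {0..T}) \<and>
           \<bar>\<kappa> k t\<bar> \<le> \<mu> k \<and> \<bar>\<rho> k t\<bar> \<le> \<mu>' k \<and>
           \<bar>\<kappa>' k t\<bar> \<le> \<delta> k \<and> \<bar>\<rho>' k t\<bar> \<le> \<delta>' k))"


section \<open>Filtered probability space and noise\<close>

definition complete_filtered_prob_space :: "'w measure \<Rightarrow> (real \<Rightarrow> 'w measure) \<Rightarrow> bool" where
  "complete_filtered_prob_space M F \<longleftrightarrow> prob_space M \<and> complete_measure M \<and>
     (\<forall>t\<ge>0. subalgebra M (F t)) \<and>
     (\<forall>s t. 0 \<le> s \<and> s \<le> t \<longrightarrow> sets (F s) \<subseteq> sets (F t)) \<and>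
     null_sets M \<subseteq> sets (F 0)"

definition indep_processes :: "'w measure \<Rightarrow> (nat \<Rightarrow> real \<Rightarrow> 'w \<Rightarrow> real) \<Rightarrow> bool" where
  "indep_processes M X \<longleftrightarrow>
     prob_space.indep_vars M (\<lambda>_. \<Pi>\<^sub>M t\<in>{0..}. borel) (\<lambda>k \<omega>. \<lambda>t\<in>{0..}. X k t \<omega>) UNIV"

definition brownian_motion :: "'w measure \<Rightarrow> (real \<Rightarrow> 'w measure) \<Rightarrow> (real \<Rightarrow> 'w \<Rightarrow> real) \<Rightarrow> bool" where
  "brownian_motion M F W \<longleftrightarrow>
     (\<forall>t\<ge>0. W t \<in> borel_measurable (F t)) \<and>
     (AE \<omega> in M. W 0 \<omega> = 0) \<and>
     (AE \<omega> in M. continuous_on {0..} (\<lambda>t. W t \<omega>)) \<and>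
     (\<forall>s t. 0 \<le> s \<and> s < t \<longrightarrow>
        distributed M lborel (\<lambda>\<omega>. W t \<omega> - W s \<omega>) (normal_density 0 (sqrt (t - s))) \<and>
        prob_space.indep_set M (sets (F s))
          (sets (vimage_algebra (space M) (\<lambda>\<omega>. W t \<omega> - W s \<omega>) borel)))"

text \<open>Centred Gaussian random variables, including the degenerate one.\<close>

definition centred_gaussian :: "'w measure \<Rightarrow> ('w \<Rightarrow> real) \<Rightarrow> bool" where
  "centred_gaussian M Z \<longleftrightarrow> Z \<in> borel_measurable M \<and>
     ((AE \<omega> in M. Z \<omega> = 0) \<or> (\<exists>\<sigma>>0. distributed M lborel Z (normal_density 0 \<sigma>)))"

definition fractional_brownian_motion :: "'w measure \<Rightarrow> real \<Rightarrow> (real \<Rightarrow> 'w \<Rightarrow> real) \<Rightarrow> bool" where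
  "fractional_brownian_motion M H X \<longleftrightarrow>
     (\<forall>A c. finite A \<and> A \<subseteq> {0..} \<longrightarrow> centred_gaussian M (\<lambda>\<omega>. \<Sum>t\<in>A. c t * X t \<omega>)) \<and>
     (\<forall>s\<ge>0. \<forall>t\<ge>0. prob_space.expectation M (\<lambda>\<omega>. X t \<omega> * X s \<omega>) =
        (\<bar>t\<bar> powr (2 * H) + \<bar>s\<bar> powr (2 * H) - \<bar>t - s\<bar> powr (2 * H)) / 2)"


section \<open>Stochastic integrals\<close>

text \<open>\<open>L\<^sup>2(\<Omega> \<times> [0,T])\<close>, with the time variable as first argument.\<close>

definition L2_process :: "'w measure \<Rightarrow> real \<Rightarrow> (real \<Rightarrow> 'w \<Rightarrow> real) \<Rightarrow> bool" where
  "L2_process M T X \<longleftrightarrow>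
     (\<lambda>(s, \<omega>). X s \<omega>) \<in> borel_measurable (restrict_space lborel {0..T} \<Otimes>\<^sub>M M) \<and>
     (\<integral>\<^sup>+\<omega>. \<integral>\<^sup>+s. ennreal ((X s \<omega>)\<^sup>2) \<partial>(restrict_space lborel {0..T}) \<partial>M) < \<infinity>"

text \<open>Simple adapted processes \<open>\<Sum>\<^bsub>i<n\<^esub> \<eta>\<^sub>i \<one>\<^bsub>(\<tau>\<^sub>i, \<tau>\<^sub>i\<^sub>+\<^sub>1]\<^esub>\<close> on \<open>[0,t]\<close> and the Ito integral as the mean-square limit of
  the elementary integrals.\<close>

definition simple_data ::
  "(real \<Rightarrow> 'w measure) \<Rightarrow> real \<Rightarrow> nat \<Rightarrow> (nat \<Rightarrow> real) \<Rightarrow> (nat \<Rightarrow> 'w \<Rightarrow> real) \<Rightarrow> bool"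
  where
  "simple_data F t n \<tau> \<eta> \<longleftrightarrow> 0 \<le> \<tau> 0 \<and> \<tau> n \<le> t \<and>
     (\<forall>i<n. \<tau> i \<le> \<tau> (Suc i) \<and> \<eta> i \<in> borel_measurable (F (\<tau> i)) \<and>
        (\<exists>B. \<forall>\<omega>\<in>space (F (\<tau> i)). \<bar>\<eta> i \<omega>\<bar> \<le> B))"

definition simple_process :: "nat \<Rightarrow> (nat \<Rightarrow> real) \<Rightarrow> (nat \<Rightarrow> 'w \<Rightarrow> real) \<Rightarrow> real \<Rightarrow> 'w \<Rightarrow> real" where
  "simple_process n \<tau> \<eta> s \<omega> = (\<Sum>i<n. \<eta> i \<omega> * indicator {\<tau> i<..\<tau> (Suc i)} s)"

definition simple_integral ::
  "(real \<Rightarrow> 'w \<Rightarrow> real) \<Rightarrow> nat \<Rightarrow> (nat \<Rightarrow> real) \<Rightarrow> (nat \<Rightarrow> 'w \<Rightarrow> real) \<Rightarrow> 'w \<Rightarrow> real"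
  where
  "simple_integral W n \<tau> \<eta> \<omega> = (\<Sum>i<n. \<eta> i \<omega> * (W (\<tau> (Suc i)) \<omega> - W (\<tau> i) \<omega>))"

definition has_ito_integral ::
  "'w measure \<Rightarrow> (real \<Rightarrow> 'w measure) \<Rightarrow> (real \<Rightarrow> 'w \<Rightarrow> real) \<Rightarrow> real \<Rightarrow>
   (real \<Rightarrow> 'w \<Rightarrow> real) \<Rightarrow> ('w \<Rightarrow> real) \<Rightarrow> bool"
  where
  "has_ito_integral M F W t X Y \<longleftrightarrow>
     L2_process M t X \<and> Y \<in> borel_measurable M \<and>
     (\<exists>n \<tau> \<eta>. (\<forall>m. simple_data F t (n m) (\<tau> m) (\<eta> m)) \<and>
        (\<lambda>m. \<integral>\<^sup>+\<omega>. \<integral>\<^sup>+s. ennreal ((X s \<omega> - simple_process (n m) (\<tau> m) (\<eta> m) s \<omega>)\<^sup>2)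
               \<partial>(restrict_space lborel {0..t}) \<partial>M) \<longlonglongrightarrow> 0 \<and>
        (\<lambda>m. \<integral>\<^sup>+\<omega>. ennreal ((Y \<omega> - simple_integral W (n m) (\<tau> m) (\<eta> m) \<omega>)\<^sup>2) \<partial>M) \<longlonglongrightarrow> 0)"

text \<open>
  \<open>J\<close> is an integral over \<open>[0,T]\<close> against the fractional Brownian motion \<open>X\<close>, defined on all of
  \<open>L\<^sup>2(\<Omega> \<times> [0,T])\<close>: square-integrable and of mean zero, with the covariance identity for \<open>H > 1/2\<close>, and
  equal to the increments of \<open>X\<close> on deterministic indicators. By the covariance
  identity it is almost surely linear and independent of the representative.
\<close>

definition fbm_integral ::
  "'w measure \<Rightarrow> real \<Rightarrow> real \<Rightarrow> (real \<Rightarrow> 'w \<Rightarrow> real) \<Rightarrow> ((real \<Rightarrow> 'w \<Rightarrow> real) \<Rightarrow> 'w \<Rightarrow> real) \<Rightarrow> bool"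
  where
  "fbm_integral M T H X J \<longleftrightarrow>
     (\<forall>Y. L2_process M T Y \<longrightarrow>
        J Y \<in> borel_measurable M \<and> integrable M (\<lambda>\<omega>. (J Y \<omega>)\<^sup>2) \<and>
        prob_space.expectation M (J Y) = 0) \<and>
     (\<forall>Y Z. L2_process M T Y \<and> L2_process M T Z \<longrightarrow>
        prob_space.expectation M (\<lambda>\<omega>. J Y \<omega> * J Z \<omega>) =
        H * (2 * H - 1) *
          (LINT s:{0..T}|lborel. LINT r:{0..T}|lborel.
             prob_space.expectation M (\<lambda>\<omega>. Y s \<omega> * Z r \<omega>) * \<bar>s - r\<bar> powr (2 * H - 2))) \<and>
     (\<forall>s t. 0 \<le> s \<and> s \<le> t \<and> t \<le> T \<longrightarrow>
        (AE \<omega> in M. J (\<lambda>r _. indicator {s<..t} r) \<omega> = X t \<omega> - X s \<omega>))"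


section \<open>Random elements of the function spaces\<close>

text \<open>Measurability is weak measurability, which agrees with strong measurability since
  \<open>L\<^sup>2(D)\<close> is separable.\<close>

definition random_Hs ::
  "'d::euclidean_space set \<Rightarrow> (nat \<Rightarrow> real) \<Rightarrow> (nat \<Rightarrow> 'd \<Rightarrow> real) \<Rightarrow> 'w measure \<Rightarrow> real \<Rightarrow>
   ('w \<Rightarrow> 'd \<Rightarrow> real) \<Rightarrow> bool"
  where
  "random_Hs D lam \<phi> M s X \<longleftrightarrow> (\<forall>\<omega>\<in>space M. X \<omega> \<in> Hs D lam \<phi> s) \<and>
     (\<forall>v\<in>L2 D. (\<lambda>\<omega>. L2_inner D (X \<omega>) v) \<in> borel_measurable M)"

definition second_moment ::
  "'d::euclidean_space set \<Rightarrow> (nat \<Rightarrow> real) \<Rightarrow> (nat \<Rightarrow> 'd \<Rightarrow> real) \<Rightarrow> 'w measure \<Rightarrow> real \<Rightarrow>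
   ('w \<Rightarrow> 'd \<Rightarrow> real) \<Rightarrow> ennreal"
  where
  "second_moment D lam \<phi> M s X = (\<integral>\<^sup>+\<omega>. Hs_norm2 D lam \<phi> s (X \<omega>) \<partial>M)"

text \<open>\<open>u \<in> C([0,T]; L\<^sup>2(\<Omega>; \<^bold>H\<^sup>s))\<close>\<close>

definition ms_continuous ::
  "'d::euclidean_space set \<Rightarrow> (nat \<Rightarrow> real) \<Rightarrow> (nat \<Rightarrow> 'd \<Rightarrow> real) \<Rightarrow> 'w measure \<Rightarrow> real \<Rightarrow> real \<Rightarrow>
   (real \<Rightarrow> 'w \<Rightarrow> 'd \<Rightarrow> real) \<Rightarrow> bool"
  where
  "ms_continuous D lam \<phi> M T s u \<longleftrightarrow>
     (\<forall>t\<in>{0..T}. random_Hs D lam \<phi> M s (u t) \<and> second_moment D lam \<phi> M s (u t) < \<infinity> \<and>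
        ((\<lambda>r. second_moment D lam \<phi> M s (\<lambda>\<omega> x. u r \<omega> x - u t \<omega> x)) \<longlongrightarrow> 0)
          (at t within {0..T}))"

text \<open>\<open>v = \<partial>\<^sub>t u\<close> on \<open>[0,T]\<close>, as limit of the difference quotients in \<open>L\<^sup>2(\<Omega>; L\<^sup>2(D))\<close>
  (one-sided at the end points).\<close>

definition has_time_derivative ::
  "'d::euclidean_space set \<Rightarrow> (nat \<Rightarrow> real) \<Rightarrow> (nat \<Rightarrow> 'd \<Rightarrow> real) \<Rightarrow> 'w measure \<Rightarrow> real \<Rightarrow>
   (real \<Rightarrow> 'w \<Rightarrow> 'd \<Rightarrow> real) \<Rightarrow> (real \<Rightarrow> 'w \<Rightarrow> 'd \<Rightarrow> real) \<Rightarrow> bool"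
  where
  "has_time_derivative D lam \<phi> M T u v \<longleftrightarrow>
     (\<forall>t\<in>{0..T}. random_Hs D lam \<phi> M 0 (v t) \<and> second_moment D lam \<phi> M 0 (v t) < \<infinity> \<and>
        ((\<lambda>r. second_moment D lam \<phi> M 0 (\<lambda>\<omega> x. (u r \<omega> x - u t \<omega> x) / (r - t) - v t \<omega> x)) \<longlongrightarrow> 0)
          (at t within {0..T}))"


section \<open>Mild solutions\<close>

definition mittag_leffler :: "real \<Rightarrow> real \<Rightarrow> real \<Rightarrow> real" where
  "mittag_leffler \<alpha> \<mu> z = (\<Sum>k. z ^ k / Gamma (real k * \<alpha> + \<mu>))"

text \<open>The \<open>\<lambda>\<close>-components of the solution kernels: \<open>\<T>(t,x,y) = \<Sum>\<^sub>k T_kernel \<alpha> \<beta> \<nu> \<lambda>\<^sub>k t * \<phi>\<^sub>k(x) * \<phi>\<^sub>k(y)\<close>, and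
  likewise for the other two.\<close>

definition T_kernel :: "real \<Rightarrow> real \<Rightarrow> real \<Rightarrow> real \<Rightarrow> real \<Rightarrow> real" where
  "T_kernel \<alpha> \<beta> \<nu> c t = exp (- \<nu> * t) *
     (mittag_leffler \<alpha> 1 (- (c powr \<beta>) * t powr \<alpha>) + \<nu> * t * mittag_leffler \<alpha> 2 (- (c powr \<beta>) * t powr \<alpha>))"

definition R_kernel :: "real \<Rightarrow> real \<Rightarrow> real \<Rightarrow> real \<Rightarrow> real \<Rightarrow> real" where
  "R_kernel \<alpha> \<beta> \<nu> c t = t * exp (- \<nu> * t) * mittag_leffler \<alpha> 2 (- (c powr \<beta>) * t powr \<alpha>)"

definition S_kernel :: "real \<Rightarrow> real \<Rightarrow> real \<Rightarrow> real \<Rightarrow> real \<Rightarrow> real" where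
  "S_kernel \<alpha> \<beta> \<nu> c t = t powr (\<alpha> - 1) * exp (- \<nu> * t) * mittag_leffler \<alpha> \<alpha> (- (c powr \<beta>) * t powr \<alpha>)"

text \<open>\<open>N = \<Sum>\<^sub>k\<^sub>,\<^sub>l J\<^sub>k\<^sub>l \<phi>\<^sub>k\<close> with (unconditional) convergence in \<open>L\<^sup>2(\<Omega>; L\<^sup>2(D))\<close>.\<close>

definition noise_sums ::
  "'d::euclidean_space set \<Rightarrow> (nat \<Rightarrow> real) \<Rightarrow> (nat \<Rightarrow> 'd \<Rightarrow> real) \<Rightarrow> 'w measure \<Rightarrow>
   (nat \<Rightarrow> nat \<Rightarrow> 'w \<Rightarrow> real) \<Rightarrow> ('w \<Rightarrow> 'd \<Rightarrow> real) \<Rightarrow> bool"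
  where
  "noise_sums D lam \<phi> M J N \<longleftrightarrow> random_Hs D lam \<phi> M 0 N \<and>
     ((\<lambda>A. second_moment D lam \<phi> M 0 (\<lambda>\<omega> x. (\<Sum>(k, l)\<in>A. J k l \<omega> * \<phi> k x) - N \<omega> x)) \<longlongrightarrow> 0)
       (finite_subsets_at_top UNIV)"

text \<open>
  The last clause is the variation-of-constants formula, read for each \<open>t\<close> almost surely in
  \<open>L\<^sup>2(D)\<close>. The terms \<open>p\<close>, \<open>q\<close>, \<open>z\<close> stem from \<open>a\<close>, \<open>b\<close> and \<open>f\<close>; \<open>N\<close> and \<open>N'\<close> are the integrals with respect to
  the Wiener and the fractional noise. \<open>I\<close> is the family of integrals over \<open>[0,T]\<close> against the
  fractional Brownian motions, so that the integrals over \<open>[0,t]\<close> are obtained by an indicator.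
\<close>

definition mild_solution ::
  "'d::euclidean_space set \<Rightarrow> (nat \<Rightarrow> real) \<Rightarrow> (nat \<Rightarrow> 'd \<Rightarrow> real) \<Rightarrow>
   (nat \<Rightarrow> 'u) \<Rightarrow> 'w measure \<Rightarrow> (real \<Rightarrow> 'w measure) \<Rightarrow> real \<Rightarrow>
   (nat \<Rightarrow> real \<Rightarrow> 'w \<Rightarrow> real) \<Rightarrow> (nat \<Rightarrow> (real \<Rightarrow> 'w \<Rightarrow> real) \<Rightarrow> 'w \<Rightarrow> real) \<Rightarrow>
   (nat \<Rightarrow> real \<Rightarrow> real) \<Rightarrow> (nat \<Rightarrow> real \<Rightarrow> real) \<Rightarrow>
   real \<Rightarrow> real \<Rightarrow> real \<Rightarrow>
   (real \<Rightarrow> ('d \<Rightarrow> real) \<Rightarrow> ('d \<Rightarrow> real)) \<Rightarrow>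
   (real \<Rightarrow> ('d \<Rightarrow> real) \<Rightarrow> 'u \<Rightarrow> ('d \<Rightarrow> real)) \<Rightarrow>
   (real \<Rightarrow> ('d \<Rightarrow> real) \<Rightarrow> 'u \<Rightarrow> ('d \<Rightarrow> real)) \<Rightarrow>
   ('w \<Rightarrow> 'd \<Rightarrow> real) \<Rightarrow> ('w \<Rightarrow> 'd \<Rightarrow> real) \<Rightarrow> (real \<Rightarrow> 'w \<Rightarrow> 'd \<Rightarrow> real) \<Rightarrow> bool"
  where
  "mild_solution D lam \<phi> e M F T \<xi> I \<kappa> \<rho> \<alpha> \<beta> \<nu> f g h a b u \<longleftrightarrow>
     (\<forall>t\<in>{0..T}. random_Hs D lam \<phi> (F t) 0 (u t)) \<and>
     (\<forall>v\<in>L2 D. (\<lambda>(s, \<omega>). L2_inner D (u s \<omega>) v)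
        \<in> borel_measurable (restrict_space lborel {0..T} \<Otimes>\<^sub>M M)) \<and>
     (\<forall>t\<in>{0..T}. \<exists>p q z J J' N N'.
        (AE \<omega> in M.
           L2_sums D \<phi> (\<lambda>k. T_kernel \<alpha> \<beta> \<nu> (lam k) t * L2_inner D (a \<omega>) (\<phi> k)) (p \<omega>) \<and>
           L2_sums D \<phi> (\<lambda>k. R_kernel \<alpha> \<beta> \<nu> (lam k) t * L2_inner D (b \<omega>) (\<phi> k)) (q \<omega>) \<and>
           L2_sums D \<phi> (\<lambda>k. LINT s:{0..t}|lborel.
             S_kernel \<alpha> \<beta> \<nu> (lam k) (t - s) * L2_inner D (f s (u s \<omega>)) (\<phi> k)) (z \<omega>)) \<and>
        (\<forall>k l. has_ito_integral M F (\<xi> l) t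
           (\<lambda>s \<omega>. S_kernel \<alpha> \<beta> \<nu> (lam k) (t - s) * L2_inner D (g s (u s \<omega>) (e l)) (\<phi> k) * \<kappa> l s)
           (J k l)) \<and>
        noise_sums D lam \<phi> M J N \<and>
        (\<forall>k l. J' k l = I l (\<lambda>s \<omega>. indicator {0..t} s *
           (S_kernel \<alpha> \<beta> \<nu> (lam k) (t - s) * L2_inner D (h s (u s \<omega>) (e l)) (\<phi> k) * \<rho> l s))) \<and>
        noise_sums D lam \<phi> M J' N' \<and>
        (AE \<omega> in M. L2_eq D (u t \<omega>) (\<lambda>x. p \<omega> x + q \<omega> x + z \<omega> x + N \<omega> x + N' \<omega> x)))"

end

theory Submission
  imports Defs "HOL-Complex_Analysis.Complex_Analysis"
begin

text \<open>In the eigenbasis the mild formula reads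
\<open>u\<^sub>k(t) = T\<^sub>k(t) a\<^sub>k + R\<^sub>k(t) b\<^sub>k + U\<^sub>k(t)\<close>, where the memory part \<open>U\<^sub>k\<close> collects the drift, Wiener and
fractional convolutions of the forcing coefficients with \<open>S\<^sub>k(t - s)\<close>. Formally \<open>\<partial>\<^sub>tU\<^sub>k\<close> is the same
expression with \<open>S\<^sub>k'\<close>, and \<open>S\<^sub>k'(\<tau>)\<close> is bounded by a multiple of \<open>\<tau> powr (\<alpha> - 2)\<close> uniformly in the
eigenvalue. This is square integrable at \<open>0\<close> exactly when \<open>\<alpha> > 3 / 2\<close>. So \<open>\<partial>\<^sub>tU\<close> has the spatial
regularity \<open>\<sigma> = 2 \<gamma>t - 2 \<beta> / \<alpha>\<close> of the forcing, while differentiating \<open>T\<^sub>k\<close> costs the factor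
\<open>\<lambda>\<^sub>k powr (\<beta> / \<alpha>)\<close>, which is what the extra regularity of \<open>a\<close> pays for.

The stochastic integrals are never differentiated. The argument uses one inequality,
\<open>memory_combination_bound\<close>: the second moment of a finite combination \<open>\<Sum>\<^sub>j d\<^sub>j U\<^sub>k(t\<^sub>j)\<close> is at most a
constant times \<open>\<integral> (\<Sum>\<^sub>j d\<^sub>j S\<^sub>k(t\<^sub>j - s))\<^sup>2 G\<^sub>k(s) ds\<close>, with densities \<open>G\<^sub>k\<close> whose weighted sum over \<open>k\<close>
is bounded by the growth condition. It comes from the Ito isometry (\<open>ito_combination_bound\<close>), the
covariance identity for the fractional integral (\<open>fbm_combination_bound\<close>) and Cauchy--Schwarz for
the drift. Applied to difference quotients it bounds them uniformly (\<open>memory_quotient_bound\<close>), and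
applied to differences of two quotients it makes them Cauchy by dominated convergence
(\<open>memory_quotient_Cauchy\<close>). Completeness then produces the derivative, together with its bound.

The uniformity in the eigenvalue is \<open>kernel_bounds\<close>. Derivatives of the kernels are again
Mittag-Leffler functions, so one needs \<open>E\<^bsub>\<alpha>,\<mu>\<^esub>(-x) = O(x powr (- \<mu> / \<alpha>))\<close> for \<open>0 < \<mu> \<le> \<alpha> < 2\<close>
(\<open>mittag_leffler_decay\<close>). The reason is that \<open>\<tau> powr \<mu> * E\<^bsub>\<alpha>,\<mu>\<^esub>(- (\<tau> powr \<alpha>))\<close> is an inverse Laplace
transform along a vertical line in the right half-plane, where \<open>s powr \<alpha> + 1\<close> does not vanish, and that the
line may be moved to \<open>Re s \<le> 1 / \<tau>\<close>, on which the exponential is bounded by \<open>e\<close>.\<close>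

section \<open>Fourier inversion for the Gamma density\<close>

text \<open>A remainder of second order gives differentiability under an integral sign without a dominated
convergence argument.\<close>

lemma has_vector_derivative_quadratic_bound:
  fixes F :: "real => 'a::real_normed_vector"
  assumes "\<And>y. norm (F y - F x - (y - x) *\<^sub>R d) \<le> K * (y - x)^2"
  shows "(F has_vector_derivative d) (at x)"
  unfolding has_vector_derivative_def has_derivative_at2
proof (intro conjI bounded_linear_scaleR_left)
  show "((\<lambda>y. (1 / norm (y - x)) *\<^sub>R (F y - (F x + (y - x) *\<^sub>R d))) \<longlongrightarrow> 0) (at x)"
  proof (rule Lim_null_comparison)
    show "eventually (\<lambda>y. norm ((1 / norm (y - x)) *\<^sub>R (F y - (F x + (y - x) *\<^sub>R d))) \<le> K * \<bar>y - x\<bar>) (at x)"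
      unfolding eventually_at
    proof (intro exI[of _ 1] conjI ballI impI)
      fix y :: real assume y: "y \<noteq> x \<and> dist y x < 1"
      have "norm ((1 / norm (y - x)) *\<^sub>R (F y - (F x + (y - x) *\<^sub>R d)))
          = norm (F y - F x - (y - x) *\<^sub>R d) / \<bar>y - x\<bar>"
        by (simp add: diff_diff_eq)
      also have "\<dots> \<le> (K * (y - x)^2) / \<bar>y - x\<bar>"
        using assms by (intro divide_right_mono) auto
      also have "\<dots> = K * \<bar>y - x\<bar>"
        using y by (cases "y < x") (simp_all add: power2_eq_square field_simps)
      finally show "norm ((1 / norm (y - x)) *\<^sub>R (F y - (F x + (y - x) *\<^sub>R d))) \<le> K * \<bar>y - x\<bar>" .
    qed simp
    show "((\<lambda>y. K * \<bar>y - x\<bar>) \<longlongrightarrow> 0) (at x)"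
      by (auto intro!: tendsto_eq_intros)
  qed
qed

text \<open>The unnormalised Gamma density, extended by \<open>0\<close> to the negative axis.\<close>

definition gamma_weight :: "real => real => real" where
  "gamma_weight m x = indicator {0<..} x * x powr (m - 1) * exp (- x)"

lemma gamma_weight_measurable [measurable]: "gamma_weight m \<in> borel_measurable borel"
  unfolding gamma_weight_def by measurable

lemma gamma_weight_nonneg [simp]: "0 \<le> gamma_weight m x"
  by (simp add: gamma_weight_def)

lemma gamma_weight_nn_integral:
  assumes "m > 0"
  shows "(\<integral>\<^sup>+x. ennreal (gamma_weight m x) \<partial>lborel) = ennreal (Gamma m)"
proof -
  have "ennreal (Gamma m) = (\<integral>\<^sup>+t. ennreal (indicator {0..} t * t powr (m - 1) / exp t) \<partial>lborel)"
    by (rule Gamma_conv_nn_integral_real) fact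
  also have "\<dots> = (\<integral>\<^sup>+x. ennreal (gamma_weight m x) \<partial>lborel)"
    by (intro nn_integral_cong arg_cong[where f=ennreal])
       (auto simp: gamma_weight_def exp_minus field_simps indicator_def)
  finally show ?thesis by simp
qed

lemma gamma_weight_integrable: "m > 0 ==> integrable lborel (gamma_weight m)"
  by (intro integrableI_nonneg) (auto simp: gamma_weight_nn_integral)

lemma gamma_weight_integral: "m > 0 ==> (LINT x|lborel. gamma_weight m x) = Gamma m"
  by (subst integral_eq_nn_integral) (auto simp: gamma_weight_nn_integral)

lemma gamma_weight_Suc: "gamma_weight (m + 1) x = x * gamma_weight m x"
  by (cases "x > 0") (auto simp: gamma_weight_def powr_diff)

definition gamma_fourier :: "real => real => complex" where
  "gamma_fourier m t = (CLINT x|lborel. of_real (gamma_weight m x) * iexp (t * x))"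

lemma gamma_fourier_integrable:
  assumes "m > 0"
  shows "integrable lborel (\<lambda>x. of_real (gamma_weight m x) * iexp (t * x))"
  by (rule Bochner_Integration.integrable_bound[OF gamma_weight_integrable[OF assms]]) (auto simp: norm_mult)

lemma gamma_fourier_deriv:
  assumes "m > 0"
  shows "(gamma_fourier m has_vector_derivative \<i> * gamma_fourier (m + 1) t) (at t)"
proof (rule has_vector_derivative_quadratic_bound)
  fix y :: real
  let ?g = "\<lambda>x. complex_of_real (gamma_weight m x)"
  have "gamma_fourier m y - gamma_fourier m t - (y - t) *\<^sub>R (\<i> * gamma_fourier (m + 1) t)
      = (CLINT x|lborel. ?g x * iexp (y * x) - ?g x * iexp (t * x)
          - (y - t) *\<^sub>R (\<i> * (of_real (gamma_weight (m + 1) x) * iexp (t * x))))"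
    unfolding gamma_fourier_def
    using gamma_fourier_integrable[OF assms, of y] gamma_fourier_integrable[OF assms, of t]
      gamma_fourier_integrable[of "m + 1" t] assms
    by (subst Bochner_Integration.integral_diff; simp?)+
  also have "\<dots> = (CLINT x|lborel. ?g x * iexp (t * x) * (iexp ((y - t) * x) - (\<Sum>k\<le>1. (\<i> * of_real ((y - t) * x))^k / fact k)))"
    unfolding gamma_weight_Suc
    by (intro Bochner_Integration.integral_cong refl)
       (simp add: algebra_simps exp_add exp_diff scaleR_conv_of_real)
  also have "norm \<dots> \<le> (LINT x|lborel. gamma_weight (m + 1 + 1) x * (y - t)^2 / 2)"
  proof (rule Bochner_Integration.integral_norm_bound_integral)
    show "integrable lborel (\<lambda>x. gamma_weight (m + 1 + 1) x * (y - t)^2 / 2)"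
      using gamma_weight_integrable[of "m + 1 + 1"] assms by simp
    show bd: "norm (?g x * iexp (t * x) * (iexp ((y - t) * x) - (\<Sum>k\<le>1. (\<i> * of_real ((y - t) * x))^k / fact k)))
        \<le> gamma_weight (m + 1 + 1) x * (y - t)^2 / 2" for x
    proof -
      have "cmod (iexp ((y - t) * x) - (\<Sum>k\<le>1. (\<i> * of_real ((y - t) * x))^k / fact k)) \<le> \<bar>(y - t) * x\<bar>\<^sup>2 / 2"
        using iexp_approx1[of "(y - t) * x" 1] by (simp add: numeral_2_eq_2)
      then have "gamma_weight m x * cmod (iexp ((y - t) * x) - (\<Sum>k\<le>1. (\<i> * of_real ((y - t) * x))^k / fact k))
          \<le> gamma_weight m x * (\<bar>(y - t) * x\<bar>\<^sup>2 / 2)"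
        by (intro mult_left_mono) auto
      then show ?thesis
        unfolding norm_mult gamma_weight_Suc by (simp add: power2_eq_square algebra_simps)
    qed
    show "integrable lborel (\<lambda>x. ?g x * iexp (t * x) * (iexp ((y - t) * x) - (\<Sum>k\<le>1. (\<i> * of_real ((y - t) * x))^k / fact k)))"
      by (rule Bochner_Integration.integrable_bound[OF \<open>integrable lborel (\<lambda>x. gamma_weight (m + 1 + 1) x * (y - t)^2 / 2)\<close>])
         (use bd in \<open>auto intro: order_trans\<close>)
  qed
  also have "\<dots> = Gamma (m + 1 + 1) / 2 * (y - t)^2"
    using assms gamma_weight_integral[of "m + 1 + 1"] by simp
  finally show "norm (gamma_fourier m y - gamma_fourier m t - (y - t) *\<^sub>R (\<i> * gamma_fourier (m + 1) t))
     \<le> Gamma (m + 1 + 1) / 2 * (y - t)^2" .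
qed

text \<open>Integration by parts: the boundary terms vanish because of \<open>m > 0\<close> at \<open>0\<close> and of the exponential at
infinity.\<close>

lemma gamma_fourier_Suc:
  assumes "m > 0"
  shows "(1 - \<i> * t) * gamma_fourier (m + 1) t = m * gamma_fourier m t"
proof -
  define F where "F x = complex_of_real (x powr m) * exp ((\<i> * t - 1) * x)" for x :: real
  define f where "f x = complex_of_real (m * x powr (m - 1)) * exp ((\<i> * t - 1) * x)
     + (\<i> * t - 1) * (complex_of_real (x powr m) * exp ((\<i> * t - 1) * x))" for x :: real
  have e: "exp ((\<i> * t - 1) * of_real x) = of_real (exp (- x)) * iexp (t * x)" for x :: real
    by (simp add: exp_of_real[symmetric] exp_add[symmetric] algebra_simps)
  have f_eq: "indicator {0<..} x *\<^sub>R f x = m * (of_real (gamma_weight m x) * iexp (t * x))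
      + (\<i> * t - 1) * (of_real (gamma_weight (m + 1) x) * iexp (t * x))" for x
    unfolding f_def e gamma_weight_def by (auto simp: indicator_def algebra_simps)
  have int: "integrable lborel (\<lambda>x. indicator {0<..} x *\<^sub>R f x)"
    unfolding f_eq using assms
    by (intro Bochner_Integration.integrable_add integrable_mult_right gamma_fourier_integrable) auto
  have "(LBINT x=0..\<infinity>. f x) = 0 - 0"
  proof (rule interval_integral_FTC_integrable[where F = F])
    fix x :: real assume "(0::ereal) < ereal x"
    then have x: "x > 0" by simp
    have d: "((\<lambda>x. complex_of_real (x powr m)) has_vector_derivative of_real (m * x powr (m - 1))) (at x)"
      by (intro has_vector_derivative_of_real has_real_derivative_powr x)
    have "((\<lambda>z. exp ((\<i> * t - 1) * z)) has_field_derivative exp ((\<i> * t - 1) * x) * (\<i> * t - 1)) (at (of_real x))"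
      by (auto intro!: derivative_eq_intros)
    then have "((\<lambda>x. exp ((\<i> * t - 1) * of_real x)) has_vector_derivative exp ((\<i> * t - 1) * x) * (\<i> * t - 1)) (at x)"
      by (rule has_vector_derivative_real_field)
    from has_vector_derivative_mult[OF d this]
    show "(F has_vector_derivative f x) (at x)"
      unfolding F_def f_def by (simp add: algebra_simps)
    show "isCont f x"
      unfolding f_def using x by (intro continuous_intros) auto
  next
    show "set_integrable lborel (einterval 0 \<infinity>) f"
      using int by (simp add: set_integrable_def einterval_def greaterThan_def[symmetric])
  next
    have "((\<lambda>x::real. x powr m * exp (- x)) \<longlongrightarrow> 0) (at_right 0)"
      using assms by real_asymp
    then have "(F \<longlongrightarrow> 0) (at_right 0)"
      by (rule tendsto_norm_zero_cancel[OF tendsto_cong[THEN iffD1, rotated]])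
         (auto simp: F_def e norm_mult eventually_at_filter)
    then show "((F \<circ> real_of_ereal) \<longlongrightarrow> 0) (at_right 0)"
      by (simp add: ereal_tendsto_simps zero_ereal_def)
  next
    have "((\<lambda>x::real. x powr m * exp (- x)) \<longlongrightarrow> 0) at_top"
      by real_asymp
    then have "(F \<longlongrightarrow> 0) at_top"
      by (rule tendsto_norm_zero_cancel[OF tendsto_cong[THEN iffD1, rotated]])
         (auto simp: F_def e norm_mult)
    then show "((F \<circ> real_of_ereal) \<longlongrightarrow> 0) (at_left \<infinity>)"
      by (simp add: ereal_tendsto_simps)
  qed simp
  then have "(CLINT x|lborel. indicator {0<..} x *\<^sub>R f x) = 0"
    by (simp add: interval_lebesgue_integral_def set_lebesgue_integral_def einterval_def greaterThan_def[symmetric])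
  then have "m * gamma_fourier m t + (\<i> * t - 1) * gamma_fourier (m + 1) t = 0"
    unfolding f_eq gamma_fourier_def
    using gamma_fourier_integrable[OF assms, of t] gamma_fourier_integrable[of "m + 1" t] assms
    by (subst (asm) Bochner_Integration.integral_add) (simp_all del: of_real_mult)
  then show ?thesis by (simp add: algebra_simps)
qed

text \<open>The recursion turns the derivative of the transform into a first-order linear differential equation,
for which \<open>(1 - \<i> t) powr (- m)\<close> is an integrating factor; the value at \<open>0\<close> is the Gamma integral.\<close>

lemma gamma_fourier_eq:
  assumes "m > 0"
  shows "gamma_fourier m t = of_real (Gamma m) * (1 - \<i> * t) powr (- of_real m)"
proof -
  let ?P = "\<lambda>t::real. (1 - \<i> * of_real t) powr (of_real m :: complex)"
  have np: "1 - \<i> * of_real t \<notin> \<real>\<^sub>\<le>\<^sub>0" for t :: real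
    by (auto simp: complex_nonpos_Reals_iff)
  have nz: "1 - \<i> * of_real t \<noteq> 0" for t :: real
    using np[of t] by auto
  have "((\<lambda>t. gamma_fourier m t * ?P t) has_vector_derivative 0) (at t within UNIV)" for t
  proof -
    have "((\<lambda>z. (1 - \<i> * z) powr (of_real m :: complex)) has_field_derivative
        of_real m * (1 - \<i> * t) powr (of_real m - 1) * (- \<i>)) (at (of_real t))"
      by (rule DERIV_chain2[where f = "\<lambda>z. z powr of_real m" and g = "\<lambda>z. 1 - \<i> * z", OF has_field_derivative_powr[OF np]])
         (auto intro!: derivative_eq_intros)
    then have "(?P has_vector_derivative of_real m * (1 - \<i> * t) powr (of_real m - 1) * (- \<i>)) (at t)"
      by (rule has_vector_derivative_real_field)
    from has_vector_derivative_mult[OF gamma_fourier_deriv[OF assms] this]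
    have "((\<lambda>t. gamma_fourier m t * ?P t) has_vector_derivative
       gamma_fourier m t * (of_real m * (1 - \<i> * t) powr (of_real m - 1) * (- \<i>)) + \<i> * gamma_fourier (m + 1) t * ?P t) (at t)" .
    also have "?P t = (1 - \<i> * t) powr (of_real m - 1) * (1 - \<i> * t)"
      using nz[of t] by (simp add: powr_diff)
    also have "gamma_fourier m t * (of_real m * (1 - \<i> * t) powr (of_real m - 1) * (- \<i>)) +
        \<i> * gamma_fourier (m + 1) t * ((1 - \<i> * t) powr (of_real m - 1) * (1 - \<i> * t))
        = \<i> * (1 - \<i> * t) powr (of_real m - 1) * ((1 - \<i> * t) * gamma_fourier (m + 1) t - m * gamma_fourier m t)"
      by (simp add: algebra_simps)
    also have "\<dots> = 0" using gamma_fourier_Suc[OF assms, of t] by simp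
    finally show ?thesis by simp
  qed
  then obtain c where c: "\<And>t. gamma_fourier m t * ?P t = c"
    using has_vector_derivative_zero_constant[of UNIV "\<lambda>t. gamma_fourier m t * ?P t"] by auto
  have "gamma_fourier m 0 = Gamma m"
    unfolding gamma_fourier_def using gamma_weight_integral[OF assms] by simp
  with c[of 0] have "c = Gamma m" by simp
  with c[of t] have "gamma_fourier m t * ?P t * (1 - \<i> * t) powr (- of_real m) = of_real (Gamma m) * (1 - \<i> * t) powr (- of_real m)"
    by simp
  moreover have "?P t * (1 - \<i> * t) powr (- of_real m) = 1"
    using nz[of t] by (simp add: powr_minus)
  ultimately show ?thesis by (simp add: mult.assoc)
qed

lemma integrable_indicator_powr_0:
  assumes "a > (-1::real)" "0 \<le> c"
  shows "integrable lborel (\<lambda>x. indicator {0..c} x * x powr a)"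
    and "(\<integral>\<^sup>+x. ennreal (indicator {0..c} x * x powr a) \<partial>lborel) = ennreal (c powr (a + 1) / (a + 1))"
proof -
  show *: "(\<integral>\<^sup>+x. ennreal (indicator {0..c} x * x powr a) \<partial>lborel) = ennreal (c powr (a + 1) / (a + 1))"
    using nn_integral_has_integral_lebesgue[OF _ has_integral_powr_from_0[OF assms]] by (simp add: mult.commute)
  show "integrable lborel (\<lambda>x. indicator {0..c} x * x powr a)"
    by (intro integrableI_nonneg) (auto simp: *)
qed

lemma integrable_indicator_powr_inf:
  assumes "b < (-1::real)"
  shows "integrable lborel (\<lambda>x. indicator {1..} x * x powr b)"
proof -
  have "(\<integral>\<^sup>+x. ennreal (indicator {1..} x * x powr b) \<partial>lborel) = ennreal (- (1 powr (b + 1)) / (b + 1))"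
    using nn_integral_has_integral_lebesgue[OF _ has_integral_powr_to_inf[OF assms, of 1]] by (simp add: mult.commute)
  then show ?thesis
    by (intro integrableI_nonneg) auto
qed

text \<open>The dominating function for the inversion integrals: integrable as soon as \<open>a > -1\<close> and \<open>b < -1\<close>.\<close>

definition two_powr :: "real => real => real => real" where
  "two_powr a b x = (if \<bar>x\<bar> \<le> 1 then \<bar>x\<bar> powr a else \<bar>x\<bar> powr b)"

lemma two_powr_measurable [measurable]: "two_powr a b \<in> borel_measurable borel"
  unfolding two_powr_def by measurable

lemma two_powr_nonneg [simp]: "0 \<le> two_powr a b x"
  by (simp add: two_powr_def)

lemma two_powr_integrable:
  assumes "a > -1" "b < -1"
  shows "integrable lborel (two_powr a b)"
proof -
  let ?g = "\<lambda>x::real. indicator {0..1} x * x powr a + indicator {1..} x * x powr b"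
  have g: "integrable lborel ?g"
    using assms by (intro Bochner_Integration.integrable_add integrable_indicator_powr_0 integrable_indicator_powr_inf) auto
  have g': "integrable lborel (\<lambda>x. ?g (0 + (-1) * x))"
    by (rule lborel_integrable_real_affine[OF g]) simp
  show ?thesis
  proof (rule Bochner_Integration.integrable_bound[OF Bochner_Integration.integrable_add[OF g g']])
    show "AE x in lborel. norm (two_powr a b x) \<le> norm (?g x + ?g (0 + (-1) * x))"
      by (auto simp: two_powr_def indicator_def)
  qed simp
qed

lemma cmod_ge_two: "1 \<le> cmod (1 - \<i> * of_real t)" "\<bar>t\<bar> \<le> cmod (1 - \<i> * of_real t)"
  using abs_Re_le_cmod[of "1 - \<i> * of_real t"] abs_Im_le_cmod[of "1 - \<i> * of_real t"] by auto

lemma gamma_char_integrable: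
  assumes "m > 1"
  shows "integrable lborel (\<lambda>t. (1 - \<i> * complex_of_real t) powr (- of_real m))"
proof (rule Bochner_Integration.integrable_bound[OF two_powr_integrable[of 0 "-m"]])
  show "AE t in lborel. cmod ((1 - \<i> * complex_of_real t) powr (- of_real m)) \<le> norm (two_powr 0 (- m) t)"
  proof (rule AE_mp[OF AE_lborel_singleton[of 0]], intro AE_I2 impI)
    fix t :: real assume t0: "t \<noteq> 0"
    let ?r = "cmod (1 - \<i> * complex_of_real t)"
    have "cmod ((1 - \<i> * complex_of_real t) powr (- of_real m)) = ?r powr (- m)"
      by (simp add: norm_powr_real_powr')
    also have "\<dots> \<le> two_powr 0 (- m) t"
    proof (cases "\<bar>t\<bar> \<le> 1")
      case True
      have "?r powr (- m) \<le> 1 powr (- m)"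
        using cmod_ge_two[of t] assms by (intro powr_mono2') auto
      also have "\<dots> \<le> two_powr 0 (- m) t"
        using True t0 by (auto simp: two_powr_def)
      finally show ?thesis .
    next
      case False
      then show ?thesis
        using cmod_ge_two[of t] assms by (auto simp: two_powr_def intro!: powr_mono2')
    qed
    finally show "cmod ((1 - \<i> * complex_of_real t) powr (- of_real m)) \<le> norm (two_powr 0 (- m) t)"
      by simp
  qed
  show "(\<lambda>t. (1 - \<i> * complex_of_real t) powr (- of_real m)) \<in> borel_measurable lborel"
    by measurable
qed (use assms in auto)

text \<open>Levy inversion expresses the distribution function of the Gamma law through its integrable
characteristic function; comparing derivatives gives the density pointwise.\<close>

lemma gamma_density_inversion:
  assumes m: "m > 1" and x: "x > 0"
  shows "(CLBINT t. iexp (- (t * x)) * (1 - \<i> * t) powr (- of_real m)) = 2 * pi * of_real (gamma_weight m x / Gamma m)"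
proof -
  have m0: "m > 0" using m by simp
  have Gm: "Gamma m > 0" using m by (intro Gamma_real_pos) auto
  define p where "p x = gamma_weight m x / Gamma m" for x
  have p[measurable]: "p \<in> borel_measurable borel" unfolding p_def by measurable
  have p0: "0 \<le> p x" for x using Gm by (simp add: p_def)
  have p_int: "integrable lborel p"
    unfolding p_def using m by (intro Bochner_Integration.integrable_divide gamma_weight_integrable) auto
  define N where "N = density lborel (\<lambda>x. ennreal (p x))"
  have "emeasure N (space N) = (\<integral>\<^sup>+x. ennreal (p x) \<partial>lborel)"
    unfolding N_def by (simp add: emeasure_density)
  also have "\<dots> = (\<integral>\<^sup>+x. ennreal (gamma_weight m x) / ennreal (Gamma m) \<partial>lborel)"
    unfolding p_def using Gm by (intro nn_integral_cong) (simp add: divide_ennreal)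
  also have "\<dots> = 1"
  proof -
    have "(\<integral>\<^sup>+x. ennreal (gamma_weight m x) / ennreal (Gamma m) \<partial>lborel) = ennreal (Gamma m) / ennreal (Gamma m)"
      unfolding gamma_weight_nn_integral[OF m0, symmetric] by (rule nn_integral_divide) measurable
    then show ?thesis using Gm by (simp add: divide_ennreal)
  qed
  finally interpret N: prob_space N by (rule prob_spaceI)
  interpret N: real_distribution N by standard (simp add: N_def)
  define \<phi> where "\<phi> t = (1 - \<i> * complex_of_real t) powr (- of_real m)" for t
  have \<phi>_int: "integrable lborel \<phi>" unfolding \<phi>_def using m by (rule gamma_char_integrable)
  have \<phi>_meas[measurable]: "\<phi> \<in> borel_measurable borel" using \<phi>_int by auto
  have char: "char N t = \<phi> t" for t
  proof -
    have "char N t = (CLINT x|lborel. p x *\<^sub>R iexp (t * x))"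
      unfolding char_def N_def by (rule integral_density) (auto simp: p0)
    also have "\<dots> = (CLINT x|lborel. of_real (gamma_weight m x) * iexp (t * x) / of_real (Gamma m))"
      by (simp add: p_def scaleR_conv_of_real)
    also have "\<dots> = gamma_fourier m t / of_real (Gamma m)"
      unfolding gamma_fourier_def by simp
    finally show ?thesis using gamma_fourier_eq[of m t] m Gm by (simp add: \<phi>_def)
  qed
  define h where "h x = (CLBINT t. iexp (- (t * x)) * \<phi> t)" for x
  have h_cont: "continuous_on UNIV h"
    unfolding continuous_on_def
  proof
    fix x :: real
    have "(h \<longlongrightarrow> h x) (at x within UNIV)"
      unfolding h_def tendsto_at_iff_sequentially comp_def
    proof (intro allI impI)
      fix X :: "nat => real" assume X: "X \<longlonglongrightarrow> x"
      show "(\<lambda>i. CLBINT t. iexp (- (t * X i)) * \<phi> t) \<longlonglongrightarrow> (CLBINT t. iexp (- (t * x)) * \<phi> t)"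
        by (rule integral_dominated_convergence[where w = "\<lambda>t. norm (\<phi> t)"])
           (use \<phi>_int X in \<open>auto simp: norm_mult intro!: tendsto_intros\<close>)
    qed
    then show "(h \<longlongrightarrow> h x) (at x within UNIV)" .
  qed
  have key: "(CLBINT x:{a..b}. h x) = (CLBINT x:{a..b}. 2 * pi * complex_of_real (p x))" if ab: "a \<le> b" for a b
  proof -
    define J where "J t = (iexp (- (t * a)) - iexp (- (t * b))) / (\<i> * t)" for t :: real
    have ie: "iexp (- (t * x)) = exp (- (\<i> * of_real t * of_real x))" for t x :: real
      by (simp add: mult.assoc)
    have J: "(CLBINT x:{a..b}. iexp (- (t * x))) = J t" if "t \<noteq> 0" for t
    proof -
      have "(CLBINT x=a..b. iexp (- (t * x))) = - (iexp (- (t * b))) / (\<i> * t) - (- (iexp (- (t * a))) / (\<i> * t))"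
      proof (rule interval_integral_FTC_finite)
        fix x :: real
        have "((\<lambda>z. - exp (- (\<i> * t * z)) / (\<i> * t)) has_field_derivative exp (- (\<i> * t * x))) (at (of_real x))"
          using that by (auto intro!: derivative_eq_intros)
        then have "((\<lambda>x. - exp (- (\<i> * t * of_real x)) / (\<i> * t)) has_vector_derivative exp (- (\<i> * t * x))) (at x)"
          by (rule has_vector_derivative_real_field)
        then show "((\<lambda>x. - (iexp (- (t * x))) / (\<i> * t)) has_vector_derivative iexp (- (t * x))) (at x within {min a b..max a b})"
          unfolding ie by (rule has_vector_derivative_at_within)
      qed (auto intro!: continuous_intros)
      then show ?thesis
        using ab by (simp add: interval_integral_Icc J_def diff_divide_distrib)
    qed
    have bound: "norm (J t * \<phi> t) \<le> (b - a) * norm (\<phi> t)" if "t \<noteq> 0" for t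
    proof -
      have "norm (J t) \<le> b - a"
        using Levy_Inversion_aux2[of "-b" "-a" t] ab that by (simp add: J_def)
      then show ?thesis by (simp add: norm_mult mult_right_mono)
    qed
    have [measurable]: "J \<in> borel_measurable borel" unfolding J_def by measurable
    have J_int: "integrable lborel (\<lambda>t. J t * \<phi> t)"
    proof (rule Bochner_Integration.integrable_bound[of _ "\<lambda>t. (b - a) * norm (\<phi> t)"])
      have "AE t in lborel. (t::real) \<noteq> 0" by (rule AE_lborel_singleton)
      then show "AE t in lborel. norm (J t * \<phi> t) \<le> norm ((b - a) * norm (\<phi> t))"
        by eventually_elim (use bound ab in \<open>auto simp: abs_mult\<close>)
    qed (use \<phi>_int in auto)
    have sing: "measure N {c} = 0" for c
    proof -
      have "emeasure N {c} = (\<integral>\<^sup>+x. ennreal (p x) * indicator {c} x \<partial>lborel)"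
        unfolding N_def by (rule emeasure_density) auto
      also have "\<dots> = (\<integral>\<^sup>+(x::real). 0 \<partial>lborel)"
        using AE_lborel_singleton[of c] by (intro nn_integral_cong_AE) (auto simp: indicator_def)
      finally show ?thesis by (simp add: measure_def)
    qed
    have "(\<lambda>T::nat. 1 / (2 * pi) * (CLBINT t=ereal (- real T)..ereal (real T). J t * \<phi> t)) \<longlonglongrightarrow> measure N {a<..b}"
      using N.Levy_Inversion[OF ab sing sing] unfolding J_def char by simp
    moreover have "(\<lambda>T::nat. 1 / (2 * pi) * (CLBINT t=ereal (- real T)..ereal (real T). J t * \<phi> t)) \<longlonglongrightarrow> 1 / (2 * pi) * (CLBINT t. J t * \<phi> t)"
    proof (rule tendsto_mult_left)
      have "(\<lambda>T::nat. CLBINT t. indicator {-real T<..<real T} t *\<^sub>R (J t * \<phi> t)) \<longlonglongrightarrow> (CLBINT t. J t * \<phi> t)"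
      proof (rule integral_dominated_convergence[where w = "\<lambda>t. norm (J t * \<phi> t)"])
        show "AE t in lborel. (\<lambda>n. indicat_real {- real n<..<real n} t *\<^sub>R (J t * \<phi> t)) \<longlonglongrightarrow> J t * \<phi> t"
        proof (intro AE_I2 tendsto_eventually)
          fix t :: real
          obtain n0 :: nat where "\<bar>t\<bar> < n0" using reals_Archimedean2 by blast
          then show "\<forall>\<^sub>F n in sequentially. indicat_real {- real n<..<real n} t *\<^sub>R (J t * \<phi> t) = J t * \<phi> t"
            by (intro eventually_sequentiallyI[of n0]) (auto simp: indicator_def)
        qed
      qed (use J_int in \<open>auto simp: indicator_def\<close>)
      then show "(\<lambda>T::nat. CLBINT t=ereal (- real T)..ereal (real T). J t * \<phi> t) \<longlonglongrightarrow> (CLBINT t. J t * \<phi> t)"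
        by (simp add: interval_lebesgue_integral_def set_lebesgue_integral_def)
    qed
    ultimately have 1: "complex_of_real (measure N {a<..b}) = 1 / (2 * pi) * (CLBINT t. J t * \<phi> t)"
      by (rule LIMSEQ_unique)
    have "(CLBINT t. J t * \<phi> t) = (CLBINT t. CLBINT x. indicator {a..b} x *\<^sub>R (iexp (- (t * x)) * \<phi> t))"
    proof (rule integral_cong_AE)
      have "AE t in lborel. (t::real) \<noteq> 0" by (rule AE_lborel_singleton)
      then show "AE t in lborel. J t * \<phi> t = (CLBINT x. indicator {a..b} x *\<^sub>R (iexp (- (t * x)) * \<phi> t))"
      proof eventually_elim
        fix t :: real assume "t \<noteq> 0"
        have "(CLBINT x. indicator {a..b} x *\<^sub>R (iexp (- (t * x)) * \<phi> t))
           = (CLBINT x. (indicator {a..b} x *\<^sub>R iexp (- (t * x))) * \<phi> t)"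
          by simp
        also have "\<dots> = (CLBINT x:{a..b}. iexp (- (t * x))) * \<phi> t"
          unfolding set_lebesgue_integral_def by (rule integral_mult_left_zero)
        finally show "J t * \<phi> t = (CLBINT x. indicator {a..b} x *\<^sub>R (iexp (- (t * x)) * \<phi> t))"
          using J[OF \<open>t \<noteq> 0\<close>] by simp
      qed
    qed measurable
    also have "\<dots> = (CLBINT x. CLBINT t. indicator {a..b} x *\<^sub>R (iexp (- (t * x)) * \<phi> t))"
    proof (rule lborel_pair.Fubini_integral)
      show "integrable (lborel \<Otimes>\<^sub>M lborel) (\<lambda>(x, t). indicator {a..b} x *\<^sub>R (iexp (- (t * x)) * \<phi> t))"
      proof (rule lborel_pair.Fubini_integrable)
        have ind: "integrable lborel (indicat_real {a..b})"
          by (rule integrable_real_indicator) (auto simp: emeasure_lborel_Icc_eq)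
        show "integrable lborel (\<lambda>x. LBINT y. norm (case (x, y) of (x, t) => indicat_real {a..b} x *\<^sub>R (iexp (- (t * x)) * \<phi> t)))"
          using ind by (simp add: norm_mult)
        show "AE x in lborel. complex_integrable lborel (\<lambda>y. case (x, y) of (x, t) => indicat_real {a..b} x *\<^sub>R (iexp (- (t * x)) * \<phi> t))"
          by (intro AE_I2, simp, intro integrable_scaleR_right impI, rule Bochner_Integration.integrable_bound[OF \<phi>_int])
             (auto simp: norm_mult)
      qed measurable
    qed
    also have "\<dots> = (CLBINT x:{a..b}. h x)"
      unfolding set_lebesgue_integral_def h_def by simp
    finally have 2: "(CLBINT t. J t * \<phi> t) = (CLBINT x:{a..b}. h x)" .
    have "measure N {a<..b} = measure N {a..b}"
    proof -
      have "AE x in N. x \<noteq> a"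
        using sing[of a] N.prob_eq_0[of "{a}"] by simp
      then show ?thesis by (intro N.finite_measure_eq_AE) auto
    qed
    also have "\<dots> = (LBINT x:{a..b}. p x)"
    proof -
      have "emeasure N {a..b} = (\<integral>\<^sup>+x. ennreal (p x) * indicator {a..b} x \<partial>lborel)"
        unfolding N_def by (rule emeasure_density) auto
      also have "\<dots> = (\<integral>\<^sup>+x. ennreal (indicator {a..b} x *\<^sub>R p x) \<partial>lborel)"
        by (intro nn_integral_cong) (auto simp: indicator_def)
      finally show ?thesis
        unfolding set_lebesgue_integral_def measure_def
        by (subst integral_eq_nn_integral) (auto simp: p0)
    qed
    finally have 3: "complex_of_real (measure N {a<..b}) = (CLBINT x:{a..b}. of_real (p x))"
      by (simp add: set_integral_complex_of_real)
    have "(CLBINT x:{a..b}. h x) = 2 * pi * (CLBINT x:{a..b}. of_real (p x))"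
      using 1 2 3 by (simp add: field_simps)
    then show ?thesis by simp
  qed
  define k where "k x = h x - 2 * pi * complex_of_real (p x)" for x
  have keq: "k = (\<lambda>x. h x - 2 * pi * complex_of_real (p x))" by (simp add: k_def fun_eq_iff)
  have pc: "continuous_on {0<..} p"
  proof -
    have "continuous_on {0<..} (\<lambda>x. x powr (m - 1) * exp (- x) / Gamma m)"
      using Gm by (intro continuous_intros) auto
    then show ?thesis
      by (rule continuous_on_eq) (simp add: p_def gamma_weight_def)
  qed
  have kc: "continuous_on {x/2..2*x} k"
    unfolding k_def using x by (intro continuous_intros continuous_on_subset[OF h_cont] continuous_on_subset[OF pc]) auto
  have hs: "set_integrable lborel {x/2..v} h" for v
    by (rule borel_integrable_atLeastAtMost') (auto intro: continuous_on_subset[OF h_cont])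
  have ps: "set_integrable lborel {x/2..v} (\<lambda>x. 2 * pi * complex_of_real (p x))" for v
    using x by (intro borel_integrable_atLeastAtMost' continuous_intros continuous_on_subset[OF pc]) auto
  have "((\<lambda>v. integral {x/2..v} k) has_vector_derivative k x) (at x within {x/2..2*x})"
    by (rule integral_has_vector_derivative[OF kc]) (use x in auto)
  then have D: "((\<lambda>v. integral {x/2..v} k) has_vector_derivative k x) (at x within cbox (x/2) (2*x))"
    by simp
  have zero: "integral {x/2..v} k = 0" if "v \<in> cbox (x/2) (2*x)" for v
  proof -
    have "integral {x/2..v} k = (CLBINT x:{x/2..v}. k x)"
      unfolding keq by (rule set_borel_integral_eq_integral(2)[OF set_integral_diff(1)[OF hs ps], symmetric])
    also have "\<dots> = 0"
      unfolding k_def using key[of "x/2" v] that by (subst set_integral_diff(2)[OF hs ps]) simp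
    finally show ?thesis .
  qed
  have "((\<lambda>v. integral {x/2..v} k) has_vector_derivative 0) (at x within cbox (x/2) (2*x))"
    by (rule has_vector_derivative_transform[OF _ zero has_vector_derivative_const]) (use x in auto)
  from vector_derivative_unique_within_closed_interval[OF _ _ D this]
  have "k x = 0" using x by auto
  then show ?thesis by (simp add: k_def h_def p_def \<phi>_def)
qed

section \<open>Decay of Mittag-Leffler functions on the negative axis\<close>

lemma line_integrable:
  fixes F :: "complex => complex"
  assumes hol: "F holomorphic_on {s. Re s > 0}" and c: "0 < c" and ab: "a > -1" "b < -1"
    and bound: "\<And>x. x \<noteq> 0 ==> cmod (F (Complex c x)) \<le> K * two_powr a b x"
  shows "integrable lborel (\<lambda>x. F (Complex c x))"
    and "cmod (CLBINT x. F (Complex c x)) \<le> K * (LBINT x. two_powr a b x)"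
proof -
  have "continuous_on UNIV (\<lambda>x. F (Complex c x))"
    using c by (intro continuous_on_compose2[OF holomorphic_on_imp_continuous_on[OF hol]])
      (auto simp: Complex_eq intro!: continuous_intros)
  then have [measurable]: "(\<lambda>x. F (Complex c x)) \<in> borel_measurable borel"
    by (rule borel_measurable_continuous_onI)
  have K: "integrable lborel (\<lambda>x. K * two_powr a b x)"
    using two_powr_integrable[OF ab] by simp
  have AE: "AE x in lborel. cmod (F (Complex c x)) \<le> K * two_powr a b x"
    by (rule AE_mp[OF AE_lborel_singleton[of 0]]) (use bound in auto)
  show int: "integrable lborel (\<lambda>x. F (Complex c x))"
    by (rule Bochner_Integration.integrable_bound[OF K]) (use AE in \<open>auto elim!: eventually_mono\<close>)
  have "cmod (CLBINT x. F (Complex c x)) \<le> (LBINT x. cmod (F (Complex c x)))"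
    by (rule integral_norm_bound)
  also have "\<dots> \<le> (LBINT x. K * two_powr a b x)"
    using int K AE by (intro integral_mono_AE) auto
  finally show "cmod (CLBINT x. F (Complex c x)) \<le> K * (LBINT x. two_powr a b x)" by simp
qed

text \<open>\<open>F\<close> has a primitive on the half-plane. The integrals over the two lines, truncated at height \<open>n\<close>, differ
by the increments of the primitive over horizontal segments at height \<open>n\<close> and \<open>- n\<close>, which are of
order \<open>n powr b\<close>.\<close>

lemma line_integral_shift:
  fixes F :: "complex => complex"
  assumes hol: "F holomorphic_on {s. Re s > 0}" and c: "0 < c1" "c1 \<le> c2" and ab: "a > -1" "b < -1"
    and bound: "\<And>c x. c1 \<le> c ==> c \<le> c2 ==> x \<noteq> 0 ==> cmod (F (Complex c x)) \<le> K * two_powr a b x"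
  shows "(CLBINT x. F (Complex c1 x)) = (CLBINT x. F (Complex c2 x))"
proof -
  have conv: "convex {s. Re s > 0}" and op: "open {s. Re s > 0}"
    by (rule convex_halfspace_Re_gt, rule open_halfspace_Re_gt)
  obtain P where "\<And>s. s \<in> {s. Re s > 0} ==> (P has_field_derivative F s) (at s within {s. Re s > 0})"
    using holomorphic_convex_primitive'[OF conv op hol] by blast
  then have P: "(P has_field_derivative F s) (at s)" if "Re s > 0" for s
    using that op by (metis at_within_open mem_Collect_eq)
  have lim: "(\<lambda>n::nat. P (Complex c n) - P (Complex c (- real n))) \<longlonglongrightarrow> \<i> * (CLBINT x. F (Complex c x))"
    if "c1 \<le> c" "c \<le> c2" for c
  proof -
    have c0: "c > 0" using that c by simp
    note int = line_integrable(1)[OF hol c0 ab bound[OF that]]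
    have "(CLBINT x=ereal (- real n)..ereal (real n). \<i> * F (Complex c x)) = P (Complex c n) - P (Complex c (- real n))" for n :: nat
    proof -
      have "(CLBINT x=ereal (- real n)..ereal (real n). \<i> * F (Complex c x)) = P (Complex c n) - P (Complex c (- real n))"
      proof (rule interval_integral_FTC_finite)
        show "continuous_on {min (- real n) (real n)..max (- real n) (real n)} (\<lambda>x. \<i> * F (Complex c x))"
          using c0 by (intro continuous_on_mult_left continuous_on_compose2[OF holomorphic_on_imp_continuous_on[OF hol]])
            (auto simp: Complex_eq intro!: continuous_intros)
        fix x :: real
        have "((\<lambda>x. P (Complex c x)) has_vector_derivative \<i> * F (Complex c x)) (at x)"
        proof -
          have "((\<lambda>x. Complex c x) has_vector_derivative \<i>) (at x)"
            unfolding Complex_eq by (auto intro!: derivative_eq_intros)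
          from field_vector_diff_chain_at[OF this P[of "Complex c x"]] show ?thesis
            using c0 by (simp add: o_def)
        qed
        then show "((\<lambda>x. P (Complex c x)) has_vector_derivative \<i> * F (Complex c x))
          (at x within {min (- real n) (real n)..max (- real n) (real n)})"
          by (rule has_vector_derivative_at_within)
      qed
      then show ?thesis by simp
    qed
    moreover have "(CLBINT x=ereal (- real n)..ereal (real n). \<i> * F (Complex c x)) = (CLBINT x. indicator {-real n<..<real n} x *\<^sub>R (\<i> * F (Complex c x)))" for n :: nat
      by (simp add: interval_lebesgue_integral_def set_lebesgue_integral_def mult_scaleR_right[symmetric] del: mult_scaleR_right)
    moreover have "(\<lambda>n::nat. CLBINT x. indicator {-real n<..<real n} x *\<^sub>R (\<i> * F (Complex c x))) \<longlonglongrightarrow> (CLBINT x. \<i> * F (Complex c x))"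
    proof (rule integral_dominated_convergence[where w = "\<lambda>x. norm (F (Complex c x))"])
      show "AE x in lborel. (\<lambda>n. indicat_real {- real n<..<real n} x *\<^sub>R (\<i> * F (Complex c x))) \<longlonglongrightarrow> \<i> * F (Complex c x)"
      proof (intro AE_I2 tendsto_eventually)
        fix x :: real
        obtain n0 :: nat where "\<bar>x\<bar> < n0" using reals_Archimedean2 by blast
        then show "\<forall>\<^sub>F n in sequentially. indicat_real {- real n<..<real n} x *\<^sub>R (\<i> * F (Complex c x)) = \<i> * F (Complex c x)"
          by (intro eventually_sequentiallyI[of n0]) (auto simp: indicator_def)
      qed
    qed (use int in \<open>auto simp: indicator_def norm_mult\<close>)
    ultimately show ?thesis by simp
  qed
  have "(\<lambda>n::nat. (P (Complex c2 n) - P (Complex c2 (- real n))) - (P (Complex c1 n) - P (Complex c1 (- real n)))) \<longlonglongrightarrow> 0"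
  proof (rule Lim_null_comparison)
    have side: "cmod (P (Complex c2 y) - P (Complex c1 y)) \<le> K * two_powr a b y * (c2 - c1)" if "y \<noteq> 0" for y
    proof -
      let ?S = "{s. c1 \<le> Re s \<and> Re s \<le> c2 \<and> Im s = y}"
      have "?S = {s. Re s \<ge> c1} \<inter> {s. Re s \<le> c2} \<inter> ({s. Im s \<ge> y} \<inter> {s. Im s \<le> y})"
        by auto
      then have S: "convex ?S"
        by (simp only: convex_Int convex_halfspace_Re_ge convex_halfspace_Re_le
              convex_halfspace_Im_ge convex_halfspace_Im_le)
      have "cmod (P (Complex c2 y) - P (Complex c1 y)) \<le> K * two_powr a b y * cmod (Complex c2 y - Complex c1 y)"
      proof (rule field_differentiable_bound[OF S])
        fix z assume "z \<in> ?S"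
        then have z: "c1 \<le> Re z" "Re z \<le> c2" "z = Complex (Re z) y" by (auto simp: complex_eq_iff)
        then show "(P has_field_derivative F z) (at z within ?S)"
          using P[of z] c by (auto intro: has_field_derivative_at_within)
        show "cmod (F z) \<le> K * two_powr a b y"
          using bound[OF z(1,2) that] z(3) by simp
      qed (use c in auto)
      also have "Complex c2 y - Complex c1 y = of_real (c2 - c1)"
        by (simp add: complex_eq_iff)
      finally show ?thesis using c by (simp add: norm_of_real del: of_real_diff)
    qed
    show "\<forall>\<^sub>F n in sequentially. norm ((P (Complex c2 (real n)) - P (Complex c2 (- real n))) - (P (Complex c1 (real n)) - P (Complex c1 (- real n))))
       \<le> 2 * K * (c2 - c1) * real n powr b"
    proof (rule eventually_sequentiallyI[of 2])
      fix n :: nat assume n: "2 \<le> n"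
      have "norm ((P (Complex c2 (real n)) - P (Complex c2 (- real n))) - (P (Complex c1 (real n)) - P (Complex c1 (- real n))))
         = norm ((P (Complex c2 (real n)) - P (Complex c1 (real n))) - (P (Complex c2 (- real n)) - P (Complex c1 (- real n))))"
        by (simp add: algebra_simps)
      also have "\<dots> \<le> K * two_powr a b (real n) * (c2 - c1) + K * two_powr a b (- real n) * (c2 - c1)"
        using n by (intro order_trans[OF norm_triangle_ineq4] add_mono side) auto
      also have "\<dots> = 2 * K * (c2 - c1) * real n powr b"
        using n by (simp add: two_powr_def)
      finally show "norm ((P (Complex c2 (real n)) - P (Complex c2 (- real n))) - (P (Complex c1 (real n)) - P (Complex c1 (- real n))))
       \<le> 2 * K * (c2 - c1) * real n powr b" .
    qed
    have "(\<lambda>n. real n powr b) \<longlonglongrightarrow> 0"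
      using ab by (intro tendsto_neg_powr filterlim_real_sequentially) auto
    then show "(\<lambda>n. 2 * K * (c2 - c1) * real n powr b) \<longlonglongrightarrow> 0"
      by (rule tendsto_mult_right_zero)
  qed
  moreover have "(\<lambda>n::nat. (P (Complex c2 n) - P (Complex c2 (- real n))) - (P (Complex c1 n) - P (Complex c1 (- real n))))
     \<longlonglongrightarrow> \<i> * (CLBINT x. F (Complex c2 x)) - \<i> * (CLBINT x. F (Complex c1 x))"
    using c by (intro tendsto_diff lim) auto
  ultimately have "\<i> * (CLBINT x. F (Complex c2 x)) - \<i> * (CLBINT x. F (Complex c1 x)) = 0"
    using LIMSEQ_unique by blast
  then show ?thesis by simp
qed

text \<open>On the line \<open>Re s = 1\<close> this is the inversion formula for the Gamma density at \<open>t\<close>; then the line is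
shifted.\<close>

lemma power_inverse_laplace:
  assumes m: "m > 1" and t: "t > 0"
  shows "(CLBINT x. exp (Complex 2 x * t) * Complex 2 x powr (- of_real m)) = of_real (2 * pi * (t powr (m - 1) / Gamma m))"
proof -
  define F where "F s = exp (s * of_real t) * s powr (- of_real m)" for s :: complex
  have hol: "F holomorphic_on {s. Re s > 0}"
    unfolding F_def by (intro holomorphic_intros) (auto simp: complex_nonpos_Reals_iff)
  have "(CLBINT x. F (Complex 1 x)) = (CLBINT x. F (Complex 2 x))"
  proof (rule line_integral_shift[OF hol, where a = 0 and b = "-m" and K = "exp (2 * t)"])
    fix c x :: real assume cx: "1 \<le> c" "c \<le> 2" "x \<noteq> 0"
    let ?r = "cmod (Complex c x)"
    have r: "1 \<le> ?r" "\<bar>x\<bar> \<le> ?r"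
      using abs_Re_le_cmod[of "Complex c x"] abs_Im_le_cmod[of "Complex c x"] cx by auto
    have "cmod (F (Complex c x)) = exp (c * t) * ?r powr (- m)"
      by (simp add: F_def norm_mult norm_powr_real_powr')
    also have "\<dots> \<le> exp (2 * t) * two_powr 0 (- m) x"
    proof (intro mult_mono)
      show "?r powr (- m) \<le> two_powr 0 (- m) x"
      proof (cases "\<bar>x\<bar> \<le> 1")
        case True
        have "?r powr (- m) \<le> 1 powr (- m)"
          using r m by (intro powr_mono2') auto
        then show ?thesis using True cx by (simp add: two_powr_def)
      next
        case False
        then show ?thesis
          using r m by (auto simp: two_powr_def intro!: powr_mono2')
      qed
    qed (use cx t in auto)
    finally show "cmod (F (Complex c x)) \<le> exp (2 * t) * two_powr 0 (- m) x" .
  qed (use m in auto)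
  moreover have "(CLBINT x. F (Complex 1 x)) = exp t * (CLBINT x. iexp (- (x * t)) * (1 - \<i> * x) powr (- of_real m))"
  proof -
    have "(CLBINT x. F (Complex 1 x)) = \<bar>-1\<bar> *\<^sub>R (CLBINT x. F (Complex 1 (0 + (-1) * x)))"
      by (rule lborel_integral_real_affine) simp
    also have "\<dots> = (CLBINT x. exp t * (iexp (- (x * t)) * (1 - \<i> * x) powr (- of_real m)))"
    proof -
      have "F (Complex 1 (- x)) = exp t * (iexp (- (x * t)) * (1 - \<i> * x) powr (- of_real m))" for x
        by (simp add: F_def Complex_eq exp_of_real[symmetric] exp_diff exp_minus field_simps)
      then show ?thesis by simp
    qed
    finally show ?thesis by simp
  qed
  ultimately have "(CLBINT x. F (Complex 2 x)) = exp t * (2 * pi * of_real (gamma_weight m t / Gamma m))"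
    using gamma_density_inversion[OF m t] by simp
  also have "\<dots> = of_real (2 * pi * (t powr (m - 1) / Gamma m))"
    using t by (simp add: gamma_weight_def exp_minus exp_of_real[symmetric] field_simps)
  finally show ?thesis unfolding F_def .
qed

text \<open>The Laplace transform of \<open>t \<mapsto> t powr \<mu> * mittag_leffler \<alpha> \<mu> (- (t powr \<alpha>))\<close>. It is minus
the derivative of \<open>s powr (\<alpha> - \<mu>) / (s powr \<alpha> + 1)\<close>, the transform with \<open>t powr (\<mu> - 1)\<close> in place of
\<open>t powr \<mu>\<close>. The additional power of \<open>t\<close> makes the symbol absolutely integrable along vertical lines for every
\<open>\<mu> > 0\<close>.\<close>

definition ml_symbol :: "real => real => complex => complex" where
  "ml_symbol \<alpha> \<mu> s = s powr (- of_real (\<mu> + 1)) *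
     (of_real \<mu> * (s powr of_real \<alpha>)^2 + of_real (\<mu> - \<alpha>) * s powr of_real \<alpha>) / (s powr of_real \<alpha> + 1)^2"

text \<open>On \<open>Re s = 2\<close> one has \<open>\<bar>s powr \<alpha>\<bar> > 1\<close>, so the symbol can be expanded into powers of \<open>s powr (- \<alpha>)\<close> and
inverted term by term; the resulting series is the Mittag-Leffler series.\<close>

lemma mittag_leffler_integral:
  assumes \<alpha>: "\<alpha> > 1" and \<mu>: "\<mu> > 0" and t: "t > 0"
  shows "of_real (2 * pi * (t powr \<mu> * mittag_leffler \<alpha> \<mu> (- (t powr \<alpha>)))) =
     (CLBINT x. exp (Complex 2 x * t) * ml_symbol \<alpha> \<mu> (Complex 2 x))"
    and "summable (\<lambda>n. (- (t powr \<alpha>)) ^ n / Gamma (real n * \<alpha> + \<mu>))"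
proof -
  define q where "q n = (-1)^n * (\<alpha> * real n + \<mu>)" for n :: nat
  define T where "T n x = of_real (q n) * (exp (Complex 2 x * t) * Complex 2 x powr (- of_real (\<alpha> * n + \<mu> + 1)))" for n :: nat and x
  have m1: "\<alpha> * real n + \<mu> + 1 > 1" for n using \<alpha> \<mu> by (simp add: add_nonneg_pos)
  define r where "r x = cmod (Complex 2 x)" for x
  have r: "2 \<le> r x" "\<bar>x\<bar> \<le> r x" for x
    using abs_Re_le_cmod[of "Complex 2 x"] abs_Im_le_cmod[of "Complex 2 x"] by (auto simp: r_def)
  define B where "B x = exp (2 * t) * two_powr 0 (- (\<mu> + 1)) x" for x
  have B0: "0 \<le> B x" for x by (simp add: B_def)
  have B_int: "integrable lborel B"
    unfolding B_def using \<mu> two_powr_integrable[of 0 "- (\<mu> + 1)"] by simp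
  define d where "d n = (\<alpha> * real n + \<mu>) * (2 powr (- \<alpha>)) ^ n" for n :: nat
  have d0: "0 \<le> d n" for n using \<alpha> \<mu> by (simp add: d_def)
  have q2: "2 powr (- \<alpha>) < 1" using \<alpha> powr_less_mono[of "-\<alpha>" 0 2] by simp
  have d_sum: "summable d"
  proof -
    have "summable (\<lambda>n. of_nat (Suc n) * (2 powr (- \<alpha>)) ^ n)"
      using geometric_deriv_sums[of "2 powr (- \<alpha>)"] q2 by (auto simp: sums_iff)
    moreover have "summable (\<lambda>n. (2 powr (- \<alpha>)) ^ n)"
      using q2 by (intro summable_geometric) auto
    ultimately have "summable (\<lambda>n. \<alpha> * (of_nat (Suc n) * (2 powr (- \<alpha>)) ^ n) + (\<mu> - \<alpha>) * (2 powr (- \<alpha>)) ^ n)"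
      by (intro summable_add summable_mult)
    then show ?thesis unfolding d_def by (simp add: algebra_simps)
  qed
  have T_meas[measurable]: "T n \<in> borel_measurable borel" for n
    unfolding T_def Complex_eq by measurable
  have T_bound: "cmod (T n x) \<le> d n * B x" if "x \<noteq> 0" for n x
  proof -
    have "cmod (T n x) = (\<alpha> * real n + \<mu>) * (exp (2 * t) * r x powr (- (\<alpha> * n + \<mu> + 1)))"
      using \<alpha> \<mu> by (simp add: T_def q_def norm_mult norm_powr_real_powr' r_def abs_mult norm_power del: of_real_add of_real_mult of_real_minus)
    also have "r x powr (- (\<alpha> * n + \<mu> + 1)) = (r x powr (- \<alpha>)) ^ n * r x powr (- (\<mu> + 1))"
      using r(1)[of x] by (simp add: powr_realpow[symmetric] powr_powr powr_add[symmetric] algebra_simps)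
    also have "(\<alpha> * real n + \<mu>) * (exp (2 * t) * \<dots>) \<le> (\<alpha> * real n + \<mu>) * (exp (2 * t) * ((2 powr (- \<alpha>)) ^ n * two_powr 0 (- (\<mu> + 1)) x))"
    proof (intro mult_left_mono mult_mono power_mono)
      show "r x powr - \<alpha> \<le> 2 powr - \<alpha>" using r(1)[of x] \<alpha> by (intro powr_mono2') auto
      show "r x powr - (\<mu> + 1) \<le> two_powr 0 (- (\<mu> + 1)) x"
      proof (cases "\<bar>x\<bar> \<le> 1")
        case True
        have "r x powr (- (\<mu> + 1)) \<le> 1 powr (- (\<mu> + 1))"
          using r(1)[of x] \<mu> by (intro powr_mono2') auto
        then show ?thesis using True that by (simp add: two_powr_def)
      next
        case False
        then show ?thesis
          using r(2)[of x] \<mu> by (auto simp: two_powr_def intro!: powr_mono2')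
      qed
    qed (use \<alpha> \<mu> in auto)
    finally show ?thesis by (simp add: d_def B_def mult_ac)
  qed
  have T_AE: "AE x in lborel. \<forall>n. cmod (T n x) \<le> d n * B x"
    by (rule AE_mp[OF AE_lborel_singleton[of 0]]) (use T_bound in auto)
  have T_int: "integrable lborel (T n)" for n
    by (rule Bochner_Integration.integrable_bound[of _ "\<lambda>x. d n * B x"])
       (use B_int T_AE d0 B0 in \<open>auto elim!: eventually_mono simp: abs_mult\<close>)
  have sums1: "(\<lambda>n. integral\<^sup>L lborel (T n)) sums (CLBINT x. (\<Sum>n. T n x))"
  proof (rule sums_integral[OF T_int])
    show "AE x in lborel. summable (\<lambda>n. cmod (T n x))"
      using T_AE by eventually_elim (auto intro!: summable_comparison_test'[OF summable_mult2[OF d_sum]])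
    show "summable (\<lambda>n. LBINT x. cmod (T n x))"
    proof (rule summable_comparison_test'[OF summable_mult2[OF d_sum, of "LBINT x. B x"]])
      fix n
      have "(LBINT x. cmod (T n x)) \<le> (LBINT x. d n * B x)"
        using T_int B_int T_AE by (intro integral_mono_AE) (auto elim!: eventually_mono)
      then show "norm (LBINT x. cmod (T n x)) \<le> d n * (LBINT x. B x)" by simp
    qed
  qed
  have pt: "(\<Sum>n. T n x) = exp (Complex 2 x * t) * ml_symbol \<alpha> \<mu> (Complex 2 x)" for x
  proof -
    define s where "s = Complex 2 x"
    define A where "A = s powr of_real \<alpha>"
    define z where "z = - (1 / A)"
    have s0: "s \<noteq> 0" by (simp add: s_def complex_eq_iff)
    have A0: "A \<noteq> 0" using s0 by (simp add: A_def)
    have "cmod A = r x powr \<alpha>" by (simp add: A_def norm_powr_real_powr' s_def r_def)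
    also have "\<dots> > 1" using r(1)[of x] \<alpha> by (intro gr_one_powr) auto
    finally have z1: "cmod z < 1" by (auto simp: z_def norm_divide divide_less_eq)
    have A1: "A + 1 \<noteq> 0"
    proof
      assume "A + 1 = 0"
      then have "A = -1" by (simp add: eq_neg_iff_add_eq_0)
      with z1 show False by (simp add: z_def)
    qed
    have "(\<lambda>n. of_real \<alpha> * (of_nat (Suc n) * z ^ n) + of_real (\<mu> - \<alpha>) * z ^ n) sums
        (of_real \<alpha> * (1 / (1 - z)^2) + of_real (\<mu> - \<alpha>) * (1 / (1 - z)))"
      by (intro sums_add sums_mult geometric_deriv_sums geometric_sums z1)
    from sums_mult[OF this, of "exp (s * t) * s powr (- of_real (\<mu> + 1))"]
    have "(\<lambda>n. exp (s * t) * s powr (- of_real (\<mu> + 1)) * (of_real \<alpha> * (of_nat (Suc n) * z ^ n) + of_real (\<mu> - \<alpha>) * z ^ n)) sums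
       (exp (s * t) * s powr (- of_real (\<mu> + 1)) * (of_real \<alpha> * (1 / (1 - z)^2) + of_real (\<mu> - \<alpha>) * (1 / (1 - z))))" .
    moreover have "exp (s * t) * s powr (- of_real (\<mu> + 1)) * (of_real \<alpha> * (of_nat (Suc n) * z ^ n) + of_real (\<mu> - \<alpha>) * z ^ n) = T n x" for n
    proof -
      have "z = (-1) * s powr (- of_real \<alpha>)"
        by (simp add: z_def A_def powr_minus divide_inverse)
      then have "z ^ n = (-1) ^ n * (s powr (- of_real \<alpha>)) ^ n"
        by (simp only: power_mult_distrib)
      also have "(s powr (- of_real \<alpha>)) ^ n = s powr (- of_real (\<alpha> * n))"
        using s0 by (simp add: powr_def exp_of_nat_mult[symmetric] mult_ac)
      finally have zn: "z ^ n = (-1) ^ n * s powr (- of_real (\<alpha> * n))" .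
      have sp: "s powr (- of_real (\<alpha> * n + \<mu> + 1)) = s powr (- of_real (\<mu> + 1)) * s powr (- of_real (\<alpha> * n))"
        by (simp add: powr_add[symmetric] algebra_simps)
      show ?thesis
        unfolding T_def q_def s_def[symmetric] sp zn by (simp add: algebra_simps)
    qed
    moreover have "exp (s * t) * s powr (- of_real (\<mu> + 1)) * (of_real \<alpha> * (1 / (1 - z)^2) + of_real (\<mu> - \<alpha>) * (1 / (1 - z)))
        = exp (s * t) * ml_symbol \<alpha> \<mu> s"
    proof -
      have z2: "1 - z = (A + 1) / A" using A0 by (simp add: z_def field_simps)
      have "of_real \<alpha> * (1 / (1 - z)^2) + of_real (\<mu> - \<alpha>) * (1 / (1 - z)) = (of_real \<mu> * A\<^sup>2 + of_real (\<mu> - \<alpha>) * A) / (A + 1)^2"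
      proof -
        have i2: "1 / (1 - z)^2 = A\<^sup>2 / (A + 1)^2"
          by (simp add: z2 power_divide)
        have i1: "1 / (1 - z) = A * (A + 1) / (A + 1)^2"
          using A1 by (simp add: z2 power2_eq_square)
        have "of_real \<alpha> * A\<^sup>2 + of_real (\<mu> - \<alpha>) * (A * (A + 1)) = of_real \<mu> * A\<^sup>2 + of_real (\<mu> - \<alpha>) * A"
          by (simp add: power2_eq_square algebra_simps)
        then show ?thesis
          unfolding i1 i2 by (simp only: times_divide_eq_right add_divide_distrib[symmetric])
      qed
      then show ?thesis by (simp add: ml_symbol_def A_def)
    qed
    ultimately show ?thesis by (simp add: sums_iff s_def)
  qed
  have trm: "integral\<^sup>L lborel (T n) = of_real (2 * pi * t powr \<mu> * ((- (t powr \<alpha>)) ^ n / Gamma (real n * \<alpha> + \<mu>)))" for n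
  proof -
    have g: "Gamma (\<alpha> * n + \<mu> + 1) = (\<alpha> * n + \<mu>) * Gamma (\<alpha> * n + \<mu>)"
      using \<alpha> \<mu> m1[of n] by (intro Gamma_plus1) (auto elim!: nonpos_Ints_cases)
    have tp: "t powr (\<alpha> * n + \<mu>) = (t powr \<alpha>) ^ n * t powr \<mu>"
      using t by (simp add: powr_add powr_powr[symmetric] powr_realpow)
    have "integral\<^sup>L lborel (T n) = of_real (q n) * of_real (2 * pi * (t powr (\<alpha> * n + \<mu> + 1 - 1) / Gamma (\<alpha> * n + \<mu> + 1)))"
      unfolding T_def using power_inverse_laplace[OF m1 t, of n] by (subst integral_mult_right_zero) simp
    also have "\<dots> = of_real (2 * pi * t powr \<mu> * ((- (t powr \<alpha>)) ^ n / Gamma (real n * \<alpha> + \<mu>)))"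
      unfolding of_real_mult[symmetric] of_real_eq_iff g
      using m1[of n] by (simp add: q_def tp power_minus[of "t powr \<alpha>"] mult_ac divide_simps)
    finally show ?thesis .
  qed
  have "(\<lambda>n. complex_of_real (2 * pi * t powr \<mu> * ((- (t powr \<alpha>)) ^ n / Gamma (real n * \<alpha> + \<mu>)))) sums
      (CLBINT x. exp (Complex 2 x * t) * ml_symbol \<alpha> \<mu> (Complex 2 x))"
    using sums1 unfolding trm pt .
  from sums_Re[OF this] sums_Im[OF this]
  have re: "(\<lambda>n. 2 * pi * t powr \<mu> * ((- (t powr \<alpha>)) ^ n / Gamma (real n * \<alpha> + \<mu>))) sums
      Re (CLBINT x. exp (Complex 2 x * t) * ml_symbol \<alpha> \<mu> (Complex 2 x))"
    and im: "Im (CLBINT x. exp (Complex 2 x * t) * ml_symbol \<alpha> \<mu> (Complex 2 x)) = 0"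
    by (auto simp: sums_iff)
  show summ: "summable (\<lambda>n. (- (t powr \<alpha>)) ^ n / Gamma (real n * \<alpha> + \<mu>))"
    by (rule summable_mult_D[OF sums_summable[OF re]]) (use t in simp)
  have "2 * pi * t powr \<mu> * mittag_leffler \<alpha> \<mu> (- (t powr \<alpha>)) = Re (CLBINT x. exp (Complex 2 x * t) * ml_symbol \<alpha> \<mu> (Complex 2 x))"
    unfolding mittag_leffler_def using re summ by (subst suminf_mult[symmetric]) (auto simp: sums_iff)
  then show "of_real (2 * pi * (t powr \<mu> * mittag_leffler \<alpha> \<mu> (- (t powr \<alpha>)))) =
     (CLBINT x. exp (Complex 2 x * t) * ml_symbol \<alpha> \<mu> (Complex 2 x))"
    using im by (simp add: complex_eq_iff mult_ac)
qed

text \<open>On the right half-plane the argument of \<open>s powr \<alpha>\<close> stays below \<open>\<alpha> \<pi> / 2 < \<pi>\<close>, hence away from the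
negative axis. This is where \<open>\<alpha> < 2\<close> enters.\<close>

lemma cmod_powr_plus_one:
  assumes \<alpha>: "1 < \<alpha>" "\<alpha> < 2"
  obtains k where "k < 1" "\<And>s. Re s > 0 ==> (1 - k) * (1 + (cmod s powr \<alpha>)^2) \<le> (cmod (s powr of_real \<alpha> + 1))^2"
proof
  define k where "k = - cos (\<alpha> * pi / 2)"
  have ap: "pi / 2 < \<alpha> * pi / 2" "\<alpha> * pi / 2 < pi" using \<alpha> by auto
  have "cos (\<alpha> * pi / 2) > cos pi"
    using ap pi_gt_zero by (intro cos_monotone_0_pi) auto
  then show "k < 1" by (simp add: k_def)
  have "cos (\<alpha> * pi / 2) < cos (pi / 2)"
    using ap pi_gt_zero by (intro cos_monotone_0_pi) auto
  then have k0: "k \<ge> 0" by (simp add: k_def)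
  fix s :: complex assume s: "Re s > 0"
  define A where "A = s powr of_real \<alpha>"
  define R where "R = cmod s powr \<alpha>"
  have s0: "s \<noteq> 0" using s by auto
  define \<theta> where "\<theta> = Im (Ln s)"
  have th: "\<bar>\<theta>\<bar> < pi / 2" using Re_Ln_pos_lt[OF s0] s by (simp add: \<theta>_def)
  have cA: "cmod A = R" by (simp add: A_def R_def norm_powr_real_powr')
  have ReA: "Re A = R * cos (\<alpha> * \<theta>)"
    using s0 by (simp add: A_def R_def \<theta>_def powr_def Re_exp)
  have "cos (\<alpha> * \<theta>) = cos \<bar>\<alpha> * \<theta>\<bar>" by (simp add: abs_if)
  moreover have "cos (\<alpha> * pi / 2) \<le> cos \<bar>\<alpha> * \<theta>\<bar>"
    using th \<alpha> ap by (intro cos_monotone_0_pi_le) (auto simp: abs_mult)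
  ultimately have "Re A \<ge> R * (- k)"
    unfolding ReA by (intro mult_left_mono) (auto simp: k_def R_def)
  have "(cmod (A + 1))^2 = (cmod A)^2 + 2 * Re A + 1"
    unfolding cmod_power2 by (simp add: power2_eq_square algebra_simps)
  also have "\<dots> \<ge> R\<^sup>2 + 2 * (R * (- k)) + 1"
    using \<open>Re A \<ge> R * (- k)\<close> cA by simp
  finally have "(cmod (A + 1))^2 \<ge> R\<^sup>2 + 2 * (R * (- k)) + 1" .
  moreover have "R\<^sup>2 + 2 * (R * (- k)) + 1 - (1 - k) * (1 + R\<^sup>2) = k * (1 - R)^2"
    by (simp add: power2_eq_square algebra_simps)
  moreover have "k * (1 - R)^2 \<ge> 0" using k0 by simp
  ultimately show "(1 - k) * (1 + (cmod s powr \<alpha>)^2) \<le> (cmod (s powr of_real \<alpha> + 1))^2"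
    unfolding A_def R_def by linarith
qed

text \<open>A bound in terms of \<open>Im s\<close> alone, so that one dominating function serves all vertical lines. Near the
real axis the symbol is at worst of order \<open>\<bar>s\<bar> powr (\<alpha> - \<mu> - 1)\<close>, which is locally integrable for
\<open>\<mu> < \<alpha>\<close>; for \<open>\<mu> = \<alpha>\<close> this singular term has coefficient \<open>0\<close>.\<close>

lemma ml_symbol_bound:
  assumes \<alpha>: "1 < \<alpha>" "\<alpha> < 2" and \<mu>: "0 < \<mu>" "\<mu> \<le> \<alpha>"
  obtains a K where "a > -1" "K \<ge> 0"
    "\<And>s. Re s > 0 ==> Im s \<noteq> 0 ==> cmod (ml_symbol \<alpha> \<mu> s) \<le> K * two_powr a (- (\<mu> + 1)) (Im s)"
proof -
  obtain k where k: "k < 1" "\<And>s. Re s > 0 ==> (1 - k) * (1 + (cmod s powr \<alpha>)^2) \<le> (cmod (s powr of_real \<alpha> + 1))^2"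
    using cmod_powr_plus_one[OF \<alpha>] by blast
  define a where "a = (if \<mu> = \<alpha> then 0 else min 0 (\<alpha> - \<mu> - 1))"
  have a: "a > -1" "a \<le> 0" using \<mu> by (auto simp: a_def)
  define K where "K = (2 * \<alpha>) / (1 - k)"
  show ?thesis
  proof (rule that[OF a(1)])
    show "K \<ge> 0" using \<alpha> k by (simp add: K_def)
    fix s assume s: "Re s > 0" and y: "Im s \<noteq> 0"
    define r where "r = cmod s"
    define x where "x = \<bar>Im s\<bar>"
    have r: "r > 0" "x \<le> r" "x > 0" using s y by (auto simp: r_def x_def abs_Im_le_cmod)
    define N where "N = r powr (- (\<mu> + 1)) * (\<mu> * (r powr \<alpha>)^2 + (\<alpha> - \<mu>) * r powr \<alpha>)"
    have "cmod (ml_symbol \<alpha> \<mu> s) = r powr (- (\<mu> + 1)) *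
       cmod (of_real \<mu> * (s powr of_real \<alpha>)^2 + of_real (\<mu> - \<alpha>) * s powr of_real \<alpha>) / (cmod (s powr of_real \<alpha> + 1))^2"
      by (simp add: ml_symbol_def norm_divide norm_mult norm_power norm_powr_real_powr' r_def
          del: of_real_add of_real_mult of_real_minus of_real_diff)
    also have "\<dots> \<le> r powr (- (\<mu> + 1)) * (\<mu> * (r powr \<alpha>)^2 + (\<alpha> - \<mu>) * r powr \<alpha>) / ((1 - k) * (1 + (r powr \<alpha>)^2))"
    proof (intro frac_le mult_left_mono)
      have "cmod (of_real \<mu> * (s powr of_real \<alpha>)^2 + of_real (\<mu> - \<alpha>) * s powr of_real \<alpha>)
         \<le> cmod (of_real \<mu> * (s powr of_real \<alpha>)^2) + cmod (of_real (\<mu> - \<alpha>) * s powr of_real \<alpha>)"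
        by (rule norm_triangle_ineq)
      also have "\<dots> = \<mu> * (r powr \<alpha>)^2 + (\<alpha> - \<mu>) * r powr \<alpha>"
        using \<mu> by (simp add: norm_mult norm_power norm_powr_real_powr' r_def abs_if
            del: of_real_add of_real_mult of_real_minus of_real_diff)
      finally show "cmod (of_real \<mu> * (s powr of_real \<alpha>)^2 + of_real (\<mu> - \<alpha>) * s powr of_real \<alpha>)
         \<le> \<mu> * (r powr \<alpha>)^2 + (\<alpha> - \<mu>) * r powr \<alpha>" .
    qed (use k s \<mu> in \<open>auto simp: r_def intro!: mult_pos_pos add_pos_nonneg\<close>)
    also have "\<dots> = N / (1 + (r powr \<alpha>)^2) / (1 - k)"
      by (simp add: N_def)
    also have "\<dots> \<le> (2 * \<alpha> * two_powr a (- (\<mu> + 1)) x) / (1 - k)"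
    proof (intro divide_right_mono)
      show "N / (1 + (r powr \<alpha>)^2) \<le> 2 * \<alpha> * two_powr a (- (\<mu> + 1)) x"
      proof (cases "r \<ge> 1")
        case True
        have ra: "1 \<le> r powr \<alpha>" using True \<alpha> by (intro ge_one_powr_ge_zero) auto
        have "(\<alpha> - \<mu>) * r powr \<alpha> \<le> (\<alpha> - \<mu>) * (r powr \<alpha>)^2"
          using ra \<mu> mult_right_mono[OF ra, of "r powr \<alpha>"] by (intro mult_left_mono) (auto simp: power2_eq_square)
        then have "\<mu> * (r powr \<alpha>)^2 + (\<alpha> - \<mu>) * r powr \<alpha> \<le> \<alpha> * (1 + (r powr \<alpha>)^2)"
          using \<alpha> by (simp add: algebra_simps)
        then have "N / (1 + (r powr \<alpha>)^2) \<le> r powr (- (\<mu> + 1)) * (\<alpha> * (1 + (r powr \<alpha>)^2)) / (1 + (r powr \<alpha>)^2)"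
          unfolding N_def by (intro divide_right_mono mult_left_mono) auto
        also have "\<dots> = \<alpha> * r powr (- (\<mu> + 1))"
          by (simp add: add_nonneg_eq_0_iff)
        also have "\<dots> \<le> \<alpha> * two_powr a (- (\<mu> + 1)) x"
        proof (intro mult_left_mono)
          show "r powr (- (\<mu> + 1)) \<le> two_powr a (- (\<mu> + 1)) x"
          proof (cases "x \<le> 1")
            case x1: True
            have "r powr (- (\<mu> + 1)) \<le> 1 powr (- (\<mu> + 1))"
              using True \<mu> by (intro powr_mono2') auto
            also have "\<dots> = 1 powr a" by simp
            also have "\<dots> \<le> x powr a"
              using r x1 a by (intro powr_mono2') auto
            finally show ?thesis using x1 r by (simp add: two_powr_def)
          next
            case False
            then show ?thesis using r \<mu> by (auto simp: two_powr_def intro!: powr_mono2')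
          qed
        qed (use \<alpha> in auto)
        also have "\<dots> \<le> 2 * \<alpha> * two_powr a (- (\<mu> + 1)) x"
          using \<alpha> by (intro mult_right_mono) auto
        finally show ?thesis .
      next
        case False
        then have x1: "x \<le> 1" using r by simp
        have ra1: "1 \<le> r powr a"
          using powr_mono2'[of a r 1] False r a by simp
        have "N / (1 + (r powr \<alpha>)^2) \<le> N / 1"
          unfolding N_def using \<mu> by (intro divide_left_mono) (auto intro!: add_pos_nonneg)
        also have "N / 1 = \<mu> * r powr (2 * \<alpha> - \<mu> - 1) + (\<alpha> - \<mu>) * r powr (\<alpha> - \<mu> - 1)"
        proof -
          have e1: "r powr (2 * \<alpha> - \<mu> - 1) = r powr (- (\<mu> + 1)) * (r powr \<alpha>)^2"
            by (simp add: power2_eq_square powr_add[symmetric] algebra_simps)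
          have e2: "r powr (\<alpha> - \<mu> - 1) = r powr (- (\<mu> + 1)) * r powr \<alpha>"
            by (simp add: powr_add[symmetric] algebra_simps)
          show ?thesis unfolding e1 e2 N_def by (simp add: algebra_simps)
        qed
        also have "\<dots> \<le> \<mu> * 1 + (\<alpha> - \<mu>) * r powr a"
        proof (rule add_mono)
          have "r powr (2 * \<alpha> - \<mu> - 1) \<le> r powr 0"
            using False r \<alpha> \<mu> by (intro powr_mono') auto
          then show "\<mu> * r powr (2 * \<alpha> - \<mu> - 1) \<le> \<mu> * 1"
            using r \<mu> by (intro mult_left_mono) auto
          show "(\<alpha> - \<mu>) * r powr (\<alpha> - \<mu> - 1) \<le> (\<alpha> - \<mu>) * r powr a"
          proof (cases "\<mu> = \<alpha>")
            case False
            then have "a \<le> \<alpha> - \<mu> - 1" by (simp add: a_def)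
            then show ?thesis using \<open>\<not> r \<ge> 1\<close> r \<mu> by (intro mult_left_mono powr_mono') auto
          qed simp
        qed
        also have "\<dots> \<le> \<mu> * r powr a + (\<alpha> - \<mu>) * r powr a"
          using ra1 \<mu> by simp
        also have "\<dots> = \<alpha> * r powr a" by (simp add: algebra_simps)
        also have "\<dots> \<le> \<alpha> * x powr a"
          using r a \<alpha> by (intro mult_left_mono powr_mono2') auto
        also have "\<dots> \<le> 2 * \<alpha> * two_powr a (- (\<mu> + 1)) x"
          using x1 r \<alpha> by (simp add: two_powr_def)
        finally show ?thesis .
      qed
    qed (use k in auto)
    also have "\<dots> = K * two_powr a (- (\<mu> + 1)) (Im s)"
      by (simp add: K_def x_def two_powr_def)
    finally show "cmod (ml_symbol \<alpha> \<mu> s) \<le> K * two_powr a (- (\<mu> + 1)) (Im s)" .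
  qed
qed

text \<open>The inversion integral is shifted from \<open>Re s = 2\<close> to a line with \<open>Re s * t \<le> 1\<close>. There the
exponential is bounded by \<open>e\<close> and what remains does not depend on \<open>t\<close>.\<close>

lemma mittag_leffler_decay:
  assumes \<alpha>: "1 < \<alpha>" "\<alpha> < 2" and \<mu>: "0 < \<mu>" "\<mu> \<le> \<alpha>"
  obtains C where "C \<ge> 0" "\<And>t. t > 0 ==> t powr \<mu> * \<bar>mittag_leffler \<alpha> \<mu> (- (t powr \<alpha>))\<bar> \<le> C"
proof -
  obtain a K where a: "a > -1" and K0: "K \<ge> 0" and
    K: "\<And>s. Re s > 0 ==> Im s \<noteq> 0 ==> cmod (ml_symbol \<alpha> \<mu> s) \<le> K * two_powr a (- (\<mu> + 1)) (Im s)"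
    using ml_symbol_bound[OF \<alpha> \<mu>] by metis
  define L where "L = (LBINT x. two_powr a (- (\<mu> + 1)) x)"
  have L0: "L \<ge> 0" unfolding L_def by (intro integral_nonneg_AE) auto
  have b: "- (\<mu> + 1) < -1" using \<mu> by simp
  obtain k where k: "k < 1" "\<And>s. Re s > 0 ==> (1 - k) * (1 + (cmod s powr \<alpha>)^2) \<le> (cmod (s powr of_real \<alpha> + 1))^2"
    using cmod_powr_plus_one[OF \<alpha>] by blast
  have nz: "s powr of_real \<alpha> + 1 \<noteq> 0" if "Re s > 0" for s
  proof
    assume "s powr of_real \<alpha> + 1 = 0"
    with k(2)[OF that] have "(1 - k) * (1 + (cmod s powr \<alpha>)^2) \<le> 0" by simp
    moreover have "(1 - k) * (1 + (cmod s powr \<alpha>)^2) > 0"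
      using k(1) by (intro mult_pos_pos add_pos_nonneg) auto
    ultimately show False by simp
  qed
  show ?thesis
  proof (rule that[of "exp 1 * K * L / (2 * pi)"])
    show "exp 1 * K * L / (2 * pi) \<ge> 0" using K0 L0 by simp
    fix t :: real assume t: "t > 0"
    define F where "F s = exp (s * of_real t) * ml_symbol \<alpha> \<mu> s" for s
    have hol: "F holomorphic_on {s. Re s > 0}"
      unfolding F_def ml_symbol_def using nz by (intro holomorphic_intros) (auto simp: complex_nonpos_Reals_iff)
    have bound: "cmod (F (Complex c x)) \<le> exp (c * t) * K * two_powr a (- (\<mu> + 1)) x" if "c > 0" "x \<noteq> 0" for c x
      using K[of "Complex c x"] that by (simp add: F_def norm_mult mult.assoc)
    \<comment> \<open>The minimum keeps the new line to the left of \<open>Re s = 2\<close> when \<open>t\<close> is small.\<close>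
    obtain c where c: "0 < c" "c \<le> 2" "c * t \<le> 1"
      using t by (intro that[of "min 2 (1 / t)"]) (auto simp: min_def field_simps)
    have "(CLBINT x. F (Complex c x)) = (CLBINT x. F (Complex 2 x))"
    proof (rule line_integral_shift[OF hol c(1,2) a b])
      fix c' x :: real assume "c \<le> c'" "c' \<le> 2" "x \<noteq> 0"
      then have "cmod (F (Complex c' x)) \<le> exp (c' * t) * K * two_powr a (- (\<mu> + 1)) x"
        using c by (intro bound) auto
      also have "\<dots> \<le> exp (2 * t) * K * two_powr a (- (\<mu> + 1)) x"
        using \<open>c' \<le> 2\<close> t K0 by (intro mult_right_mono) auto
      finally show "cmod (F (Complex c' x)) \<le> exp (2 * t) * K * two_powr a (- (\<mu> + 1)) x" .
    qed
    then have "of_real (2 * pi * (t powr \<mu> * mittag_leffler \<alpha> \<mu> (- (t powr \<alpha>)))) = (CLBINT x. F (Complex c x))"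
      using mittag_leffler_integral(1)[of \<alpha> \<mu> t] \<alpha> \<mu> t unfolding F_def by simp
    then have "cmod (of_real (2 * pi * (t powr \<mu> * mittag_leffler \<alpha> \<mu> (- (t powr \<alpha>))))) \<le> (exp (c * t) * K) * L"
      unfolding L_def using line_integrable(2)[OF hol c(1) a b bound] c by simp
    also have "\<dots> \<le> exp 1 * K * L"
      using c K0 L0 by (intro mult_right_mono) auto
    finally show "t powr \<mu> * \<bar>mittag_leffler \<alpha> \<mu> (- (t powr \<alpha>))\<bar> \<le> exp 1 * K * L / (2 * pi)"
      unfolding norm_of_real by (simp add: abs_mult field_simps)
  qed
qed

section \<open>Lipschitz bounds for the solution kernels\<close>

lemma mittag_leffler_summable:
  assumes "\<alpha> > 1" "\<mu> > 0"
  shows "summable (\<lambda>n. 1 / Gamma (real n * \<alpha> + \<mu>) * z ^ n)"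
proof -
  define x where "x = \<bar>z\<bar> + 1"
  have "summable (\<lambda>n. 1 / Gamma (real n * \<alpha> + \<mu>) * (- x) ^ n)"
    using mittag_leffler_integral(2)[of \<alpha> \<mu> "x powr (1 / \<alpha>)"] assms
    by (simp add: x_def powr_powr)
  then show ?thesis
    by (rule powser_inside) (simp add: x_def)
qed

lemma mittag_leffler_powser:
  "mittag_leffler \<alpha> \<mu> z = (\<Sum>n. 1 / Gamma (real n * \<alpha> + \<mu>) * z ^ n)"
  by (simp add: mittag_leffler_def)

definition mittag_leffler_deriv :: "real => real => real => real" where
  "mittag_leffler_deriv \<alpha> \<mu> z = (\<Sum>n. diffs (\<lambda>n. 1 / Gamma (real n * \<alpha> + \<mu>)) n * z ^ n)"

lemma mittag_leffler_has_deriv: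
  assumes "\<alpha> > 1" "\<mu> > 0"
  shows "(mittag_leffler \<alpha> \<mu> has_real_derivative mittag_leffler_deriv \<alpha> \<mu> z) (at z)"
  unfolding mittag_leffler_powser[abs_def] mittag_leffler_deriv_def
  by (rule termdiffs_strong_converges_everywhere) (rule mittag_leffler_summable[OF assms])

lemma mittag_leffler_deriv_1:
  assumes "\<alpha> > 1"
  shows "\<alpha> * mittag_leffler_deriv \<alpha> 1 z = mittag_leffler \<alpha> \<alpha> z"
proof -
  have s: "summable (\<lambda>n. diffs (\<lambda>n. 1 / Gamma (real n * \<alpha> + 1)) n * z ^ n)"
    by (rule termdiff_converges_all) (rule mittag_leffler_summable[OF assms], simp)
  have "\<alpha> * (diffs (\<lambda>n. 1 / Gamma (real n * \<alpha> + 1)) n * z ^ n) = 1 / Gamma (real n * \<alpha> + \<alpha>) * z ^ n" for n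
  proof -
    have p: "real (Suc n) * \<alpha> > 0" using assms by simp
    have "Gamma (real (Suc n) * \<alpha> + 1) = real (Suc n) * \<alpha> * Gamma (real (Suc n) * \<alpha>)"
      using p by (intro Gamma_plus1) (auto elim!: nonpos_Ints_cases)
    then have "\<alpha> * (real (Suc n) * (1 / Gamma (real (Suc n) * \<alpha> + 1))) = 1 / Gamma (real (Suc n) * \<alpha>)"
      using assms by (simp del: of_nat_Suc)
    moreover have "real (Suc n) * \<alpha> = real n * \<alpha> + \<alpha>" by (simp add: algebra_simps)
    ultimately show ?thesis
      unfolding diffs_def by (simp only: mult.assoc[symmetric] of_nat_Suc)
  qed
  then show ?thesis
    unfolding mittag_leffler_deriv_def mittag_leffler_powser by (subst suminf_mult[OF s, symmetric]) simp
qed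

text \<open>The differentiation formula \<open>(t powr (\<mu> - 1) * E\<^sub>\<mu>(- c t powr \<alpha>))' = t powr (\<mu> - 2) * E\<^sub>\<mu>\<^sub>-\<^sub>1(- c t powr \<alpha>)\<close>
in terms of the argument \<open>z = - c t powr \<alpha>\<close>: both sides agree coefficient by coefficient.\<close>

lemma mittag_leffler_deriv_shift:
  assumes "\<alpha> > 1" "\<mu> > 1"
  shows "\<alpha> * z * mittag_leffler_deriv \<alpha> \<mu> z + (\<mu> - 1) * mittag_leffler \<alpha> \<mu> z = mittag_leffler \<alpha> (\<mu> - 1) z"
proof -
  define c where "c n = 1 / Gamma (real n * \<alpha> + \<mu>)" for n
  have \<mu>0: "\<mu> > 0" using assms by simp
  note sc = mittag_leffler_summable[OF assms(1) \<mu>0, folded c_def]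
  have s: "summable (\<lambda>n. diffs c n * z ^ n)"
    by (rule termdiff_converges_all) (rule sc)
  have "(\<lambda>n. of_nat n * c n * z ^ (n - Suc 0)) sums mittag_leffler_deriv \<alpha> \<mu> z"
    unfolding mittag_leffler_deriv_def using diffs_equiv[OF s] by (simp add: c_def[abs_def])
  from sums_add[OF sums_mult[OF this, of "\<alpha> * z"] sums_mult[OF summable_sums[OF sc, of z], of "\<mu> - 1"]]
  have "(\<lambda>n. \<alpha> * z * (of_nat n * c n * z ^ (n - Suc 0)) + (\<mu> - 1) * (c n * z ^ n)) sums
      (\<alpha> * z * mittag_leffler_deriv \<alpha> \<mu> z + (\<mu> - 1) * mittag_leffler \<alpha> \<mu> z)"
    by (simp add: mittag_leffler_powser c_def)
  moreover have "\<alpha> * z * (of_nat n * c n * z ^ (n - Suc 0)) + (\<mu> - 1) * (c n * z ^ n) = 1 / Gamma (real n * \<alpha> + (\<mu> - 1)) * z ^ n" for n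
  proof -
    have p: "real n * \<alpha> + (\<mu> - 1) > 0" using assms by (intro add_nonneg_pos) auto
    have "Gamma (real n * \<alpha> + (\<mu> - 1) + 1) = (real n * \<alpha> + (\<mu> - 1)) * Gamma (real n * \<alpha> + (\<mu> - 1))"
      using p by (intro Gamma_plus1) (auto elim!: nonpos_Ints_cases)
    then have g: "Gamma (real n * \<alpha> + \<mu>) = (real n * \<alpha> + (\<mu> - 1)) * Gamma (real n * \<alpha> + (\<mu> - 1))" by simp
    have "\<alpha> * z * (of_nat n * c n * z ^ (n - Suc 0)) = \<alpha> * real n * (c n * z ^ n)"
      by (cases n) auto
    then have "\<alpha> * z * (of_nat n * c n * z ^ (n - Suc 0)) + (\<mu> - 1) * (c n * z ^ n) = (real n * \<alpha> + (\<mu> - 1)) * (c n * z ^ n)"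
      by (simp add: algebra_simps)
    also have "\<dots> = 1 / Gamma (real n * \<alpha> + (\<mu> - 1)) * z ^ n"
      unfolding c_def g using p by simp
    finally show ?thesis .
  qed
  ultimately show ?thesis by (simp add: mittag_leffler_powser sums_iff)
qed

lemma mittag_leffler_isCont: "\<alpha> > 1 ==> \<mu> > 0 ==> isCont (mittag_leffler \<alpha> \<mu>) z"
  using mittag_leffler_has_deriv by (rule DERIV_isCont)

text \<open>Continuity covers bounded arguments and the decay estimate the remaining ones.\<close>

lemma mittag_leffler_bounded:
  assumes \<alpha>: "1 < \<alpha>" "\<alpha> < 2" and \<mu>: "0 < \<mu>" "\<mu> \<le> \<alpha>"
  obtains M where "M \<ge> 0" "\<And>x. x \<ge> 0 ==> \<bar>mittag_leffler \<alpha> \<mu> (- x)\<bar> \<le> M"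
    "\<And>\<tau>. \<tau> > 0 ==> \<tau> powr \<mu> * \<bar>mittag_leffler \<alpha> \<mu> (- (\<tau> powr \<alpha>))\<bar> \<le> M"
proof -
  obtain C where C: "C \<ge> 0" "\<And>t. t > 0 ==> t powr \<mu> * \<bar>mittag_leffler \<alpha> \<mu> (- (t powr \<alpha>))\<bar> \<le> C"
    using mittag_leffler_decay[OF assms] by blast
  have "continuous_on {0..1} (\<lambda>x. mittag_leffler \<alpha> \<mu> (- x))"
  proof (rule continuous_on_compose2[where g = "mittag_leffler \<alpha> \<mu>" and t = UNIV])
    show "continuous_on UNIV (mittag_leffler \<alpha> \<mu>)"
      using mittag_leffler_isCont \<alpha> \<mu> by (intro continuous_at_imp_continuous_on) auto
  qed (auto intro!: continuous_intros)
  then have "compact ((\<lambda>x. mittag_leffler \<alpha> \<mu> (- x)) ` {0..1})"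
    by (rule compact_continuous_image) simp
  then obtain B where "\<forall>x\<in>{0..1}. \<bar>mittag_leffler \<alpha> \<mu> (- x)\<bar> \<le> B"
    by (auto dest!: compact_imp_bounded simp: bounded_iff)
  then have B: "\<And>x. x \<in> {0..1} ==> \<bar>mittag_leffler \<alpha> \<mu> (- x)\<bar> \<le> B" by blast
  show ?thesis
  proof (rule that[of "max (\<bar>B\<bar>) C"])
    fix x :: real assume x: "x \<ge> 0"
    show "\<bar>mittag_leffler \<alpha> \<mu> (- x)\<bar> \<le> max \<bar>B\<bar> C"
    proof (cases "x \<le> 1")
      case True
      then show ?thesis using B[of x] x by auto
    next
      case False
      define t where "t = x powr (1 / \<alpha>)"
      have t: "t > 0" "t powr \<alpha> = x" using False \<alpha> by (auto simp: t_def powr_powr)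
      have "1 \<le> t" unfolding t_def using False \<alpha> by (intro ge_one_powr_ge_zero) auto
      then have "1 \<le> t powr \<mu>" using \<mu> by (intro ge_one_powr_ge_zero) auto
      then have "1 * \<bar>mittag_leffler \<alpha> \<mu> (- x)\<bar> \<le> t powr \<mu> * \<bar>mittag_leffler \<alpha> \<mu> (- x)\<bar>"
        by (intro mult_right_mono) auto
      also have "\<dots> \<le> C" using C(2)[OF t(1)] t(2) by simp
      finally show ?thesis by simp
    qed
  next
    fix \<tau> :: real assume "\<tau> > 0"
    then show "\<tau> powr \<mu> * \<bar>mittag_leffler \<alpha> \<mu> (- (\<tau> powr \<alpha>))\<bar> \<le> max \<bar>B\<bar> C"
      using C(2)[of \<tau>] by simp
  qed simp
qed

lemma powr_alpha_deriv:
  fixes t c :: real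
  assumes "t > 0"
  shows "((\<lambda>t. - c * t powr \<alpha>) has_real_derivative (- c * \<alpha> * t powr (\<alpha> - 1))) (at t)"
  using assms by (auto intro!: derivative_eq_intros)

lemma ml_time_1:
  assumes "\<alpha> > 1" "t > 0"
  shows "((\<lambda>t. mittag_leffler \<alpha> 1 (- c * t powr \<alpha>)) has_real_derivative
     (- (c * t powr (\<alpha> - 1) * mittag_leffler \<alpha> \<alpha> (- c * t powr \<alpha>)))) (at t)"
proof -
  have "((\<lambda>t. mittag_leffler \<alpha> 1 (- c * t powr \<alpha>)) has_real_derivative
     mittag_leffler_deriv \<alpha> 1 (- c * t powr \<alpha>) * (- c * \<alpha> * t powr (\<alpha> - 1))) (at t)"
    by (rule DERIV_chain2[OF mittag_leffler_has_deriv powr_alpha_deriv]) (use assms in auto)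
  also have "mittag_leffler_deriv \<alpha> 1 (- c * t powr \<alpha>) * (- c * \<alpha> * t powr (\<alpha> - 1))
     = - (c * t powr (\<alpha> - 1) * mittag_leffler \<alpha> \<alpha> (- c * t powr \<alpha>))"
    unfolding mittag_leffler_deriv_1[OF assms(1), symmetric] by (simp add: algebra_simps)
  finally show ?thesis .
qed

lemma ml_time_shift:
  assumes "\<alpha> > 1" "t > 0" "\<mu> > 1"
  shows "((\<lambda>t. t powr (\<mu> - 1) * mittag_leffler \<alpha> \<mu> (- c * t powr \<alpha>)) has_real_derivative
     (t powr (\<mu> - 2) * mittag_leffler \<alpha> (\<mu> - 1) (- c * t powr \<alpha>))) (at t)"
proof -
  define z where "z = - c * t powr \<alpha>"
  have "((\<lambda>t. mittag_leffler \<alpha> \<mu> (- c * t powr \<alpha>)) has_real_derivative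
     mittag_leffler_deriv \<alpha> \<mu> (- c * t powr \<alpha>) * (- c * \<alpha> * t powr (\<alpha> - 1))) (at t)"
    by (rule DERIV_chain2[OF mittag_leffler_has_deriv powr_alpha_deriv]) (use assms in auto)
  from DERIV_mult[OF has_real_derivative_powr[OF assms(2), of "\<mu> - 1"] this]
  have "((\<lambda>t. t powr (\<mu> - 1) * mittag_leffler \<alpha> \<mu> (- c * t powr \<alpha>)) has_real_derivative
    (\<mu> - 1) * t powr (\<mu> - 1 - 1) * mittag_leffler \<alpha> \<mu> z + mittag_leffler_deriv \<alpha> \<mu> z * (- c * \<alpha> * t powr (\<alpha> - 1)) * t powr (\<mu> - 1)) (at t)"
    unfolding z_def .
  also have "(\<mu> - 1) * t powr (\<mu> - 1 - 1) * mittag_leffler \<alpha> \<mu> z + mittag_leffler_deriv \<alpha> \<mu> z * (- c * \<alpha> * t powr (\<alpha> - 1)) * t powr (\<mu> - 1)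
    = t powr (\<mu> - 2) * (\<alpha> * z * mittag_leffler_deriv \<alpha> \<mu> z + (\<mu> - 1) * mittag_leffler \<alpha> \<mu> z)"
  proof -
    have "t powr (\<alpha> - 1) * t powr (\<mu> - 1) = t powr (\<mu> - 2) * t powr \<alpha>"
      by (simp add: powr_add[symmetric] algebra_simps)
    then show ?thesis by (simp add: z_def algebra_simps)
  qed
  also have "\<dots> = t powr (\<mu> - 2) * mittag_leffler \<alpha> (\<mu> - 1) z"
    using mittag_leffler_deriv_shift[OF assms(1,3), of z] by simp
  finally show ?thesis unfolding z_def .
qed

lemma continuous_on_ml_time:
  assumes "\<alpha> > 1" "\<mu> > 0"
  shows "continuous_on {0..} (\<lambda>t. mittag_leffler \<alpha> \<mu> (- c * t powr \<alpha>))"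
proof (rule continuous_on_compose2[where g = "mittag_leffler \<alpha> \<mu>" and t = UNIV])
  show "continuous_on UNIV (mittag_leffler \<alpha> \<mu>)"
    using mittag_leffler_isCont assms by (intro continuous_at_imp_continuous_on) auto
  show "continuous_on {0..} (\<lambda>t. - c * t powr \<alpha>)"
    using assms by (intro continuous_intros continuous_on_powr') auto
qed auto

text \<open>Comparison with a primitive \<open>\<phi>\<close> of the derivative bound allows derivatives that blow up at \<open>0\<close>.\<close>

lemma Lipschitz_of_deriv_bound:
  fixes f \<phi> :: "real => real"
  assumes f: "continuous_on {0..T} f" "\<And>t. 0 < t ==> t \<le> T ==> (f has_real_derivative f' t) (at t)"
    and \<phi>: "continuous_on {0..T} \<phi>" "\<And>t. 0 < t ==> t \<le> T ==> (\<phi> has_real_derivative \<phi>' t) (at t)"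
    and b: "\<And>t. 0 < t ==> t \<le> T ==> \<bar>f' t\<bar> \<le> \<phi>' t" and xy: "0 \<le> y" "y \<le> x" "x \<le> T"
  shows "\<bar>f x - f y\<bar> \<le> \<phi> x - \<phi> y"
proof (cases "y = x")
  case False
  then have yx: "y < x" using xy by simp
  have "\<phi> y - f y \<le> \<phi> x - f x"
  proof (rule DERIV_nonneg_imp_increasing_open[OF less_imp_le[OF yx]])
    fix t assume t: "y < t" "t < x"
    have "((\<lambda>t. \<phi> t - f t) has_real_derivative \<phi>' t - f' t) (at t)"
      using f(2) \<phi>(2) t xy by (intro DERIV_diff) auto
    then show "\<exists>z. ((\<lambda>t. \<phi> t - f t) has_real_derivative z) (at t) \<and> 0 \<le> z"
      using b[of t] t xy by (intro exI[of _ "\<phi>' t - f' t"]) auto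
  qed (use xy in \<open>auto intro!: continuous_on_diff continuous_on_subset[OF \<phi>(1)] continuous_on_subset[OF f(1)]\<close>)
  moreover have "\<phi> y + f y \<le> \<phi> x + f x"
  proof (rule DERIV_nonneg_imp_increasing_open[OF less_imp_le[OF yx]])
    fix t assume t: "y < t" "t < x"
    have "((\<lambda>t. \<phi> t + f t) has_real_derivative \<phi>' t + f' t) (at t)"
      using f(2) \<phi>(2) t xy by (intro DERIV_add) auto
    then show "\<exists>z. ((\<lambda>t. \<phi> t + f t) has_real_derivative z) (at t) \<and> 0 \<le> z"
      using b[of t] t xy by (intro exI[of _ "\<phi>' t + f' t"]) auto
  qed (use xy in \<open>auto intro!: continuous_on_add continuous_on_subset[OF \<phi>(1)] continuous_on_subset[OF f(1)]\<close>)
  ultimately show ?thesis by linarith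
qed simp

lemma powr_concave_chord:
  fixes x y p :: real
  assumes "0 \<le> y" "y \<le> x" "0 < p" "p \<le> 1"
  shows "x powr p - y powr p \<le> (x - y) * x powr (p - 1)"
proof (cases "y = 0")
  case True
  then show ?thesis using assms by (cases "x = 0") (auto simp: powr_diff)
next
  case False
  then have y: "y > 0" "x > 0" using assms by auto
  have "x powr (p - 1) \<le> y powr (p - 1)"
    using assms y by (intro powr_mono2') auto
  then have "y * x powr (p - 1) \<le> y * y powr (p - 1)"
    using y by (intro mult_left_mono) auto
  then show ?thesis using y by (simp add: powr_diff field_simps)
qed

text \<open>Extending the kernel by \<open>0\<close> turns the integral over \<open>{0..t}\<close> of \<open>S_kernel (t - s)\<close> into an integral over
\<open>{0..T}\<close> whose domain does not move with \<open>t\<close>.\<close>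

definition S_ext :: "real => real => real => real => real => real" where
  "S_ext \<alpha> \<beta> \<nu> c t = (if t > 0 then S_kernel \<alpha> \<beta> \<nu> c t else 0)"

lemma S_kernel_deriv:
  assumes "\<alpha> > 1" "t > 0"
  shows "(S_kernel \<alpha> \<beta> \<nu> c has_real_derivative
    exp (- \<nu> * t) * (t powr (\<alpha> - 2) * mittag_leffler \<alpha> (\<alpha> - 1) (- (c powr \<beta>) * t powr \<alpha>)
      - \<nu> * (t powr (\<alpha> - 1) * mittag_leffler \<alpha> \<alpha> (- (c powr \<beta>) * t powr \<alpha>)))) (at t)"
proof -
  have "((\<lambda>t. exp (- \<nu> * t)) has_real_derivative - \<nu> * exp (- \<nu> * t)) (at t)"
    by (auto intro!: derivative_eq_intros)
  from DERIV_mult[OF this ml_time_shift[OF assms assms(1), of "c powr \<beta>"]]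
  have "((\<lambda>t. exp (- \<nu> * t) * (t powr (\<alpha> - 1) * mittag_leffler \<alpha> \<alpha> (- (c powr \<beta>) * t powr \<alpha>))) has_real_derivative
     - \<nu> * exp (- \<nu> * t) * (t powr (\<alpha> - 1) * mittag_leffler \<alpha> \<alpha> (- (c powr \<beta>) * t powr \<alpha>))
     + t powr (\<alpha> - 2) * mittag_leffler \<alpha> (\<alpha> - 1) (- (c powr \<beta>) * t powr \<alpha>) * exp (- \<nu> * t)) (at t)" .
  moreover have "S_kernel \<alpha> \<beta> \<nu> c = (\<lambda>t. exp (- \<nu> * t) * (t powr (\<alpha> - 1) * mittag_leffler \<alpha> \<alpha> (- (c powr \<beta>) * t powr \<alpha>)))"
    by (simp add: S_kernel_def fun_eq_iff mult_ac)
  ultimately show ?thesis by (simp add: algebra_simps)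
qed

lemma S_kernel_continuous:
  assumes "\<alpha> > 1"
  shows "continuous_on {0..} (S_kernel \<alpha> \<beta> \<nu> c)"
  unfolding S_kernel_def using assms
  by (intro continuous_on_mult continuous_on_ml_time continuous_on_powr' continuous_intros) auto

lemma S_ext_continuous:
  assumes "\<alpha> > 1"
  shows "continuous_on UNIV (S_ext \<alpha> \<beta> \<nu> c)"
proof -
  have "continuous_on UNIV (\<lambda>t. S_kernel \<alpha> \<beta> \<nu> c (max 0 t))"
    by (rule continuous_on_compose2[OF S_kernel_continuous[OF assms]]) (auto intro!: continuous_intros)
  moreover have "S_ext \<alpha> \<beta> \<nu> c = (\<lambda>t. S_kernel \<alpha> \<beta> \<nu> c (max 0 t))"
    by (auto simp: S_ext_def fun_eq_iff S_kernel_def max_def)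
  ultimately show ?thesis by simp
qed

lemma S_ext_measurable [measurable]: "\<alpha> > 1 ==> S_ext \<alpha> \<beta> \<nu> c \<in> borel_measurable borel"
  by (rule borel_measurable_continuous_onI) (rule S_ext_continuous)

text \<open>The derivative behaves like \<open>t powr (\<alpha> - 2)\<close> to the right of \<open>0\<close>, so \<open>0\<close> has to be left out.\<close>

lemma S_ext_differentiable:
  assumes "\<alpha> > 1" "t \<noteq> 0"
  shows "\<exists>d. (S_ext \<alpha> \<beta> \<nu> c has_real_derivative d) (at t)"
proof (cases "t > 0")
  case True
  have "eventually (\<lambda>s. s > 0) (nhds t)"
    using True by (simp add: eventually_nhds_in_open[of "{0<..}", simplified])
  then have "eventually (\<lambda>s. S_ext \<alpha> \<beta> \<nu> c s = S_kernel \<alpha> \<beta> \<nu> c s) (nhds t)"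
    by eventually_elim (simp add: S_ext_def)
  then show ?thesis
    using S_kernel_deriv[OF assms(1) True] by (subst DERIV_cong_ev[OF refl _ refl]) auto
next
  case False
  then have "eventually (\<lambda>s. s < 0) (nhds t)"
    using assms by (simp add: eventually_nhds_in_open[of "{..<0}", simplified])
  then have "eventually (\<lambda>s. S_ext \<alpha> \<beta> \<nu> c s = 0) (nhds t)"
    by eventually_elim (simp add: S_ext_def)
  then show ?thesis
    by (subst DERIV_cong_ev[OF refl _ refl]) (auto intro: DERIV_const)
qed

lemma R_kernel_deriv:
  assumes "\<alpha> > 1" "t > 0"
  shows "(R_kernel \<alpha> \<beta> \<nu> c has_real_derivative
    exp (- \<nu> * t) * (mittag_leffler \<alpha> 1 (- (c powr \<beta>) * t powr \<alpha>)
      - \<nu> * (t * mittag_leffler \<alpha> 2 (- (c powr \<beta>) * t powr \<alpha>)))) (at t)"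
    and "((\<lambda>t. t * mittag_leffler \<alpha> 2 (- (c powr \<beta>) * t powr \<alpha>)) has_real_derivative
      mittag_leffler \<alpha> 1 (- (c powr \<beta>) * t powr \<alpha>)) (at t)"
proof -
  have "((\<lambda>t. t powr (2 - 1) * mittag_leffler \<alpha> 2 (- (c powr \<beta>) * t powr \<alpha>)) has_real_derivative
     t powr (2 - 2) * mittag_leffler \<alpha> (2 - 1) (- (c powr \<beta>) * t powr \<alpha>)) (at t)"
    by (rule ml_time_shift) (use assms in auto)
  then have "((\<lambda>t. t powr 1 * mittag_leffler \<alpha> 2 (- (c powr \<beta>) * t powr \<alpha>)) has_real_derivative
      mittag_leffler \<alpha> 1 (- (c powr \<beta>) * t powr \<alpha>)) (at t)"
    using assms by simp
  moreover have "eventually (\<lambda>s. s > 0) (nhds t)"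
    using assms by (simp add: eventually_nhds_in_open[of "{0<..}", simplified])
  then have "eventually (\<lambda>t. t * mittag_leffler \<alpha> 2 (- (c powr \<beta>) * t powr \<alpha>) =
      t powr 1 * mittag_leffler \<alpha> 2 (- (c powr \<beta>) * t powr \<alpha>)) (nhds t)"
    by eventually_elim simp
  ultimately show d: "((\<lambda>t. t * mittag_leffler \<alpha> 2 (- (c powr \<beta>) * t powr \<alpha>)) has_real_derivative
      mittag_leffler \<alpha> 1 (- (c powr \<beta>) * t powr \<alpha>)) (at t)"
    by (subst DERIV_cong_ev[OF refl _ refl]) auto
  have "((\<lambda>t. exp (- \<nu> * t)) has_real_derivative - \<nu> * exp (- \<nu> * t)) (at t)"
    by (auto intro!: derivative_eq_intros)
  from DERIV_mult[OF this d]
  have "((\<lambda>t. exp (- \<nu> * t) * (t * mittag_leffler \<alpha> 2 (- (c powr \<beta>) * t powr \<alpha>))) has_real_derivative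
     - \<nu> * exp (- \<nu> * t) * (t * mittag_leffler \<alpha> 2 (- (c powr \<beta>) * t powr \<alpha>))
     + mittag_leffler \<alpha> 1 (- (c powr \<beta>) * t powr \<alpha>) * exp (- \<nu> * t)) (at t)" .
  moreover have "R_kernel \<alpha> \<beta> \<nu> c = (\<lambda>t. exp (- \<nu> * t) * (t * mittag_leffler \<alpha> 2 (- (c powr \<beta>) * t powr \<alpha>)))"
    by (simp add: R_kernel_def fun_eq_iff mult_ac)
  ultimately show "(R_kernel \<alpha> \<beta> \<nu> c has_real_derivative
    exp (- \<nu> * t) * (mittag_leffler \<alpha> 1 (- (c powr \<beta>) * t powr \<alpha>)
      - \<nu> * (t * mittag_leffler \<alpha> 2 (- (c powr \<beta>) * t powr \<alpha>)))) (at t)"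
    by (simp add: algebra_simps)
qed

lemma R_kernel_continuous:
  assumes "\<alpha> > 1"
  shows "continuous_on {0..} (R_kernel \<alpha> \<beta> \<nu> c)"
    and "continuous_on {0..} (\<lambda>t. t * mittag_leffler \<alpha> 2 (- (c powr \<beta>) * t powr \<alpha>))"
  unfolding R_kernel_def using assms
  by (intro continuous_on_mult continuous_on_ml_time continuous_intros; simp)+

lemma T_kernel_eq:
  "T_kernel \<alpha> \<beta> \<nu> c t = exp (- \<nu> * t) * mittag_leffler \<alpha> 1 (- (c powr \<beta>) * t powr \<alpha>) + \<nu> * R_kernel \<alpha> \<beta> \<nu> c t"
  by (simp add: T_kernel_def R_kernel_def algebra_simps)

lemma T_kernel_deriv:
  assumes "\<alpha> > 1" "t > 0"
  shows "(T_kernel \<alpha> \<beta> \<nu> c has_real_derivative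
    - exp (- \<nu> * t) * (c powr \<beta> * t powr (\<alpha> - 1) * mittag_leffler \<alpha> \<alpha> (- (c powr \<beta>) * t powr \<alpha>)
      + \<nu>\<^sup>2 * (t * mittag_leffler \<alpha> 2 (- (c powr \<beta>) * t powr \<alpha>)))) (at t)"
proof -
  have "((\<lambda>t. exp (- \<nu> * t)) has_real_derivative - \<nu> * exp (- \<nu> * t)) (at t)"
    by (auto intro!: derivative_eq_intros)
  from DERIV_add[OF DERIV_mult[OF this ml_time_1[OF assms]] DERIV_cmult[OF R_kernel_deriv(1)[OF assms]]]
  show ?thesis
    unfolding T_kernel_eq[abs_def] by (rule DERIV_cong) (simp add: algebra_simps power2_eq_square)
qed

lemma T_kernel_continuous: "\<alpha> > 1 ==> continuous_on {0..} (T_kernel \<alpha> \<beta> \<nu> c)"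
  unfolding T_kernel_eq[abs_def]
  by (intro continuous_on_add continuous_on_mult continuous_on_ml_time R_kernel_continuous continuous_intros) simp_all

lemma R_kernel_differentiable:
  assumes "\<alpha> > 1" "t \<ge> 0"
  shows "\<exists>d. (R_kernel \<alpha> \<beta> \<nu> c has_real_derivative d) (at t within {0..})"
proof (cases "t = 0")
  case False
  then have "t > 0" using assms by simp
  from has_field_derivative_at_within[OF R_kernel_deriv(1)[OF assms(1) this]] show ?thesis by blast
next
  case True
  define G where "G s = exp (- \<nu> * s) * mittag_leffler \<alpha> 2 (- (c powr \<beta>) * s powr \<alpha>)" for s
  have "continuous_on {0..} G"
    unfolding G_def by (intro continuous_on_mult continuous_on_ml_time continuous_intros) (use assms in auto)
  then have "(G \<longlongrightarrow> G 0) (at 0 within {0..})" by (simp add: continuous_on_def)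
  moreover have "eventually (\<lambda>s. G s = (R_kernel \<alpha> \<beta> \<nu> c s - R_kernel \<alpha> \<beta> \<nu> c 0) / (s - 0)) (at 0 within {0..})"
    unfolding eventually_at_filter by (auto simp: R_kernel_def G_def)
  ultimately have "((\<lambda>s. (R_kernel \<alpha> \<beta> \<nu> c s - R_kernel \<alpha> \<beta> \<nu> c 0) / (s - 0)) \<longlongrightarrow> G 0) (at 0 within {0..})"
    by (rule tendsto_cong[THEN iffD1, rotated])
  then show ?thesis unfolding has_field_derivative_iff True by blast
qed

lemma T_kernel_differentiable:
  assumes "\<alpha> > 1" "t \<ge> 0"
  shows "\<exists>d. (T_kernel \<alpha> \<beta> \<nu> c has_real_derivative d) (at t within {0..})"
proof (cases "t = 0")
  case False
  then have "t > 0" using assms by simp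
  from has_field_derivative_at_within[OF T_kernel_deriv[OF assms(1) this]] show ?thesis by blast
next
  case True
  have "((\<lambda>s::real. s powr (\<alpha> - 1)) \<longlongrightarrow> 0) (at 0 within {0..})"
  proof -
    have "continuous_on {0..} (\<lambda>s::real. s powr (\<alpha> - 1))"
      using assms by (intro continuous_on_powr' continuous_intros) auto
    then show ?thesis by (force simp: continuous_on_def)
  qed
  moreover have "eventually (\<lambda>s::real. s powr (\<alpha> - 1) = (s powr \<alpha> - 0 powr \<alpha>) / (s - 0)) (at 0 within {0..})"
    unfolding eventually_at_filter by (auto simp: powr_diff)
  ultimately have "((\<lambda>s. (s powr \<alpha> - 0 powr \<alpha>) / (s - 0)) \<longlongrightarrow> 0) (at (0::real) within {0..})"
    by (rule tendsto_cong[THEN iffD1, rotated])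
  then have "((\<lambda>s. s powr \<alpha>) has_real_derivative 0) (at (0::real) within {0..})"
    unfolding has_field_derivative_iff .
  then have "((\<lambda>s. - (c powr \<beta>) * s powr \<alpha>) has_real_derivative - (c powr \<beta>) * 0) (at 0 within {0..})"
    by (rule DERIV_cmult)
  from DERIV_chain2[OF mittag_leffler_has_deriv this] assms
  have 1: "((\<lambda>s. mittag_leffler \<alpha> 1 (- (c powr \<beta>) * s powr \<alpha>)) has_real_derivative
     mittag_leffler_deriv \<alpha> 1 (- (c powr \<beta>) * 0 powr \<alpha>) * (- (c powr \<beta>) * 0)) (at 0 within {0..})"
    by simp
  have 2: "((\<lambda>t. exp (- \<nu> * t)) has_real_derivative - \<nu> * exp (- \<nu> * 0)) (at 0 within {0..})"
    by (auto intro!: derivative_eq_intros)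
  obtain d where d: "(R_kernel \<alpha> \<beta> \<nu> c has_real_derivative d) (at 0 within {0..})"
    using R_kernel_differentiable[OF assms(1), of 0 \<beta> \<nu> c] by auto
  show ?thesis
    unfolding T_kernel_eq[abs_def] True using DERIV_add[OF DERIV_mult[OF 2 1] DERIV_cmult[OF d]] by blast
qed

lemma max_powr_bound:
  fixes x y p :: real
  assumes K: "0 \<le> K" "0 < p" "p \<le> 1" and zero: "\<And>t. t \<le> 0 ==> f t = 0"
    and b: "\<And>x y. 0 \<le> y ==> y \<le> x ==> x \<le> T ==> \<bar>f x - f y\<bar> \<le> K * (x powr p - y powr p)"
    and T: "x \<le> T" "y \<le> (T::real)"
  shows "\<bar>f x - f y\<bar> \<le> K * (\<bar>x - y\<bar> * max x y powr (p - 1))"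
proof -
  have main: "\<bar>f x - f y\<bar> \<le> K * (\<bar>x - y\<bar> * max x y powr (p - 1))" if "y \<le> x" "x \<le> T" for x y
  proof (cases "x \<le> 0")
    case True
    then show ?thesis using zero that K by auto
  next
    case False
    define y' where "y' = max 0 y"
    have fy: "f y = f y'" using zero[of y] zero[of 0] by (auto simp: y'_def max_def)
    have y': "0 \<le> y'" "y' \<le> x" "y \<le> y'" using False that by (auto simp: y'_def)
    have "\<bar>f x - f y\<bar> \<le> K * (x powr p - y' powr p)"
      unfolding fy using b y' that by auto
    also have "\<dots> \<le> K * ((x - y') * x powr (p - 1))"
      using K y' by (intro mult_left_mono powr_concave_chord) auto
    also have "\<dots> \<le> K * ((x - y) * x powr (p - 1))"
      using K y' by (intro mult_left_mono mult_right_mono) auto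
    finally show ?thesis using that by (simp add: max_def)
  qed
  show ?thesis
  proof (cases "y \<le> x")
    case True
    then show ?thesis using main T by blast
  next
    case False
    then have "\<bar>f y - f x\<bar> \<le> K * (\<bar>y - x\<bar> * max y x powr (p - 1))"
      using main[of x y] T by simp
    then show ?thesis
      by (simp only: abs_minus_commute[of "f y"] abs_minus_commute[of y] max.commute[of y])
  qed
qed

text \<open>By the differentiation formulas the derivatives of \<open>S\<close>, \<open>T\<close> and \<open>R\<close> are combinations of Mittag-Leffler
functions with parameters \<open>\<alpha> - 1\<close>, \<open>1\<close>, \<open>2\<close> and \<open>\<alpha>\<close>, times powers of \<open>t\<close>. For \<open>S\<close> this gives
\<open>\<bar>S'(t)\<bar> \<le> K t powr (\<alpha> - 2)\<close>, which is integrated and then estimated by the chord of a concave power. For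
\<open>T\<close> the derivative carries a factor \<open>c powr \<beta>\<close>; with \<open>\<tau> = c powr (\<beta> / \<alpha>) * t\<close> it becomes
\<open>c powr (\<beta> / \<alpha>)\<close> times \<open>\<tau> powr (\<alpha> - 1) * E\<^bsub>\<alpha>,\<alpha>\<^esub>(- (\<tau> powr \<alpha>))\<close>, and the last expression is bounded by
the decay estimate.\<close>

lemma kernel_bounds:
  assumes \<alpha>: "1 < \<alpha>" "\<alpha> < 2" and \<nu>: "\<nu> > 0" and T: "T > 0" and \<beta>: "\<beta> > 0" and c0: "c0 > 0"
  obtains K where "K \<ge> 0"
    "\<And>c x y. x \<le> T ==> y \<le> T ==> \<bar>S_ext \<alpha> \<beta> \<nu> c x - S_ext \<alpha> \<beta> \<nu> c y\<bar> \<le> K * (\<bar>x - y\<bar> * max x y powr (\<alpha> - 2))"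
    "\<And>c x y. c0 \<le> c ==> x \<in> {0..T} ==> y \<in> {0..T} ==> \<bar>T_kernel \<alpha> \<beta> \<nu> c x - T_kernel \<alpha> \<beta> \<nu> c y\<bar> \<le> K * c powr (\<beta> / \<alpha>) * \<bar>x - y\<bar>"
    "\<And>c x y. x \<in> {0..T} ==> y \<in> {0..T} ==> \<bar>R_kernel \<alpha> \<beta> \<nu> c x - R_kernel \<alpha> \<beta> \<nu> c y\<bar> \<le> K * \<bar>x - y\<bar>"
proof -
  have ex: "\<exists>M\<ge>0. (\<forall>x\<ge>0. \<bar>mittag_leffler \<alpha> \<mu> (- x)\<bar> \<le> M) \<and>
      (\<forall>\<tau>>0. \<tau> powr \<mu> * \<bar>mittag_leffler \<alpha> \<mu> (- (\<tau> powr \<alpha>))\<bar> \<le> M)" if "0 < \<mu>" "\<mu> \<le> \<alpha>" for \<mu>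
    by (rule mittag_leffler_bounded[OF \<alpha> that]) blast
  obtain M1 where M1: "M1 \<ge> 0" "\<And>x. x \<ge> 0 ==> \<bar>mittag_leffler \<alpha> 1 (- x)\<bar> \<le> M1"
    using ex[of 1] \<alpha> by auto
  obtain M2 where M2: "M2 \<ge> 0" "\<And>x. x \<ge> 0 ==> \<bar>mittag_leffler \<alpha> (\<alpha> - 1) (- x)\<bar> \<le> M2"
    using ex[of "\<alpha> - 1"] \<alpha> by auto
  obtain M3 where M3: "M3 \<ge> 0" "\<And>x. x \<ge> 0 ==> \<bar>mittag_leffler \<alpha> \<alpha> (- x)\<bar> \<le> M3"
      "\<And>\<tau>. \<tau> > 0 ==> \<tau> powr \<alpha> * \<bar>mittag_leffler \<alpha> \<alpha> (- (\<tau> powr \<alpha>))\<bar> \<le> M3"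
    using ex[of \<alpha>] \<alpha> by auto
  have e1: "exp (- \<nu> * t) \<le> 1" if "t \<ge> 0" for t using \<nu> that by simp
  have rb: "\<bar>t * mittag_leffler \<alpha> 2 (- (c powr \<beta>) * t powr \<alpha>)\<bar> \<le> M1 * t" if "0 \<le> t" for c t
  proof -
    have "\<bar>t * mittag_leffler \<alpha> 2 (- (c powr \<beta>) * t powr \<alpha>) - 0 * mittag_leffler \<alpha> 2 (- (c powr \<beta>) * 0 powr \<alpha>)\<bar>
        \<le> M1 * t - M1 * 0"
    proof (rule Lipschitz_of_deriv_bound[where T = t and \<phi> = "\<lambda>t. M1 * t" and \<phi>' = "\<lambda>_. M1"
          and f' = "\<lambda>t. mittag_leffler \<alpha> 1 (- (c powr \<beta>) * t powr \<alpha>)"])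
      show "continuous_on {0..t} (\<lambda>t. t * mittag_leffler \<alpha> 2 (- (c powr \<beta>) * t powr \<alpha>))"
        using R_kernel_continuous(2)[of \<alpha> c \<beta>] \<alpha> by (auto intro: continuous_on_subset)
      show "\<bar>mittag_leffler \<alpha> 1 (- (c powr \<beta>) * s powr \<alpha>)\<bar> \<le> M1" for s
        using M1(2)[of "c powr \<beta> * s powr \<alpha>"] by simp
      show "((\<lambda>t. t * mittag_leffler \<alpha> 2 (- (c powr \<beta>) * t powr \<alpha>)) has_real_derivative
          mittag_leffler \<alpha> 1 (- (c powr \<beta>) * s powr \<alpha>)) (at s)" if "0 < s" for s
        by (rule R_kernel_deriv(2)) (use \<alpha> that in auto)
    qed (use that in \<open>auto intro!: derivative_eq_intros continuous_intros\<close>)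
    then show ?thesis by simp
  qed
  define KS where "KS = (M2 + \<nu> * T * M3) / (\<alpha> - 1)"
  define KR where "KR = M1 + \<nu> * (M1 * T)"
  define KT where "KT = max M3 0 + \<nu>\<^sup>2 * (M1 * T) * c0 powr (- (\<beta> / \<alpha>))"
  have S: "\<bar>S_ext \<alpha> \<beta> \<nu> c x - S_ext \<alpha> \<beta> \<nu> c y\<bar> \<le> KS * (\<bar>x - y\<bar> * max x y powr (\<alpha> - 2))"
    if xy: "x \<le> T" "y \<le> T" for c x y
  proof -
    have "\<bar>S_ext \<alpha> \<beta> \<nu> c x - S_ext \<alpha> \<beta> \<nu> c y\<bar> \<le> KS * (\<bar>x - y\<bar> * max x y powr (\<alpha> - 1 - 1))"
    proof (rule max_powr_bound[OF _ _ _ _ _ xy])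
      show "0 \<le> KS" using M2 M3 \<nu> T \<alpha> by (simp add: KS_def)
      fix x y assume xy: "0 \<le> y" "y \<le> x" "x \<le> T"
      have "\<bar>S_kernel \<alpha> \<beta> \<nu> c x - S_kernel \<alpha> \<beta> \<nu> c y\<bar> \<le> KS * x powr (\<alpha> - 1) - KS * y powr (\<alpha> - 1)"
      proof (rule Lipschitz_of_deriv_bound[where T = T and \<phi> = "\<lambda>t. KS * t powr (\<alpha> - 1)"
          and \<phi>' = "\<lambda>t. (M2 + \<nu> * T * M3) * t powr (\<alpha> - 2)", OF _ S_kernel_deriv _ _ _ xy])
        show "continuous_on {0..T} (S_kernel \<alpha> \<beta> \<nu> c)"
          using S_kernel_continuous[of \<alpha> \<beta> \<nu> c] \<alpha> by (auto intro: continuous_on_subset)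
        show "continuous_on {0..T} (\<lambda>t. KS * t powr (\<alpha> - 1))"
          using \<alpha> by (intro continuous_intros continuous_on_powr') auto
        fix t assume t: "0 < t" "t \<le> T"
        have "((\<lambda>t. KS * t powr (\<alpha> - 1)) has_real_derivative KS * ((\<alpha> - 1) * t powr (\<alpha> - 1 - 1))) (at t)"
          by (intro DERIV_cmult has_real_derivative_powr t)
        then show "((\<lambda>t. KS * t powr (\<alpha> - 1)) has_real_derivative (M2 + \<nu> * T * M3) * t powr (\<alpha> - 2)) (at t)"
          using \<alpha> by (simp add: KS_def)
        let ?A = "mittag_leffler \<alpha> (\<alpha> - 1) (- (c powr \<beta>) * t powr \<alpha>)"
        let ?B = "mittag_leffler \<alpha> \<alpha> (- (c powr \<beta>) * t powr \<alpha>)"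
        have A: "\<bar>?A\<bar> \<le> M2" using M2(2)[of "c powr \<beta> * t powr \<alpha>"] by simp
        have B: "\<bar>?B\<bar> \<le> M3" using M3(2)[of "c powr \<beta> * t powr \<alpha>"] by simp
        have tp: "t powr (\<alpha> - 1) = t * t powr (\<alpha> - 2)" using t by (simp add: powr_diff power2_eq_square powr_numeral)
        have "\<bar>exp (- \<nu> * t) * (t powr (\<alpha> - 2) * ?A - \<nu> * (t powr (\<alpha> - 1) * ?B))\<bar>
          \<le> 1 * (t powr (\<alpha> - 2) * M2 + \<nu> * (t powr (\<alpha> - 1) * M3))"
        proof -
          have "\<bar>t powr (\<alpha> - 2) * ?A - \<nu> * (t powr (\<alpha> - 1) * ?B)\<bar> \<le> \<bar>t powr (\<alpha> - 2) * ?A\<bar> + \<bar>\<nu> * (t powr (\<alpha> - 1) * ?B)\<bar>"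
            by (rule abs_triangle_ineq4)
          also have "\<dots> = t powr (\<alpha> - 2) * \<bar>?A\<bar> + \<nu> * (t powr (\<alpha> - 1) * \<bar>?B\<bar>)"
            using \<nu> by (simp add: abs_mult)
          also have "\<dots> \<le> t powr (\<alpha> - 2) * M2 + \<nu> * (t powr (\<alpha> - 1) * M3)"
            using A B \<nu> by (intro add_mono mult_left_mono) auto
          finally show ?thesis
            unfolding abs_mult[of "exp (- \<nu> * t)"] using e1[of t] t by (intro mult_mono) auto
        qed
        also have "\<dots> \<le> (M2 + \<nu> * T * M3) * t powr (\<alpha> - 2)"
        proof -
          have "\<nu> * (t * t powr (\<alpha> - 2) * M3) \<le> \<nu> * (T * t powr (\<alpha> - 2) * M3)"
            using \<nu> t M3 by (intro mult_left_mono mult_right_mono) auto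
          then show ?thesis unfolding tp by (simp add: algebra_simps)
        qed
        finally show "\<bar>exp (- \<nu> * t) * (t powr (\<alpha> - 2) * ?A - \<nu> * (t powr (\<alpha> - 1) * ?B))\<bar>
          \<le> (M2 + \<nu> * T * M3) * t powr (\<alpha> - 2)" .
      qed (use \<alpha> in auto)
      moreover have "S_ext \<alpha> \<beta> \<nu> c t = S_kernel \<alpha> \<beta> \<nu> c t" if "t \<ge> 0" for t
        using that by (auto simp: S_ext_def S_kernel_def)
      ultimately show "\<bar>S_ext \<alpha> \<beta> \<nu> c x - S_ext \<alpha> \<beta> \<nu> c y\<bar> \<le> KS * (x powr (\<alpha> - 1) - y powr (\<alpha> - 1))"
        using xy by (simp add: right_diff_distrib)
    qed (use \<alpha> in \<open>auto simp: S_ext_def\<close>)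
    then show ?thesis by simp
  qed
  have R: "\<bar>R_kernel \<alpha> \<beta> \<nu> c x - R_kernel \<alpha> \<beta> \<nu> c y\<bar> \<le> KR * x - KR * y"
    if xy: "0 \<le> y" "y \<le> x" "x \<le> T" for c x y
  proof (rule Lipschitz_of_deriv_bound[where T = T and \<phi> = "\<lambda>t. KR * t" and \<phi>' = "\<lambda>t. KR", OF _ R_kernel_deriv(1) _ _ _ xy])
    show "continuous_on {0..T} (R_kernel \<alpha> \<beta> \<nu> c)"
      using R_kernel_continuous(1)[of \<alpha> \<beta> \<nu> c] \<alpha> by (auto intro: continuous_on_subset)
    fix t assume t: "0 < t" "t \<le> T"
    let ?A = "mittag_leffler \<alpha> 1 (- (c powr \<beta>) * t powr \<alpha>)"
    let ?B = "t * mittag_leffler \<alpha> 2 (- (c powr \<beta>) * t powr \<alpha>)"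
    have A: "\<bar>?A\<bar> \<le> M1" using M1(2)[of "c powr \<beta> * t powr \<alpha>"] by simp
    have "M1 * t \<le> M1 * T" using M1 t by (intro mult_left_mono) auto
    then have B: "\<bar>?B\<bar> \<le> M1 * T" using rb[of t c] t by linarith
    have "\<bar>?A - \<nu> * ?B\<bar> \<le> \<bar>?A\<bar> + \<bar>\<nu> * ?B\<bar>" by (rule abs_triangle_ineq4)
    also have "\<bar>\<nu> * ?B\<bar> = \<nu> * \<bar>?B\<bar>" using \<nu> by (simp add: abs_mult)
    also have "\<bar>?A\<bar> + \<nu> * \<bar>?B\<bar> \<le> KR"
      unfolding KR_def using A B \<nu> by (intro add_mono mult_left_mono) auto
    finally have "\<bar>?A - \<nu> * ?B\<bar> \<le> KR" .
    then have "exp (- \<nu> * t) * \<bar>?A - \<nu> * ?B\<bar> \<le> 1 * KR"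
      using e1[of t] t by (intro mult_mono) auto
    then show "\<bar>exp (- \<nu> * t) * (?A - \<nu> * ?B)\<bar> \<le> KR" by (simp add: abs_mult)
  qed (use \<alpha> in \<open>auto intro!: derivative_eq_intros continuous_intros\<close>)
  have Tb: "\<bar>T_kernel \<alpha> \<beta> \<nu> c x - T_kernel \<alpha> \<beta> \<nu> c y\<bar> \<le> KT * c powr (\<beta> / \<alpha>) * x - KT * c powr (\<beta> / \<alpha>) * y"
    if c: "c0 \<le> c" and xy: "0 \<le> y" "y \<le> x" "x \<le> T" for c x y
  proof (rule Lipschitz_of_deriv_bound[where T = T and \<phi> = "\<lambda>t. KT * c powr (\<beta> / \<alpha>) * t" and \<phi>' = "\<lambda>t. KT * c powr (\<beta> / \<alpha>)", OF _ T_kernel_deriv _ _ _ xy])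
    show "continuous_on {0..T} (T_kernel \<alpha> \<beta> \<nu> c)"
      using T_kernel_continuous[of \<alpha> \<beta> \<nu> c] \<alpha> by (auto intro: continuous_on_subset)
    fix t assume t: "0 < t" "t \<le> T"
    let ?A = "c powr \<beta> * t powr (\<alpha> - 1) * mittag_leffler \<alpha> \<alpha> (- (c powr \<beta>) * t powr \<alpha>)"
    let ?B = "t * mittag_leffler \<alpha> 2 (- (c powr \<beta>) * t powr \<alpha>)"
    have cp: "c > 0" using c c0 by simp
    define \<tau> where "\<tau> = c powr (\<beta> / \<alpha>) * t"
    have \<tau>: "\<tau> > 0" using cp t by (simp add: \<tau>_def)
    have \<tau>a: "\<tau> powr \<alpha> = c powr \<beta> * t powr \<alpha>"
      using cp t \<alpha> by (simp add: \<tau>_def powr_mult powr_powr)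
    have "c powr \<beta> * t powr (\<alpha> - 1) = c powr (\<beta> / \<alpha>) * \<tau> powr (\<alpha> - 1)"
    proof -
      have "\<tau> powr (\<alpha> - 1) = c powr (\<beta> / \<alpha> * (\<alpha> - 1)) * t powr (\<alpha> - 1)"
        using cp t by (simp add: \<tau>_def powr_mult powr_powr)
      moreover have "c powr (\<beta> / \<alpha>) * c powr (\<beta> / \<alpha> * (\<alpha> - 1)) = c powr \<beta>"
        using \<alpha> by (simp add: powr_add[symmetric] field_simps)
      ultimately show ?thesis by (metis mult.assoc)
    qed
    then have "\<bar>?A\<bar> = c powr (\<beta> / \<alpha>) * (\<tau> powr (\<alpha> - 1) * \<bar>mittag_leffler \<alpha> \<alpha> (- (\<tau> powr \<alpha>))\<bar>)"
      by (simp add: abs_mult \<tau>a)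
    also have "\<dots> \<le> c powr (\<beta> / \<alpha>) * M3"
    proof (intro mult_left_mono)
      show "\<tau> powr (\<alpha> - 1) * \<bar>mittag_leffler \<alpha> \<alpha> (- (\<tau> powr \<alpha>))\<bar> \<le> M3"
      proof (cases "\<tau> \<le> 1")
        case True
        have "\<tau> powr (\<alpha> - 1) \<le> 1 powr (\<alpha> - 1)"
          using True \<tau> \<alpha> by (intro powr_mono2) auto
        then have "\<tau> powr (\<alpha> - 1) * \<bar>mittag_leffler \<alpha> \<alpha> (- (\<tau> powr \<alpha>))\<bar> \<le> 1 * M3"
          using M3(2)[of "\<tau> powr \<alpha>"] by (intro mult_mono) auto
        then show ?thesis by simp
      next
        case False
        have "\<tau> powr (\<alpha> - 1) \<le> \<tau> powr \<alpha>" using False by (intro powr_mono) auto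
        then have "\<tau> powr (\<alpha> - 1) * \<bar>mittag_leffler \<alpha> \<alpha> (- (\<tau> powr \<alpha>))\<bar> \<le> \<tau> powr \<alpha> * \<bar>mittag_leffler \<alpha> \<alpha> (- (\<tau> powr \<alpha>))\<bar>"
          by (intro mult_right_mono) auto
        then show ?thesis using M3(3)[OF \<tau>] by linarith
      qed
    qed simp
    finally have A: "\<bar>?A\<bar> \<le> c powr (\<beta> / \<alpha>) * M3" .
    have "M1 * t \<le> M1 * T" using M1 t by (intro mult_left_mono) auto
    then have B: "\<bar>?B\<bar> \<le> M1 * T" using rb[of t c] t by linarith
    have cc: "1 \<le> c0 powr (- (\<beta> / \<alpha>)) * c powr (\<beta> / \<alpha>)"
    proof -
      have "c0 powr (- (\<beta> / \<alpha>)) * c0 powr (\<beta> / \<alpha>) \<le> c0 powr (- (\<beta> / \<alpha>)) * c powr (\<beta> / \<alpha>)"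
        using c c0 \<beta> \<alpha> by (intro mult_left_mono powr_mono2) auto
      then show ?thesis using c0 by (simp add: powr_add[symmetric])
    qed
    have "\<bar>?A + \<nu>\<^sup>2 * ?B\<bar> \<le> \<bar>?A\<bar> + \<bar>\<nu>\<^sup>2 * ?B\<bar>" by (rule abs_triangle_ineq)
    also have "\<bar>\<nu>\<^sup>2 * ?B\<bar> = \<nu>\<^sup>2 * \<bar>?B\<bar>" by (simp add: abs_mult)
    also have "\<bar>?A\<bar> + \<nu>\<^sup>2 * \<bar>?B\<bar> \<le> c powr (\<beta> / \<alpha>) * M3 + \<nu>\<^sup>2 * (M1 * T)"
      using A B by (intro add_mono mult_left_mono) auto
    also have "\<nu>\<^sup>2 * (M1 * T) \<le> \<nu>\<^sup>2 * (M1 * T) * (c0 powr (- (\<beta> / \<alpha>)) * c powr (\<beta> / \<alpha>))"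
      using mult_left_mono[OF cc, of "\<nu>\<^sup>2 * (M1 * T)"] M1 T by simp
    also have "c powr (\<beta> / \<alpha>) * M3 + \<dots> = KT * c powr (\<beta> / \<alpha>)"
      using M3(1) by (simp add: KT_def algebra_simps)
    finally have "\<bar>?A + \<nu>\<^sup>2 * ?B\<bar> \<le> KT * c powr (\<beta> / \<alpha>)" by simp
    then have "exp (- \<nu> * t) * \<bar>?A + \<nu>\<^sup>2 * ?B\<bar> \<le> 1 * (KT * c powr (\<beta> / \<alpha>))"
      using e1[of t] t by (intro mult_mono) auto
    then show "\<bar>- exp (- \<nu> * t) * (?A + \<nu>\<^sup>2 * ?B)\<bar> \<le> KT * c powr (\<beta> / \<alpha>)"
      by (simp add: abs_mult)
  qed (use \<alpha> in \<open>auto intro!: derivative_eq_intros continuous_intros\<close>)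
  have Kpos: "0 \<le> KS" "0 \<le> KR" "0 \<le> KT" using M1 M2 M3 \<nu> T \<alpha> by (auto simp: KS_def KR_def KT_def)
  show ?thesis
  proof (rule that[of "KS + KR + KT"])
    show "0 \<le> KS + KR + KT" using Kpos by simp
    show "\<bar>S_ext \<alpha> \<beta> \<nu> c x - S_ext \<alpha> \<beta> \<nu> c y\<bar> \<le> (KS + KR + KT) * (\<bar>x - y\<bar> * max x y powr (\<alpha> - 2))"
      if "x \<le> T" "y \<le> T" for c x y
      using S[OF that, of c] by (rule order_trans) (use Kpos in \<open>auto intro!: mult_right_mono\<close>)
    have "KT * c powr (\<beta> / \<alpha>) * \<bar>x - y\<bar> \<le> (KS + KR + KT) * c powr (\<beta> / \<alpha>) * \<bar>x - y\<bar>" for c x y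
      using Kpos by (intro mult_right_mono) auto
    moreover have "\<bar>T_kernel \<alpha> \<beta> \<nu> c x - T_kernel \<alpha> \<beta> \<nu> c y\<bar> \<le> KT * c powr (\<beta> / \<alpha>) * \<bar>x - y\<bar>"
      if "c0 \<le> c" "x \<in> {0..T}" "y \<in> {0..T}" for c x y
      using Tb[OF that(1), of x y] Tb[OF that(1), of y x] that
      by (cases "x \<le> y") (auto simp: abs_if algebra_simps split: if_splits)
    ultimately show "\<bar>T_kernel \<alpha> \<beta> \<nu> c x - T_kernel \<alpha> \<beta> \<nu> c y\<bar> \<le> (KS + KR + KT) * c powr (\<beta> / \<alpha>) * \<bar>x - y\<bar>"
      if "c0 \<le> c" "x \<in> {0..T}" "y \<in> {0..T}" for c x y
      using that by (meson order_trans)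
    have "KR * \<bar>x - y\<bar> \<le> (KS + KR + KT) * \<bar>x - y\<bar>" for x y
      using Kpos by (intro mult_right_mono) auto
    moreover have "\<bar>R_kernel \<alpha> \<beta> \<nu> c x - R_kernel \<alpha> \<beta> \<nu> c y\<bar> \<le> KR * \<bar>x - y\<bar>"
      if "x \<in> {0..T}" "y \<in> {0..T}" for c x y
      using R[of x y c] R[of y x c] that
      by (cases "x \<le> y") (auto simp: abs_if algebra_simps split: if_splits)
    ultimately show "\<bar>R_kernel \<alpha> \<beta> \<nu> c x - R_kernel \<alpha> \<beta> \<nu> c y\<bar> \<le> (KS + KR + KT) * \<bar>x - y\<bar>"
      if "x \<in> {0..T}" "y \<in> {0..T}" for c x y
      using that by (meson order_trans)
  qed
qed

section \<open>Second moments of combinations of Ito integrals\<close>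

lemma sum_square_weighted:
  fixes a w :: "'i => real"
  assumes "finite I" "\<And>i. i \<in> I ==> w i > 0"
  shows "(\<Sum>i\<in>I. a i)^2 \<le> (\<Sum>i\<in>I. w i) * (\<Sum>i\<in>I. (a i)^2 / w i)"
  using assms
proof (induction I rule: finite_induct)
  case (insert x J)
  define S W Q where "S = (\<Sum>i\<in>J. a i)" and "W = (\<Sum>i\<in>J. w i)" and "Q = (\<Sum>i\<in>J. (a i)^2 / w i)"
  have IH: "S\<^sup>2 \<le> W * Q" using insert by (simp add: S_def W_def Q_def)
  have wx: "w x > 0" using insert by simp
  show ?case
  proof (cases "J = {}")
    case True
    then show ?thesis using wx by (simp add: power2_eq_square)
  next
    case False
    have W: "W > 0" unfolding W_def using insert False by (intro sum_pos) auto
    have "0 \<le> (w x * S - W * a x)^2" by simp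
    then have "2 * (w x * W) * (S * a x) \<le> (w x)^2 * S\<^sup>2 + W\<^sup>2 * (a x)^2"
      by (simp add: power2_eq_square algebra_simps)
    also have "\<dots> \<le> (w x)^2 * (W * Q) + W\<^sup>2 * (a x)^2"
      using IH by (intro add_mono mult_left_mono) auto
    also have "\<dots> = (w x * W) * (w x * Q + W * (a x)^2 / w x)"
      using wx by (simp add: power2_eq_square field_simps)
    finally have "2 * (S * a x) \<le> w x * Q + W * (a x)^2 / w x"
      using wx W by (simp add: mult.assoc[symmetric])
    moreover have "(w x + W) * ((a x)^2 / w x + Q) = (a x)^2 + w x * Q + W * (a x)^2 / w x + W * Q"
      using wx by (simp add: field_simps)
    moreover have "(a x + S)^2 = (a x)^2 + S\<^sup>2 + 2 * (S * a x)"
      by (simp add: power2_sum)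
    ultimately have "(a x + S)^2 \<le> (w x + W) * ((a x)^2 / w x + Q)"
      using IH by linarith
    then show ?thesis
      using insert by (simp add: S_def W_def Q_def)
  qed
qed simp

lemma sum_square_card:
  fixes a :: "'i => real"
  assumes "finite I"
  shows "(\<Sum>i\<in>I. a i)^2 \<le> real (card I) * (\<Sum>i\<in>I. (a i)^2)"
  using sum_square_weighted[OF assms, of "\<lambda>_. 1" a] by simp

text \<open>Passing from processes on \<open>[0,T]\<close> to processes on the whole line that vanish outside \<open>[0,T]\<close>.\<close>

lemma measurable_restrict_pair:
  fixes f :: "'a => 'b => real"
  assumes f: "(\<lambda>(s, w). f s w) \<in> borel_measurable (restrict_space N A \<Otimes>\<^sub>M M)" and A: "A \<in> sets N"
  shows "(\<lambda>(s, w). indicator A s * f s w) \<in> borel_measurable (N \<Otimes>\<^sub>M M)"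
proof -
  let ?P = "N \<Otimes>\<^sub>M M"
  have "(\<lambda>x. if fst x \<in> A then (\<lambda>(s, w). f s w) x else 0) \<in> borel_measurable ?P"
  proof (subst measurable_If_restrict_space_iff)
    show "{x \<in> space ?P. fst x \<in> A} \<in> sets ?P" using A by measurable
    have "(\<lambda>x. (fst x, snd x)) \<in> restrict_space ?P {x. fst x \<in> A} \<rightarrow>\<^sub>M restrict_space N A \<Otimes>\<^sub>M M"
      by (intro measurable_Pair measurable_restrict_space2 measurable_restrict_space1 measurable_fst measurable_snd)
         (auto simp: space_restrict_space)
    then have "(\<lambda>x. (\<lambda>(s, w). f s w) (fst x, snd x)) \<in> borel_measurable (restrict_space ?P {x. fst x \<in> A})"
      by (rule measurable_compose[OF _ f])
    then show "(\<lambda>(s, w). f s w) \<in> borel_measurable (restrict_space ?P {x. fst x \<in> A}) \<and>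
        (\<lambda>x. 0) \<in> borel_measurable (restrict_space ?P {x. fst x \<notin> A})"
      by (simp add: case_prod_beta)
  qed
  also have "(\<lambda>x. if fst x \<in> A then (\<lambda>(s, w). f s w) x else 0) = (\<lambda>(s, w). indicator A s * f s w)"
    by (auto simp: fun_eq_iff indicator_def)
  finally show ?thesis .
qed

locale wiener = prob_space M for M :: "'w measure" +
  fixes F :: "real => 'w measure" and W :: "real => 'w => real"
  assumes filtration: "complete_filtered_prob_space M F" and brownian: "brownian_motion M F W"
begin

lemma F_sub: "t \<ge> 0 ==> subalgebra M (F t)"
  and F_mono: "0 \<le> s ==> s \<le> t ==> sets (F s) \<subseteq> sets (F t)"
  using filtration by (auto simp: complete_filtered_prob_space_def)

lemma F_space: "t \<ge> 0 ==> space (F t) = space M"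
  using F_sub by (simp add: subalgebra_def)

lemma F_measurable_mono:
  assumes "f \<in> borel_measurable (F s)" "0 \<le> s" "s \<le> t"
  shows "f \<in> borel_measurable (F t)"
proof (rule measurable_from_subalg[OF _ assms(1)])
  have "t \<ge> 0" using assms by simp
  then show "subalgebra (F t) (F s)"
    using assms F_mono[of s t] F_space[of s] F_space[of t] by (simp add: subalgebra_def)
qed

lemma F_measurable: "f \<in> borel_measurable (F s) ==> 0 \<le> s ==> f \<in> borel_measurable M"
  by (rule measurable_from_subalg[OF F_sub])

lemma W_F: "0 \<le> s ==> s \<le> t ==> W s \<in> borel_measurable (F t)"
  using brownian by (intro F_measurable_mono[of "W s" s t]) (simp_all add: brownian_motion_def)

lemma increment_F: "0 \<le> a ==> a \<le> b ==> b \<le> c ==> (\<lambda>w. W b w - W a w) \<in> borel_measurable (F c)"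
  by (intro borel_measurable_diff W_F) simp_all

lemma increment_moments:
  assumes "0 \<le> s" "s < t"
  shows "integrable M (\<lambda>w. W t w - W s w)" "expectation (\<lambda>w. W t w - W s w) = 0"
    "integrable M (\<lambda>w. (W t w - W s w)^2)" "expectation (\<lambda>w. (W t w - W s w)^2) = t - s"
proof -
  let ?\<sigma> = "sqrt (t - s)"
  have \<sigma>: "?\<sigma> > 0" using assms by simp
  have d: "distributed M lborel (\<lambda>w. W t w - W s w) (normal_density 0 ?\<sigma>)"
    using brownian assms by (auto simp: brownian_motion_def)
  show i1: "integrable M (\<lambda>w. W t w - W s w)"
    using distributed_integrable[OF d, of "\<lambda>x. x"] integrable_normal_moment_nz_1[OF \<sigma>, of 0] by simp
  show e1: "expectation (\<lambda>w. W t w - W s w) = 0"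
    by (rule normal_distributed_expectation[OF \<sigma> d])
  show "integrable M (\<lambda>w. (W t w - W s w)^2)"
    using distributed_integrable[OF d, of "\<lambda>x. x\<^sup>2"] integrable_normal_moment[OF \<sigma>, of 0 2] by simp
  show "expectation (\<lambda>w. (W t w - W s w)^2) = t - s"
    using normal_distributed_variance[OF \<sigma> d] assms unfolding e1 by simp
qed

lemma increment_indep:
  assumes st: "0 \<le> s" "s < t" and \<zeta>: "\<zeta> \<in> borel_measurable (F s)" and h: "h \<in> borel_measurable borel"
  shows "indep_var borel \<zeta> borel (\<lambda>w. h (W t w - W s w) :: real)"
proof -
  let ?D = "\<lambda>w. W t w - W s w"
  have ind: "indep_set (sets (F s)) (sets (vimage_algebra (space M) ?D borel))"
    using brownian st by (auto simp: brownian_motion_def)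
  have D: "?D \<in> borel_measurable M"
    by (rule F_measurable[OF increment_F[of s t t]]) (use st in simp_all)
  have "indep_var borel \<zeta> borel ?D"
    unfolding indep_var_eq
  proof (intro conjI)
    show "random_variable borel \<zeta>" by (rule F_measurable[OF \<zeta> st(1)])
    show "random_variable borel ?D" by fact
    have 1: "sigma_sets (space M) {\<zeta> -` A \<inter> space M |A. A \<in> sets borel} \<subseteq> sets (F s)"
    proof -
      have "{\<zeta> -` A \<inter> space M |A. A \<in> sets borel} \<subseteq> sets (F s)"
        unfolding F_space[OF st(1), symmetric] using measurable_sets[OF \<zeta>] by blast
      from sets.sigma_sets_subset[OF this] show ?thesis
        by (simp add: F_space[OF st(1)])
    qed
    have 2: "sigma_sets (space M) {?D -` A \<inter> space M |A. A \<in> sets borel} = sets (vimage_algebra (space M) ?D borel)"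
      unfolding vimage_algebra_def by (subst sets_measure_of) auto
    show "indep_set (sigma_sets (space M) {\<zeta> -` A \<inter> space M |A. A \<in> sets borel})
       (sigma_sets (space M) {?D -` A \<inter> space M |A. A \<in> sets borel})"
      using ind unfolding indep_set_def 2
      by (rule indep_sets_mono_sets) (use 1 in \<open>auto split: bool.split\<close>)
  qed
  from indep_var_compose[OF this, of "\<lambda>x. x" borel h borel] h show ?thesis
    by (simp add: comp_def)
qed

lemma increment_zero:
  assumes st: "0 \<le> s" "s \<le> t" and \<zeta>: "\<zeta> \<in> borel_measurable (F s)" "integrable M \<zeta>"
  shows "integrable M (\<lambda>w. \<zeta> w * (W t w - W s w))" "expectation (\<lambda>w. \<zeta> w * (W t w - W s w)) = 0"
proof (atomize (full), cases "s = t")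
  case False
  then have st': "s < t" using st by simp
  note i = increment_indep[OF st(1) st' \<zeta>(1), of "\<lambda>x. x"]
  show "integrable M (\<lambda>w. \<zeta> w * (W t w - W s w)) \<and> expectation (\<lambda>w. \<zeta> w * (W t w - W s w)) = 0"
    using indep_var_integrable[OF i \<zeta>(2)] indep_var_lebesgue_integral[OF i \<zeta>(2)] increment_moments[OF st(1) st'] by simp
qed simp

lemma increment_square:
  assumes st: "0 \<le> s" "s \<le> t" and \<zeta>: "\<zeta> \<in> borel_measurable (F s)" "integrable M \<zeta>"
  shows "integrable M (\<lambda>w. \<zeta> w * (W t w - W s w)^2)"
    "expectation (\<lambda>w. \<zeta> w * (W t w - W s w)^2) = expectation \<zeta> * (t - s)"
proof (atomize (full), cases "s = t")
  case False
  then have st': "s < t" using st by simp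
  note i = increment_indep[OF st(1) st' \<zeta>(1), of "\<lambda>x. x\<^sup>2"]
  show "integrable M (\<lambda>w. \<zeta> w * (W t w - W s w)^2) \<and> expectation (\<lambda>w. \<zeta> w * (W t w - W s w)^2) = expectation \<zeta> * (t - s)"
    using indep_var_integrable[OF i \<zeta>(2)] indep_var_lebesgue_integral[OF i \<zeta>(2)] increment_moments[OF st(1) st'] by simp
qed simp

definition bounded_in :: "real => ('w => real) => bool" where
  "bounded_in s \<eta> \<longleftrightarrow> \<eta> \<in> borel_measurable (F s) \<and> (\<exists>B. \<forall>w\<in>space M. \<bar>\<eta> w\<bar> \<le> B)"

lemma bounded_in_mono: "bounded_in s \<eta> ==> 0 \<le> s ==> s \<le> t ==> bounded_in t \<eta>"
  using F_measurable_mono by (auto simp: bounded_in_def)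

lemma bounded_in_mult:
  assumes "bounded_in s \<eta>" "bounded_in s \<eta>'"
  shows "bounded_in s (\<lambda>w. \<eta> w * \<eta>' w)"
proof -
  obtain B B' where "\<And>w. w \<in> space M ==> \<bar>\<eta> w\<bar> \<le> B" "\<And>w. w \<in> space M ==> \<bar>\<eta>' w\<bar> \<le> B'"
    using assms unfolding bounded_in_def by metis
  then have "\<bar>\<eta> w * \<eta>' w\<bar> \<le> \<bar>B\<bar> * \<bar>B'\<bar>" if "w \<in> space M" for w
    unfolding abs_mult using that by (intro mult_mono) (auto intro: order_trans[OF _ abs_ge_self])
  then show ?thesis using assms unfolding bounded_in_def by (auto intro!: borel_measurable_times)
qed

lemma bounded_in_cmult: "bounded_in s \<eta> ==> bounded_in s (\<lambda>w. c * \<eta> w)"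
  using bounded_in_mult[of s "\<lambda>_. c" \<eta>] by (auto simp: bounded_in_def)

lemma bounded_in_integrable:
  assumes "bounded_in s \<eta>" "0 \<le> s" "integrable M \<zeta>"
  shows "integrable M (\<lambda>w. \<eta> w * \<zeta> w)"
proof -
  obtain B where B: "\<And>w. w \<in> space M ==> \<bar>\<eta> w\<bar> \<le> B"
    using assms unfolding bounded_in_def by metis
  have m: "\<eta> \<in> borel_measurable M" using assms F_measurable by (auto simp: bounded_in_def)
  show ?thesis
  proof (rule Bochner_Integration.integrable_bound[OF integrable_mult_right[OF integrable_norm[OF assms(3)], of "\<bar>B\<bar>"]])
    show "AE w in M. norm (\<eta> w * \<zeta> w) \<le> norm (\<bar>B\<bar> * norm (\<zeta> w))"
      by (intro AE_I2) (auto simp: abs_mult intro!: mult_right_mono dest!: B)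
  qed (use m assms in auto)
qed

lemma bounded_in_integrable': "bounded_in s \<eta> ==> 0 \<le> s ==> integrable M \<eta>"
  using bounded_in_integrable[of s \<eta> "\<lambda>_. 1"] by simp

lemma increment_cov_disjoint:
  assumes ab: "0 \<le> a" "a \<le> b" "b \<le> c" "c \<le> d" and \<eta>: "bounded_in a \<eta>" and \<eta>': "bounded_in c \<eta>'"
  shows "integrable M (\<lambda>w. (\<eta> w * (W b w - W a w)) * (\<eta>' w * (W d w - W c w)))"
    "expectation (\<lambda>w. (\<eta> w * (W b w - W a w)) * (\<eta>' w * (W d w - W c w))) = 0"
proof -
  let ?\<zeta> = "\<lambda>w. (\<eta> w * \<eta>' w) * (W b w - W a w)"
  have bb: "bounded_in c (\<lambda>w. \<eta> w * \<eta>' w)"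
    using bounded_in_mult bounded_in_mono[OF \<eta>] \<eta>' ab by simp
  have "integrable M (\<lambda>w. W b w - W a w)"
    using increment_moments(1)[of a b] ab by (cases "a = b") auto
  then have i: "integrable M ?\<zeta>"
    using ab by (intro bounded_in_integrable[OF bb]) auto
  have m: "?\<zeta> \<in> borel_measurable (F c)"
    using bb increment_F[of a b c] ab by (auto simp: bounded_in_def intro!: borel_measurable_times)
  have eq: "(\<eta> w * (W b w - W a w)) * (\<eta>' w * (W d w - W c w)) = ?\<zeta> w * (W d w - W c w)" for w
    by (simp add: mult_ac)
  have c0: "0 \<le> c" using ab by simp
  show "integrable M (\<lambda>w. (\<eta> w * (W b w - W a w)) * (\<eta>' w * (W d w - W c w)))"
    "expectation (\<lambda>w. (\<eta> w * (W b w - W a w)) * (\<eta>' w * (W d w - W c w))) = 0"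
    unfolding eq using increment_zero[OF c0 ab(4) m i] by auto
qed

lemma increment_cov_same_left:
  assumes bd: "0 \<le> c" "c \<le> b" "b \<le> d" and \<eta>: "bounded_in c \<eta>" and \<eta>': "bounded_in c \<eta>'"
  shows "integrable M (\<lambda>w. (\<eta> w * (W b w - W c w)) * (\<eta>' w * (W d w - W c w)))"
    "expectation (\<lambda>w. (\<eta> w * (W b w - W c w)) * (\<eta>' w * (W d w - W c w))) = expectation (\<lambda>w. \<eta> w * \<eta>' w) * (b - c)"
proof -
  have eq: "(\<eta> w * (W b w - W c w)) * (\<eta>' w * (W d w - W c w))
    = (\<eta> w * \<eta>' w) * (W b w - W c w)^2 + (\<eta> w * (W b w - W c w)) * (\<eta>' w * (W d w - W b w))" for w
    by (simp add: power2_eq_square algebra_simps)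
  have bb: "bounded_in c (\<lambda>w. \<eta> w * \<eta>' w)" by (rule bounded_in_mult[OF \<eta> \<eta>'])
  have m: "(\<lambda>w. \<eta> w * \<eta>' w) \<in> borel_measurable (F c)" using bb by (simp add: bounded_in_def)
  note sq = increment_square[OF bd(1,2) m bounded_in_integrable'[OF bb bd(1)]]
  have b0: "0 \<le> b" using bd by simp
  note dj = increment_cov_disjoint[OF bd(1,2) order_refl bd(3) \<eta> bounded_in_mono[OF \<eta>' bd(1,2)]]
  show "integrable M (\<lambda>w. (\<eta> w * (W b w - W c w)) * (\<eta>' w * (W d w - W c w)))"
    unfolding eq using sq dj by simp
  show "expectation (\<lambda>w. (\<eta> w * (W b w - W c w)) * (\<eta>' w * (W d w - W c w))) = expectation (\<lambda>w. \<eta> w * \<eta>' w) * (b - c)"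
    unfolding eq using sq dj by simp
qed

lemma increment_cov_ordered:
  assumes ab: "0 \<le> a" "a \<le> b" "a \<le> c" "c \<le> d" and \<eta>: "bounded_in a \<eta>" and \<eta>': "bounded_in c \<eta>'"
  shows "integrable M (\<lambda>w. (\<eta> w * (W b w - W a w)) * (\<eta>' w * (W d w - W c w))) \<and>
    expectation (\<lambda>w. (\<eta> w * (W b w - W a w)) * (\<eta>' w * (W d w - W c w)))
      = expectation (\<lambda>w. \<eta> w * \<eta>' w) * measure lborel ({a<..b} \<inter> {c<..d})"
proof (cases "b \<le> c")
  case True
  then have e0: "{a<..b} \<inter> {c<..d} = {}" by auto
  show ?thesis unfolding e0 using increment_cov_disjoint[OF ab(1,2) True ab(4) \<eta> \<eta>'] by simp
next
  case False
  then have bc: "c \<le> b" by simp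
  have c0: "0 \<le> c" using ab by simp
  have int: "{a<..b} \<inter> {c<..d} = {c<..min b d}" using ab by auto
  have \<eta>c: "bounded_in c \<eta>" by (rule bounded_in_mono[OF \<eta> ab(1,3)])
  have eq: "(\<eta> w * (W b w - W a w)) * (\<eta>' w * (W d w - W c w))
    = (\<eta> w * (W c w - W a w)) * (\<eta>' w * (W d w - W c w)) + (\<eta> w * (W b w - W c w)) * (\<eta>' w * (W d w - W c w))" for w
    by (simp add: algebra_simps)
  note dj = increment_cov_disjoint[OF ab(1,3) order_refl ab(4) \<eta> \<eta>']
  have same: "integrable M (\<lambda>w. (\<eta> w * (W b w - W c w)) * (\<eta>' w * (W d w - W c w))) \<and>
     expectation (\<lambda>w. (\<eta> w * (W b w - W c w)) * (\<eta>' w * (W d w - W c w))) = expectation (\<lambda>w. \<eta> w * \<eta>' w) * (min b d - c)"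
  proof (cases "b \<le> d")
    case True
    then show ?thesis using increment_cov_same_left[OF c0 bc True \<eta>c \<eta>'] by simp
  next
    case False
    then have "d \<le> b" by simp
    from increment_cov_same_left[OF c0 ab(4) this \<eta>' \<eta>c] False show ?thesis by (simp add: mult.commute)
  qed
  have "measure lborel {c<..min b d} = min b d - c" using ab bc by (subst measure_lborel_Ioc) auto
  then show ?thesis unfolding eq int using same dj by simp
qed

text \<open>All four relative positions of two intervals reduce to disjoint intervals, where the later increment is
independent of the rest, and to intervals with a common left end point.\<close>

lemma increment_cov:
  assumes ab: "0 \<le> a" "a \<le> b" "0 \<le> c" "c \<le> d" and \<eta>: "bounded_in a \<eta>" and \<eta>': "bounded_in c \<eta>'"
  shows "integrable M (\<lambda>w. (\<eta> w * (W b w - W a w)) * (\<eta>' w * (W d w - W c w))) \<and>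
    expectation (\<lambda>w. (\<eta> w * (W b w - W a w)) * (\<eta>' w * (W d w - W c w)))
      = expectation (\<lambda>w. \<eta> w * \<eta>' w) * measure lborel ({a<..b} \<inter> {c<..d})"
proof (cases "a \<le> c")
  case True
  then show ?thesis using increment_cov_ordered[OF ab(1,2) _ ab(4) \<eta> \<eta>'] by simp
next
  case False
  then have "c \<le> a" by simp
  from increment_cov_ordered[OF ab(3,4) this ab(2) \<eta>' \<eta>] show ?thesis
    by (simp add: mult.commute Int_commute)
qed

text \<open>The Ito isometry for an arbitrary finite family of intervals, which may overlap. In this form it applies
directly to linear combinations of simple integrals with different partitions and different end times.\<close>

lemma simple_isometry:
  fixes a b :: "'i => real" and \<eta> :: "'i => 'w => real"
  assumes A: "finite A" and ab: "\<And>i. i \<in> A ==> 0 \<le> a i \<and> a i \<le> b i \<and> bounded_in (a i) (\<eta> i)"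
  shows "(\<integral>\<^sup>+w. ennreal ((\<Sum>i\<in>A. \<eta> i w * (W (b i) w - W (a i) w))^2) \<partial>M)
    = (\<integral>\<^sup>+w. \<integral>\<^sup>+s. ennreal ((\<Sum>i\<in>A. \<eta> i w * indicator {a i<..b i} s)^2) \<partial>lborel \<partial>M)"
proof -
  let ?Z = "\<lambda>i w. \<eta> i w * (W (b i) w - W (a i) w)"
  let ?m = "\<lambda>i j. measure lborel ({a i<..b i} \<inter> {a j<..b j})"
  have cov: "integrable M (\<lambda>w. ?Z i w * ?Z j w)" "expectation (\<lambda>w. ?Z i w * ?Z j w) = expectation (\<lambda>w. \<eta> i w * \<eta> j w) * ?m i j"
    if "i \<in> A" "j \<in> A" for i j
    using increment_cov[of "a i" "b i" "a j" "b j" "\<eta> i" "\<eta> j"] ab that by auto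
  have ee: "integrable M (\<lambda>w. \<eta> i w * \<eta> j w)" if "i \<in> A" "j \<in> A" for i j
    using bounded_in_integrable[of "a i" "\<eta> i" "\<eta> j"] bounded_in_integrable'[of "a j" "\<eta> j"] ab that by auto
  have sq: "(\<Sum>i\<in>A. ?Z i w)^2 = (\<Sum>i\<in>A. \<Sum>j\<in>A. ?Z i w * ?Z j w)" for w
    by (simp add: power2_eq_square sum_product)
  have inner: "(\<Sum>i\<in>A. \<Sum>j\<in>A. \<eta> i w * \<eta> j w * ?m i j) = (LBINT s. (\<Sum>i\<in>A. \<eta> i w * indicator {a i<..b i} s)^2)"
    and inner_int: "integrable lborel (\<lambda>s. (\<Sum>i\<in>A. \<eta> i w * indicator {a i<..b i} s)^2)" for w
  proof -
    have e: "(\<Sum>i\<in>A. \<eta> i w * indicator {a i<..b i} s)^2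
       = (\<Sum>i\<in>A. \<Sum>j\<in>A. \<eta> i w * \<eta> j w * indicator ({a i<..b i} \<inter> {a j<..b j}) s)" for s
      unfolding indicator_inter_arith power2_eq_square sum_product by (simp add: mult_ac)
    have f: "integrable lborel (indicat_real ({a i<..b i} \<inter> {a j<..b j}))" for i j
    proof (rule integrable_real_indicator)
      have "emeasure lborel ({a i<..b i} \<inter> {a j<..b j}) \<le> emeasure lborel {a i..b i}"
        by (intro emeasure_mono) auto
      also have "\<dots> < \<infinity>" by (simp add: emeasure_lborel_Icc_eq)
      finally show "emeasure lborel ({a i<..b i} \<inter> {a j<..b j}) < \<infinity>" .
    qed simp
    show "integrable lborel (\<lambda>s. (\<Sum>i\<in>A. \<eta> i w * indicator {a i<..b i} s)^2)"
      unfolding e using f by (intro Bochner_Integration.integrable_sum integrable_mult_right) auto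
    show "(\<Sum>i\<in>A. \<Sum>j\<in>A. \<eta> i w * \<eta> j w * ?m i j) = (LBINT s. (\<Sum>i\<in>A. \<eta> i w * indicator {a i<..b i} s)^2)"
      unfolding e using f by (simp add: integral_sum)
  qed
  have sq_int: "integrable M (\<lambda>w. (\<Sum>i\<in>A. ?Z i w)^2)"
    unfolding sq by (intro Bochner_Integration.integrable_sum cov(1))
  have "(\<integral>\<^sup>+w. ennreal ((\<Sum>i\<in>A. ?Z i w)^2) \<partial>M) = ennreal (expectation (\<lambda>w. (\<Sum>i\<in>A. ?Z i w)^2))"
    using sq_int by (rule nn_integral_eq_integral) simp
  also have "expectation (\<lambda>w. (\<Sum>i\<in>A. ?Z i w)^2) = (\<Sum>i\<in>A. \<Sum>j\<in>A. expectation (\<lambda>w. \<eta> i w * \<eta> j w) * ?m i j)"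
    unfolding sq using cov by (simp add: integral_sum)
  also have "\<dots> = expectation (\<lambda>w. \<Sum>i\<in>A. \<Sum>j\<in>A. \<eta> i w * \<eta> j w * ?m i j)"
    using ee by (simp add: integral_sum)
  also have "\<dots> = expectation (\<lambda>w. LBINT s. (\<Sum>i\<in>A. \<eta> i w * indicator {a i<..b i} s)^2)"
    by (simp only: inner)
  also have "ennreal (expectation (\<lambda>w. (LBINT s. (\<Sum>i\<in>A. \<eta> i w * indicator {a i<..b i} s)^2)))
     = (\<integral>\<^sup>+w. ennreal (LBINT s. (\<Sum>i\<in>A. \<eta> i w * indicator {a i<..b i} s)^2) \<partial>M)"
  proof (rule nn_integral_eq_integral[symmetric])
    show "integrable M (\<lambda>w. LBINT s. (\<Sum>i\<in>A. \<eta> i w * indicator {a i<..b i} s)^2)"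
      unfolding inner[symmetric] using ee by (intro Bochner_Integration.integrable_sum integrable_mult_left) auto
  qed simp
  also have "\<dots> = (\<integral>\<^sup>+w. \<integral>\<^sup>+s. ennreal ((\<Sum>i\<in>A. \<eta> i w * indicator {a i<..b i} s)^2) \<partial>lborel \<partial>M)"
    by (intro nn_integral_cong nn_integral_eq_integral[symmetric] inner_int) simp
  finally show ?thesis .
qed

lemma simple_data_times:
  assumes "simple_data F t n \<tau> \<eta>" "i \<le> n"
  shows "0 \<le> \<tau> i" "\<tau> i \<le> t"
proof -
  have s: "0 \<le> \<tau> 0" "\<tau> n \<le> t" "\<And>i. i < n ==> \<tau> i \<le> \<tau> (Suc i)"
    using assms(1) by (auto simp: simple_data_def)
  show "0 \<le> \<tau> i" using assms(2)
    by (induction i) (use s in \<open>auto intro: order_trans\<close>)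
  have "\<tau> i \<le> \<tau> n" using assms(2)
    by (induction rule: inc_induct) (use s in \<open>auto intro: order_trans\<close>)
  then show "\<tau> i \<le> t" using s by simp
qed

lemma simple_combination_isometry:
  fixes c :: "'j => real"
  assumes J: "finite J" and sd: "\<And>j. j \<in> J ==> simple_data F (t j) (n j) (\<tau> j) (\<eta> j)"
  shows "(\<integral>\<^sup>+w. ennreal ((\<Sum>j\<in>J. c j * simple_integral W (n j) (\<tau> j) (\<eta> j) w)^2) \<partial>M)
    = (\<integral>\<^sup>+w. \<integral>\<^sup>+s. ennreal ((\<Sum>j\<in>J. c j * simple_process (n j) (\<tau> j) (\<eta> j) s w)^2) \<partial>lborel \<partial>M)"
proof -
  define A where "A = Sigma J (\<lambda>j. {..<n j})"
  have A: "finite A" using J by (simp add: A_def)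
  have "(\<Sum>j\<in>J. c j * simple_integral W (n j) (\<tau> j) (\<eta> j) w)
    = (\<Sum>p\<in>A. (c (fst p) * \<eta> (fst p) (snd p) w) * (W (\<tau> (fst p) (Suc (snd p))) w - W (\<tau> (fst p) (snd p)) w))" for w
    unfolding A_def simple_integral_def sum_distrib_left
    by (subst sum.Sigma) (use J in \<open>auto simp: mult.assoc case_prod_beta\<close>)
  moreover have "(\<Sum>j\<in>J. c j * simple_process (n j) (\<tau> j) (\<eta> j) s w)
    = (\<Sum>p\<in>A. (c (fst p) * \<eta> (fst p) (snd p) w) * indicator {\<tau> (fst p) (snd p)<..\<tau> (fst p) (Suc (snd p))} s)" for s w
    unfolding A_def simple_process_def sum_distrib_left
    by (subst sum.Sigma) (use J in \<open>auto simp: mult.assoc case_prod_beta\<close>)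
  moreover have "0 \<le> \<tau> (fst p) (snd p) \<and> \<tau> (fst p) (snd p) \<le> \<tau> (fst p) (Suc (snd p)) \<and>
      bounded_in (\<tau> (fst p) (snd p)) (\<lambda>w. c (fst p) * \<eta> (fst p) (snd p) w)" if pA: "p \<in> A" for p
  proof -
    obtain j i where p: "p = (j, i)" "j \<in> J" "i < n j" using pA by (cases p) (auto simp: A_def)
    have 0: "0 \<le> \<tau> j i" using simple_data_times(1)[OF sd[OF p(2)], of i] p by simp
    have "\<tau> j i \<le> \<tau> j (Suc i) \<and> \<eta> j i \<in> borel_measurable (F (\<tau> j i)) \<and>
        (\<exists>B. \<forall>w\<in>space (F (\<tau> j i)). \<bar>\<eta> j i w\<bar> \<le> B)"
      using sd[OF p(2)] p(3) unfolding simple_data_def by blast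
    then have "bounded_in (\<tau> j i) (\<eta> j i)" "\<tau> j i \<le> \<tau> j (Suc i)"
      unfolding F_space[OF 0] bounded_in_def by auto
    then show ?thesis using 0 bounded_in_cmult by (simp add: p(1))
  qed
  ultimately show ?thesis
    using simple_isometry[OF A, of "\<lambda>p. \<tau> (fst p) (snd p)" "\<lambda>p. \<tau> (fst p) (Suc (snd p))" "\<lambda>p w. c (fst p) * \<eta> (fst p) (snd p) w"]
    by simp
qed

lemma nn_square_split:
  fixes f g :: "'a => real"
  assumes "f \<in> borel_measurable N" "g \<in> borel_measurable N"
  shows "(\<integral>\<^sup>+x. ennreal ((f x)^2) \<partial>N) \<le> 2 * (\<integral>\<^sup>+x. ennreal ((f x - g x)^2) \<partial>N) + 2 * (\<integral>\<^sup>+x. ennreal ((g x)^2) \<partial>N)"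
proof -
  have "(\<integral>\<^sup>+x. ennreal ((f x)^2) \<partial>N) \<le> (\<integral>\<^sup>+x. 2 * ennreal ((f x - g x)^2) + 2 * ennreal ((g x)^2) \<partial>N)"
  proof (intro nn_integral_mono)
    fix x
    have "(f x)^2 \<le> 2 * (f x - g x)^2 + 2 * (g x)^2"
      using zero_le_power2[of "f x - 2 * g x"] by (simp add: power2_eq_square algebra_simps)
    then have "ennreal ((f x)^2) \<le> ennreal (2 * (f x - g x)^2 + 2 * (g x)^2)"
      by (rule ennreal_leI)
    also have "\<dots> = 2 * ennreal ((f x - g x)^2) + 2 * ennreal ((g x)^2)"
      by (simp add: ennreal_mult)
    finally show "ennreal ((f x)^2) \<le> 2 * ennreal ((f x - g x)^2) + 2 * ennreal ((g x)^2)" .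
  qed
  also have "\<dots> = 2 * (\<integral>\<^sup>+x. ennreal ((f x - g x)^2) \<partial>N) + 2 * (\<integral>\<^sup>+x. ennreal ((g x)^2) \<partial>N)"
    using assms by (simp add: nn_integral_add nn_integral_cmult)
  finally show ?thesis .
qed

lemma nn_sum_square:
  fixes f :: "'j => 'a => real" and c :: "'j => real"
  assumes "finite J" "\<And>j. j \<in> J ==> f j \<in> borel_measurable N"
  shows "(\<integral>\<^sup>+x. ennreal ((\<Sum>j\<in>J. c j * f j x)^2) \<partial>N) \<le> (\<Sum>j\<in>J. ennreal (card J * (c j)^2) * (\<integral>\<^sup>+x. ennreal ((f j x)^2) \<partial>N))"
proof -
  have "(\<integral>\<^sup>+x. ennreal ((\<Sum>j\<in>J. c j * f j x)^2) \<partial>N) \<le> (\<integral>\<^sup>+x. (\<Sum>j\<in>J. ennreal (card J * (c j)^2) * ennreal ((f j x)^2)) \<partial>N)"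
  proof (intro nn_integral_mono)
    fix x
    have "(\<Sum>j\<in>J. c j * f j x)^2 \<le> (\<Sum>j\<in>J. (card J * (c j)^2) * (f j x)^2)"
      using sum_square_card[OF assms(1), of "\<lambda>j. c j * f j x"]
      by (simp add: power_mult_distrib sum_distrib_left mult.assoc)
    then have "ennreal ((\<Sum>j\<in>J. c j * f j x)^2) \<le> ennreal (\<Sum>j\<in>J. (card J * (c j)^2) * (f j x)^2)"
      by (rule ennreal_leI)
    also have "\<dots> = (\<Sum>j\<in>J. ennreal (card J * (c j)^2) * ennreal ((f j x)^2))"
      by (subst sum_ennreal[symmetric]) (auto simp: ennreal_mult)
    finally show "ennreal ((\<Sum>j\<in>J. c j * f j x)^2) \<le> (\<Sum>j\<in>J. ennreal (card J * (c j)^2) * ennreal ((f j x)^2))" .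
  qed
  also have "\<dots> = (\<Sum>j\<in>J. ennreal (card J * (c j)^2) * (\<integral>\<^sup>+x. ennreal ((f j x)^2) \<partial>N))"
    using assms(2) by (subst nn_integral_sum) (auto simp: nn_integral_cmult)
  finally show ?thesis .
qed

text \<open>Up to the constant this is the isometry for \<open>\<Sum>\<^sub>j c\<^sub>j \<integral>\<^sub>0\<^bsup>t\<^sub>j\<^esup> X\<^sub>j dW\<close>. Splitting off the approximation error costs
a factor \<open>2\<close> on each side, and only an inequality is needed later.\<close>

lemma ito_combination_bound:
  fixes c :: "'j => real"
  assumes J: "finite J" and ito: "\<And>j. j \<in> J ==> has_ito_integral M F W (t j) (X j) (Y j)"
  shows "(\<integral>\<^sup>+w. ennreal ((\<Sum>j\<in>J. c j * Y j w)^2) \<partial>M)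
    \<le> 4 * (\<integral>\<^sup>+w. \<integral>\<^sup>+s. ennreal ((\<Sum>j\<in>J. c j * (indicator {0..t j} s * X j s w))^2) \<partial>lborel \<partial>M)"
    (is "?L \<le> 4 * ?R")
proof -
  define approx where "approx j q \<longleftrightarrow> (\<forall>m. simple_data F (t j) (fst q m) (fst (snd q) m) (snd (snd q) m)) \<and>
        (\<lambda>m. \<integral>\<^sup>+w. \<integral>\<^sup>+s. ennreal ((X j s w - simple_process (fst q m) (fst (snd q) m) (snd (snd q) m) s w)^2)
               \<partial>(restrict_space lborel {0..t j}) \<partial>M) \<longlonglongrightarrow> 0 \<and>
        (\<lambda>m. \<integral>\<^sup>+w. ennreal ((Y j w - simple_integral W (fst q m) (fst (snd q) m) (snd (snd q) m) w)^2) \<partial>M) \<longlonglongrightarrow> 0"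
    for j q
  have "\<exists>q. approx j q" if j: "j \<in> J" for j
  proof -
    obtain n \<tau> \<eta> where "approx j (n, \<tau>, \<eta>)"
      using ito[OF j] unfolding has_ito_integral_def approx_def by auto
    then show ?thesis by blast
  qed
  then have "\<forall>j\<in>J. \<exists>q. approx j q" by blast
  from bchoice[OF this] obtain q where q: "\<forall>j\<in>J. approx j (q j)" ..
  define n where "n j = fst (q j)" for j
  define \<tau> where "\<tau> j = fst (snd (q j))" for j
  define \<eta> where "\<eta> j = snd (snd (q j))" for j
  have *: "(\<forall>m. simple_data F (t j) (n j m) (\<tau> j m) (\<eta> j m)) \<and>
        (\<lambda>m. \<integral>\<^sup>+w. \<integral>\<^sup>+s. ennreal ((X j s w - simple_process (n j m) (\<tau> j m) (\<eta> j m) s w)^2)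
               \<partial>(restrict_space lborel {0..t j}) \<partial>M) \<longlonglongrightarrow> 0 \<and>
        (\<lambda>m. \<integral>\<^sup>+w. ennreal ((Y j w - simple_integral W (n j m) (\<tau> j m) (\<eta> j m) w)^2) \<partial>M) \<longlonglongrightarrow> 0"
    if "j \<in> J" for j
    using q that unfolding approx_def n_def \<tau>_def \<eta>_def by blast
  define Xt where "Xt j = (\<lambda>(s, w). indicator {0..t j} s * X j s w)" for j
  define SP where "SP j m = (\<lambda>(s, w). simple_process (n j m) (\<tau> j m) (\<eta> j m) s w)" for j m
  define SI where "SI j m = simple_integral W (n j m) (\<tau> j m) (\<eta> j m)" for j m
  interpret P: pair_sigma_finite lborel M ..
  have sd: "simple_data F (t j) (n j m) (\<tau> j m) (\<eta> j m)" if "j \<in> J" for j m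
    using *[OF that] by blast
  have Xt[measurable]: "Xt j \<in> borel_measurable (lborel \<Otimes>\<^sub>M M)" if "j \<in> J" for j
    unfolding Xt_def using ito[OF that] by (intro measurable_restrict_pair) (auto simp: has_ito_integral_def L2_process_def)
  have Y[measurable]: "Y j \<in> borel_measurable M" if "j \<in> J" for j
    using ito[OF that] by (auto simp: has_ito_integral_def)
  have \<eta>M: "\<eta> j m i \<in> borel_measurable M" and WM: "W (\<tau> j m i) \<in> borel_measurable M" "W (\<tau> j m (Suc i)) \<in> borel_measurable M"
    if "j \<in> J" "i < n j m" for j m i
  proof -
    have 0: "0 \<le> \<tau> j m i" using simple_data_times(1)[OF sd[OF that(1)], of i] that by simp
    have 1: "0 \<le> \<tau> j m (Suc i)" using simple_data_times(1)[OF sd[OF that(1)], of "Suc i"] that by simp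
    show "\<eta> j m i \<in> borel_measurable M"
      using F_measurable[OF _ 0] sd[OF that(1), of m] that by (auto simp: simple_data_def)
    show "W (\<tau> j m i) \<in> borel_measurable M" "W (\<tau> j m (Suc i)) \<in> borel_measurable M"
      using F_measurable[OF W_F] 0 1 by blast+
  qed
  have SP[measurable]: "SP j m \<in> borel_measurable (lborel \<Otimes>\<^sub>M M)" if "j \<in> J" for j m
    unfolding SP_def simple_process_def case_prod_beta
    by (intro borel_measurable_sum borel_measurable_times measurable_compose[OF measurable_snd \<eta>M]
        measurable_compose[OF measurable_fst borel_measurable_indicator]) (use that in auto)
  have SI[measurable]: "SI j m \<in> borel_measurable M" if "j \<in> J" for j m
    unfolding SI_def simple_integral_def[abs_def]
    by (intro borel_measurable_sum borel_measurable_times borel_measurable_diff \<eta>M WM) (use that in auto)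
  have swap: "(\<integral>\<^sup>+w. \<integral>\<^sup>+s. f (s, w) \<partial>lborel \<partial>M) = integral\<^sup>N (lborel \<Otimes>\<^sub>M M) f"
    if "f \<in> borel_measurable (lborel \<Otimes>\<^sub>M M)" for f
    using P.nn_integral_snd[OF that] .
  have lim1: "(\<lambda>m. \<integral>\<^sup>+x. ennreal ((Xt j x - SP j m x)^2) \<partial>(lborel \<Otimes>\<^sub>M M)) \<longlonglongrightarrow> 0" if "j \<in> J" for j
  proof -
    have "(\<integral>\<^sup>+s. ennreal ((X j s w - simple_process (n j m) (\<tau> j m) (\<eta> j m) s w)^2) \<partial>(restrict_space lborel {0..t j}))
      = (\<integral>\<^sup>+s. ennreal ((Xt j (s, w) - SP j m (s, w))^2) \<partial>lborel)" for m w
    proof -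
      have z: "simple_process (n j m) (\<tau> j m) (\<eta> j m) s w = 0" if "s \<notin> {0..t j}" for s
        unfolding simple_process_def
      proof (intro sum.neutral ballI)
        fix i assume "i \<in> {..<n j m}"
        then have "0 \<le> \<tau> j m i" "\<tau> j m (Suc i) \<le> t j"
          using simple_data_times[OF sd[OF \<open>j \<in> J\<close>], of i m] simple_data_times[OF sd[OF \<open>j \<in> J\<close>], of "Suc i" m] by auto
        then show "\<eta> j m i w * indicator {\<tau> j m i<..\<tau> j m (Suc i)} s = 0"
          using that by (auto simp: indicator_def)
      qed
      show ?thesis
        by (subst nn_integral_restrict_space) (auto simp: Xt_def SP_def indicator_def z intro!: nn_integral_cong)
    qed
    then have "(\<lambda>m. \<integral>\<^sup>+w. \<integral>\<^sup>+s. ennreal ((Xt j (s, w) - SP j m (s, w))^2) \<partial>lborel \<partial>M) \<longlonglongrightarrow> 0"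
      using *[OF that] by simp
    moreover have "(\<integral>\<^sup>+w. \<integral>\<^sup>+s. ennreal ((Xt j (s, w) - SP j m (s, w))^2) \<partial>lborel \<partial>M)
       = (\<integral>\<^sup>+x. ennreal ((Xt j x - SP j m x)^2) \<partial>(lborel \<Otimes>\<^sub>M M))" for m
      using Xt[OF that] SP[OF that] by (subst swap[symmetric]) auto
    ultimately show ?thesis by simp
  qed
  have lim2: "(\<lambda>m. \<integral>\<^sup>+w. ennreal ((Y j w - SI j m w)^2) \<partial>M) \<longlonglongrightarrow> 0" if "j \<in> J" for j
    using *[OF that] by (simp add: SI_def)
  define A B where "A m = (\<Sum>j\<in>J. ennreal (card J * (c j)^2) * (\<integral>\<^sup>+w. ennreal ((Y j w - SI j m w)^2) \<partial>M))"
    and "B m = (\<Sum>j\<in>J. ennreal (card J * (c j)^2) * (\<integral>\<^sup>+x. ennreal ((Xt j x - SP j m x)^2) \<partial>(lborel \<Otimes>\<^sub>M M)))" for m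
  have limA: "A \<longlonglongrightarrow> (\<Sum>j\<in>J. ennreal (card J * (c j)^2) * 0)"
    unfolding A_def by (intro tendsto_sum ennreal_tendsto_cmult lim2) auto
  have limB: "B \<longlonglongrightarrow> (\<Sum>j\<in>J. ennreal (card J * (c j)^2) * 0)"
    unfolding B_def by (intro tendsto_sum ennreal_tendsto_cmult lim1) auto
  have R: "?R = (\<integral>\<^sup>+x. ennreal ((\<Sum>j\<in>J. c j * Xt j x)^2) \<partial>(lborel \<Otimes>\<^sub>M M))"
    using Xt by (subst swap[symmetric]) (auto simp: Xt_def)
  have main: "?L \<le> 2 * A m + 2 * (2 * B m + 2 * ?R)" for m
  proof -
    have 1: "?L \<le> 2 * (\<integral>\<^sup>+w. ennreal (((\<Sum>j\<in>J. c j * Y j w) - (\<Sum>j\<in>J. c j * SI j m w))^2) \<partial>M)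
        + 2 * (\<integral>\<^sup>+w. ennreal ((\<Sum>j\<in>J. c j * SI j m w)^2) \<partial>M)"
      by (rule nn_square_split) (use Y SI in auto)
    have 2: "(\<integral>\<^sup>+w. ennreal (((\<Sum>j\<in>J. c j * Y j w) - (\<Sum>j\<in>J. c j * SI j m w))^2) \<partial>M) \<le> A m"
      unfolding A_def sum_subtractf[symmetric] right_diff_distrib[symmetric]
      using nn_sum_square[OF J, of "\<lambda>j w. Y j w - SI j m w" M c] Y SI by simp
    have 3: "(\<integral>\<^sup>+w. ennreal ((\<Sum>j\<in>J. c j * SI j m w)^2) \<partial>M) = (\<integral>\<^sup>+x. ennreal ((\<Sum>j\<in>J. c j * SP j m x)^2) \<partial>(lborel \<Otimes>\<^sub>M M))"
      unfolding SI_def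
      by (subst simple_combination_isometry[OF J sd], assumption, subst swap[symmetric]) (use SP in \<open>auto simp: SP_def\<close>)
    have 4: "(\<integral>\<^sup>+x. ennreal ((\<Sum>j\<in>J. c j * SP j m x)^2) \<partial>(lborel \<Otimes>\<^sub>M M))
        \<le> 2 * (\<integral>\<^sup>+x. ennreal (((\<Sum>j\<in>J. c j * SP j m x) - (\<Sum>j\<in>J. c j * Xt j x))^2) \<partial>(lborel \<Otimes>\<^sub>M M)) + 2 * ?R"
      unfolding R by (rule nn_square_split) (use Xt SP in auto)
    have 5: "(\<integral>\<^sup>+x. ennreal (((\<Sum>j\<in>J. c j * SP j m x) - (\<Sum>j\<in>J. c j * Xt j x))^2) \<partial>(lborel \<Otimes>\<^sub>M M)) \<le> B m"
    proof -
      have "((\<Sum>j\<in>J. c j * SP j m x) - (\<Sum>j\<in>J. c j * Xt j x))^2 = (\<Sum>j\<in>J. c j * (Xt j x - SP j m x))^2" for x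
        by (simp add: power2_commute[of "\<Sum>j\<in>J. c j * SP j m x"] sum_subtractf right_diff_distrib)
      then show ?thesis
        unfolding B_def using nn_sum_square[OF J, of "\<lambda>j x. Xt j x - SP j m x" "lborel \<Otimes>\<^sub>M M" c] Xt SP by simp
    qed
    have "?L \<le> 2 * A m + 2 * (\<integral>\<^sup>+x. ennreal ((\<Sum>j\<in>J. c j * SP j m x)^2) \<partial>(lborel \<Otimes>\<^sub>M M))"
      using 1 2 unfolding 3 by (meson add_mono mult_left_mono order_trans order_refl zero_le)
    also have "\<dots> \<le> 2 * A m + 2 * (2 * B m + 2 * ?R)"
      using 4 5 by (meson add_mono mult_left_mono order_trans order_refl zero_le)
    finally show ?thesis .
  qed
  have "(\<lambda>m. 2 * A m + 2 * (2 * B m + 2 * ?R)) \<longlonglongrightarrow> 2 * (\<Sum>j\<in>J. ennreal (card J * (c j)^2) * 0) + 2 * (2 * (\<Sum>j\<in>J. ennreal (card J * (c j)^2) * 0) + 2 * ?R)"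
    by (intro tendsto_add ennreal_tendsto_cmult limA limB tendsto_const) auto
  then have "?L \<le> 2 * (\<Sum>j\<in>J. ennreal (card J * (c j)^2) * 0) + 2 * (2 * (\<Sum>j\<in>J. ennreal (card J * (c j)^2) * 0) + 2 * ?R)"
    by (rule LIMSEQ_le_const) (use main in auto)
  then show ?thesis by (simp add: mult.assoc[symmetric])
qed

end

section \<open>Second moments of combinations of fractional integrals\<close>

lemma L2_process_ext:
  assumes "L2_process M T Y"
  shows "(\<lambda>(s, w). indicator {0..T} s * Y s w) \<in> borel_measurable (lborel \<Otimes>\<^sub>M M)"
    and "(\<integral>\<^sup>+w. \<integral>\<^sup>+s. ennreal ((indicator {0..T} s * Y s w)^2) \<partial>lborel \<partial>M) < \<infinity>"
proof -
  show "(\<lambda>(s, w). indicator {0..T} s * Y s w) \<in> borel_measurable (lborel \<Otimes>\<^sub>M M)"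
    using assms by (intro measurable_restrict_pair) (auto simp: L2_process_def)
  have "(\<integral>\<^sup>+s. ennreal ((Y s w)^2) \<partial>(restrict_space lborel {0..T}))
      = (\<integral>\<^sup>+s. ennreal ((indicator {0..T} s * Y s w)^2) \<partial>lborel)" for w
    by (subst nn_integral_restrict_space) (auto simp: indicator_def intro!: nn_integral_cong)
  then show "(\<integral>\<^sup>+w. \<integral>\<^sup>+s. ennreal ((indicator {0..T} s * Y s w)^2) \<partial>lborel \<partial>M) < \<infinity>"
    using assms by (simp add: L2_process_def)
qed

text \<open>For \<open>H > 1 / 2\<close> the exponent exceeds \<open>-1\<close>, so the kernel of the covariance form has bounded mass.\<close>

lemma fbm_kernel_mass:
  assumes H: "1 / 2 < H" "H < (1::real)" and T: "T > 0" and s: "s \<in> {0..T}"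
  shows "(\<integral>\<^sup>+r. ennreal (indicator {0..T} r * \<bar>s - r\<bar> powr (2 * H - 2)) \<partial>lborel) \<le> ennreal (2 * T powr (2 * H - 1) / (2 * H - 1))"
proof -
  define a where "a = 2 * H - 2"
  have a: "a > -1" "a + 1 = 2 * H - 1" using H by (auto simp: a_def)
  let ?g = "\<lambda>x::real. indicator {0..T} x * x powr a"
  have "(\<integral>\<^sup>+r. ennreal (indicator {0..T} r * \<bar>s - r\<bar> powr a) \<partial>lborel)
     = ennreal \<bar>-1\<bar> * (\<integral>\<^sup>+x. ennreal (indicator {0..T} (s + (-1) * x) * \<bar>s - (s + (-1) * x)\<bar> powr a) \<partial>lborel)"
    by (rule nn_integral_real_affine) auto
  also have "\<dots> = (\<integral>\<^sup>+x. ennreal (indicator {0..T} (s - x) * \<bar>x\<bar> powr a) \<partial>lborel)"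
    by simp
  also have "\<dots> \<le> (\<integral>\<^sup>+x. ennreal (?g x) + ennreal (?g (0 + (-1) * x)) \<partial>lborel)"
  proof (intro nn_integral_mono)
    fix x :: real
    have "indicator {0..T} (s - x) * \<bar>x\<bar> powr a \<le> ?g x + ?g (0 + (-1) * x)"
      using s by (cases "x \<ge> 0") (auto simp: indicator_def)
    then have "ennreal (indicator {0..T} (s - x) * \<bar>x\<bar> powr a) \<le> ennreal (?g x + ?g (0 + (-1) * x))"
      by (rule ennreal_leI)
    then show "ennreal (indicator {0..T} (s - x) * \<bar>x\<bar> powr a) \<le> ennreal (?g x) + ennreal (?g (0 + (-1) * x))"
      by (simp add: ennreal_plus)
  qed
  also have "\<dots> = (\<integral>\<^sup>+x. ennreal (?g x) \<partial>lborel) + (\<integral>\<^sup>+x. ennreal (?g (0 + (-1) * x)) \<partial>lborel)"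
    by (rule nn_integral_add) auto
  also have "(\<integral>\<^sup>+x. ennreal (?g (0 + (-1) * x)) \<partial>lborel) = (\<integral>\<^sup>+x. ennreal (?g x) \<partial>lborel)"
    using nn_integral_real_affine[of "\<lambda>x. ennreal (?g x)" "-1" 0] by simp
  also have "(\<integral>\<^sup>+x. ennreal (?g x) \<partial>lborel) = ennreal (T powr (a + 1) / (a + 1))"
    using T by (intro integrable_indicator_powr_0(2)[OF a(1)]) simp
  also have "\<dots> + \<dots> = ennreal (2 * T powr (2 * H - 1) / (2 * H - 1))"
    unfolding a(2) using H by (subst ennreal_plus[symmetric]) (auto simp: add_divide_distrib[symmetric])
  finally show ?thesis by (simp add: a_def)
qed

text \<open>The Schur test in its simplest form: \<open>\<bar>y z\<bar> \<le> (y\<^sup>2 + z\<^sup>2) / 2\<close>, and each square is integrated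
against the bounded mass of the kernel.\<close>

lemma fbm_kernel_form:
  fixes y z :: "real \<times> 'w => real"
  assumes M: "prob_space M" and H: "1 / 2 < H" "H < (1::real)" and T: "T > 0"
    and y[measurable]: "y \<in> borel_measurable (lborel \<Otimes>\<^sub>M M)" and ys: "\<And>s w. s \<notin> {0..T} ==> y (s, w) = 0"
    and z[measurable]: "z \<in> borel_measurable (lborel \<Otimes>\<^sub>M M)" and zs: "\<And>s w. s \<notin> {0..T} ==> z (s, w) = 0"
  shows "(\<integral>\<^sup>+x. ennreal \<bar>y (fst (fst x), snd x) * z (snd (fst x), snd x) * \<bar>fst (fst x) - snd (fst x)\<bar> powr (2 * H - 2)\<bar>
        \<partial>((lborel \<Otimes>\<^sub>M lborel) \<Otimes>\<^sub>M M))
    \<le> ennreal (T powr (2 * H - 1) / (2 * H - 1)) *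
      ((\<integral>\<^sup>+w. \<integral>\<^sup>+s. ennreal ((y (s, w))^2) \<partial>lborel \<partial>M) + (\<integral>\<^sup>+w. \<integral>\<^sup>+s. ennreal ((z (s, w))^2) \<partial>lborel \<partial>M))"
proof -
  interpret prob_space M by fact
  interpret P: pair_sigma_finite lborel M ..
  interpret LL: sigma_finite_measure "(lborel :: real measure) \<Otimes>\<^sub>M (lborel :: real measure)"
    unfolding lborel_prod by (rule sigma_finite_lborel)
  interpret Q: pair_sigma_finite "(lborel :: real measure) \<Otimes>\<^sub>M (lborel :: real measure)" M ..
  define \<kappa> where "\<kappa> = T powr (2 * H - 1) / (2 * H - 1)"
  define k where "k s r = indicator {0..T} s * (indicator {0..T} r * \<bar>s - r\<bar> powr (2 * H - 2))" for s r :: real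
  have k0: "0 \<le> k s r" and ksym: "k s r = k r s" for s r
    by (auto simp: k_def abs_minus_commute)
  have k_meas[measurable]: "(\<lambda>x. k (fst x) (snd x)) \<in> borel_measurable (lborel \<Otimes>\<^sub>M lborel)"
    unfolding k_def by measurable
  have mass: "(\<integral>\<^sup>+r. ennreal (k s r / 2) \<partial>lborel) \<le> ennreal \<kappa>" for s
  proof (cases "s \<in> {0..T}")
    case True
    have "(\<integral>\<^sup>+r. ennreal (k s r / 2) \<partial>lborel) = (\<integral>\<^sup>+r. ennreal (indicator {0..T} r * \<bar>s - r\<bar> powr (2 * H - 2)) / 2 \<partial>lborel)"
      using True by (intro nn_integral_cong) (simp add: k_def ennreal_divide_numeral)
    also have "\<dots> = (\<integral>\<^sup>+r. ennreal (indicator {0..T} r * \<bar>s - r\<bar> powr (2 * H - 2)) \<partial>lborel) / 2"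
      by (rule nn_integral_divide) measurable
    also have "\<dots> \<le> ennreal (2 * T powr (2 * H - 1) / (2 * H - 1)) / 2"
      using fbm_kernel_mass[OF H T True] by (intro divide_right_mono_ennreal)
    also have "\<dots> = ennreal \<kappa>"
      using H by (subst ennreal_divide_numeral) (auto simp: \<kappa>_def field_simps)
    finally show ?thesis .
  qed (simp add: k_def)
  have half: "(\<integral>\<^sup>+x. ennreal (k (fst (fst x)) (snd (fst x)) / 2) * ennreal ((v (fst (fst x), snd x))^2) \<partial>((lborel \<Otimes>\<^sub>M lborel) \<Otimes>\<^sub>M M))
      \<le> ennreal \<kappa> * (\<integral>\<^sup>+w. \<integral>\<^sup>+s. ennreal ((v (s, w))^2) \<partial>lborel \<partial>M)"
    if v[measurable]: "v \<in> borel_measurable (lborel \<Otimes>\<^sub>M M)" for v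
  proof -
    define V where "V s = (\<integral>\<^sup>+w. ennreal ((v (s, w))^2) \<partial>M)" for s
    have [measurable]: "V \<in> borel_measurable lborel" unfolding V_def by measurable
    have "(\<integral>\<^sup>+x. ennreal (k (fst (fst x)) (snd (fst x)) / 2) * ennreal ((v (fst (fst x), snd x))^2) \<partial>((lborel \<Otimes>\<^sub>M lborel) \<Otimes>\<^sub>M M))
      = (\<integral>\<^sup>+p. \<integral>\<^sup>+w. ennreal (k (fst p) (snd p) / 2) * ennreal ((v (fst p, w))^2) \<partial>M \<partial>(lborel \<Otimes>\<^sub>M lborel))"
      by (subst nn_integral_fst[symmetric]) simp_all
    also have "\<dots> = (\<integral>\<^sup>+p. ennreal (k (fst p) (snd p) / 2) * V (fst p) \<partial>(lborel \<Otimes>\<^sub>M lborel))"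
      unfolding V_def by (intro nn_integral_cong nn_integral_cmult) measurable
    also have "\<dots> = (\<integral>\<^sup>+s. \<integral>\<^sup>+r. ennreal (k s r / 2) * V s \<partial>lborel \<partial>lborel)"
      by (subst lborel.nn_integral_fst[symmetric]) simp_all
    also have "\<dots> = (\<integral>\<^sup>+s. (\<integral>\<^sup>+r. ennreal (k s r / 2) \<partial>lborel) * V s \<partial>lborel)"
      by (intro nn_integral_cong nn_integral_multc) (simp add: k_def)
    also have "\<dots> \<le> (\<integral>\<^sup>+s. ennreal \<kappa> * V s \<partial>lborel)"
      by (intro nn_integral_mono mult_right_mono mass) simp
    also have "\<dots> = ennreal \<kappa> * (\<integral>\<^sup>+s. V s \<partial>lborel)"
      by (rule nn_integral_cmult) measurable
    also have "(\<integral>\<^sup>+s. V s \<partial>lborel) = (\<integral>\<^sup>+w. \<integral>\<^sup>+s. ennreal ((v (s, w))^2) \<partial>lborel \<partial>M)"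
      unfolding V_def using P.Fubini'[of "\<lambda>s w. ennreal ((v (s, w))^2)"] by simp
    finally show ?thesis .
  qed
  have half': "(\<integral>\<^sup>+x. ennreal (k (fst (fst x)) (snd (fst x)) / 2) * ennreal ((v (snd (fst x), snd x))^2) \<partial>((lborel \<Otimes>\<^sub>M lborel) \<Otimes>\<^sub>M M))
      \<le> ennreal \<kappa> * (\<integral>\<^sup>+w. \<integral>\<^sup>+s. ennreal ((v (s, w))^2) \<partial>lborel \<partial>M)"
    if v[measurable]: "v \<in> borel_measurable (lborel \<Otimes>\<^sub>M M)" for v
  proof -
    have m1: "(\<lambda>p. \<integral>\<^sup>+w. ennreal (k (fst p) (snd p) / 2) * ennreal ((v (fst p, w))^2) \<partial>M) \<in> borel_measurable (lborel \<Otimes>\<^sub>M lborel)"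
      by measurable
    have m2: "(\<lambda>p. \<integral>\<^sup>+w. ennreal (k (fst p) (snd p) / 2) * ennreal ((v (snd p, w))^2) \<partial>M) \<in> borel_measurable (lborel \<Otimes>\<^sub>M lborel)"
      by measurable
    have "(\<integral>\<^sup>+x. ennreal (k (fst (fst x)) (snd (fst x)) / 2) * ennreal ((v (snd (fst x), snd x))^2) \<partial>((lborel \<Otimes>\<^sub>M lborel) \<Otimes>\<^sub>M M))
      = (\<integral>\<^sup>+p. \<integral>\<^sup>+w. ennreal (k (fst p) (snd p) / 2) * ennreal ((v (snd p, w))^2) \<partial>M \<partial>(lborel \<Otimes>\<^sub>M lborel))"
      by (subst nn_integral_fst[symmetric]) simp_all
    also have "\<dots> = (\<integral>\<^sup>+r. \<integral>\<^sup>+s. \<integral>\<^sup>+w. ennreal (k s r / 2) * ennreal ((v (r, w))^2) \<partial>M \<partial>lborel \<partial>lborel)"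
      using lborel_pair.nn_integral_snd[OF m2] by simp
    also have "\<dots> = (\<integral>\<^sup>+r. \<integral>\<^sup>+s. \<integral>\<^sup>+w. ennreal (k r s / 2) * ennreal ((v (r, w))^2) \<partial>M \<partial>lborel \<partial>lborel)"
      by (simp only: ksym)
    also have "\<dots> = (\<integral>\<^sup>+p. \<integral>\<^sup>+w. ennreal (k (fst p) (snd p) / 2) * ennreal ((v (fst p, w))^2) \<partial>M \<partial>(lborel \<Otimes>\<^sub>M lborel))"
      using lborel.nn_integral_fst[OF m1] by simp
    also have "\<dots> = (\<integral>\<^sup>+x. ennreal (k (fst (fst x)) (snd (fst x)) / 2) * ennreal ((v (fst (fst x), snd x))^2) \<partial>((lborel \<Otimes>\<^sub>M lborel) \<Otimes>\<^sub>M M))"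
      by (subst nn_integral_fst[symmetric]) simp_all
    finally show ?thesis using half[OF v] by simp
  qed
  have "(\<integral>\<^sup>+x. ennreal \<bar>y (fst (fst x), snd x) * z (snd (fst x), snd x) * \<bar>fst (fst x) - snd (fst x)\<bar> powr (2 * H - 2)\<bar>
        \<partial>((lborel \<Otimes>\<^sub>M lborel) \<Otimes>\<^sub>M M))
    \<le> (\<integral>\<^sup>+x. ennreal (k (fst (fst x)) (snd (fst x)) / 2) * ennreal ((y (fst (fst x), snd x))^2)
        + ennreal (k (fst (fst x)) (snd (fst x)) / 2) * ennreal ((z (snd (fst x), snd x))^2) \<partial>((lborel \<Otimes>\<^sub>M lborel) \<Otimes>\<^sub>M M))"
  proof (intro nn_integral_mono)
    fix x :: "(real \<times> real) \<times> 'w"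
    obtain s r w where x: "x = ((s, r), w)" by (cases x) auto
    have "\<bar>y (s, w) * z (r, w) * \<bar>s - r\<bar> powr (2 * H - 2)\<bar> \<le> k s r / 2 * (y (s, w))^2 + k s r / 2 * (z (r, w))^2"
    proof (cases "s \<in> {0..T} \<and> r \<in> {0..T}")
      case True
      have "2 * \<bar>y (s, w) * z (r, w)\<bar> \<le> (y (s, w))^2 + (z (r, w))^2"
        using zero_le_power2[of "\<bar>y (s, w)\<bar> - \<bar>z (r, w)\<bar>"] by (simp add: power2_diff abs_mult)
      then have "k s r / 2 * (2 * \<bar>y (s, w) * z (r, w)\<bar>) \<le> k s r / 2 * ((y (s, w))^2 + (z (r, w))^2)"
        using k0[of s r] by (intro mult_left_mono) auto
      moreover have "\<bar>y (s, w) * z (r, w) * \<bar>s - r\<bar> powr (2 * H - 2)\<bar> = k s r / 2 * (2 * \<bar>y (s, w) * z (r, w)\<bar>)"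
        using True by (simp add: k_def abs_mult)
      ultimately show ?thesis by (simp add: distrib_left)
    next
      case False
      then have yz: "y (s, w) * z (r, w) = 0" using ys zs by auto
      have "0 \<le> k s r / 2 * (y (s, w))^2" "0 \<le> k s r / 2 * (z (r, w))^2"
        using k0[of s r] by simp_all
      then show ?thesis unfolding yz by simp
    qed
    then have "ennreal \<bar>y (s, w) * z (r, w) * \<bar>s - r\<bar> powr (2 * H - 2)\<bar> \<le> ennreal (k s r / 2 * (y (s, w))^2 + k s r / 2 * (z (r, w))^2)"
      by (rule ennreal_leI)
    also have "\<dots> = ennreal (k s r / 2) * ennreal ((y (s, w))^2) + ennreal (k s r / 2) * ennreal ((z (r, w))^2)"
    proof -
      have "ennreal (k s r / 2) * ennreal a = ennreal (k s r / 2 * a)" if "a \<ge> 0" for a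
        using k0[of s r] that by (intro ennreal_mult[symmetric]) auto
      then show ?thesis using k0[of s r] by (subst ennreal_plus) auto
    qed
    finally show "ennreal \<bar>y (fst (fst x), snd x) * z (snd (fst x), snd x) * \<bar>fst (fst x) - snd (fst x)\<bar> powr (2 * H - 2)\<bar>
      \<le> ennreal (k (fst (fst x)) (snd (fst x)) / 2) * ennreal ((y (fst (fst x), snd x))^2)
        + ennreal (k (fst (fst x)) (snd (fst x)) / 2) * ennreal ((z (snd (fst x), snd x))^2)"
      by (simp add: x)
  qed
  also have "\<dots> = (\<integral>\<^sup>+x. ennreal (k (fst (fst x)) (snd (fst x)) / 2) * ennreal ((y (fst (fst x), snd x))^2) \<partial>((lborel \<Otimes>\<^sub>M lborel) \<Otimes>\<^sub>M M))
     + (\<integral>\<^sup>+x. ennreal (k (fst (fst x)) (snd (fst x)) / 2) * ennreal ((z (snd (fst x), snd x))^2) \<partial>((lborel \<Otimes>\<^sub>M lborel) \<Otimes>\<^sub>M M))"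
    by (rule nn_integral_add) measurable
  also have "\<dots> \<le> ennreal \<kappa> * (\<integral>\<^sup>+w. \<integral>\<^sup>+s. ennreal ((y (s, w))^2) \<partial>lborel \<partial>M) + ennreal \<kappa> * (\<integral>\<^sup>+w. \<integral>\<^sup>+s. ennreal ((z (s, w))^2) \<partial>lborel \<partial>M)"
    by (intro add_mono half half' y z)
  finally show ?thesis by (simp add: \<kappa>_def distrib_left)
qed

text \<open>Expanding the square and using the covariance identity for each pair turns the left-hand side into the
covariance form of the single process \<open>\<Sum>\<^sub>j c\<^sub>j Y\<^sub>j\<close>.\<close>

lemma fbm_combination_bound:
  fixes c :: "'j => real"
  assumes M: "prob_space M" and H: "1 / 2 < H" "H < (1::real)" and T: "T > 0"
    and fbm: "fbm_integral M T H B I"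
    and J: "finite J" and Y: "\<And>j. j \<in> J ==> L2_process M T (Y j)"
  shows "(\<integral>\<^sup>+w. ennreal ((\<Sum>j\<in>J. c j * I (Y j) w)^2) \<partial>M)
    \<le> ennreal (2 * H * T powr (2 * H - 1)) *
       (\<integral>\<^sup>+w. \<integral>\<^sup>+s. ennreal ((\<Sum>j\<in>J. c j * (indicator {0..T} s * Y j s w))^2) \<partial>lborel \<partial>M)"
proof -
  interpret prob_space M by fact
  interpret P: pair_sigma_finite lborel M ..
  interpret LL: sigma_finite_measure "(lborel :: real measure) \<Otimes>\<^sub>M (lborel :: real measure)"
    unfolding lborel_prod by (rule sigma_finite_lborel)
  interpret Q: pair_sigma_finite "(lborel :: real measure) \<Otimes>\<^sub>M (lborel :: real measure)" M ..
  let ?N = "((lborel :: real measure) \<Otimes>\<^sub>M (lborel :: real measure)) \<Otimes>\<^sub>M M"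
  define y where "y j = (\<lambda>(s, w). indicator {0..T} s * Y j s w)" for j
  define k where "k s r = \<bar>s - r\<bar> powr (2 * H - 2)" for s r :: real
  define G where "G i j x = y i (fst (fst x), snd x) * y j (snd (fst x), snd x) * k (fst (fst x)) (snd (fst x))" for i j and x :: "(real \<times> real) \<times> 'a"
  have ym[measurable]: "y j \<in> borel_measurable (lborel \<Otimes>\<^sub>M M)" and y2: "(\<integral>\<^sup>+w. \<integral>\<^sup>+s. ennreal ((y j (s, w))^2) \<partial>lborel \<partial>M) < \<infinity>"
    if "j \<in> J" for j
    using L2_process_ext[OF Y[OF that]] by (auto simp: y_def)
  have ys: "y j (s, w) = 0" if "s \<notin> {0..T}" for j s w using that by (simp add: y_def)
  have km[measurable]: "(\<lambda>x. k (fst x) (snd x)) \<in> borel_measurable (lborel \<Otimes>\<^sub>M lborel)"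
    unfolding k_def by measurable
  have G_meas: "G i j \<in> borel_measurable ?N" if "i \<in> J" "j \<in> J" for i j
    using ym[OF that(1)] ym[OF that(2)] unfolding G_def by measurable
  have G_int: "integrable ?N (G i j)" if ij: "i \<in> J" "j \<in> J" for i j
  proof (rule integrableI_bounded[OF G_meas[OF ij]])
    have "(\<integral>\<^sup>+x. ennreal (norm (G i j x)) \<partial>?N) \<le> ennreal (T powr (2 * H - 1) / (2 * H - 1)) *
      ((\<integral>\<^sup>+w. \<integral>\<^sup>+s. ennreal ((y i (s, w))^2) \<partial>lborel \<partial>M) + (\<integral>\<^sup>+w. \<integral>\<^sup>+s. ennreal ((y j (s, w))^2) \<partial>lborel \<partial>M))"
      unfolding G_def k_def real_norm_def using ij
      by (intro fbm_kernel_form[OF M H T] ym ys) auto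
    also have "\<dots> < \<infinity>"
      using y2[OF ij(1)] y2[OF ij(2)] by (simp add: ennreal_mult_less_top)
    finally show "(\<integral>\<^sup>+x. ennreal (norm (G i j x)) \<partial>?N) < \<infinity>" .
  qed
  have cov: "expectation (\<lambda>w. I (Y i) w * I (Y j) w) = H * (2 * H - 1) * (LINT x|?N. G i j x)"
    if ij: "i \<in> J" "j \<in> J" for i j
  proof -
    have "expectation (\<lambda>w. I (Y i) w * I (Y j) w) = H * (2 * H - 1) *
          (LINT s:{0..T}|lborel. LINT r:{0..T}|lborel. expectation (\<lambda>w. Y i s w * Y j r w) * \<bar>s - r\<bar> powr (2 * H - 2))"
      using fbm Y ij unfolding fbm_integral_def by blast
    also have "(LINT s:{0..T}|lborel. LINT r:{0..T}|lborel. expectation (\<lambda>w. Y i s w * Y j r w) * \<bar>s - r\<bar> powr (2 * H - 2))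
       = (LINT s|lborel. (LINT r|lborel. (LINT w|M. G i j ((s, r), w))))"
    proof -
      have "(LINT w|M. G i j ((s, r), w)) = indicator {0..T} s * (indicator {0..T} r * (expectation (\<lambda>w. Y i s w * Y j r w) * \<bar>s - r\<bar> powr (2 * H - 2)))" for s r
      proof -
        have "G i j ((s, r), w) = (indicator {0..T} s * (indicator {0..T} r * \<bar>s - r\<bar> powr (2 * H - 2))) * (Y i s w * Y j r w)" for w
          by (simp add: G_def y_def k_def)
        then show ?thesis by simp
      qed
      then show ?thesis by (simp add: set_lebesgue_integral_def)
    qed
    also have "\<dots> = (LINT p|(lborel \<Otimes>\<^sub>M lborel). (LINT w|M. G i j (p, w)))"
      using lborel_pair.integral_fst'[OF Q.integrable_fst'[OF G_int[OF ij]]] by simp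
    also have "\<dots> = (LINT x|?N. G i j x)"
      by (rule Q.integral_fst'[OF G_int[OF ij]])
    finally show ?thesis .
  qed
  have I_sq: "integrable M (\<lambda>w. (I (Y j) w)^2)" and I_m[measurable]: "I (Y j) \<in> borel_measurable M" if "j \<in> J" for j
    using fbm Y[OF that] unfolding fbm_integral_def by blast+
  have I_int: "integrable M (\<lambda>w. I (Y i) w * I (Y j) w)" if ij: "i \<in> J" "j \<in> J" for i j
  proof (rule Bochner_Integration.integrable_bound[OF Bochner_Integration.integrable_add[OF I_sq[OF ij(1)] I_sq[OF ij(2)]]])
    show "AE w in M. norm (I (Y i) w * I (Y j) w) \<le> norm ((I (Y i) w)^2 + (I (Y j) w)^2)"
    proof (rule AE_I2)
      fix w
      have "2 * \<bar>I (Y i) w * I (Y j) w\<bar> \<le> (I (Y i) w)^2 + (I (Y j) w)^2"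
        using zero_le_power2[of "\<bar>I (Y i) w\<bar> - \<bar>I (Y j) w\<bar>"] by (simp add: power2_diff abs_mult)
      then show "norm (I (Y i) w * I (Y j) w) \<le> norm ((I (Y i) w)^2 + (I (Y j) w)^2)"
        unfolding real_norm_def by linarith
    qed
  qed (use I_m[OF ij(1)] I_m[OF ij(2)] in measurable)
  define z where "z x = (\<Sum>j\<in>J. c j * y j x)" for x
  have zm: "z \<in> borel_measurable (lborel \<Otimes>\<^sub>M M)" unfolding z_def using ym by auto
  have zs: "z (s, w) = 0" if "s \<notin> {0..T}" for s w using ys that by (simp add: z_def)
  define Gz where "Gz x = z (fst (fst x), snd x) * z (snd (fst x), snd x) * k (fst (fst x)) (snd (fst x))" for x :: "(real \<times> real) \<times> 'a"
  have Gz: "Gz x = (\<Sum>i\<in>J. \<Sum>j\<in>J. c i * c j * G i j x)" for x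
    unfolding Gz_def z_def G_def sum_product sum_distrib_right[of _ _ "k _ _"]
    by (intro sum.cong refl) (simp add: mult_ac)
  have sq: "(\<Sum>j\<in>J. c j * I (Y j) w)^2 = (\<Sum>i\<in>J. \<Sum>j\<in>J. c i * c j * (I (Y i) w * I (Y j) w))" for w
    unfolding power2_eq_square sum_product by (intro sum.cong refl) (simp add: mult_ac)
  have sq_int: "integrable M (\<lambda>w. (\<Sum>j\<in>J. c j * I (Y j) w)^2)"
    unfolding sq by (intro Bochner_Integration.integrable_sum integrable_mult_right I_int)
  have Gz_int: "integrable ?N Gz"
    unfolding Gz[abs_def] by (intro Bochner_Integration.integrable_sum integrable_mult_right G_int)
  have "expectation (\<lambda>w. (\<Sum>j\<in>J. c j * I (Y j) w)^2) = (\<Sum>i\<in>J. \<Sum>j\<in>J. c i * c j * expectation (\<lambda>w. I (Y i) w * I (Y j) w))"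
    unfolding sq using I_int by (subst Bochner_Integration.integral_sum) (auto simp: Bochner_Integration.integral_sum intro!: Bochner_Integration.integrable_sum)
  also have "\<dots> = (\<Sum>i\<in>J. \<Sum>j\<in>J. H * (2 * H - 1) * (c i * c j * (LINT x|?N. G i j x)))"
    by (intro sum.cong refl) (simp add: cov)
  also have "\<dots> = H * (2 * H - 1) * (\<Sum>i\<in>J. \<Sum>j\<in>J. c i * c j * (LINT x|?N. G i j x))"
    by (simp add: sum_distrib_left)
  also have "(\<Sum>i\<in>J. \<Sum>j\<in>J. c i * c j * (LINT x|?N. G i j x)) = (LINT x|?N. Gz x)"
    unfolding Gz using G_int by (subst Bochner_Integration.integral_sum) (auto simp: Bochner_Integration.integral_sum intro!: Bochner_Integration.integrable_sum)
  finally have E: "expectation (\<lambda>w. (\<Sum>j\<in>J. c j * I (Y j) w)^2) = H * (2 * H - 1) * (LINT x|?N. Gz x)" .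
  have hpos: "0 \<le> H * (2 * H - 1)" using H by simp
  let ?Z = "\<integral>\<^sup>+w. \<integral>\<^sup>+s. ennreal ((z (s, w))^2) \<partial>lborel \<partial>M"
  have "(\<integral>\<^sup>+w. ennreal ((\<Sum>j\<in>J. c j * I (Y j) w)^2) \<partial>M) = ennreal (expectation (\<lambda>w. (\<Sum>j\<in>J. c j * I (Y j) w)^2))"
    using sq_int by (rule nn_integral_eq_integral) simp
  also have "\<dots> \<le> ennreal (H * (2 * H - 1) * (LINT x|?N. norm (Gz x)))"
  proof -
    have "(LINT x|?N. Gz x) \<le> (LINT x|?N. norm (Gz x))"
      using Gz_int by (intro integral_mono) auto
    then show ?thesis unfolding E using hpos by (intro ennreal_leI mult_left_mono)
  qed
  also have "\<dots> = ennreal (H * (2 * H - 1)) * (\<integral>\<^sup>+x. ennreal (norm (Gz x)) \<partial>?N)"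
    using hpos Gz_int by (subst nn_integral_eq_integral) (auto simp: ennreal_mult)
  also have "\<dots> \<le> ennreal (H * (2 * H - 1)) * (ennreal (T powr (2 * H - 1) / (2 * H - 1)) * (?Z + ?Z))"
    unfolding Gz_def k_def real_norm_def by (intro mult_left_mono fbm_kernel_form[OF M H T] zm zs) auto
  also have "\<dots> = ennreal (H * (2 * H - 1) * (T powr (2 * H - 1) / (2 * H - 1))) * (2 * ?Z)"
  proof -
    have "ennreal (H * (2 * H - 1) * (T powr (2 * H - 1) / (2 * H - 1))) = ennreal (H * (2 * H - 1)) * ennreal (T powr (2 * H - 1) / (2 * H - 1))"
      using hpos H by (intro ennreal_mult) auto
    then show ?thesis by (simp only: mult.assoc mult_2)
  qed
  also have "\<dots> = ennreal (2 * H * T powr (2 * H - 1)) * ?Z"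
  proof -
    have 1: "H * (2 * H - 1) * (T powr (2 * H - 1) / (2 * H - 1)) = H * T powr (2 * H - 1)" using H by simp
    have "ennreal (2 * (H * T powr (2 * H - 1))) = ennreal 2 * ennreal (H * T powr (2 * H - 1))"
      using H by (intro ennreal_mult) auto
    then have 2: "ennreal (2 * H * T powr (2 * H - 1)) = 2 * ennreal (H * T powr (2 * H - 1))"
      by (simp add: mult.assoc)
    show ?thesis unfolding 1 2 by (simp only: mult_ac)
  qed
  finally show ?thesis unfolding z_def y_def by simp
qed

section \<open>Coefficients in the Dirichlet eigenbasis\<close>

locale dirichlet_basis =
  fixes D :: "'d::euclidean_space set" and lam :: "nat => real" and \<phi> :: "nat => 'd => real"
  assumes domain: "convex_polygonal_domain D" and basis: "dirichlet_eigenbasis D lam \<phi>"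
begin

abbreviation "N \<equiv> lebesgue_on D"
abbreviation "coef v k \<equiv> L2_inner D v (\<phi> k)"

lemma lam_pos: "0 < lam 0" and lam_mono: "lam 0 \<le> lam k" and lam_pos': "0 < lam k"
proof -
  show 1: "0 < lam 0" using basis by (simp add: dirichlet_eigenbasis_def)
  show 2: "lam 0 \<le> lam k" using basis by (simp add: dirichlet_eigenbasis_def incseq_def)
  show "0 < lam k" using 1 2 by simp
qed

lemma phi_L2: "\<phi> k \<in> L2 D"
proof -
  have "dirichlet_eigenpair D (lam k) (\<phi> k)" using basis by (simp add: dirichlet_eigenbasis_def)
  then show ?thesis unfolding dirichlet_eigenpair_def H10_grad_def by blast
qed

lemma orthonormal: "L2_inner D (\<phi> j) (\<phi> k) = (if j = k then 1 else 0)"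
  using basis by (simp add: dirichlet_eigenbasis_def)

lemma finite_N: "finite_measure N"
proof -
  obtain P where P: "polytope P" "D = interior P" using domain by (auto simp: convex_polygonal_domain_def)
  have "bounded D" using P polytope_imp_bounded bounded_subset interior_subset by blast
  then have "D \<in> lmeasurable" using P(2) by (intro lmeasurable_open) auto
  then show ?thesis by (rule finite_measure_lebesgue_on)
qed

lemma L2_measurable: "v \<in> L2 D ==> v \<in> borel_measurable N"
  and L2_square: "v \<in> L2 D ==> integrable N (\<lambda>x. (v x)^2)"
  by (auto simp: L2_def)

lemma L2_mult_integrable:
  assumes "v \<in> L2 D" "w \<in> L2 D"
  shows "integrable N (\<lambda>x. v x * w x)"
proof (rule Bochner_Integration.integrable_bound[OF Bochner_Integration.integrable_add[OF L2_square[OF assms(1)] L2_square[OF assms(2)]]])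
  show "AE x in N. norm (v x * w x) \<le> norm ((v x)^2 + (w x)^2)"
  proof (rule AE_I2)
    fix x
    have "2 * \<bar>v x * w x\<bar> \<le> (v x)^2 + (w x)^2"
      using zero_le_power2[of "\<bar>v x\<bar> - \<bar>w x\<bar>"] by (simp add: power2_diff abs_mult)
    then show "norm (v x * w x) \<le> norm ((v x)^2 + (w x)^2)"
      unfolding real_norm_def by linarith
  qed
qed (use assms L2_measurable in auto)

lemma L2_lin:
  assumes "v \<in> L2 D" "w \<in> L2 D"
  shows "(\<lambda>x. a * v x + b * w x) \<in> L2 D"
proof -
  have "integrable N (\<lambda>x. a\<^sup>2 * (v x)^2 + 2 * a * b * (v x * w x) + b\<^sup>2 * (w x)^2)"
    by (intro Bochner_Integration.integrable_add integrable_mult_right L2_square L2_mult_integrable assms)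
  also have "(\<lambda>x. a\<^sup>2 * (v x)^2 + 2 * a * b * (v x * w x) + b\<^sup>2 * (w x)^2) = (\<lambda>x. (a * v x + b * w x)^2)"
    by (auto simp: power2_eq_square algebra_simps)
  finally have "integrable N (\<lambda>x. (a * v x + b * w x)^2)" .
  moreover have "(\<lambda>x. a * v x + b * w x) \<in> borel_measurable N"
    using L2_measurable[OF assms(1)] L2_measurable[OF assms(2)] by measurable
  ultimately show ?thesis by (simp add: L2_def)
qed

lemma L2_inner_lin:
  assumes "v \<in> L2 D" "w \<in> L2 D" "z \<in> L2 D"
  shows "L2_inner D (\<lambda>x. a * v x + b * w x) z = a * L2_inner D v z + b * L2_inner D w z"
proof -
  have "L2_inner D (\<lambda>x. a * v x + b * w x) z = (LINT x|N. a * (v x * z x) + b * (w x * z x))"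
    unfolding L2_inner_def by (simp add: algebra_simps)
  also have "\<dots> = a * L2_inner D v z + b * L2_inner D w z"
    unfolding L2_inner_def using L2_mult_integrable assms by simp
  finally show ?thesis .
qed

lemma L2_inner_commute: "L2_inner D v w = L2_inner D w v"
  by (simp add: L2_inner_def mult.commute)

lemma L2_diff: "v \<in> L2 D ==> w \<in> L2 D ==> (\<lambda>x. v x - w x) \<in> L2 D"
  using L2_lin[of v w 1 "-1"] by simp

lemma L2_inner_diff:
  "v \<in> L2 D ==> w \<in> L2 D ==> z \<in> L2 D ==> L2_inner D (\<lambda>x. v x - w x) z = L2_inner D v z - L2_inner D w z"
  using L2_inner_lin[of v w z 1 "-1"] by simp

lemma L2_cmult: "v \<in> L2 D ==> (\<lambda>x. a * v x) \<in> L2 D"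
  using L2_lin[of v v a 0] by simp

lemma L2_inner_cmult: "v \<in> L2 D ==> z \<in> L2 D ==> L2_inner D (\<lambda>x. a * v x) z = a * L2_inner D v z"
  using L2_inner_lin[of v v z a 0] by simp

lemma L2_add: "v \<in> L2 D ==> w \<in> L2 D ==> (\<lambda>x. v x + w x) \<in> L2 D"
  using L2_lin[of v w 1 1] by simp

lemma L2_inner_add:
  "v \<in> L2 D ==> w \<in> L2 D ==> z \<in> L2 D ==> L2_inner D (\<lambda>x. v x + w x) z = L2_inner D v z + L2_inner D w z"
  using L2_inner_lin[of v w z 1 1] by simp

lemma L2_zero: "(\<lambda>x. 0) \<in> L2 D"
  by (simp add: L2_def)

lemma L2_sum: "finite A ==> (\<lambda>x. \<Sum>i\<in>A. c i * \<phi> i x) \<in> L2 D"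
  by (induction A rule: finite_induct) (auto simp: L2_zero intro!: L2_add L2_cmult phi_L2)

lemma L2_inner_sum:
  assumes "finite A" "z \<in> L2 D"
  shows "L2_inner D (\<lambda>x. \<Sum>i\<in>A. c i * \<phi> i x) z = (\<Sum>i\<in>A. c i * L2_inner D (\<phi> i) z)"
  using assms(1)
proof (induction A rule: finite_induct)
  case empty
  then show ?case by (simp add: L2_inner_def)
next
  case (insert i A)
  then show ?case
    using L2_inner_add[OF L2_cmult[OF phi_L2[of i], of "c i"] L2_sum[OF insert(1), of c] assms(2)]
      L2_inner_cmult[OF phi_L2[of i] assms(2), of "c i"] by simp
qed

lemma coef_sum: "finite A ==> coef (\<lambda>x. \<Sum>i\<in>A. c i * \<phi> i x) k = (if k \<in> A then c k else 0)"
proof -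
  assume A: "finite A"
  have "coef (\<lambda>x. \<Sum>i\<in>A. c i * \<phi> i x) k = (\<Sum>i\<in>A. c i * coef (\<phi> i) k)"
    by (rule L2_inner_sum[OF A phi_L2])
  also have "\<dots> = (\<Sum>i\<in>A. if i = k then c i else 0)"
    by (intro sum.cong refl) (simp add: orthonormal)
  finally show ?thesis using A by simp
qed

lemma L2_inner_self: "0 \<le> L2_inner D v v"
  unfolding L2_inner_def by (intro integral_nonneg_AE) auto

lemma L2_norm_square: "(L2_norm D v)^2 = L2_inner D v v"
  using L2_inner_self by (simp add: L2_norm_def)

lemma L2_norm_nonneg: "0 \<le> L2_norm D v"
  using L2_inner_self by (simp add: L2_norm_def)

lemma L2_Cauchy_Schwarz:
  assumes "v \<in> L2 D" "w \<in> L2 D"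
  shows "\<bar>L2_inner D v w\<bar> \<le> L2_norm D v * L2_norm D w"
proof -
  define A B C where "A = L2_inner D v v" and "B = L2_inner D v w" and "C = L2_inner D w w"
  have quad: "0 \<le> A + 2 * t * B + t\<^sup>2 * C" for t
  proof -
    have 1: "(\<lambda>x. 1 * v x + t * w x) \<in> L2 D" by (rule L2_lin[OF assms])
    have "L2_inner D (\<lambda>x. 1 * v x + t * w x) (\<lambda>x. 1 * v x + t * w x) = 1 * L2_inner D v (\<lambda>x. 1 * v x + t * w x) + t * L2_inner D w (\<lambda>x. 1 * v x + t * w x)"
      by (rule L2_inner_lin[OF assms 1])
    also have "\<dots> = A + 2 * t * B + t\<^sup>2 * C"
      unfolding L2_inner_commute[of v "\<lambda>x. 1 * v x + t * w x"] L2_inner_commute[of w "\<lambda>x. 1 * v x + t * w x"]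
        L2_inner_lin[OF assms assms(1)] L2_inner_lin[OF assms assms(2)]
      by (simp add: A_def B_def C_def L2_inner_commute[of w v] power2_eq_square algebra_simps)
    finally show ?thesis using L2_inner_self by metis
  qed
  have "B\<^sup>2 \<le> A * C"
  proof (cases "C = 0")
    case True
    have "B = 0"
    proof (rule ccontr)
      assume "B \<noteq> 0"
      then show False using quad[of "- (A + 1) / (2 * B)"] True by (simp add: field_simps)
    qed
    then show ?thesis using True by simp
  next
    case False
    then have C: "C > 0" using L2_inner_self[of w] by (simp add: C_def)
    have "A + 2 * (- B / C) * B + (- B / C)^2 * C = A - B\<^sup>2 / C"
      using C by (simp add: field_simps power2_eq_square)
    with quad[of "- B / C"] have "B\<^sup>2 / C \<le> A" by simp
    then show ?thesis using C by (simp add: field_simps)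
  qed
  also have "A * C = (L2_norm D v * L2_norm D w)^2"
    by (simp add: power_mult_distrib L2_norm_square A_def C_def)
  finally show ?thesis
    using L2_norm_nonneg by (simp add: B_def abs_le_square_iff[symmetric] abs_mult)
qed

lemma L2_sums_inner:
  assumes s: "L2_sums D \<phi> c v" and w: "w \<in> L2 D"
  shows "(\<lambda>k. c k * coef w k) sums L2_inner D v w"
proof -
  have v: "v \<in> L2 D" and lim: "(\<lambda>n. L2_norm D (\<lambda>x. (\<Sum>k<n. c k * \<phi> k x) - v x)) \<longlonglongrightarrow> 0"
    using s by (auto simp: L2_sums_def)
  have "(\<lambda>n. (\<Sum>k<n. c k * coef w k) - L2_inner D v w) \<longlonglongrightarrow> 0"
  proof (rule Lim_null_comparison)
    show "eventually (\<lambda>n. norm ((\<Sum>k<n. c k * coef w k) - L2_inner D v w) \<le> L2_norm D (\<lambda>x. (\<Sum>k<n. c k * \<phi> k x) - v x) * L2_norm D w) sequentially"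
    proof (intro always_eventually allI)
      fix n
      have "(\<Sum>k<n. c k * coef w k) = L2_inner D (\<lambda>x. \<Sum>k<n. c k * \<phi> k x) w"
        by (simp add: L2_inner_sum w L2_inner_commute[of w])
      then have "(\<Sum>k<n. c k * coef w k) - L2_inner D v w = L2_inner D (\<lambda>x. (\<Sum>k<n. c k * \<phi> k x) - v x) w"
        by (simp add: L2_inner_diff L2_sum v w)
      then show "norm ((\<Sum>k<n. c k * coef w k) - L2_inner D v w) \<le> L2_norm D (\<lambda>x. (\<Sum>k<n. c k * \<phi> k x) - v x) * L2_norm D w"
        using L2_Cauchy_Schwarz[OF L2_diff[OF L2_sum v] w, of "{..<n}" c] by simp
    qed
    show "(\<lambda>n. L2_norm D (\<lambda>x. (\<Sum>k<n. c k * \<phi> k x) - v x) * L2_norm D w) \<longlonglongrightarrow> 0"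
      by (rule tendsto_mult_left_zero[OF lim])
  qed
  then show ?thesis
    unfolding sums_def by (simp add: LIM_zero_iff)
qed

lemma L2_sums_coef:
  assumes "L2_sums D \<phi> c v"
  shows "coef v k = c k"
proof -
  have "(\<lambda>j. c j * coef (\<phi> k) j) sums coef v k"
    by (rule L2_sums_inner[OF assms phi_L2])
  moreover have "(\<lambda>j. c j * coef (\<phi> k) j) = (\<lambda>j. if j = k then c j else 0)"
    by (auto simp: orthonormal)
  ultimately show ?thesis using sums_single[of k c] sums_unique2 by (metis (no_types, lifting))
qed

lemma Parseval_inner:
  assumes "v \<in> L2 D" "w \<in> L2 D"
  shows "(\<lambda>k. coef v k * coef w k) sums L2_inner D v w"
  using basis assms by (intro L2_sums_inner) (auto simp: dirichlet_eigenbasis_def)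

lemma Parseval: "v \<in> L2 D ==> (\<lambda>k. (coef v k)^2) sums (L2_norm D v)\<^sup>2"
  unfolding L2_norm_square unfolding power2_eq_square by (rule Parseval_inner)

text \<open>The partial sums are Cauchy in \<open>L\<^sup>2\<close>, hence in \<open>L\<^sup>1\<close> on the bounded domain. An almost everywhere
convergent subsequence provides the limit, and Fatou's lemma upgrades the convergence to \<open>L\<^sup>2\<close>.\<close>

lemma Riesz_Fischer:
  assumes c: "summable (\<lambda>k. (c k)^2)"
  shows "\<exists>w. L2_sums D \<phi> c w"
proof -
  interpret finite_measure N by (rule finite_N)
  define s where "s n x = (\<Sum>k<n. c k * \<phi> k x)" for n x
  have sL2: "s n \<in> L2 D" for n unfolding s_def[abs_def] by (rule L2_sum) simp
  have sm[measurable]: "s n \<in> borel_measurable N" for n using L2_measurable[OF sL2] .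
  have int1: "integrable N v" if "v \<in> L2 D" for v
  proof -
    have "(\<lambda>_. 1) \<in> L2 D" by (simp add: L2_def)
    from L2_mult_integrable[OF that this] show ?thesis by simp
  qed
  define R where "R n = (\<Sum>k. (c (k + n))^2)" for n
  have R0: "R n \<ge> 0" for n unfolding R_def using summable_ignore_initial_segment[OF c, of n] by (intro suminf_nonneg) auto
  have Rlim: "R \<longlonglongrightarrow> 0" unfolding R_def by (rule suminf_exist_split2[OF c])
  have diff: "L2_inner D (\<lambda>x. s m x - s n x) (\<lambda>x. s m x - s n x) \<le> R n" if "n \<le> m" for m n
  proof -
    have e: "(\<lambda>x. s m x - s n x) = (\<lambda>x. \<Sum>k\<in>{n..<m}. c k * \<phi> k x)"
    proof (rule ext)
      fix x show "s m x - s n x = (\<Sum>k\<in>{n..<m}. c k * \<phi> k x)"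
        using that sum_diff_nat_ivl[of 0 n m "\<lambda>k. c k * \<phi> k x"] by (simp add: s_def lessThan_atLeast0)
    qed
    have "L2_inner D (\<lambda>x. \<Sum>k\<in>{n..<m}. c k * \<phi> k x) (\<lambda>x. \<Sum>k\<in>{n..<m}. c k * \<phi> k x) = (\<Sum>k\<in>{n..<m}. c k * coef (\<lambda>x. \<Sum>k\<in>{n..<m}. c k * \<phi> k x) k)"
      by (subst L2_inner_sum) (auto simp: L2_sum L2_inner_commute[of "\<phi> _"])
    also have "\<dots> = (\<Sum>k\<in>{n..<m}. (c k)^2)"
      by (intro sum.cong refl) (subst coef_sum, auto simp: power2_eq_square)
    also have "\<dots> = (\<Sum>k<m - n. (c (k + n))^2)"
      using that sum.shift_bounds_nat_ivl[of "\<lambda>k. (c k)^2" 0 n "m - n"] by (simp add: lessThan_atLeast0)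
    also have "\<dots> \<le> R n"
      unfolding R_def using summable_ignore_initial_segment[OF c, of n] by (intro sum_le_suminf) auto
    finally show ?thesis unfolding e .
  qed
  define V where "V = measure N (space N)"
  have "\<exists>K. \<forall>i\<ge>K. \<forall>j\<ge>K. (LINT x|N. norm (s i x - s j x)) < \<epsilon>" if \<epsilon>: "\<epsilon> > 0" for \<epsilon>
  proof -
    have one: "(\<lambda>_. 1) \<in> L2 D" by (simp add: L2_def)
    have "eventually (\<lambda>n. sqrt (R n) * sqrt V < \<epsilon>) sequentially"
    proof (rule order_tendstoD(2)[OF _ \<epsilon>])
      show "(\<lambda>n. sqrt (R n) * sqrt V) \<longlonglongrightarrow> 0"
        using tendsto_real_sqrt[OF Rlim] by (intro tendsto_mult_left_zero) simp
    qed
    then obtain K where K: "\<And>n. n \<ge> K ==> sqrt (R n) * sqrt V < \<epsilon>" by (auto simp: eventually_sequentially)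
    have main: "(LINT x|N. norm (s m x - s n x)) < \<epsilon>" if "K \<le> n" "n \<le> m" for m n
    proof -
      have dL2: "(\<lambda>x. s m x - s n x) \<in> L2 D" by (intro L2_diff sL2)
      then have aL2: "(\<lambda>x. \<bar>s m x - s n x\<bar>) \<in> L2 D" by (auto simp: L2_def)
      have "(LINT x|N. norm (s m x - s n x)) = L2_inner D (\<lambda>x. \<bar>s m x - s n x\<bar>) (\<lambda>_. 1)"
        by (simp add: L2_inner_def)
      also have "\<dots> \<le> L2_norm D (\<lambda>x. \<bar>s m x - s n x\<bar>) * L2_norm D (\<lambda>_. 1)"
        using L2_Cauchy_Schwarz[OF aL2 one] by simp
      also have "L2_norm D (\<lambda>_. 1) = sqrt V" by (simp add: L2_norm_def L2_inner_def V_def)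
      also have "L2_norm D (\<lambda>x. \<bar>s m x - s n x\<bar>) * sqrt V \<le> sqrt (R n) * sqrt V"
      proof (rule mult_right_mono)
        show "L2_norm D (\<lambda>x. \<bar>s m x - s n x\<bar>) \<le> sqrt (R n)"
          using diff[OF that(2)] by (simp add: L2_norm_def L2_inner_def)
      qed (simp add: V_def)
      also have "\<dots> < \<epsilon>" by (rule K[OF that(1)])
      finally show ?thesis .
    qed
    have "(LINT x|N. norm (s i x - s j x)) < \<epsilon>" if "K \<le> i" "K \<le> j" for i j
    proof (cases "i \<le> j")
      case True
      have "(LINT x|N. norm (s j x - s i x)) < \<epsilon>" using main True that by blast
      then show ?thesis by (simp only: norm_minus_commute[of "s i _"])
    next
      case False
      then show ?thesis using main that by simp
    qed
    then show ?thesis by blast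
  qed
  from cauchy_L1_AE_cauchy_subseq[OF int1[OF sL2] this]
  obtain r where r: "strict_mono r" "AE x in N. Cauchy (\<lambda>i. s (r i) x)" by blast
  define w where "w x = lim (\<lambda>i. s (r i) x)" for x
  have wm[measurable]: "w \<in> borel_measurable N"
    unfolding w_def by (rule borel_measurable_lim_metric) measurable
  have wlim: "AE x in N. (\<lambda>i. s (r i) x) \<longlonglongrightarrow> w x"
    using r(2) by eventually_elim (simp add: w_def Cauchy_convergent_iff convergent_LIMSEQ_iff)
  have bound: "(\<integral>\<^sup>+x. ennreal ((s n x - w x)^2) \<partial>N) \<le> ennreal (R n)" for n
  proof -
    have "(\<integral>\<^sup>+x. ennreal ((s n x - w x)^2) \<partial>N) = (\<integral>\<^sup>+x. liminf (\<lambda>i. ennreal ((s n x - s (r i) x)^2)) \<partial>N)"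
    proof (rule nn_integral_cong_AE, use wlim in eventually_elim)
      fix x assume "(\<lambda>i. s (r i) x) \<longlonglongrightarrow> w x"
      then have "(\<lambda>i. ennreal ((s n x - s (r i) x)^2)) \<longlonglongrightarrow> ennreal ((s n x - w x)^2)"
        by (intro tendsto_intros)
      then show "ennreal ((s n x - w x)^2) = liminf (\<lambda>i. ennreal ((s n x - s (r i) x)^2))"
        by (rule lim_imp_Liminf[symmetric, rotated]) simp
    qed
    also have "\<dots> \<le> liminf (\<lambda>i. \<integral>\<^sup>+x. ennreal ((s n x - s (r i) x)^2) \<partial>N)"
      by (rule nn_integral_liminf) measurable
    also have "\<dots> \<le> ennreal (R n)"
    proof (rule Liminf_le, simp)
      show "\<forall>\<^sub>F i in sequentially. (\<integral>\<^sup>+x. ennreal ((s n x - s (r i) x)^2) \<partial>N) \<le> ennreal (R n)"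
      proof (rule eventually_sequentiallyI[of n])
        fix i assume "n \<le> i"
        then have ni: "n \<le> r i" using seq_suble[OF r(1), of i] by linarith
        have "(\<integral>\<^sup>+x. ennreal ((s n x - s (r i) x)^2) \<partial>N) = ennreal (LINT x|N. (s n x - s (r i) x)^2)"
          by (rule nn_integral_eq_integral) (use L2_square[OF L2_diff[OF sL2 sL2]] in auto)
        also have "(LINT x|N. (s n x - s (r i) x)^2) = L2_inner D (\<lambda>x. s (r i) x - s n x) (\<lambda>x. s (r i) x - s n x)"
          unfolding L2_inner_def by (simp add: power2_eq_square algebra_simps)
        finally show "(\<integral>\<^sup>+x. ennreal ((s n x - s (r i) x)^2) \<partial>N) \<le> ennreal (R n)"
          using diff[OF ni] by (simp add: ennreal_leI)
      qed
    qed
    finally show ?thesis .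
  qed
  have dint: "integrable N (\<lambda>x. (s n x - w x)^2)" for n
    by (rule integrableI_bounded) (use bound[of n] in \<open>auto simp: le_less_trans\<close>)
  have dL2: "(\<lambda>x. s n x - w x) \<in> L2 D" for n using dint[of n] by (simp add: L2_def)
  have wL2: "w \<in> L2 D"
    using L2_diff[OF sL2[of 0] dL2[of 0]] by simp
  have bnd: "L2_norm D (\<lambda>x. s n x - w x) \<le> sqrt (R n)" for n
  proof -
    have "ennreal (LINT x|N. (s n x - w x)^2) \<le> ennreal (R n)"
      using bound[of n] nn_integral_eq_integral[OF dint[of n]] by simp
    then have "(LINT x|N. (s n x - w x)^2) \<le> R n" using R0[of n] by simp
    then show ?thesis by (simp add: L2_norm_def L2_inner_def power2_eq_square)
  qed
  have "(\<lambda>n. L2_norm D (\<lambda>x. s n x - w x)) \<longlonglongrightarrow> 0"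
  proof (rule Lim_null_comparison)
    show "\<forall>\<^sub>F n in sequentially. norm (L2_norm D (\<lambda>x. s n x - w x)) \<le> sqrt (R n)"
      using bnd L2_norm_nonneg by (intro always_eventually allI) simp
    show "(\<lambda>n. sqrt (R n)) \<longlonglongrightarrow> 0" using tendsto_real_sqrt[OF Rlim] by simp
  qed
  then have "L2_sums D \<phi> c w" using wL2 by (simp add: L2_sums_def s_def)
  then show ?thesis by (rule exI[where x = w])
qed

lemma Hs_zero: "Hs D lam \<phi> 0 = L2 D"
proof -
  have p: "lam k powr 0 = 1" for k using lam_pos'[of k] by simp
  show ?thesis unfolding Hs_def p using sums_summable[OF Parseval] by auto
qed

lemma Hs_L2: "v \<in> Hs D lam \<phi> s ==> v \<in> L2 D"
  and Hs_summable: "v \<in> Hs D lam \<phi> s ==> summable (\<lambda>k. lam k powr s * (coef v k)^2)"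
  by (auto simp: Hs_def)

text \<open>By Riesz--Fischer the series that defines \<open>frac_lap\<close> converges, and Parseval gives its norm.\<close>

lemma frac_lap_norm:
  assumes "v \<in> Hs D lam \<phi> (2 * s)"
  shows "(\<lambda>k. lam k powr (2 * s) * (coef v k)^2) sums (L2_norm D (frac_lap D lam \<phi> s v))\<^sup>2"
proof -
  have e: "(lam k powr s * coef v k)^2 = lam k powr (2 * s) * (coef v k)^2" for k
    by (simp add: power_mult_distrib power2_eq_square powr_add[symmetric])
  have "summable (\<lambda>k. (lam k powr s * coef v k)^2)" using Hs_summable[OF assms] by (simp add: e)
  then have "\<exists>w. L2_sums D \<phi> (\<lambda>k. lam k powr s * coef v k) w" by (rule Riesz_Fischer)
  then have w: "L2_sums D \<phi> (\<lambda>k. lam k powr s * coef v k) (frac_lap D lam \<phi> s v)"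
    unfolding frac_lap_def by (rule someI_ex)
  then have "frac_lap D lam \<phi> s v \<in> L2 D" by (simp add: L2_sums_def)
  from Parseval[OF this] show ?thesis by (simp add: L2_sums_coef[OF w] e)
qed

text \<open>\<open>\<Lambda>\<close> stands for the operator inside the norms of the first condition: the identity when \<open>\<gamma> \<le> \<beta> / \<alpha>\<close>
and a fractional power of the Laplacian otherwise. Both cases are treated at once, since only the
norm of \<open>\<Lambda> v\<close> matters.\<close>

definition weighted_norm :: "real => (('d => real) => ('d => real)) => bool" where
  "weighted_norm \<sigma> \<Lambda> \<longleftrightarrow>
     (\<forall>v\<in>Hs D lam \<phi> \<sigma>. (\<lambda>k. lam k powr \<sigma> * (coef v k)^2) sums (L2_norm D (\<Lambda> v))\<^sup>2)"

lemma Hs_diff: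
  assumes "v \<in> Hs D lam \<phi> s" "w \<in> Hs D lam \<phi> s"
  shows "(\<lambda>x. v x - w x) \<in> Hs D lam \<phi> s"
proof -
  have L: "v \<in> L2 D" "w \<in> L2 D" using assms Hs_L2 by auto
  have "summable (\<lambda>k. lam k powr s * (coef (\<lambda>x. v x - w x) k)^2)"
  proof (rule summable_comparison_test')
    show "summable (\<lambda>k. 2 * (lam k powr s * (coef v k)^2) + 2 * (lam k powr s * (coef w k)^2))"
      by (intro summable_add summable_mult Hs_summable assms)
    fix k
    have "(coef v k - coef w k)^2 \<le> 2 * (coef v k)^2 + 2 * (coef w k)^2"
      using zero_le_power2[of "coef v k + coef w k"] by (simp add: power2_eq_square algebra_simps)
    then have "lam k powr s * (coef v k - coef w k)^2 \<le> lam k powr s * (2 * (coef v k)^2 + 2 * (coef w k)^2)"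
      by (intro mult_left_mono) auto
    then show "norm (lam k powr s * (coef (\<lambda>x. v x - w x) k)^2) \<le> 2 * (lam k powr s * (coef v k)^2) + 2 * (lam k powr s * (coef w k)^2)"
      by (simp add: L2_inner_diff L phi_L2 algebra_simps)
  qed
  then show ?thesis using L2_diff[OF L] by (simp add: Hs_def)
qed

text \<open>The coefficientwise content of the growth and Lipschitz conditions for a sequence of maps \<open>\<Phi> l\<close>. A
Hilbert--Schmidt-valued map enters through its values on the basis of the noise space, and the drift as a
sequence with a single nonzero member. The Lipschitz condition serves only to obtain measurability, so a
bound for each coefficient is enough.\<close>

definition admissible :: "real => (('d => real) => ('d => real)) => real => (nat => real => ('d => real) => 'd => real) => bool" where
  "admissible \<sigma> \<Lambda> L \<Phi> \<longleftrightarrow> L \<ge> 0 \<and>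
     (\<forall>l t. \<forall>v\<in>Hs D lam \<phi> \<sigma>. \<Phi> l t v \<in> L2 D) \<and>
     (\<forall>t. \<forall>v\<in>Hs D lam \<phi> \<sigma>. (\<Sum>l. \<Sum>k. ennreal (lam k powr \<sigma> * (coef (\<Phi> l t v) k)^2)) \<le> ennreal ((L * (1 + L2_norm D (\<Lambda> v)))^2)) \<and>
     (\<forall>l k t s. \<forall>v\<in>Hs D lam \<phi> \<sigma>. \<forall>w\<in>Hs D lam \<phi> \<sigma>.
        lam k powr \<sigma> * (coef (\<Phi> l t v) k - coef (\<Phi> l s w) k)^2 \<le> (L * (\<bar>t - s\<bar> + L2_norm D (\<Lambda> (\<lambda>x. v x - w x))))^2)"

lemma admissible_family:
  assumes \<Lambda>: "weighted_norm \<sigma> \<Lambda>" and L: "L \<ge> 0"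
    and Hs: "\<And>l t v. v \<in> Hs D lam \<phi> \<sigma> ==> \<Phi> l t v \<in> Hs D lam \<phi> \<sigma>"
    and summ: "\<And>t v. v \<in> Hs D lam \<phi> \<sigma> ==> summable (\<lambda>l. (L2_norm D (\<Lambda> (\<Phi> l t v)))^2)"
    and growth: "\<And>t v. v \<in> Hs D lam \<phi> \<sigma> ==> sqrt (\<Sum>l. (L2_norm D (\<Lambda> (\<Phi> l t v)))^2) \<le> L * (1 + L2_norm D (\<Lambda> v))"
    and lip: "\<And>t s v w. v \<in> Hs D lam \<phi> \<sigma> ==> w \<in> Hs D lam \<phi> \<sigma> ==>
        sqrt (\<Sum>l. (L2_norm D (\<Lambda> (\<lambda>x. \<Phi> l t v x - \<Phi> l s w x)))^2) \<le> L * (\<bar>t - s\<bar> + L2_norm D (\<Lambda> (\<lambda>x. v x - w x)))"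
  shows "admissible \<sigma> \<Lambda> L \<Phi>"
  unfolding admissible_def
proof (intro conjI allI ballI L)
  fix l t v assume v: "v \<in> Hs D lam \<phi> \<sigma>"
  show "\<Phi> l t v \<in> L2 D" using Hs[OF v] Hs_L2 by blast
next
  fix t v assume v: "v \<in> Hs D lam \<phi> \<sigma>"
  have "(\<Sum>k. ennreal (lam k powr \<sigma> * (coef (\<Phi> l t v) k)^2)) = ennreal ((L2_norm D (\<Lambda> (\<Phi> l t v)))^2)" for l
    using \<Lambda> Hs[OF v, of l t] unfolding weighted_norm_def by (intro suminf_ennreal_eq) auto
  then have "(\<Sum>l. \<Sum>k. ennreal (lam k powr \<sigma> * (coef (\<Phi> l t v) k)^2)) = (\<Sum>l. ennreal ((L2_norm D (\<Lambda> (\<Phi> l t v)))^2))"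
    by simp
  also have "\<dots> = ennreal (\<Sum>l. (L2_norm D (\<Lambda> (\<Phi> l t v)))^2)"
    by (intro suminf_ennreal_eq summable_sums summ v) simp
  also have "\<dots> \<le> ennreal ((L * (1 + L2_norm D (\<Lambda> v)))^2)"
    using growth[OF v, of t] suminf_nonneg[OF summ[OF v, of t]] by (intro ennreal_leI sqrt_le_D) auto
  finally show "(\<Sum>l. \<Sum>k. ennreal (lam k powr \<sigma> * (coef (\<Phi> l t v) k)^2)) \<le> ennreal ((L * (1 + L2_norm D (\<Lambda> v)))^2)" .
next
  fix l k t s v w assume v: "v \<in> Hs D lam \<phi> \<sigma>" and w: "w \<in> Hs D lam \<phi> \<sigma>"
  let ?d = "\<lambda>l x. \<Phi> l t v x - \<Phi> l s w x"
  have dHs: "?d l \<in> Hs D lam \<phi> \<sigma>" for l by (intro Hs_diff Hs v w)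
  have sd: "(\<lambda>k. lam k powr \<sigma> * (coef (?d l) k)^2) sums (L2_norm D (\<Lambda> (?d l)))\<^sup>2" for l
    using \<Lambda> dHs[of l] unfolding weighted_norm_def by blast
  have sv: "(\<lambda>k. lam k powr \<sigma> * (coef (\<Phi> l t v) k)^2) sums (L2_norm D (\<Lambda> (\<Phi> l t v)))\<^sup>2" for l
    using \<Lambda> Hs[OF v] unfolding weighted_norm_def by blast
  have sw: "(\<lambda>k. lam k powr \<sigma> * (coef (\<Phi> l s w) k)^2) sums (L2_norm D (\<Lambda> (\<Phi> l s w)))\<^sup>2" for l
    using \<Lambda> Hs[OF w] unfolding weighted_norm_def by blast
  have L2: "\<Phi> l t v \<in> L2 D" "\<Phi> l s w \<in> L2 D" for l using Hs[OF v] Hs[OF w] Hs_L2 by blast+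
  have cd: "coef (?d l) k = coef (\<Phi> l t v) k - coef (\<Phi> l s w) k" for l k
    by (intro L2_inner_diff L2 phi_L2)
  have le: "(L2_norm D (\<Lambda> (?d l)))^2 \<le> 2 * (L2_norm D (\<Lambda> (\<Phi> l t v)))^2 + 2 * (L2_norm D (\<Lambda> (\<Phi> l s w)))^2" for l
  proof (rule sums_le[OF _ sd sums_add[OF sums_mult[OF sv] sums_mult[OF sw]]])
    fix k
    have "(coef (\<Phi> l t v) k - coef (\<Phi> l s w) k)^2 \<le> 2 * (coef (\<Phi> l t v) k)^2 + 2 * (coef (\<Phi> l s w) k)^2"
      using zero_le_power2[of "coef (\<Phi> l t v) k + coef (\<Phi> l s w) k"] by (simp add: power2_eq_square algebra_simps)
    then have "lam k powr \<sigma> * (coef (\<Phi> l t v) k - coef (\<Phi> l s w) k)^2 \<le> lam k powr \<sigma> * (2 * (coef (\<Phi> l t v) k)^2 + 2 * (coef (\<Phi> l s w) k)^2)"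
      by (intro mult_left_mono) auto
    then show "lam k powr \<sigma> * (coef (?d l) k)^2 \<le> 2 * (lam k powr \<sigma> * (coef (\<Phi> l t v) k)^2) + 2 * (lam k powr \<sigma> * (coef (\<Phi> l s w) k)^2)"
      unfolding cd by (simp add: algebra_simps)
  qed
  have summd: "summable (\<lambda>l. (L2_norm D (\<Lambda> (?d l)))^2)"
    by (rule summable_comparison_test'[OF summable_add[OF summable_mult[OF summ[OF v, of t], of 2] summable_mult[OF summ[OF w, of s], of 2]]])
       (use le in auto)
  have "lam k powr \<sigma> * (coef (?d l) k)^2 \<le> (L2_norm D (\<Lambda> (?d l)))^2"
    using sum_le_suminf[OF sums_summable[OF sd[of l]], of "{k}"] sums_unique[OF sd[of l]] by simp
  also have "\<dots> \<le> (\<Sum>l. (L2_norm D (\<Lambda> (?d l)))^2)"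
    using sum_le_suminf[OF summd, of "{l}"] by simp
  also have "\<dots> \<le> (L * (\<bar>t - s\<bar> + L2_norm D (\<Lambda> (\<lambda>x. v x - w x))))^2"
    using lip[OF v w, of t s] suminf_nonneg[OF summd] by (intro sqrt_le_D) auto
  finally show "lam k powr \<sigma> * (coef (\<Phi> l t v) k - coef (\<Phi> l s w) k)^2 \<le> (L * (\<bar>t - s\<bar> + L2_norm D (\<Lambda> (\<lambda>x. v x - w x))))^2"
    unfolding cd .
qed

lemma hs_norm_nonneg:
  assumes "summable (\<lambda>k. (L2_norm D (R (e k)))^2)"
  shows "0 \<le> hs_norm D e R"
  unfolding hs_norm_def using suminf_nonneg[OF assms] by simp

lemma condition_A1_admissible:
  fixes e :: "nat => 'u::real_inner"
  assumes A1: "condition_A1 D lam \<phi> e \<alpha> \<beta> \<gamma> f g h" and \<gamma>: "\<gamma> \<ge> 0" and \<sigma>: "\<sigma> = 2 * max \<gamma> (\<beta> / \<alpha>) - 2 * \<beta> / \<alpha>"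
  obtains \<Lambda> L where "weighted_norm \<sigma> \<Lambda>"
    "admissible \<sigma> \<Lambda> L (\<lambda>l t v. if l = 0 then f t v else (\<lambda>x. 0))"
    "admissible \<sigma> \<Lambda> L (\<lambda>l t v. g t v (e l))" "admissible \<sigma> \<Lambda> L (\<lambda>l t v. h t v (e l))"
proof -
  have Hm: "H_map D f" "HS_map D e g" "HS_map D e h" using A1 by (auto simp: condition_A1_def)
  obtain l where l: "l > 0"
    "0 \<le> \<gamma> \<and> \<gamma> \<le> \<beta> / \<alpha> ==> lipschitz_growth D e (L2 D) (\<lambda>v. v) f g h l"
    "\<gamma> > \<beta> / \<alpha> ==> frac_lap_finite D lam \<phi> (\<gamma> - \<beta> / \<alpha>) f \<and>
           frac_lap_hs_finite D lam \<phi> e (\<gamma> - \<beta> / \<alpha>) g \<and>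
           frac_lap_hs_finite D lam \<phi> e (\<gamma> - \<beta> / \<alpha>) h \<and>
           lipschitz_growth D e (Hs D lam \<phi> (2 * \<gamma> - 2 * \<beta> / \<alpha>))
             (frac_lap D lam \<phi> (\<gamma> - \<beta> / \<alpha>)) f g h l"
    using A1 unfolding condition_A1_def by blast
  have ex: "\<exists>\<Lambda>. weighted_norm \<sigma> \<Lambda> \<and> lipschitz_growth D e (Hs D lam \<phi> \<sigma>) \<Lambda> f g h l \<and>
      (\<forall>t. \<forall>v\<in>Hs D lam \<phi> \<sigma>. f t v \<in> Hs D lam \<phi> \<sigma>) \<and>
      (\<forall>R\<in>{g, h}. \<forall>t. \<forall>v\<in>Hs D lam \<phi> \<sigma>. (\<forall>k. R t v (e k) \<in> Hs D lam \<phi> \<sigma>) \<and> summable (\<lambda>k. (L2_norm D (\<Lambda> (R t v (e k))))^2))"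
      (is "\<exists>\<Lambda>. ?P \<Lambda>")
  proof (cases "\<gamma> > \<beta> / \<alpha>")
    case True
    then have s: "\<sigma> = 2 * (\<gamma> - \<beta> / \<alpha>)" "2 * \<gamma> - 2 * \<beta> / \<alpha> = 2 * (\<gamma> - \<beta> / \<alpha>)" using \<sigma> by (auto simp: max_def)
    have "weighted_norm \<sigma> (frac_lap D lam \<phi> (\<gamma> - \<beta> / \<alpha>))"
      unfolding weighted_norm_def s using frac_lap_norm by blast
    note l3 = l(3)[OF True, unfolded s(2)]
    show ?thesis
    proof (intro exI[of _ "frac_lap D lam \<phi> (\<gamma> - \<beta> / \<alpha>)"] conjI)
      show "lipschitz_growth D e (Hs D lam \<phi> \<sigma>) (frac_lap D lam \<phi> (\<gamma> - \<beta> / \<alpha>)) f g h l"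
        unfolding s using l3 by simp
      show "\<forall>t. \<forall>v\<in>Hs D lam \<phi> \<sigma>. f t v \<in> Hs D lam \<phi> \<sigma>"
        unfolding s using l3 by (simp add: frac_lap_finite_def)
      show "\<forall>R\<in>{g, h}. \<forall>t. \<forall>v\<in>Hs D lam \<phi> \<sigma>. (\<forall>k. R t v (e k) \<in> Hs D lam \<phi> \<sigma>) \<and>
          summable (\<lambda>k. (L2_norm D (frac_lap D lam \<phi> (\<gamma> - \<beta> / \<alpha>) (R t v (e k))))^2)"
        unfolding s using l3 by (simp add: frac_lap_hs_finite_def)
    qed (fact \<open>weighted_norm \<sigma> (frac_lap D lam \<phi> (\<gamma> - \<beta> / \<alpha>))\<close>)
  next
    case False
    then have s: "\<sigma> = 0" using \<sigma> by (auto simp: max_def)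
    have "weighted_norm \<sigma> (\<lambda>v. v)"
      unfolding weighted_norm_def s Hs_zero using Parseval lam_pos' by (simp add: less_imp_neq[THEN not_sym])
    moreover have "lipschitz_growth D e (Hs D lam \<phi> \<sigma>) (\<lambda>v. v) f g h l"
      using l(2) False \<gamma> unfolding s Hs_zero by simp
    moreover have "\<forall>t. \<forall>v\<in>Hs D lam \<phi> \<sigma>. f t v \<in> Hs D lam \<phi> \<sigma>"
      using Hm unfolding s Hs_zero by (simp add: H_map_def)
    moreover have "\<forall>R\<in>{g, h}. \<forall>t. \<forall>v\<in>Hs D lam \<phi> \<sigma>. (\<forall>k. R t v (e k) \<in> Hs D lam \<phi> \<sigma>) \<and>
          summable (\<lambda>k. (L2_norm D (R t v (e k)))^2)"
      using Hm unfolding s Hs_zero by (simp add: HS_map_def hilbert_schmidt_def)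
    ultimately show ?thesis by blast
  qed
  obtain \<Lambda> where A: "?P \<Lambda>" using ex by (rule exE)
  have \<Lambda>: "weighted_norm \<sigma> \<Lambda>" by (rule A[THEN conjunct1])
  have lg: "lipschitz_growth D e (Hs D lam \<phi> \<sigma>) \<Lambda> f g h l" by (rule A[THEN conjunct2, THEN conjunct1])
  have fH: "f t v \<in> Hs D lam \<phi> \<sigma>" if "v \<in> Hs D lam \<phi> \<sigma>" for t v
    using A[THEN conjunct2, THEN conjunct2, THEN conjunct1] that by blast
  have RHS: "(\<forall>k. R t v (e k) \<in> Hs D lam \<phi> \<sigma>) \<and> summable (\<lambda>k. (L2_norm D (\<Lambda> (R t v (e k))))^2)"
    if "R \<in> {g, h}" "v \<in> Hs D lam \<phi> \<sigma>" for R t v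
    by (rule A[THEN conjunct2, THEN conjunct2, THEN conjunct2, THEN bspec, THEN spec, THEN bspec, OF that])
  have RH: "R t v (e k) \<in> Hs D lam \<phi> \<sigma>" if "R \<in> {g, h}" "v \<in> Hs D lam \<phi> \<sigma>" for R t v k
    using RHS[OF that] by simp
  have RS: "summable (\<lambda>k. (L2_norm D (\<Lambda> (R t v (e k))))^2)" if "R \<in> {g, h}" "v \<in> Hs D lam \<phi> \<sigma>" for R t v
    using RHS[OF that] by simp
  have zero_sum: "(\<lambda>l::nat. if l = 0 then a else 0) sums a" for a :: real
    using sums_single[of 0 "\<lambda>_. a"] by simp
  have z0: "L2_norm D (\<Lambda> (\<lambda>x. 0)) = 0"
  proof -
    have "(\<lambda>x. 0) \<in> Hs D lam \<phi> \<sigma>" by (simp add: Hs_def L2_zero L2_inner_def)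
    then have "(\<lambda>k. lam k powr \<sigma> * (coef (\<lambda>x. 0) k)^2) sums (L2_norm D (\<Lambda> (\<lambda>x. 0)))\<^sup>2"
      using \<Lambda> by (simp add: weighted_norm_def)
    then show ?thesis using sums_unique2[OF _ sums_zero] by (force simp: L2_inner_def)
  qed
  have zHs: "(\<lambda>x. 0) \<in> Hs D lam \<phi> \<sigma>" by (simp add: Hs_def L2_zero L2_inner_def)
  have dHs: "summable (\<lambda>k. (L2_norm D (\<Lambda> (\<lambda>x. R t v (e k) x - R s w (e k) x)))^2)"
    if R: "R \<in> {g, h}" and v: "v \<in> Hs D lam \<phi> \<sigma>" and w: "w \<in> Hs D lam \<phi> \<sigma>" for R t s v w
  proof (rule summable_comparison_test'[OF summable_add[OF summable_mult[OF RS[OF R v, of t], of 2] summable_mult[OF RS[OF R w, of s], of 2]]])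
    fix j
    let ?a = "R t v (e j)" and ?b = "R s w (e j)"
    have ab: "?a \<in> Hs D lam \<phi> \<sigma>" "?b \<in> Hs D lam \<phi> \<sigma>" using RH R v w by blast+
    have "(L2_norm D (\<Lambda> (\<lambda>x. ?a x - ?b x)))^2 \<le> 2 * (L2_norm D (\<Lambda> ?a))^2 + 2 * (L2_norm D (\<Lambda> ?b))^2"
    proof (rule sums_le[OF _ _ sums_add[OF sums_mult sums_mult]])
      show "(\<lambda>k. lam k powr \<sigma> * (coef (\<lambda>x. ?a x - ?b x) k)^2) sums (L2_norm D (\<Lambda> (\<lambda>x. ?a x - ?b x)))\<^sup>2"
        "(\<lambda>k. lam k powr \<sigma> * (coef ?a k)^2) sums (L2_norm D (\<Lambda> ?a))\<^sup>2"
        "(\<lambda>k. lam k powr \<sigma> * (coef ?b k)^2) sums (L2_norm D (\<Lambda> ?b))\<^sup>2"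
        using \<Lambda>[unfolded weighted_norm_def, THEN bspec] ab Hs_diff[OF ab] by simp_all
      fix k
      have "(coef ?a k - coef ?b k)^2 \<le> 2 * (coef ?a k)^2 + 2 * (coef ?b k)^2"
        using zero_le_power2[of "coef ?a k + coef ?b k"] by (simp add: power2_eq_square algebra_simps)
      then have "lam k powr \<sigma> * (coef ?a k - coef ?b k)^2 \<le> lam k powr \<sigma> * (2 * (coef ?a k)^2 + 2 * (coef ?b k)^2)"
        by (intro mult_left_mono) auto
      then show "lam k powr \<sigma> * (coef (\<lambda>x. ?a x - ?b x) k)^2 \<le> 2 * (lam k powr \<sigma> * (coef ?a k)^2) + 2 * (lam k powr \<sigma> * (coef ?b k)^2)"
        by (simp add: L2_inner_diff Hs_L2[OF ab(1)] Hs_L2[OF ab(2)] phi_L2 algebra_simps)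
    qed
    then show "norm ((L2_norm D (\<Lambda> (\<lambda>x. ?a x - ?b x)))^2) \<le> 2 * (L2_norm D (\<Lambda> ?a))^2 + 2 * (L2_norm D (\<Lambda> ?b))^2"
      by simp
  qed
  have lip: "L2_norm D (\<Lambda> (\<lambda>x. f t1 u1 x - f t2 u2 x)) +
        hs_norm D e (\<lambda>y. \<Lambda> (\<lambda>x. g t1 u1 y x - g t2 u2 y x)) +
        hs_norm D e (\<lambda>y. \<Lambda> (\<lambda>x. h t1 u1 y x - h t2 u2 y x))
        \<le> l * (\<bar>t1 - t2\<bar> + L2_norm D (\<Lambda> (\<lambda>x. u1 x - u2 x)))"
    and gr: "L2_norm D (\<Lambda> (f t u)) + hs_norm D e (\<lambda>y. \<Lambda> (g t u y)) + hs_norm D e (\<lambda>y. \<Lambda> (h t u y))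
        \<le> l * (1 + L2_norm D (\<Lambda> u))"
    if "u1 \<in> Hs D lam \<phi> \<sigma>" "u2 \<in> Hs D lam \<phi> \<sigma>" "u \<in> Hs D lam \<phi> \<sigma>" for t t1 t2 u u1 u2
    using lg that unfolding lipschitz_growth_def by simp_all
  have f: "admissible \<sigma> \<Lambda> l (\<lambda>l t v. if l = 0 then f t v else (\<lambda>x. 0))"
  proof (rule admissible_family[OF \<Lambda> less_imp_le[OF l(1)]])
    fix i :: nat and t v assume v: "v \<in> Hs D lam \<phi> \<sigma>"
    show "(if i = 0 then f t v else (\<lambda>x. 0)) \<in> Hs D lam \<phi> \<sigma>" using fH[OF v] zHs by simp
    have e: "(\<lambda>i::nat. (L2_norm D (\<Lambda> (if i = 0 then f t v else (\<lambda>x. 0))))^2) = (\<lambda>i. if i = 0 then (L2_norm D (\<Lambda> (f t v)))\<^sup>2 else 0)"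
      by (auto simp: z0)
    show "summable (\<lambda>i::nat. (L2_norm D (\<Lambda> (if i = 0 then f t v else (\<lambda>x. 0))))^2)"
      unfolding e using zero_sum by (rule sums_summable)
    have "sqrt (\<Sum>i::nat. (L2_norm D (\<Lambda> (if i = 0 then f t v else (\<lambda>x. 0))))^2) = L2_norm D (\<Lambda> (f t v))"
      unfolding e sums_unique[OF zero_sum, symmetric] using L2_norm_nonneg by simp
    also have "\<dots> \<le> l * (1 + L2_norm D (\<Lambda> v))"
      using gr[OF v v v, of t] hs_norm_nonneg[of "\<lambda>y. \<Lambda> (g t v y)" e] hs_norm_nonneg[of "\<lambda>y. \<Lambda> (h t v y)" e] RS[of g v t] RS[of h v t] v by simp
    finally show "sqrt (\<Sum>i::nat. (L2_norm D (\<Lambda> (if i = 0 then f t v else (\<lambda>x. 0))))^2) \<le> l * (1 + L2_norm D (\<Lambda> v))" .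
  next
    fix t s v w assume v: "v \<in> Hs D lam \<phi> \<sigma>" and w: "w \<in> Hs D lam \<phi> \<sigma>"
    have e: "(\<lambda>i::nat. (L2_norm D (\<Lambda> (\<lambda>x. (if i = 0 then f t v else (\<lambda>x. 0)) x - (if i = 0 then f s w else (\<lambda>x. 0)) x)))^2)
       = (\<lambda>i. if i = 0 then (L2_norm D (\<Lambda> (\<lambda>x. f t v x - f s w x)))\<^sup>2 else 0)"
      by (auto simp: z0)
    have "sqrt (\<Sum>i::nat. (L2_norm D (\<Lambda> (\<lambda>x. (if i = 0 then f t v else (\<lambda>x. 0)) x - (if i = 0 then f s w else (\<lambda>x. 0)) x)))^2)
       = L2_norm D (\<Lambda> (\<lambda>x. f t v x - f s w x))"
      unfolding e sums_unique[OF zero_sum, symmetric] using L2_norm_nonneg by simp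
    also have "\<dots> \<le> l * (\<bar>t - s\<bar> + L2_norm D (\<Lambda> (\<lambda>x. v x - w x)))"
      using lip[OF v w v, of t s] hs_norm_nonneg[of "\<lambda>y. \<Lambda> (\<lambda>x. g t v y x - g s w y x)" e] hs_norm_nonneg[of "\<lambda>y. \<Lambda> (\<lambda>x. h t v y x - h s w y x)" e]
        dHs[of g, OF _ v w, of t s] dHs[of h, OF _ v w, of t s] by simp
    finally show "sqrt (\<Sum>i::nat. (L2_norm D (\<Lambda> (\<lambda>x. (if i = 0 then f t v else (\<lambda>x. 0)) x - (if i = 0 then f s w else (\<lambda>x. 0)) x)))^2)
        \<le> l * (\<bar>t - s\<bar> + L2_norm D (\<Lambda> (\<lambda>x. v x - w x)))" .
  qed
  have R: "admissible \<sigma> \<Lambda> l (\<lambda>i t v. R t v (e i))" if R: "R \<in> {g, h}" for R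
  proof (rule admissible_family[OF \<Lambda> less_imp_le[OF l(1)]])
    fix t v assume v: "v \<in> Hs D lam \<phi> \<sigma>"
    show "R t v (e i) \<in> Hs D lam \<phi> \<sigma>" for i by (rule RH[OF R v])
    show "summable (\<lambda>i. (L2_norm D (\<Lambda> (R t v (e i))))^2)" by (rule RS[OF R v])
    have "hs_norm D e (\<lambda>y. \<Lambda> (R t v y)) \<le> l * (1 + L2_norm D (\<Lambda> v))"
      using gr[OF v v v, of t] hs_norm_nonneg[of "\<lambda>y. \<Lambda> (g t v y)" e] hs_norm_nonneg[of "\<lambda>y. \<Lambda> (h t v y)" e]
        RS[of g v t] RS[of h v t] v L2_norm_nonneg[of "\<Lambda> (f t v)"] R by auto
    then show "sqrt (\<Sum>i. (L2_norm D (\<Lambda> (R t v (e i))))^2) \<le> l * (1 + L2_norm D (\<Lambda> v))"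
      by (simp add: hs_norm_def)
  next
    fix t s v w assume v: "v \<in> Hs D lam \<phi> \<sigma>" and w: "w \<in> Hs D lam \<phi> \<sigma>"
    have "hs_norm D e (\<lambda>y. \<Lambda> (\<lambda>x. R t v y x - R s w y x)) \<le> l * (\<bar>t - s\<bar> + L2_norm D (\<Lambda> (\<lambda>x. v x - w x)))"
      using lip[OF v w v, of t s] hs_norm_nonneg[of "\<lambda>y. \<Lambda> (\<lambda>x. g t v y x - g s w y x)" e] hs_norm_nonneg[of "\<lambda>y. \<Lambda> (\<lambda>x. h t v y x - h s w y x)" e]
        dHs[of g, OF _ v w, of t s] dHs[of h, OF _ v w, of t s] L2_norm_nonneg[of "\<Lambda> (\<lambda>x. f t v x - f s w x)"] R by auto
    then show "sqrt (\<Sum>i. (L2_norm D (\<Lambda> (\<lambda>x. R t v (e i) x - R s w (e i) x)))^2) \<le> l * (\<bar>t - s\<bar> + L2_norm D (\<Lambda> (\<lambda>x. v x - w x)))"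
      by (simp add: hs_norm_def)
  qed
  show ?thesis by (rule that[OF \<Lambda> f R R]) auto
qed

end

section \<open>Measurability of the forcing coefficients\<close>

context dirichlet_basis
begin

definition rat_vec :: "rat list => 'd => real" where
  "rat_vec q x = (\<Sum>i<length q. of_rat (q ! i) * \<phi> i x)"

lemma coef_rat_vec: "coef (rat_vec q) k = (if k < length q then of_rat (q ! k) else 0)"
  unfolding rat_vec_def[abs_def] by (subst coef_sum) auto

lemma rat_vec_Hs: "rat_vec q \<in> Hs D lam \<phi> s"
proof -
  have "summable (\<lambda>k. lam k powr s * (coef (rat_vec q) k)^2)"
    by (rule summable_finite[of "{..<length q}"]) (auto simp: coef_rat_vec)
  moreover have "rat_vec q \<in> L2 D" unfolding rat_vec_def[abs_def] by (rule L2_sum) simp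
  ultimately show ?thesis by (simp add: Hs_def)
qed

lemma weighted_norm_eq:
  assumes "weighted_norm \<sigma> \<Lambda>" "v \<in> Hs D lam \<phi> \<sigma>"
  shows "L2_norm D (\<Lambda> v) = sqrt (\<Sum>k. lam k powr \<sigma> * (coef v k)^2)"
proof -
  have "(\<Sum>k. lam k powr \<sigma> * (coef v k)^2) = (L2_norm D (\<Lambda> v))^2"
    using assms by (auto simp: weighted_norm_def sums_iff)
  then show ?thesis using L2_norm_nonneg by simp
qed

text \<open>Truncating the coefficient sequence and rounding to rationals is cheap in the weighted norm.\<close>

lemma rat_vec_dense:
  assumes \<Lambda>: "weighted_norm \<sigma> \<Lambda>" and v: "v \<in> Hs D lam \<phi> \<sigma>" and \<epsilon>: "\<epsilon> > 0"
  shows "\<exists>q. L2_norm D (\<Lambda> (\<lambda>x. v x - rat_vec q x)) < \<epsilon>"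
proof -
  have sv: "summable (\<lambda>k. lam k powr \<sigma> * (coef v k)^2)" by (rule Hs_summable[OF v])
  have "(\<lambda>n. \<Sum>k. lam (k + n) powr \<sigma> * (coef v (k + n))^2) \<longlonglongrightarrow> 0"
    by (rule suminf_exist_split2[OF sv])
  moreover have "\<epsilon>\<^sup>2 / 2 > 0" using \<epsilon> by simp
  ultimately have "\<forall>\<^sub>F n in sequentially. (\<Sum>k. lam (k + n) powr \<sigma> * (coef v (k + n))^2) < \<epsilon>\<^sup>2 / 2"
    by (rule order_tendstoD(2))
  then obtain n where n: "(\<Sum>k. lam (k + n) powr \<sigma> * (coef v (k + n))^2) < \<epsilon>\<^sup>2 / 2"
    by (auto simp: eventually_sequentially)
  define \<delta> where "\<delta> k = \<epsilon> / sqrt (2 * (real n + 1) * lam k powr \<sigma>)" for k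
  have lp: "lam k powr \<sigma> > 0" for k using lam_pos'[of k] by simp
  have \<delta>: "\<delta> k > 0" for k using \<epsilon> lp[of k] by (simp add: \<delta>_def)
  have \<delta>2: "lam k powr \<sigma> * (\<delta> k)^2 = \<epsilon>\<^sup>2 / (2 * (real n + 1))" for k
    using lp[of k] by (simp add: \<delta>_def power_divide)
  have "\<exists>r::rat. \<bar>coef v k - of_rat r\<bar> < \<delta> k" for k
  proof -
    obtain r where "coef v k - \<delta> k < of_rat r" "of_rat r < coef v k + \<delta> k"
      using of_rat_dense[of "coef v k - \<delta> k" "coef v k + \<delta> k"] \<delta>[of k] by auto
    then show ?thesis by (intro exI[of _ r]) auto
  qed
  then obtain r where r: "\<And>k. \<bar>coef v k - of_rat (r k)\<bar> < \<delta> k" by metis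
  define q where "q = map r [0..<n]"
  let ?w = "\<lambda>x. v x - rat_vec q x"
  have wHs: "?w \<in> Hs D lam \<phi> \<sigma>" by (rule Hs_diff[OF v rat_vec_Hs])
  have cw: "coef ?w k = (if k < n then coef v k - of_rat (r k) else coef v k)" for k
    using L2_inner_diff[OF Hs_L2[OF v] Hs_L2[OF rat_vec_Hs[of q \<sigma>]] phi_L2[of k]] by (simp add: coef_rat_vec q_def)
  have sw: "summable (\<lambda>k. lam k powr \<sigma> * (coef ?w k)^2)" by (rule Hs_summable[OF wHs])
  have "(\<Sum>k. lam k powr \<sigma> * (coef ?w k)^2) = (\<Sum>k. lam (k + n) powr \<sigma> * (coef ?w (k + n))^2) + (\<Sum>k<n. lam k powr \<sigma> * (coef ?w k)^2)"
    by (rule suminf_split_initial_segment[OF sw])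
  also have "(\<Sum>k. lam (k + n) powr \<sigma> * (coef ?w (k + n))^2) = (\<Sum>k. lam (k + n) powr \<sigma> * (coef v (k + n))^2)"
    by (simp add: cw)
  also have "(\<Sum>k<n. lam k powr \<sigma> * (coef ?w k)^2) \<le> (\<Sum>k<n. \<epsilon>\<^sup>2 / (2 * (real n + 1)))"
  proof (rule sum_mono)
    fix k assume "k \<in> {..<n}"
    have "(coef v k - of_rat (r k))^2 \<le> (\<delta> k)^2"
      using r[of k] \<delta>[of k] by (intro power2_le_iff_abs_le[THEN iffD2]) auto
    then have "lam k powr \<sigma> * (coef v k - of_rat (r k))^2 \<le> lam k powr \<sigma> * (\<delta> k)^2"
      by (intro mult_left_mono) auto
    then show "lam k powr \<sigma> * (coef ?w k)^2 \<le> \<epsilon>\<^sup>2 / (2 * (real n + 1))"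
      using \<open>k \<in> {..<n}\<close> by (simp add: cw \<delta>2)
  qed
  also have "(\<Sum>k<n. \<epsilon>\<^sup>2 / (2 * (real n + 1))) \<le> \<epsilon>\<^sup>2 / 2"
    using \<epsilon> by (simp add: field_simps)
  finally have "(\<Sum>k. lam k powr \<sigma> * (coef ?w k)^2) < \<epsilon>\<^sup>2" using n by linarith
  then have "L2_norm D (\<Lambda> ?w) < sqrt (\<epsilon>\<^sup>2)"
    unfolding weighted_norm_eq[OF \<Lambda> wHs] by (rule real_sqrt_less_mono)
  then show ?thesis using \<epsilon> by auto
qed

text \<open>A Lipschitz function of \<open>(t, v)\<close> is the infimum of countably many cones
\<open>\<psi> p q + L (\<bar>t - p\<bar> + \<bar>v - q\<bar>)\<close> with vertices in a countable dense set, and every cone is measurable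
as a function of the coefficients of \<open>v\<close>. Joint measurability thus follows from the measurability of
the coefficients alone.\<close>

lemma Lipschitz_composition_measurable:
  fixes \<psi> :: "real => ('d => real) => real" and u :: "'x => 'd => real" and \<tau> :: "'x => real"
  assumes \<Lambda>: "weighted_norm \<sigma> \<Lambda>" and L: "L \<ge> 0"
    and lip: "\<And>t s v w. v \<in> Hs D lam \<phi> \<sigma> ==> w \<in> Hs D lam \<phi> \<sigma> ==>
        \<bar>\<psi> t v - \<psi> s w\<bar> \<le> L * (\<bar>t - s\<bar> + L2_norm D (\<Lambda> (\<lambda>x. v x - w x)))"
    and \<tau>: "\<tau> \<in> borel_measurable P"
    and u: "\<And>x. x \<in> space P ==> u x \<in> Hs D lam \<phi> \<sigma>"
    and um: "\<And>k. (\<lambda>x. coef (u x) k) \<in> borel_measurable P"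
  shows "(\<lambda>x. \<psi> (\<tau> x) (u x)) \<in> borel_measurable P"
proof -
  define h where "h p x = \<psi> (of_rat (fst p)) (rat_vec (snd p)) + L * (\<bar>\<tau> x - of_rat (fst p)\<bar>
      + sqrt (\<Sum>k. lam k powr \<sigma> * (coef (u x) k - coef (rat_vec (snd p)) k)^2))" for p :: "rat \<times> rat list" and x
  have hm[measurable]: "h p \<in> borel_measurable P" for p
    unfolding h_def using \<tau> um by measurable
  have norm_eq: "L2_norm D (\<Lambda> (\<lambda>y. u x y - rat_vec q y)) = sqrt (\<Sum>k. lam k powr \<sigma> * (coef (u x) k - coef (rat_vec q) k)^2)"
    if "x \<in> space P" for x q
    unfolding weighted_norm_eq[OF \<Lambda> Hs_diff[OF u[OF that] rat_vec_Hs]]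
    by (simp add: L2_inner_diff[OF Hs_L2[OF u[OF that]] Hs_L2[OF rat_vec_Hs] phi_L2])
  have above: "\<psi> (\<tau> x) (u x) \<le> h p x" if "x \<in> space P" for p x
    using lip[OF u[OF that] rat_vec_Hs, of "\<tau> x" "of_rat (fst p)" "snd p"]
    unfolding h_def norm_eq[OF that] by linarith
  have approx: "\<exists>p. h p x < c" if x: "x \<in> space P" and c: "\<psi> (\<tau> x) (u x) < c" for x c
  proof -
    define \<epsilon> where "\<epsilon> = (c - \<psi> (\<tau> x) (u x)) / (4 * (L + 1))"
    have \<epsilon>: "\<epsilon> > 0" using c L by (simp add: \<epsilon>_def)
    obtain q where q: "L2_norm D (\<Lambda> (\<lambda>y. u x y - rat_vec q y)) < \<epsilon>"
      using rat_vec_dense[OF \<Lambda> u[OF x] \<epsilon>] by blast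
    obtain a :: rat where a: "\<tau> x - \<epsilon> < of_rat a" "of_rat a < \<tau> x + \<epsilon>"
      using of_rat_dense[of "\<tau> x - \<epsilon>" "\<tau> x + \<epsilon>"] \<epsilon> by auto
    let ?d = "\<bar>\<tau> x - of_rat a\<bar> + L2_norm D (\<Lambda> (\<lambda>y. u x y - rat_vec q y))"
    have d: "?d \<le> 2 * \<epsilon>" using q a by linarith
    have Ld: "L * ?d \<le> L * (2 * \<epsilon>)" using d L by (rule mult_left_mono)
    have "h (a, q) x = \<psi> (of_rat a) (rat_vec q) + L * ?d"
      unfolding h_def norm_eq[OF x] by simp
    also have "\<dots> \<le> \<psi> (\<tau> x) (u x) + L * ?d + L * ?d"
      using lip[OF u[OF x] rat_vec_Hs, of "\<tau> x" "of_rat a" q] by linarith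
    also have "\<dots> \<le> \<psi> (\<tau> x) (u x) + 4 * (L * \<epsilon>)" using Ld by linarith
    also have "4 * (L * \<epsilon>) < c - \<psi> (\<tau> x) (u x)"
    proof -
      have "4 * ((L + 1) * \<epsilon>) = c - \<psi> (\<tau> x) (u x)" using L by (simp add: \<epsilon>_def field_simps)
      then show ?thesis using \<epsilon> by (simp add: algebra_simps)
    qed
    finally show ?thesis by (intro exI[of _ "(a, q)"]) simp
  qed
  show ?thesis
  proof (rule borel_measurable_iff_less[THEN iffD2], rule allI)
    fix c
    have "{x \<in> space P. \<psi> (\<tau> x) (u x) < c} = (\<Union>p. {x \<in> space P. h p x < c})"
    proof (intro equalityI subsetI)
      fix x assume "x \<in> {x \<in> space P. \<psi> (\<tau> x) (u x) < c}"
      then have x: "x \<in> space P" "\<psi> (\<tau> x) (u x) < c" by auto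
      from approx[OF this] x show "x \<in> (\<Union>p. {x \<in> space P. h p x < c})" by auto
    next
      fix x assume "x \<in> (\<Union>p. {x \<in> space P. h p x < c})"
      then obtain p where x: "x \<in> space P" and p: "h p x < c" by auto
      from le_less_trans[OF above[OF x] p] x show "x \<in> {x \<in> space P. \<psi> (\<tau> x) (u x) < c}" by simp
    qed
    also have "\<dots> \<in> sets P"
    proof (rule sets.countable_UN')
      show "countable (UNIV :: (rat \<times> rat list) set)" by (rule countableI_type)
      show "range (\<lambda>p. {x \<in> space P. h p x < c}) \<subseteq> sets P"
        by (intro image_subsetI) measurable
    qed
    finally show "{x \<in> space P. \<psi> (\<tau> x) (u x) < c} \<in> sets P" .
  qed
qed

lemma admissible_measurable:
  fixes u :: "real => 'w => 'd => real"
  assumes \<Lambda>: "weighted_norm \<sigma> \<Lambda>" and A: "admissible \<sigma> \<Lambda> L \<Phi>"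
    and u: "\<And>s \<omega>. s \<in> {0..T} ==> \<omega> \<in> space M ==> u s \<omega> \<in> Hs D lam \<phi> \<sigma>"
    and um: "\<And>k. (\<lambda>(s, \<omega>). coef (u s \<omega>) k) \<in> borel_measurable (restrict_space lborel {0..T} \<Otimes>\<^sub>M M)"
  shows "(\<lambda>(s, \<omega>). coef (\<Phi> l s (u s \<omega>)) k) \<in> borel_measurable (restrict_space lborel {0..T} \<Otimes>\<^sub>M M)"
proof -
  let ?P = "restrict_space lborel {0..T} \<Otimes>\<^sub>M M"
  have L: "L \<ge> 0" using A by (simp add: admissible_def)
  have lp: "lam k powr \<sigma> > 0" using lam_pos'[of k] by simp
  define K where "K = L / sqrt (lam k powr \<sigma>)"
  have K: "K \<ge> 0" using L by (simp add: K_def)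
  have "(\<lambda>x. coef (\<Phi> l (fst x) (u (fst x) (snd x))) k) \<in> borel_measurable ?P"
  proof (rule Lipschitz_composition_measurable[where \<psi> = "\<lambda>s v. coef (\<Phi> l s v) k" and L = K, OF \<Lambda> K])
    fix t s v w assume v: "v \<in> Hs D lam \<phi> \<sigma>" and w: "w \<in> Hs D lam \<phi> \<sigma>"
    let ?E = "\<bar>t - s\<bar> + L2_norm D (\<Lambda> (\<lambda>x. v x - w x))"
    have E0: "?E \<ge> 0" using L2_norm_nonneg by simp
    have "lam k powr \<sigma> * (coef (\<Phi> l t v) k - coef (\<Phi> l s w) k)^2 \<le> (L * ?E)^2"
      using A v w unfolding admissible_def by blast
    then have "(coef (\<Phi> l t v) k - coef (\<Phi> l s w) k)^2 \<le> (L * ?E)^2 / lam k powr \<sigma>"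
      using lp by (simp add: pos_le_divide_eq mult.commute)
    also have "\<dots> = (K * ?E)^2"
      using lp by (simp add: K_def power_mult_distrib power_divide)
    finally show "\<bar>coef (\<Phi> l t v) k - coef (\<Phi> l s w) k\<bar> \<le> K * ?E"
      using K E0 by (simp add: abs_le_square_iff[symmetric] abs_mult)
  next
    have "(\<lambda>x. x) \<in> restrict_space lborel {0..T} \<rightarrow>\<^sub>M borel" by (intro measurable_restrict_space1) simp
    from measurable_compose[OF measurable_fst[of "restrict_space lborel {0..T}" M] this]
    show "fst \<in> borel_measurable ?P" by simp
  next
    fix x assume "x \<in> space ?P"
    then show "u (fst x) (snd x) \<in> Hs D lam \<phi> \<sigma>"
      by (intro u) (auto simp: space_pair_measure space_restrict_space)
  next
    show "(\<lambda>x. coef (u (fst x) (snd x)) k) \<in> borel_measurable ?P" for k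
      using um[of k] by (simp add: case_prod_beta)
  qed
  then show ?thesis by (simp add: case_prod_beta)
qed

end

section \<open>Mean-square convergence\<close>

abbreviation E2 :: "'w measure => ('w => real) => ennreal" where
  "E2 M Z \<equiv> (\<integral>\<^sup>+w. ennreal ((Z w)^2) \<partial>M)"

lemma square_sum3: "(x + y + z)^2 \<le> 3 * (x\<^sup>2 + y\<^sup>2 + z\<^sup>2)" for x y z :: real
proof -
  have "0 \<le> (x - y)^2 + (y - z)^2 + (x - z)^2" by simp
  then show ?thesis by (simp add: power2_eq_square algebra_simps)
qed

lemma square_diff2: "(x - y)^2 \<le> 2 * x\<^sup>2 + 2 * y\<^sup>2" for x y :: real
  using zero_le_power2[of "x + y"] by (simp add: power2_eq_square algebra_simps)

lemma E2_sum3: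
  assumes [measurable]: "X \<in> borel_measurable M" "Y \<in> borel_measurable M" "Z \<in> borel_measurable M"
  shows "E2 M (\<lambda>w. X w + Y w + Z w) \<le> 3 * (E2 M X + E2 M Y + E2 M Z)"
proof -
  have "E2 M (\<lambda>w. X w + Y w + Z w) \<le> (\<integral>\<^sup>+w. 3 * (ennreal ((X w)^2) + ennreal ((Y w)^2) + ennreal ((Z w)^2)) \<partial>M)"
  proof (intro nn_integral_mono)
    fix w
    have "ennreal ((X w + Y w + Z w)^2) \<le> ennreal (3 * ((X w)^2 + (Y w)^2 + (Z w)^2))"
      by (intro ennreal_leI square_sum3)
    then show "ennreal ((X w + Y w + Z w)^2) \<le> 3 * (ennreal ((X w)^2) + ennreal ((Y w)^2) + ennreal ((Z w)^2))"
      by (simp add: ennreal_mult ennreal_plus)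
  qed
  also have "\<dots> = 3 * (E2 M X + E2 M Y + E2 M Z)"
    by (simp add: nn_integral_cmult nn_integral_add)
  finally show ?thesis .
qed

lemma E2_cmult:
  assumes "X \<in> borel_measurable M"
  shows "E2 M (\<lambda>w. c * X w) = ennreal (c\<^sup>2) * E2 M X"
  using assms by (simp add: power_mult_distrib ennreal_mult nn_integral_cmult)

lemma E2_triangle:
  assumes [measurable]: "X \<in> borel_measurable M" "Y \<in> borel_measurable M" "Z \<in> borel_measurable M"
  shows "E2 M (\<lambda>w. X w - Z w) \<le> 2 * E2 M (\<lambda>w. X w - Y w) + 2 * E2 M (\<lambda>w. Y w - Z w)"
proof -
  have "E2 M (\<lambda>w. X w - Z w) \<le> (\<integral>\<^sup>+w. 2 * ennreal ((X w - Y w)^2) + 2 * ennreal ((Y w - Z w)^2) \<partial>M)"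
  proof (intro nn_integral_mono)
    fix w
    have "(X w - Z w)^2 \<le> 2 * (X w - Y w)^2 + 2 * (Y w - Z w)^2"
      using square_diff2[of "X w - Y w" "Z w - Y w"] by (simp add: power2_commute[of "Z w"])
    then have "ennreal ((X w - Z w)^2) \<le> ennreal (2 * (X w - Y w)^2 + 2 * (Y w - Z w)^2)"
      by (rule ennreal_leI)
    then show "ennreal ((X w - Z w)^2) \<le> 2 * ennreal ((X w - Y w)^2) + 2 * ennreal ((Y w - Z w)^2)"
      by (simp add: ennreal_mult ennreal_plus)
  qed
  also have "\<dots> = 2 * E2 M (\<lambda>w. X w - Y w) + 2 * E2 M (\<lambda>w. Y w - Z w)"
    by (simp add: nn_integral_cmult nn_integral_add)
  finally show ?thesis .
qed

lemma E2_uminus: "E2 M (\<lambda>w. X w - Y w) = E2 M (\<lambda>w. Y w - X w)"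
  by (simp add: power2_commute)

lemma ennreal_suminf_swap: "(\<Sum>i. \<Sum>j. f i j) = (\<Sum>j. \<Sum>i. f i j :: ennreal)"
  using nn_integral_suminf[of "\<lambda>j i. f i j" "count_space UNIV"] by (simp add: nn_integral_count_space_nat)

lemma ennreal_term_le_suminf: "f k \<le> (\<Sum>k. f k :: ennreal)"
  using sum_le_suminf[of f "{k}"] by simp

lemma ennreal_tendsto_0I:
  fixes f :: "'i => ennreal"
  assumes "\<And>\<epsilon>. \<epsilon> > (0::real) ==> eventually (\<lambda>x. f x \<le> ennreal \<epsilon>) G"
  shows "(f \<longlongrightarrow> 0) G"
proof (rule order_tendstoI)
  fix a :: ennreal assume "0 < a"
  then obtain b where b: "0 < b" "b < a" using dense by blast
  have bt: "b < \<top>" using b(2) top_greatest[of a] by (rule less_le_trans)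
  then have "b = ennreal (enn2real b)" by simp
  moreover have "enn2real b > 0" using b bt by (simp add: enn2real_positive_iff)
  ultimately have "eventually (\<lambda>x. f x \<le> b) G" using assms[of "enn2real b"] by simp
  then show "eventually (\<lambda>x. f x < a) G" by eventually_elim (use b in auto)
qed simp

lemma tendsto_0_of_le:
  fixes f g :: "nat => ennreal"
  assumes le: "\<And>n. f n \<le> g n" and lim: "g \<longlonglongrightarrow> 0"
  shows "f \<longlonglongrightarrow> 0"
  by (rule tendsto_sandwich[OF always_eventually always_eventually tendsto_const lim]) (simp, intro allI le)

text \<open>Cauchy--Schwarz with weights, in the form \<open>(\<Sum>l. z l)\<^sup>2 \<le> (\<Sum>l. wt l) * (\<Sum>l. (z l)\<^sup>2 / wt l)\<close>.\<close>

lemma l2_series_bound: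
  assumes [measurable]: "\<And>l. Z l \<in> borel_measurable M" "Y \<in> borel_measurable M"
    and wt: "\<And>l. wt l > 0" "summable wt"
    and lim: "(\<lambda>n. E2 M (\<lambda>w. (\<Sum>l<n. Z l w) - Y w)) \<longlonglongrightarrow> 0"
    and q: "\<And>l. E2 M (Z l) \<le> ennreal ((wt l)^2) * q l"
  shows "E2 M Y \<le> ennreal (2 * (suminf wt)^2) * (\<Sum>l. q l)"
proof -
  define S where "S = suminf wt"
  have S: "S \<ge> 0" "wt l \<le> S" "(\<Sum>l<n. wt l) \<le> S" for l n
    using wt suminf_nonneg[OF wt(2)] sum_le_suminf[OF wt(2), of "{l}"] sum_le_suminf[OF wt(2), of "{..<n}"]
    by (auto simp: S_def less_imp_le)
  have part: "E2 M (\<lambda>w. \<Sum>l<n. Z l w) \<le> ennreal (S\<^sup>2) * (\<Sum>l. q l)" for n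
  proof -
    have "E2 M (\<lambda>w. \<Sum>l<n. Z l w) \<le> (\<integral>\<^sup>+w. (\<Sum>l<n. ennreal (S / wt l) * ennreal ((Z l w)^2)) \<partial>M)"
    proof (intro nn_integral_mono)
      fix w
      have "(\<Sum>l<n. Z l w)^2 \<le> (\<Sum>l<n. wt l) * (\<Sum>l<n. (Z l w)^2 / wt l)"
        using wt by (intro sum_square_weighted) auto
      also have "\<dots> \<le> S * (\<Sum>l<n. (Z l w)^2 / wt l)"
        using S wt by (intro mult_right_mono sum_nonneg) (auto simp: less_imp_le)
      also have "\<dots> = (\<Sum>l<n. (S / wt l) * (Z l w)^2)"
        by (simp add: sum_distrib_left)
      finally have "ennreal ((\<Sum>l<n. Z l w)^2) \<le> ennreal (\<Sum>l<n. (S / wt l) * (Z l w)^2)"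
        by (rule ennreal_leI)
      also have "\<dots> = (\<Sum>l<n. ennreal (S / wt l) * ennreal ((Z l w)^2))"
        using S wt by (subst sum_ennreal[symmetric]) (auto simp: ennreal_mult[symmetric] less_imp_le)
      finally show "ennreal ((\<Sum>l<n. Z l w)^2) \<le> (\<Sum>l<n. ennreal (S / wt l) * ennreal ((Z l w)^2))" .
    qed
    also have "\<dots> = (\<Sum>l<n. ennreal (S / wt l) * E2 M (Z l))"
      by (simp add: nn_integral_sum nn_integral_cmult)
    also have "\<dots> \<le> (\<Sum>l<n. ennreal (S\<^sup>2) * q l)"
    proof (rule sum_mono)
      fix l
      have "ennreal (S / wt l) * E2 M (Z l) \<le> ennreal (S / wt l) * (ennreal ((wt l)^2) * q l)"
        by (intro mult_left_mono q) auto
      also have "\<dots> = ennreal (S / wt l * (wt l)^2) * q l"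
        using S wt(1)[of l] by (subst ennreal_mult) (auto simp: mult.assoc less_imp_le)
      also have "\<dots> \<le> ennreal (S\<^sup>2) * q l"
      proof (intro mult_right_mono ennreal_leI)
        have "S / wt l * (wt l)^2 = S * wt l" using wt(1)[of l] by (simp add: power2_eq_square)
        also have "\<dots> \<le> S * S" using S by (intro mult_left_mono) auto
        finally show "S / wt l * (wt l)^2 \<le> S\<^sup>2" by (simp add: power2_eq_square)
      qed simp
      finally show "ennreal (S / wt l) * E2 M (Z l) \<le> ennreal (S\<^sup>2) * q l" .
    qed
    also have "\<dots> \<le> (\<Sum>l. ennreal (S\<^sup>2) * q l)"
      by (intro sum_le_suminf) auto
    also have "\<dots> = ennreal (S\<^sup>2) * (\<Sum>l. q l)" by simp
    finally show ?thesis .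
  qed
  have main: "E2 M Y \<le> 2 * E2 M (\<lambda>w. (\<Sum>l<n. Z l w) - Y w) + 2 * (ennreal (S\<^sup>2) * (\<Sum>l. q l))" for n
  proof -
    have "E2 M (\<lambda>w. Y w - 0) \<le> 2 * E2 M (\<lambda>w. Y w - (\<Sum>l<n. Z l w)) + 2 * E2 M (\<lambda>w. (\<Sum>l<n. Z l w) - 0)"
      by (rule E2_triangle) measurable
    also have "E2 M (\<lambda>w. Y w - (\<Sum>l<n. Z l w)) = E2 M (\<lambda>w. (\<Sum>l<n. Z l w) - Y w)"
      by (rule E2_uminus)
    also have "2 * E2 M (\<lambda>w. (\<Sum>l<n. Z l w) - Y w) + 2 * E2 M (\<lambda>w. (\<Sum>l<n. Z l w) - 0)
       \<le> 2 * E2 M (\<lambda>w. (\<Sum>l<n. Z l w) - Y w) + 2 * (ennreal (S\<^sup>2) * (\<Sum>l. q l))"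
      using part[of n] by (intro add_left_mono mult_left_mono) auto
    finally show ?thesis by simp
  qed
  have "(\<lambda>n. 2 * E2 M (\<lambda>w. (\<Sum>l<n. Z l w) - Y w) + 2 * (ennreal (S\<^sup>2) * (\<Sum>l. q l))) \<longlonglongrightarrow> 2 * 0 + 2 * (ennreal (S\<^sup>2) * (\<Sum>l. q l))"
    by (intro tendsto_add ennreal_tendsto_cmult lim tendsto_const) auto
  then have "E2 M Y \<le> 2 * 0 + 2 * (ennreal (S\<^sup>2) * (\<Sum>l. q l))"
    by (rule LIMSEQ_le_const) (use main in auto)
  also have "\<dots> = ennreal (2 * S\<^sup>2) * (\<Sum>l. q l)" by (simp add: ennreal_mult mult.assoc)
  finally show ?thesis unfolding S_def .
qed

text \<open>Cauchy in \<open>L\<^sup>2\<close> on a finite measure space implies Cauchy in \<open>L\<^sup>1\<close>, because of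
\<open>\<bar>x\<bar> \<le> \<eta> + x\<^sup>2 / \<eta>\<close>; Fatou's lemma turns the almost sure limit of a subsequence into an \<open>L\<^sup>2\<close> limit.\<close>

lemma L2_complete:
  fixes q :: "nat => 'w => real"
  assumes "finite_measure M"
    and q[measurable]: "\<And>n. q n \<in> borel_measurable M" and fin: "\<And>n. E2 M (q n) < \<infinity>"
    and cauchy: "\<And>\<epsilon>. \<epsilon> > 0 ==> \<exists>K. \<forall>m\<ge>K. \<forall>n\<ge>K. E2 M (\<lambda>w. q m w - q n w) \<le> ennreal \<epsilon>"
  shows "\<exists>v. v \<in> borel_measurable M \<and> (\<lambda>n. E2 M (\<lambda>w. q n w - v w)) \<longlonglongrightarrow> 0"
proof -
  interpret finite_measure M by fact
  \<comment> \<open>The summand \<open>1\<close> keeps the denominator positive even for the zero measure.\<close>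
  define V where "V = measure M (space M) + 1"
  have V: "V > 0" by (simp add: V_def add_nonneg_pos)
  have sq_int: "integrable M (\<lambda>w. (X w)^2)" if "X \<in> borel_measurable M" "E2 M X < \<infinity>" for X
    using that by (intro integrableI_bounded) auto
  have L1_bound: "integrable M X" "(LINT w|M. norm (X w)) \<le> \<eta> * V + (LINT w|M. (X w)^2) / \<eta>"
    if X[measurable]: "X \<in> borel_measurable M" and f: "E2 M X < \<infinity>" and \<eta>: "\<eta> > 0" for X \<eta>
  proof -
    have pt: "norm (X w) \<le> \<eta> + (X w)^2 / \<eta>" for w
    proof (cases "\<bar>X w\<bar> \<le> \<eta>")
      case True
      then show ?thesis using \<eta> by (simp add: add_increasing2)
    next
      case False
      then have "\<bar>X w\<bar> * \<eta> \<le> \<bar>X w\<bar> * \<bar>X w\<bar>" by (intro mult_left_mono) auto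
      then have "\<bar>X w\<bar> \<le> (X w)^2 / \<eta>" using \<eta> by (simp add: pos_le_divide_eq power2_eq_square)
      then show ?thesis using \<eta> by simp
    qed
    have i: "integrable M (\<lambda>w. \<eta> + (X w)^2 / \<eta>)" using sq_int[OF X f] by simp
    show int: "integrable M X"
      by (rule Bochner_Integration.integrable_bound[OF i X])
         (intro AE_I2, rule order_trans[OF pt], use \<eta> in auto)
    have "(LINT w|M. norm (X w)) \<le> (LINT w|M. \<eta> + (X w)^2 / \<eta>)"
      using int i pt by (intro integral_mono) auto
    also have "\<dots> = \<eta> * measure M (space M) + (LINT w|M. (X w)^2) / \<eta>"
      using sq_int[OF X f] by (simp add: mult.commute)
    also have "\<dots> \<le> \<eta> * V + (LINT w|M. (X w)^2) / \<eta>"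
      using \<eta> by (simp add: V_def)
    finally show "(LINT w|M. norm (X w)) \<le> \<eta> * V + (LINT w|M. (X w)^2) / \<eta>" .
  qed
  have dfin: "E2 M (\<lambda>w. q m w - q n w) < \<infinity>" for m n
  proof -
    have "E2 M (\<lambda>w. q m w - q n w) \<le> 2 * E2 M (\<lambda>w. q m w - 0) + 2 * E2 M (\<lambda>w. 0 - q n w)"
      by (rule E2_triangle) measurable
    also have "\<dots> < \<infinity>" using fin[of m] fin[of n] by (simp add: ennreal_mult_less_top)
    finally show ?thesis .
  qed
  have C: "\<exists>K. \<forall>i\<ge>K. \<forall>j\<ge>K. (LINT w|M. norm (q i w - q j w)) < \<epsilon>" if \<epsilon>: "\<epsilon> > 0" for \<epsilon>
  proof -
    define \<eta> where "\<eta> = \<epsilon> / (4 * V)"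
    have \<eta>: "\<eta> > 0" using \<epsilon> V by (simp add: \<eta>_def)
    obtain K where K: "\<And>m n. m \<ge> K ==> n \<ge> K ==> E2 M (\<lambda>w. q m w - q n w) \<le> ennreal (\<eta> * \<epsilon> / 4)"
      using cauchy[of "\<eta> * \<epsilon> / 4"] \<eta> \<epsilon> by auto
    have "(LINT w|M. norm (q i w - q j w)) < \<epsilon>" if "i \<ge> K" "j \<ge> K" for i j
    proof -
      have "ennreal (LINT w|M. (q i w - q j w)^2) = E2 M (\<lambda>w. q i w - q j w)"
        by (rule nn_integral_eq_integral[symmetric]) (use sq_int[OF _ dfin[of i j]] in auto)
      also have "\<dots> \<le> ennreal (\<eta> * \<epsilon> / 4)" by (rule K[OF that])
      finally have "(LINT w|M. (q i w - q j w)^2) \<le> \<eta> * \<epsilon> / 4" using \<eta> \<epsilon> by (simp add: ennreal_le_iff)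
      then have "(LINT w|M. (q i w - q j w)^2) / \<eta> \<le> \<epsilon> / 4" using \<eta> by (simp add: pos_divide_le_eq mult.commute)
      moreover have "\<eta> * V = \<epsilon> / 4" using V by (simp add: \<eta>_def)
      moreover have "(LINT w|M. norm (q i w - q j w)) \<le> \<eta> * V + (LINT w|M. (q i w - q j w)^2) / \<eta>"
        by (rule L1_bound(2)[OF _ dfin[of i j] \<eta>]) measurable
      ultimately show ?thesis using \<epsilon> by linarith
    qed
    then show ?thesis by blast
  qed
  obtain r where r: "strict_mono r" "AE w in M. Cauchy (\<lambda>i. q (r i) w)"
    by (rule cauchy_L1_AE_cauchy_subseq[OF L1_bound(1)[OF q fin zero_less_one] C])
  define v where "v w = lim (\<lambda>i. q (r i) w)" for w
  have vm[measurable]: "v \<in> borel_measurable M"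
    unfolding v_def by (rule borel_measurable_lim_metric) measurable
  have vlim: "AE w in M. (\<lambda>i. q (r i) w) \<longlonglongrightarrow> v w"
    using r(2) by eventually_elim (simp add: v_def Cauchy_convergent_iff convergent_LIMSEQ_iff)
  have "(\<lambda>n. E2 M (\<lambda>w. q n w - v w)) \<longlonglongrightarrow> 0"
  proof (rule ennreal_tendsto_0I)
    fix \<epsilon> :: real assume \<epsilon>: "\<epsilon> > 0"
    obtain K where K: "\<And>m n. m \<ge> K ==> n \<ge> K ==> E2 M (\<lambda>w. q m w - q n w) \<le> ennreal \<epsilon>"
      using cauchy[OF \<epsilon>] by auto
    have "E2 M (\<lambda>w. q n w - v w) \<le> ennreal \<epsilon>" if n: "n \<ge> K" for n
    proof -
      have "E2 M (\<lambda>w. q n w - v w) = (\<integral>\<^sup>+w. liminf (\<lambda>i. ennreal ((q n w - q (r i) w)^2)) \<partial>M)"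
      proof (rule nn_integral_cong_AE, use vlim in eventually_elim)
        fix w assume "(\<lambda>i. q (r i) w) \<longlonglongrightarrow> v w"
        then have "(\<lambda>i. ennreal ((q n w - q (r i) w)^2)) \<longlonglongrightarrow> ennreal ((q n w - v w)^2)"
          by (intro tendsto_intros)
        then show "ennreal ((q n w - v w)^2) = liminf (\<lambda>i. ennreal ((q n w - q (r i) w)^2))"
          by (rule lim_imp_Liminf[symmetric, rotated]) simp
      qed
      also have "\<dots> \<le> liminf (\<lambda>i. E2 M (\<lambda>w. q n w - q (r i) w))"
        by (rule nn_integral_liminf) measurable
      also have "\<dots> \<le> ennreal \<epsilon>"
      proof (rule Liminf_le, simp)
        show "\<forall>\<^sub>F i in sequentially. E2 M (\<lambda>w. q n w - q (r i) w) \<le> ennreal \<epsilon>"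
        proof (rule eventually_sequentiallyI[of K])
          fix i assume "K \<le> i"
          then have "K \<le> r i" using seq_suble[OF r(1), of i] by linarith
          then show "E2 M (\<lambda>w. q n w - q (r i) w) \<le> ennreal \<epsilon>" by (rule K[OF n])
        qed
      qed
      finally show ?thesis .
    qed
    then show "\<forall>\<^sub>F n in sequentially. E2 M (\<lambda>w. q n w - v w) \<le> ennreal \<epsilon>"
      by (auto simp: eventually_sequentially)
  qed
  then show ?thesis using vm by blast
qed

text \<open>The coefficients converge separately; the Cauchy property for the weighted sum passes to the limit on
finite partial sums.\<close>

lemma weighted_L2_complete:
  fixes q :: "nat => nat => 'w => real" and c :: "nat => real"
  assumes M: "finite_measure M"
    and q[measurable]: "\<And>n k. q n k \<in> borel_measurable M" and c: "\<And>k. c k > 0"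
    and fin: "\<And>n. (\<Sum>k. ennreal (c k) * E2 M (q n k)) < \<infinity>"
    and cauchy: "\<And>\<epsilon>. \<epsilon> > 0 ==> \<exists>K. \<forall>m\<ge>K. \<forall>n\<ge>K. (\<Sum>k. ennreal (c k) * E2 M (\<lambda>w. q m k w - q n k w)) \<le> ennreal \<epsilon>"
  shows "\<exists>v. (\<forall>k. v k \<in> borel_measurable M) \<and> (\<lambda>n. \<Sum>k. ennreal (c k) * E2 M (\<lambda>w. q n k w - v k w)) \<longlonglongrightarrow> 0"
proof -
  have div: "X \<le> ennreal (\<epsilon> / c k)" if "ennreal (c k) * X \<le> ennreal \<epsilon>" "\<epsilon> > 0" for X \<epsilon> k
  proof -
    have "X = ennreal (1 / c k) * (ennreal (c k) * X)"
      using c[of k] by (simp add: mult.assoc[symmetric] ennreal_mult[symmetric])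
    also have "\<dots> \<le> ennreal (1 / c k) * ennreal \<epsilon>" by (intro mult_left_mono that) simp
    also have "\<dots> = ennreal (\<epsilon> / c k)" using c[of k] that by (simp add: ennreal_mult[symmetric] less_imp_le)
    finally show ?thesis .
  qed
  have ex: "\<exists>v. v \<in> borel_measurable M \<and> (\<lambda>n. E2 M (\<lambda>w. q n k w - v w)) \<longlonglongrightarrow> 0" for k
  proof (rule L2_complete[OF M])
    show "E2 M (q n k) < \<infinity>" for n
    proof -
      have "ennreal (c k) * E2 M (q n k) < \<infinity>"
        using fin[of n] ennreal_term_le_suminf[of "\<lambda>k. ennreal (c k) * E2 M (q n k)" k] by (rule le_less_trans[rotated])
      then show ?thesis using c[of k] by (auto simp: ennreal_mult_less_top)
    qed
    fix \<epsilon> :: real assume \<epsilon>: "\<epsilon> > 0"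
    obtain K where K: "\<And>m n. m \<ge> K ==> n \<ge> K ==> (\<Sum>k. ennreal (c k) * E2 M (\<lambda>w. q m k w - q n k w)) \<le> ennreal (\<epsilon> * c k)"
      using cauchy[of "\<epsilon> * c k"] \<epsilon> c[of k] by auto
    have "E2 M (\<lambda>w. q m k w - q n k w) \<le> ennreal \<epsilon>" if "m \<ge> K" "n \<ge> K" for m n
      using div[of k _ "\<epsilon> * c k", OF order_trans[OF ennreal_term_le_suminf K[OF that]]] \<epsilon> c[of k] by simp
    then show "\<exists>K. \<forall>m\<ge>K. \<forall>n\<ge>K. E2 M (\<lambda>w. q m k w - q n k w) \<le> ennreal \<epsilon>" by blast
  qed measurable
  obtain v where v: "\<And>k. v k \<in> borel_measurable M" "\<And>k. (\<lambda>n. E2 M (\<lambda>w. q n k w - v k w)) \<longlonglongrightarrow> 0"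
    using choice[of "\<lambda>k v. v \<in> borel_measurable M \<and> (\<lambda>n. E2 M (\<lambda>w. q n k w - v w)) \<longlonglongrightarrow> 0"] ex by blast
  have "(\<lambda>n. \<Sum>k. ennreal (c k) * E2 M (\<lambda>w. q n k w - v k w)) \<longlonglongrightarrow> 0"
  proof (rule ennreal_tendsto_0I)
    fix \<epsilon> :: real assume \<epsilon>: "\<epsilon> > 0"
    obtain K where K: "\<And>m n. m \<ge> K ==> n \<ge> K ==> (\<Sum>k. ennreal (c k) * E2 M (\<lambda>w. q m k w - q n k w)) \<le> ennreal (\<epsilon> / 2)"
      using cauchy[of "\<epsilon> / 2"] \<epsilon> by auto
    have "(\<Sum>k. ennreal (c k) * E2 M (\<lambda>w. q n k w - v k w)) \<le> ennreal \<epsilon>" if n: "n \<ge> K" for n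
    proof (rule suminf_le_const[OF summableI])
      fix j
      have bd: "(\<Sum>k<j. ennreal (c k) * E2 M (\<lambda>w. q n k w - v k w))
         \<le> ennreal \<epsilon> + (\<Sum>k<j. ennreal (c k) * (2 * E2 M (\<lambda>w. q m k w - v k w)))" if m: "m \<ge> K" for m
      proof -
        have "(\<Sum>k<j. ennreal (c k) * E2 M (\<lambda>w. q n k w - v k w))
          \<le> (\<Sum>k<j. 2 * (ennreal (c k) * E2 M (\<lambda>w. q n k w - q m k w)) + ennreal (c k) * (2 * E2 M (\<lambda>w. q m k w - v k w)))"
        proof (rule sum_mono)
          fix k
          have "ennreal (c k) * E2 M (\<lambda>w. q n k w - v k w)
            \<le> ennreal (c k) * (2 * E2 M (\<lambda>w. q n k w - q m k w) + 2 * E2 M (\<lambda>w. q m k w - v k w))"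
            by (intro mult_left_mono E2_triangle v q) auto
          then show "ennreal (c k) * E2 M (\<lambda>w. q n k w - v k w)
            \<le> 2 * (ennreal (c k) * E2 M (\<lambda>w. q n k w - q m k w)) + ennreal (c k) * (2 * E2 M (\<lambda>w. q m k w - v k w))"
            by (simp add: distrib_left mult.left_commute)
        qed
        also have "\<dots> = 2 * (\<Sum>k<j. ennreal (c k) * E2 M (\<lambda>w. q n k w - q m k w)) + (\<Sum>k<j. ennreal (c k) * (2 * E2 M (\<lambda>w. q m k w - v k w)))"
          by (simp add: sum.distrib sum_distrib_left)
        also have "2 * (\<Sum>k<j. ennreal (c k) * E2 M (\<lambda>w. q n k w - q m k w)) \<le> 2 * ennreal (\<epsilon> / 2)"
          by (intro mult_left_mono order_trans[OF sum_le_suminf K[OF n m]]) auto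
        also have "2 * ennreal (\<epsilon> / 2) = ennreal \<epsilon>" using \<epsilon> by (simp add: ennreal_mult'[of 2, simplified, symmetric])
        finally show ?thesis by (simp add: add_right_mono)
      qed
      have "(\<lambda>m. ennreal \<epsilon> + (\<Sum>k<j. ennreal (c k) * (2 * E2 M (\<lambda>w. q m k w - v k w)))) \<longlonglongrightarrow> ennreal \<epsilon> + (\<Sum>k<j. ennreal (c k) * (2 * 0))"
        by (intro tendsto_add tendsto_const tendsto_sum ennreal_tendsto_cmult v) auto
      then have "(\<Sum>k<j. ennreal (c k) * E2 M (\<lambda>w. q n k w - v k w)) \<le> ennreal \<epsilon> + (\<Sum>k<j. ennreal (c k) * (2 * 0))"
        by (rule LIMSEQ_le_const) (use bd in blast)
      then show "(\<Sum>k<j. ennreal (c k) * E2 M (\<lambda>w. q n k w - v k w)) \<le> ennreal \<epsilon>" by simp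
    qed
    then show "\<forall>\<^sub>F n in sequentially. (\<Sum>k. ennreal (c k) * E2 M (\<lambda>w. q n k w - v k w)) \<le> ennreal \<epsilon>"
      by (auto simp: eventually_sequentially)
  qed
  then show ?thesis using v(1) by blast
qed

lemma integral_square_le:
  fixes y :: "real => real"
  assumes T: "T > 0" and y[measurable]: "y \<in> borel_measurable lborel" and supp: "\<And>s. s \<notin> {0..T} ==> y s = 0"
  shows "ennreal ((LBINT s. y s)^2) \<le> ennreal T * (\<integral>\<^sup>+s. ennreal ((y s)^2) \<partial>lborel)"
proof (cases "integrable lborel y \<and> (\<integral>\<^sup>+s. ennreal ((y s)^2) \<partial>lborel) < \<infinity>")
  case False
  show ?thesis
  proof (cases "integrable lborel y")
    case True
    then have "(\<integral>\<^sup>+s. ennreal ((y s)^2) \<partial>lborel) = \<infinity>" using False by (simp add: less_top[symmetric])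
    then show ?thesis using T by (simp add: ennreal_mult_top)
  qed (simp add: not_integrable_integral_eq)
next
  case True
  then have i1: "integrable lborel y" and i2: "integrable lborel (\<lambda>s. (y s)^2)"
    by (auto intro!: integrableI_bounded)
  define I where "I = (LBINT s. y s)"
  have ind: "integrable lborel (indicat_real {0..T})"
    by (rule integrable_real_indicator) (auto simp: emeasure_lborel_Icc_eq)
  have mT: "(LBINT s. indicat_real {0..T} s) = T" using T by simp
  have "0 \<le> (LBINT s. (y s - I / T * indicator {0..T} s)^2)" by simp
  also have "(\<lambda>s. (y s - I / T * indicator {0..T} s)^2) = (\<lambda>s. (y s)^2 - 2 * (I / T) * y s + (I / T)^2 * indicator {0..T} s)"
    using supp by (auto simp: fun_eq_iff indicator_def power2_eq_square algebra_simps)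
  also have "(LBINT s. (y s)^2 - 2 * (I / T) * y s + (I / T)^2 * indicator {0..T} s) = (LBINT s. (y s)^2) - 2 * (I / T) * I + (I / T)^2 * T"
    using i1 i2 ind mT by (simp add: I_def)
  also have "\<dots> = (LBINT s. (y s)^2) - I\<^sup>2 / T"
    using T by (simp add: power2_eq_square field_simps)
  finally have "I\<^sup>2 \<le> T * (LBINT s. (y s)^2)"
    using T by (simp add: field_simps)
  then have "ennreal (I\<^sup>2) \<le> ennreal (T * (LBINT s. (y s)^2))" by (rule ennreal_leI)
  also have "\<dots> = ennreal T * (\<integral>\<^sup>+s. ennreal ((y s)^2) \<partial>lborel)"
    using T i2 by (subst nn_integral_eq_integral) (auto simp: ennreal_mult)
  finally show ?thesis unfolding I_def .
qed

lemma powr_tail_integral: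
  assumes p: "p > (-1::real)" and am: "a \<le> m"
  shows "(\<integral>\<^sup>+s. ennreal (indicator {a..<m} s * (m - s) powr p) \<partial>lborel) \<le> ennreal ((m - a) powr (p + 1) / (p + 1))"
proof -
  have "(\<integral>\<^sup>+s. ennreal (indicator {a..<m} s * (m - s) powr p) \<partial>lborel)
     = ennreal \<bar>-1\<bar> * (\<integral>\<^sup>+x. ennreal (indicator {a..<m} (m + (-1) * x) * (m - (m + (-1) * x)) powr p) \<partial>lborel)"
    by (rule nn_integral_real_affine) auto
  also have "\<dots> \<le> (\<integral>\<^sup>+x. ennreal (indicator {0..m - a} x * x powr p) \<partial>lborel)"
    by (auto intro!: nn_integral_mono ennreal_leI simp: indicator_def)
  also have "\<dots> = ennreal ((m - a) powr (p + 1) / (p + 1))"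
    using am by (intro integrable_indicator_powr_0(2)[OF p]) simp
  finally show ?thesis .
qed

section \<open>Second moments of the convolution terms\<close>

text \<open>\<open>W\<close> is the deterministic combination of kernels, \<open>X\<close> a forcing coefficient and \<open>\<kappa>\<close> a noise amplitude; the
three convolution terms all end in this expression.\<close>

lemma weighted_square_Fubini:
  fixes X :: "real => 'w => real" and W \<kappa> :: "real => real"
  assumes M: "prob_space M" and X[measurable]: "(\<lambda>(s, w). X s w) \<in> borel_measurable (lborel \<Otimes>\<^sub>M M)"
    and W[measurable]: "W \<in> borel_measurable borel"
    and supp: "\<And>s w. s \<notin> {0..T} ==> X s w = 0" and \<kappa>: "\<And>s. s \<in> {0..T} ==> \<bar>\<kappa> s\<bar> \<le> wt"
  shows "(\<integral>\<^sup>+w. \<integral>\<^sup>+s. ennreal ((W s * X s w * \<kappa> s)^2) \<partial>lborel \<partial>M)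
    \<le> ennreal (wt\<^sup>2) * (\<integral>\<^sup>+s. ennreal ((W s)^2) * E2 M (X s) \<partial>lborel)"
proof -
  interpret prob_space M by fact
  have [measurable]: "(\<lambda>s. E2 M (X s)) \<in> borel_measurable lborel"
    by (rule borel_measurable_nn_integral) (use X in \<open>simp add: case_prod_beta\<close>)
  interpret pair_sigma_finite lborel M ..
  have [measurable]: "(\<lambda>w. X s w) \<in> borel_measurable M" for s
    using measurable_Pair2[OF X, of s] by simp
  have Xp[measurable]: "(\<lambda>x. X (fst x) (snd x)) \<in> borel_measurable (lborel \<Otimes>\<^sub>M M)"
    using X by (simp add: case_prod_beta)
  have "(\<integral>\<^sup>+w. \<integral>\<^sup>+s. ennreal ((W s * X s w * \<kappa> s)^2) \<partial>lborel \<partial>M)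
    \<le> (\<integral>\<^sup>+w. \<integral>\<^sup>+s. ennreal (wt\<^sup>2) * (ennreal ((W s)^2) * ennreal ((X s w)^2)) \<partial>lborel \<partial>M)"
  proof (intro nn_integral_mono)
    fix w s
    have "(W s * X s w * \<kappa> s)^2 \<le> wt\<^sup>2 * ((W s)^2 * (X s w)^2)"
    proof (cases "s \<in> {0..T}")
      case True
      have "(\<kappa> s)^2 \<le> wt\<^sup>2" using \<kappa>[OF True] by (metis abs_ge_zero power2_abs power_mono)
      then have "(\<kappa> s)^2 * ((W s)^2 * (X s w)^2) \<le> wt\<^sup>2 * ((W s)^2 * (X s w)^2)"
        by (intro mult_right_mono) auto
      then show ?thesis by (simp add: power_mult_distrib mult.commute mult.left_commute)
    qed (simp add: supp)
    then show "ennreal ((W s * X s w * \<kappa> s)^2) \<le> ennreal (wt\<^sup>2) * (ennreal ((W s)^2) * ennreal ((X s w)^2))"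
      by (simp add: ennreal_mult[symmetric] ennreal_leI)
  qed
  also have "\<dots> = (\<integral>\<^sup>+s. \<integral>\<^sup>+w. ennreal (wt\<^sup>2) * (ennreal ((W s)^2) * ennreal ((X s w)^2)) \<partial>M \<partial>lborel)"
    by (rule Fubini') (simp add: case_prod_beta)
  also have "\<dots> = (\<integral>\<^sup>+s. ennreal (wt\<^sup>2) * (ennreal ((W s)^2) * E2 M (X s)) \<partial>lborel)"
    by (simp add: nn_integral_cmult)
  also have "\<dots> = ennreal (wt\<^sup>2) * (\<integral>\<^sup>+s. ennreal ((W s)^2) * E2 M (X s) \<partial>lborel)"
    by (rule nn_integral_cmult) measurable
  finally show ?thesis .
qed

lemma kernel_indicator:
  assumes "t \<in> {0..T}"
  shows "indicator {0..t} s * (S_kernel \<alpha> \<beta> \<nu> c (t - s) * x * k) = S_ext \<alpha> \<beta> \<nu> c (t - s) * (indicator {0..T} s * x) * k"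
  using assms by (auto simp: indicator_def S_ext_def S_kernel_def)

lemma S_ext_bounded:
  assumes "\<alpha> > 1"
  obtains K where "K \<ge> 0" "\<And>x. \<bar>x\<bar> \<le> T ==> \<bar>S_ext \<alpha> \<beta> \<nu> c x\<bar> \<le> K"
proof -
  have "bounded (S_ext \<alpha> \<beta> \<nu> c ` {-T..T})"
    by (intro compact_imp_bounded compact_continuous_image continuous_on_subset[OF S_ext_continuous[OF assms]]) auto
  then obtain K where K: "K > 0" "\<And>x. x \<in> {-T..T} ==> \<bar>S_ext \<alpha> \<beta> \<nu> c x\<bar> \<le> K"
    by (auto simp: bounded_pos)
  have "\<bar>S_ext \<alpha> \<beta> \<nu> c x\<bar> \<le> K" if "\<bar>x\<bar> \<le> T" for x
    using that by (intro K(2)) (simp add: abs_le_iff)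
  then show thesis using K(1) by (intro that[of K]) (auto simp: less_imp_le)
qed

lemma ito_term_bound:
  fixes x :: "real => 'w => real" and d t :: "nat => real" and \<alpha> \<beta> \<nu> c :: real
  assumes W: "wiener M F W" and \<alpha>: "\<alpha> > 1"
    and x: "(\<lambda>(s, w). indicator {0..T} s * x s w) \<in> borel_measurable (lborel \<Otimes>\<^sub>M M)"
    and \<kappa>: "\<And>s. s \<in> {0..T} ==> \<bar>\<kappa> s\<bar> \<le> wt" and t: "\<And>j. j < n ==> t j \<in> {0..T}"
    and Y: "\<And>j. j < n ==> has_ito_integral M F W (t j) (\<lambda>s w. S_kernel \<alpha> \<beta> \<nu> c (t j - s) * x s w * \<kappa> s) (Y j)"
  shows "E2 M (\<lambda>w. \<Sum>j<n. d j * Y j w) \<le>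
     ennreal (wt\<^sup>2) * (4 * (\<integral>\<^sup>+s. ennreal ((\<Sum>j<n. d j * S_ext \<alpha> \<beta> \<nu> c (t j - s))^2) * E2 M (\<lambda>w. indicator {0..T} s * x s w) \<partial>lborel))"
proof -
  interpret wiener M F W by fact
  have eq: "(\<Sum>j<n. d j * (indicator {0..t j} s * (S_kernel \<alpha> \<beta> \<nu> c (t j - s) * x s w * \<kappa> s)))
     = (\<Sum>j<n. d j * S_ext \<alpha> \<beta> \<nu> c (t j - s)) * (indicator {0..T} s * x s w) * \<kappa> s" for s w
    unfolding sum_distrib_right
    by (intro sum.cong refl, subst kernel_indicator[where T = T]) (use t in \<open>auto simp: mult.assoc\<close>)
  have "E2 M (\<lambda>w. \<Sum>j<n. d j * Y j w) \<le>
    4 * (\<integral>\<^sup>+w. \<integral>\<^sup>+s. ennreal ((\<Sum>j<n. d j * (indicator {0..t j} s * (S_kernel \<alpha> \<beta> \<nu> c (t j - s) * x s w * \<kappa> s)))^2) \<partial>lborel \<partial>M)"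
    by (rule ito_combination_bound) (use Y in auto)
  also have "\<dots> \<le> 4 * (ennreal (wt\<^sup>2) * (\<integral>\<^sup>+s. ennreal ((\<Sum>j<n. d j * S_ext \<alpha> \<beta> \<nu> c (t j - s))^2) * E2 M (\<lambda>w. indicator {0..T} s * x s w) \<partial>lborel))"
    unfolding eq
    by (intro mult_left_mono weighted_square_Fubini[OF prob_space_axioms x _ _ \<kappa>])
       (use \<alpha> in measurable, auto)
  finally show ?thesis by (simp add: mult.left_commute)
qed

lemma fbm_term_bound:
  fixes x :: "real => 'w => real" and d t :: "nat => real" and \<alpha> \<beta> \<nu> c :: real
  assumes M: "prob_space M" and H: "1 / 2 < H" "H < (1::real)" and T: "T > 0"
    and fbm: "fbm_integral M T H B I" and \<alpha>: "\<alpha> > 1"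
    and x: "(\<lambda>(s, w). indicator {0..T} s * x s w) \<in> borel_measurable (lborel \<Otimes>\<^sub>M M)"
    and bd: "\<And>s. s \<in> {0..T} ==> E2 M (\<lambda>w. indicator {0..T} s * x s w) \<le> ennreal C"
    and cont: "continuous_on {0..T} \<rho>"
    and \<rho>: "\<And>s. s \<in> {0..T} ==> \<bar>\<rho> s\<bar> \<le> wt" and t: "\<And>j. j < n ==> t j \<in> {0..T}"
  defines "Y \<equiv> (\<lambda>t s w. indicator {0..t} s * (S_kernel \<alpha> \<beta> \<nu> c (t - s) * x s w * \<rho> s))"
  shows "j < n ==> I (Y (t j)) \<in> borel_measurable M"
    and "E2 M (\<lambda>w. \<Sum>j<n. d j * I (Y (t j)) w) \<le>
     ennreal (wt\<^sup>2) * (ennreal (2 * H * T powr (2 * H - 1)) * (\<integral>\<^sup>+s. ennreal ((\<Sum>j<n. d j * S_ext \<alpha> \<beta> \<nu> c (t j - s))^2) * E2 M (\<lambda>w. indicator {0..T} s * x s w) \<partial>lborel))"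
proof -
  interpret prob_space M by fact
  have Yeq: "Y (t j) s w = S_ext \<alpha> \<beta> \<nu> c (t j - s) * (indicator {0..T} s * x s w) * \<rho> s" if "j < n" for j s w
    unfolding Y_def by (rule kernel_indicator[OF t[OF that]])
  have process: "L2_process M T (Y (t j))" if j: "j < n" for j
    unfolding L2_process_def
  proof
    have "(\<lambda>(s, w). indicator {0..T} s * x s w) \<in> borel_measurable (restrict_space lborel {0..T} \<Otimes>\<^sub>M M)"
    proof -
      have "(\<lambda>p. (fst p, snd p)) \<in> measurable (restrict_space lborel {0..T} \<Otimes>\<^sub>M M) (lborel \<Otimes>\<^sub>M M)"
        by (intro measurable_Pair measurable_snd measurable_compose[OF measurable_fst measurable_restrict_space1] measurable_ident_sets[OF refl])
      from measurable_compose[OF this x] show ?thesis by (simp add: case_prod_beta)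
    qed
    moreover have [measurable]: "\<rho> \<in> borel_measurable (restrict_space lborel {0..T})"
      using borel_measurable_continuous_on_restrict[OF cont]
      by (metis (no_types, lifting) measurable_cong_sets sets_lborel sets_restrict_space_cong)
    moreover have [measurable]: "(\<lambda>s. S_ext \<alpha> \<beta> \<nu> c (t j - s)) \<in> borel_measurable (restrict_space lborel {0..T})"
      using \<alpha> by (intro measurable_restrict_space1) measurable
    ultimately show "(\<lambda>(s, w). Y (t j) s w) \<in> borel_measurable (restrict_space lborel {0..T} \<Otimes>\<^sub>M M)"
      unfolding Yeq[OF j] case_prod_beta by measurable
    obtain K where K: "K \<ge> 0" "\<And>x. \<bar>x\<bar> \<le> T ==> \<bar>S_ext \<alpha> \<beta> \<nu> c x\<bar> \<le> K" using S_ext_bounded[OF \<alpha>] by metis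
    have "(\<integral>\<^sup>+w. \<integral>\<^sup>+s. ennreal ((Y (t j) s w)^2) \<partial>restrict_space lborel {0..T} \<partial>M)
       \<le> (\<integral>\<^sup>+w. \<integral>\<^sup>+s. ennreal ((S_ext \<alpha> \<beta> \<nu> c (t j - s) * (indicator {0..T} s * x s w) * \<rho> s)^2) \<partial>lborel \<partial>M)"
      by (auto intro!: nn_integral_mono simp: nn_integral_restrict_space Yeq[OF j] indicator_def)
    also have "\<dots> \<le> ennreal (wt\<^sup>2) * (\<integral>\<^sup>+s. ennreal ((S_ext \<alpha> \<beta> \<nu> c (t j - s))^2) * E2 M (\<lambda>w. indicator {0..T} s * x s w) \<partial>lborel)"
      by (intro weighted_square_Fubini[OF M x _ _ \<rho>]) (use \<alpha> in measurable, auto)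
    also have "\<dots> \<le> ennreal (wt\<^sup>2) * (\<integral>\<^sup>+s. ennreal (K\<^sup>2) * ennreal C * indicator {0..T} s \<partial>lborel)"
    proof (intro mult_left_mono nn_integral_mono)
      fix s
      show "ennreal ((S_ext \<alpha> \<beta> \<nu> c (t j - s))^2) * E2 M (\<lambda>w. indicator {0..T} s * x s w) \<le> ennreal (K\<^sup>2) * ennreal C * indicator {0..T} s"
      proof (cases "s \<in> {0..T}")
        case True
        then have "\<bar>S_ext \<alpha> \<beta> \<nu> c (t j - s)\<bar> \<le> K" using t[OF j] by (intro K) auto
        then have "ennreal ((S_ext \<alpha> \<beta> \<nu> c (t j - s))^2) \<le> ennreal (K\<^sup>2)"
          by (intro ennreal_leI) (metis abs_ge_zero power2_abs power_mono)
        then show ?thesis using bd[OF True] True by (simp add: mult_mono)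
      qed simp
    qed simp
    also have "\<dots> < \<infinity>"
      using T by (simp add: nn_integral_cmult ennreal_mult_less_top emeasure_lborel_Icc_eq)
    finally show "(\<integral>\<^sup>+w. \<integral>\<^sup>+s. ennreal ((Y (t j) s w)^2) \<partial>restrict_space lborel {0..T} \<partial>M) < \<infinity>" .
  qed
  then show "j < n ==> I (Y (t j)) \<in> borel_measurable M"
    using fbm by (auto simp: fbm_integral_def)
  have eq: "(\<Sum>j<n. d j * (indicator {0..T} s * Y (t j) s w))
     = (\<Sum>j<n. d j * S_ext \<alpha> \<beta> \<nu> c (t j - s)) * (indicator {0..T} s * x s w) * \<rho> s" for s w
    unfolding sum_distrib_right
    by (intro sum.cong refl) (auto simp: Yeq indicator_def)
  have "E2 M (\<lambda>w. \<Sum>j<n. d j * I (Y (t j)) w) \<le>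
    ennreal (2 * H * T powr (2 * H - 1)) * (\<integral>\<^sup>+w. \<integral>\<^sup>+s. ennreal ((\<Sum>j<n. d j * (indicator {0..T} s * Y (t j) s w))^2) \<partial>lborel \<partial>M)"
    by (rule fbm_combination_bound[OF M H T fbm]) (use process in auto)
  also have "\<dots> \<le> ennreal (2 * H * T powr (2 * H - 1)) * (ennreal (wt\<^sup>2) * (\<integral>\<^sup>+s. ennreal ((\<Sum>j<n. d j * S_ext \<alpha> \<beta> \<nu> c (t j - s))^2) * E2 M (\<lambda>w. indicator {0..T} s * x s w) \<partial>lborel))"
    unfolding eq
    by (intro mult_left_mono weighted_square_Fubini[OF M x _ _ \<rho>])
       (use \<alpha> in measurable, auto)
  finally show "E2 M (\<lambda>w. \<Sum>j<n. d j * I (Y (t j)) w) \<le>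
     ennreal (wt\<^sup>2) * (ennreal (2 * H * T powr (2 * H - 1)) * (\<integral>\<^sup>+s. ennreal ((\<Sum>j<n. d j * S_ext \<alpha> \<beta> \<nu> c (t j - s))^2) * E2 M (\<lambda>w. indicator {0..T} s * x s w) \<partial>lborel))"
    by (simp add: mult.left_commute)
qed

text \<open>The pathwise integrals exist only for almost every \<open>w\<close>, namely when the forcing is square integrable in
time; for these, Cauchy--Schwarz on \<open>[0,T]\<close> applies.\<close>

lemma drift_term_bound:
  fixes x :: "real => 'w => real" and d t :: "nat => real" and \<alpha> \<beta> \<nu> c :: real
  assumes M: "prob_space M" and T: "T > 0" and \<alpha>: "\<alpha> > 1"
    and x: "(\<lambda>(s, w). indicator {0..T} s * x s w) \<in> borel_measurable (lborel \<Otimes>\<^sub>M M)"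
    and bd: "\<And>s. s \<in> {0..T} ==> E2 M (\<lambda>w. indicator {0..T} s * x s w) \<le> ennreal C"
    and t: "\<And>j. j < n ==> t j \<in> {0..T}"
  defines "z \<equiv> (\<lambda>t w. LINT s:{0..t}|lborel. S_kernel \<alpha> \<beta> \<nu> c (t - s) * x s w)"
  shows "j < n ==> z (t j) \<in> borel_measurable M"
    and "E2 M (\<lambda>w. \<Sum>j<n. d j * z (t j) w) \<le>
     ennreal T * (\<integral>\<^sup>+s. ennreal ((\<Sum>j<n. d j * S_ext \<alpha> \<beta> \<nu> c (t j - s))^2) * E2 M (\<lambda>w. indicator {0..T} s * x s w) \<partial>lborel)"
proof -
  interpret prob_space M by fact
  interpret pair_sigma_finite lborel M ..
  define y where "y s w = indicator {0..T} s * x s w" for s w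
  have y[measurable]: "(\<lambda>(s, w). y s w) \<in> borel_measurable (lborel \<Otimes>\<^sub>M M)" using x by (simp add: y_def)
  have zeq: "z (t j) w = (LBINT s. S_ext \<alpha> \<beta> \<nu> c (t j - s) * y s w)" if "j < n" for j w
    unfolding z_def set_lebesgue_integral_def y_def
    by (intro Bochner_Integration.integral_cong refl)
       (use kernel_indicator[OF t[OF that], where k = 1] in simp)
  have yp: "(\<lambda>p. y (snd p) (fst p)) \<in> borel_measurable (M \<Otimes>\<^sub>M lborel)"
    using measurable_pair_swap[OF y] by (simp add: case_prod_beta)
  have Sm[measurable]: "(\<lambda>s. S_ext \<alpha> \<beta> \<nu> c (r - s)) \<in> borel_measurable borel" for r
    using \<alpha> by measurable
  have "(\<lambda>w. LBINT s. S_ext \<alpha> \<beta> \<nu> c (t j - s) * y s w) \<in> borel_measurable M" for j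
    by (rule lborel.borel_measurable_lebesgue_integral) (use yp in \<open>simp add: case_prod_beta, measurable\<close>)
  then show "z (t j) \<in> borel_measurable M" if "j < n" for j
    using zeq[OF that] by presburger
  obtain K where K: "K \<ge> 0" "\<And>x. \<bar>x\<bar> \<le> T ==> \<bar>S_ext \<alpha> \<beta> \<nu> c x\<bar> \<le> K" using S_ext_bounded[OF \<alpha>] by metis
  have yM[measurable]: "y s \<in> borel_measurable M" and yL[measurable]: "w \<in> space M ==> (\<lambda>s. y s w) \<in> borel_measurable lborel" for s w
    using measurable_Pair2[OF y, of s] measurable_Pair1[OF y, of w] by (simp_all add: case_prod_beta)
  have "(\<integral>\<^sup>+w. \<integral>\<^sup>+s. ennreal ((y s w)^2) \<partial>lborel \<partial>M) = (\<integral>\<^sup>+s. E2 M (y s) \<partial>lborel)"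
    by (rule Fubini') (use y in \<open>simp add: case_prod_beta\<close>)
  also have "\<dots> \<le> (\<integral>\<^sup>+s. ennreal C * indicator {0..T} s \<partial>lborel)"
    using bd by (intro nn_integral_mono) (auto simp: y_def indicator_def)
  also have "\<dots> < \<infinity>" using T by (simp add: nn_integral_cmult ennreal_mult_less_top emeasure_lborel_Icc_eq)
  finally have "AE w in M. (\<integral>\<^sup>+s. ennreal ((y s w)^2) \<partial>lborel) \<noteq> \<infinity>"
    by (intro nn_integral_PInf_AE) (use yp in \<open>simp_all add: case_prod_beta\<close>)
  then have AE: "AE w in M. ennreal ((\<Sum>j<n. d j * z (t j) w)^2) \<le> ennreal T * (\<integral>\<^sup>+s. ennreal (((\<Sum>j<n. d j * S_ext \<alpha> \<beta> \<nu> c (t j - s)) * y s w * 1)^2) \<partial>lborel)"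
    using AE_space
  proof eventually_elim
    fix w assume fin: "(\<integral>\<^sup>+s. ennreal ((y s w)^2) \<partial>lborel) \<noteq> \<infinity>" and w: "w \<in> space M"
    note [measurable] = yL[OF w]
    have sq: "integrable lborel (\<lambda>s. (y s w)^2)"
      using fin by (intro integrableI_bounded) (auto simp: less_top)
    have ind: "integrable lborel (indicat_real {0..T})"
      by (rule integrable_real_indicator) (auto simp: emeasure_lborel_Icc_eq)
    have int: "integrable lborel (\<lambda>s. S_ext \<alpha> \<beta> \<nu> c (t j - s) * y s w)" if j: "j < n" for j
    proof (rule Bochner_Integration.integrable_bound)
      show "integrable lborel (\<lambda>s. K * (indicator {0..T} s + (y s w)^2))" using sq ind by simp
      show "(\<lambda>s. S_ext \<alpha> \<beta> \<nu> c (t j - s) * y s w) \<in> borel_measurable lborel" using \<alpha> by measurable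
      show "AE s in lborel. norm (S_ext \<alpha> \<beta> \<nu> c (t j - s) * y s w) \<le> norm (K * (indicator {0..T} s + (y s w)^2))"
      proof (intro AE_I2)
        fix s
        show "norm (S_ext \<alpha> \<beta> \<nu> c (t j - s) * y s w) \<le> norm (K * (indicator {0..T} s + (y s w)^2))"
        proof (cases "s \<in> {0..T}")
          case True
          have "0 \<le> (\<bar>y s w\<bar> - 1)^2" by simp
          then have "2 * \<bar>y s w\<bar> \<le> 1 + (y s w)^2" by (simp add: power2_eq_square algebra_simps)
          then have "\<bar>y s w\<bar> \<le> 1 + (y s w)^2" by linarith
          moreover have "\<bar>S_ext \<alpha> \<beta> \<nu> c (t j - s)\<bar> \<le> K" using t[OF j] True by (intro K) auto
          ultimately have "\<bar>S_ext \<alpha> \<beta> \<nu> c (t j - s)\<bar> * \<bar>y s w\<bar> \<le> K * (1 + (y s w)^2)" using K(1) by (intro mult_mono) auto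
          then show ?thesis using True K(1) by (simp add: abs_mult)
        qed (simp add: y_def)
      qed
    qed
    have "(\<Sum>j<n. d j * z (t j) w) = (\<Sum>j<n. d j * (LBINT s. S_ext \<alpha> \<beta> \<nu> c (t j - s) * y s w))"
      by (intro sum.cong refl) (simp add: zeq)
    also have "\<dots> = (LBINT s. (\<Sum>j<n. d j * (S_ext \<alpha> \<beta> \<nu> c (t j - s) * y s w)))"
      using int by simp
    also have "(\<lambda>s. \<Sum>j<n. d j * (S_ext \<alpha> \<beta> \<nu> c (t j - s) * y s w)) = (\<lambda>s. (\<Sum>j<n. d j * S_ext \<alpha> \<beta> \<nu> c (t j - s)) * y s w * 1)"
      by (simp add: sum_distrib_right mult.assoc)
    finally have e: "(\<Sum>j<n. d j * z (t j) w) = (LBINT s. (\<Sum>j<n. d j * S_ext \<alpha> \<beta> \<nu> c (t j - s)) * y s w * 1)" .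
    show "ennreal ((\<Sum>j<n. d j * z (t j) w)^2) \<le> ennreal T * (\<integral>\<^sup>+s. ennreal (((\<Sum>j<n. d j * S_ext \<alpha> \<beta> \<nu> c (t j - s)) * y s w * 1)^2) \<partial>lborel)"
      unfolding e by (rule integral_square_le[OF T]) (use \<alpha> in measurable, auto simp: y_def)
  qed
  have "E2 M (\<lambda>w. \<Sum>j<n. d j * z (t j) w) \<le> (\<integral>\<^sup>+w. ennreal T * (\<integral>\<^sup>+s. ennreal (((\<Sum>j<n. d j * S_ext \<alpha> \<beta> \<nu> c (t j - s)) * y s w * 1)^2) \<partial>lborel) \<partial>M)"
    by (rule nn_integral_mono_AE[OF AE])
  also have "\<dots> = ennreal T * (\<integral>\<^sup>+w. \<integral>\<^sup>+s. ennreal (((\<Sum>j<n. d j * S_ext \<alpha> \<beta> \<nu> c (t j - s)) * y s w * 1)^2) \<partial>lborel \<partial>M)"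
    by (rule nn_integral_cmult, rule lborel.borel_measurable_nn_integral) (use yp in \<open>simp add: case_prod_beta, measurable\<close>)
  also have "\<dots> \<le> ennreal T * (ennreal (1\<^sup>2) * (\<integral>\<^sup>+s. ennreal ((\<Sum>j<n. d j * S_ext \<alpha> \<beta> \<nu> c (t j - s))^2) * E2 M (y s) \<partial>lborel))"
    by (intro mult_left_mono weighted_square_Fubini[OF M y, where T = T]) (use \<alpha> in measurable, auto simp: y_def)
  finally show "E2 M (\<lambda>w. \<Sum>j<n. d j * z (t j) w) \<le>
     ennreal T * (\<integral>\<^sup>+s. ennreal ((\<Sum>j<n. d j * S_ext \<alpha> \<beta> \<nu> c (t j - s))^2) * E2 M (\<lambda>w. indicator {0..T} s * x s w) \<partial>lborel)"
    by (simp add: y_def)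
qed

context dirichlet_basis
begin

lemma Hs_norm2_0_coef: "ennreal ((coef v k)^2) \<le> Hs_norm2 D lam \<phi> 0 v"
proof -
  have "ennreal (lam k powr 0 * (coef v k)^2) \<le> Hs_norm2 D lam \<phi> 0 v"
    unfolding Hs_norm2_def by (rule ennreal_term_le_suminf)
  then show ?thesis using lam_pos'[of k] by simp
qed

lemma random_Hs_coef: "random_Hs D lam \<phi> M s X ==> (\<lambda>w. coef (X w) k) \<in> borel_measurable M"
  using phi_L2 by (auto simp: random_Hs_def)

lemma second_moment_coef:
  assumes [measurable]: "\<And>k. (\<lambda>w. coef (X w) k) \<in> borel_measurable M"
  shows "second_moment D lam \<phi> M s X = (\<Sum>k. ennreal (lam k powr s) * E2 M (\<lambda>w. coef (X w) k))"
  by (simp add: second_moment_def Hs_norm2_def nn_integral_suminf nn_integral_cmult ennreal_mult)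

text \<open>The unconditional convergence of the double series is used along the squares \<open>{..<n} \<times> {..<n}\<close>: as soon
as \<open>n > k\<close>, the \<open>k\<close>-th coefficient of the partial sum is the full partial sum over \<open>l\<close>.\<close>

lemma noise_sums_coef:
  assumes "noise_sums D lam \<phi> M J Z"
  shows "(\<lambda>n. E2 M (\<lambda>w. (\<Sum>l<n. J k l w) - coef (Z w) k)) \<longlonglongrightarrow> 0"
proof -
  define A where "A n = {..<n} \<times> {..<n}" for n :: nat
  have r: "random_Hs D lam \<phi> M 0 Z"
    and lim: "((\<lambda>A. second_moment D lam \<phi> M 0 (\<lambda>w x. (\<Sum>(k, l)\<in>A. J k l w * \<phi> k x) - Z w x)) \<longlongrightarrow> 0)
       (finite_subsets_at_top UNIV)"
    using assms by (auto simp: noise_sums_def)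
  have "filterlim A (finite_subsets_at_top UNIV) sequentially"
    unfolding filterlim_finite_subsets_at_top
  proof (intro allI impI)
    fix X :: "(nat \<times> nat) set" assume X: "finite X \<and> X \<subseteq> UNIV"
    define m where "m = Suc (Max (fst ` X \<union> snd ` X))"
    have "X \<subseteq> A n" if "n \<ge> m" for n
    proof
      fix p assume p: "p \<in> X"
      have "fst p \<le> Max (fst ` X \<union> snd ` X)" "snd p \<le> Max (fst ` X \<union> snd ` X)"
        using X p by (auto intro!: Max_ge)
      then show "p \<in> A n" using that by (auto simp: A_def m_def mem_Times_iff)
    qed
    then show "eventually (\<lambda>n. finite (A n) \<and> X \<subseteq> A n \<and> A n \<subseteq> UNIV) sequentially"
      by (auto simp: eventually_sequentially A_def)
  qed
  from filterlim_compose[OF lim this]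
  have l: "(\<lambda>n. second_moment D lam \<phi> M 0 (\<lambda>w x. (\<Sum>(k, l)\<in>A n. J k l w * \<phi> k x) - Z w x)) \<longlonglongrightarrow> 0" .
  have "E2 M (\<lambda>w. (\<Sum>l<n. J k l w) - coef (Z w) k)
      \<le> second_moment D lam \<phi> M 0 (\<lambda>w x. (\<Sum>(k, l)\<in>A n. J k l w * \<phi> k x) - Z w x)" if n: "n > k" for n
    unfolding second_moment_def
  proof (intro nn_integral_mono)
    fix w assume w: "w \<in> space M"
    have Z: "Z w \<in> L2 D" using r w Hs_zero by (auto simp: random_Hs_def)
    have eq: "(\<lambda>x. (\<Sum>(k, l)\<in>A n. J k l w * \<phi> k x) - Z w x) = (\<lambda>x. (\<Sum>i<n. (\<Sum>l<n. J i l w) * \<phi> i x) - Z w x)"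
      by (simp add: A_def sum.cartesian_product[symmetric] sum_distrib_right)
    have "coef (\<lambda>x. (\<Sum>(k, l)\<in>A n. J k l w * \<phi> k x) - Z w x) k = (\<Sum>l<n. J k l w) - coef (Z w) k"
      unfolding eq using n by (subst L2_inner_diff) (auto simp: coef_sum intro!: L2_sum Z phi_L2)
    then show "ennreal (((\<Sum>l<n. J k l w) - coef (Z w) k)^2) \<le> Hs_norm2 D lam \<phi> 0 (\<lambda>x. (\<Sum>(k, l)\<in>A n. J k l w * \<phi> k x) - Z w x)"
      using Hs_norm2_0_coef[of "\<lambda>x. (\<Sum>(k, l)\<in>A n. J k l w * \<phi> k x) - Z w x" k] by simp
  qed
  then have "eventually (\<lambda>n. E2 M (\<lambda>w. (\<Sum>l<n. J k l w) - coef (Z w) k)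
      \<le> second_moment D lam \<phi> M 0 (\<lambda>w x. (\<Sum>(k, l)\<in>A n. J k l w * \<phi> k x) - Z w x)) sequentially"
    using eventually_gt_at_top[of k] by (rule eventually_mono[rotated])
  then show ?thesis
    by (intro tendsto_sandwich[OF _ _ tendsto_const l]) auto
qed

lemma noise_combination_bound:
  fixes d :: "nat => real"
  assumes Z: "\<And>j. j < n ==> noise_sums D lam \<phi> M (J j) (Z j)"
    and J[measurable]: "\<And>j l. j < n ==> J j k l \<in> borel_measurable M"
    and wt: "\<And>l. wt l > 0" "summable wt"
    and q: "\<And>l. E2 M (\<lambda>w. \<Sum>j<n. d j * J j k l w) \<le> ennreal ((wt l)^2) * q l"
  shows "E2 M (\<lambda>w. \<Sum>j<n. d j * coef (Z j w) k) \<le> ennreal (2 * (suminf wt)^2) * (\<Sum>l. q l)"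
proof (rule l2_series_bound[OF _ _ wt _ q])
  have Nm[measurable]: "(\<lambda>w. coef (Z j w) k) \<in> borel_measurable M" if "j < n" for j
    using Z[OF that] by (auto simp: noise_sums_def intro: random_Hs_coef)
  show "(\<lambda>w. \<Sum>j<n. d j * J j k l w) \<in> borel_measurable M" for l
    by (intro borel_measurable_sum borel_measurable_times borel_measurable_const J) auto
  show "(\<lambda>w. \<Sum>j<n. d j * coef (Z j w) k) \<in> borel_measurable M"
    by (intro borel_measurable_sum borel_measurable_times borel_measurable_const Nm) auto
  have le: "E2 M (\<lambda>w. (\<Sum>l<m. \<Sum>j<n. d j * J j k l w) - (\<Sum>j<n. d j * coef (Z j w) k))
     \<le> (\<Sum>j<n. ennreal (real n * (d j)^2) * E2 M (\<lambda>w. (\<Sum>l<m. J j k l w) - coef (Z j w) k))" for m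
  proof -
    have "E2 M (\<lambda>w. (\<Sum>l<m. \<Sum>j<n. d j * J j k l w) - (\<Sum>j<n. d j * coef (Z j w) k))
      \<le> (\<integral>\<^sup>+w. (\<Sum>j<n. ennreal (real n * (d j)^2) * ennreal (((\<Sum>l<m. J j k l w) - coef (Z j w) k)^2)) \<partial>M)"
    proof (intro nn_integral_mono)
      fix w
      have "(\<Sum>l<m. \<Sum>j<n. d j * J j k l w) = (\<Sum>j<n. d j * (\<Sum>l<m. J j k l w))"
        by (subst sum.swap) (simp add: sum_distrib_left)
      then have "((\<Sum>l<m. \<Sum>j<n. d j * J j k l w) - (\<Sum>j<n. d j * coef (Z j w) k))^2
        = (\<Sum>j<n. d j * ((\<Sum>l<m. J j k l w) - coef (Z j w) k))^2"
        by (simp add: right_diff_distrib sum_subtractf)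
      also have "\<dots> \<le> real n * (\<Sum>j<n. (d j * ((\<Sum>l<m. J j k l w) - coef (Z j w) k))^2)"
        using sum_square_card[of "{..<n}" "\<lambda>j. d j * ((\<Sum>l<m. J j k l w) - coef (Z j w) k)"] by simp
      also have "\<dots> = (\<Sum>j<n. real n * (d j)^2 * ((\<Sum>l<m. J j k l w) - coef (Z j w) k)^2)"
        by (simp add: sum_distrib_left power_mult_distrib mult.assoc)
      finally have "ennreal (((\<Sum>l<m. \<Sum>j<n. d j * J j k l w) - (\<Sum>j<n. d j * coef (Z j w) k))^2)
         \<le> ennreal (\<Sum>j<n. real n * (d j)^2 * ((\<Sum>l<m. J j k l w) - coef (Z j w) k)^2)" by (rule ennreal_leI)
      also have "\<dots> = (\<Sum>j<n. ennreal (real n * (d j)^2) * ennreal (((\<Sum>l<m. J j k l w) - coef (Z j w) k)^2))"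
        by (subst sum_ennreal[symmetric]) (auto simp: ennreal_mult)
      finally show "ennreal (((\<Sum>l<m. \<Sum>j<n. d j * J j k l w) - (\<Sum>j<n. d j * coef (Z j w) k))^2) \<le> (\<Sum>j<n. ennreal (real n * (d j)^2) * ennreal (((\<Sum>l<m. J j k l w) - coef (Z j w) k)^2))" .
    qed
    also have "\<dots> = (\<Sum>j<n. ennreal (real n * (d j)^2) * E2 M (\<lambda>w. (\<Sum>l<m. J j k l w) - coef (Z j w) k))"
      by (subst nn_integral_sum) (auto intro!: sum.cong nn_integral_cmult)
    finally show ?thesis .
  qed
  have "(\<lambda>m. \<Sum>j<n. ennreal (real n * (d j)^2) * E2 M (\<lambda>w. (\<Sum>l<m. J j k l w) - coef (Z j w) k)) \<longlonglongrightarrow> (\<Sum>j<n. ennreal (real n * (d j)^2) * 0)"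
    by (intro tendsto_sum ennreal_tendsto_cmult noise_sums_coef Z) auto
  then have lim: "(\<lambda>m. \<Sum>j<n. ennreal (real n * (d j)^2) * E2 M (\<lambda>w. (\<Sum>l<m. J j k l w) - coef (Z j w) k)) \<longlonglongrightarrow> 0"
    by simp
  show "(\<lambda>m. E2 M (\<lambda>w. (\<Sum>l<m. \<Sum>j<n. d j * J j k l w) - (\<Sum>j<n. d j * coef (Z j w) k))) \<longlonglongrightarrow> 0"
    by (rule tendsto_0_of_le[OF le lim])
qed

end

section \<open>The memory part of a mild solution\<close>

lemma ennreal_le_divideI:
  assumes "ennreal c * X \<le> ennreal K" "K \<ge> 0" "c > 0"
  shows "X \<le> ennreal (K / c)"
proof -
  have "X = ennreal (1 / c) * (ennreal c * X)"
    using assms(3) by (simp add: mult.assoc[symmetric] ennreal_mult[symmetric])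
  also have "\<dots> \<le> ennreal (1 / c) * ennreal K" by (intro mult_left_mono assms) simp
  also have "\<dots> = ennreal (K / c)" using assms by (simp add: ennreal_mult[symmetric])
  finally show ?thesis .
qed

text \<open>The setting of the estimate after the two conditions on the coefficients have been unfolded. The weight
\<open>\<sigma>\<close> is the regularity of the forcing, \<open>wt\<close> dominates both sequences of noise amplitudes, and \<open>Cu\<close> bounds
the second moments of \<open>u\<close> over \<open>[0,T]\<close>.\<close>

locale mild_regularity = dirichlet_basis D lam \<phi> + prob_space M
  for D :: "'d::euclidean_space set" and lam :: "nat => real" and \<phi> :: "nat => 'd => real" and M :: "'w measure" +
  fixes F :: "real => 'w measure" and e :: "nat => 'u"
    and T \<alpha> \<beta> \<nu> H \<sigma> L Cu :: real
    and \<xi> B :: "nat => real => 'w => real" and I :: "nat => (real => 'w => real) => 'w => real"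
    and \<kappa> \<rho> :: "nat => real => real" and wt :: "nat => real"
    and \<Lambda> :: "('d => real) => ('d => real)"
    and f :: "real => ('d => real) => ('d => real)" and g h :: "real => ('d => real) => 'u => ('d => real)"
    and a b :: "'w => 'd => real" and u :: "real => 'w => 'd => real"
  assumes T: "T > 0" and \<alpha>: "3 / 2 < \<alpha>" "\<alpha> < 2" and \<beta>: "\<beta> > 0" and \<nu>: "\<nu> > 0"
    and H: "1 / 2 < H" "H < 1" and \<sigma>: "\<sigma> \<ge> 0" and Cu: "Cu \<ge> 0"
    and brownian: "\<And>l. wiener M F (\<xi> l)" and fbm: "\<And>l. fbm_integral M T H (B l) (I l)"
    and \<Lambda>: "weighted_norm \<sigma> \<Lambda>"
    and drift_admissible: "admissible \<sigma> \<Lambda> L (\<lambda>l t v. if l = 0 then f t v else (\<lambda>x. 0))"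
    and diffusion_admissible: "admissible \<sigma> \<Lambda> L (\<lambda>l t v. g t v (e l))" "admissible \<sigma> \<Lambda> L (\<lambda>l t v. h t v (e l))"
    and wt: "\<And>l. wt l > 0" "summable wt"
    and \<kappa>: "\<And>l s. s \<in> {0..T} ==> \<bar>\<kappa> l s\<bar> \<le> wt l" and \<rho>: "\<And>l s. s \<in> {0..T} ==> \<bar>\<rho> l s\<bar> \<le> wt l"
    and \<rho>_continuous: "\<And>l. continuous_on {0..T} (\<rho> l)"
    and u_Hs: "\<And>s w. s \<in> {0..T} ==> w \<in> space M ==> u s w \<in> Hs D lam \<phi> \<sigma>"
    and u_random: "\<And>s. s \<in> {0..T} ==> random_Hs D lam \<phi> M 0 (u s)"
    and u_moment: "\<And>s. s \<in> {0..T} ==> second_moment D lam \<phi> M \<sigma> (u s) \<le> ennreal Cu"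
    and a: "random_Hs D lam \<phi> M 0 a" "second_moment D lam \<phi> M (\<sigma> + 2 * \<beta> / \<alpha>) a < \<infinity>"
    and b: "random_Hs D lam \<phi> M 0 b" "second_moment D lam \<phi> M \<sigma> b < \<infinity>"
    and mild: "mild_solution D lam \<phi> e M F T \<xi> I \<kappa> \<rho> \<alpha> \<beta> \<nu> f g h a b u"
begin

abbreviation "drift \<equiv> (\<lambda>(l::nat) t v. if l = 0 then f t v else (\<lambda>x. 0))"
abbreviation "diffusion \<equiv> (\<lambda>(l::nat) t v. g t v (e l))"
abbreviation "fractional_diffusion \<equiv> (\<lambda>(l::nat) t v. h t v (e l))"

lemma \<alpha>1: "\<alpha> > 1" using \<alpha> by simp

definition forcing :: "(nat => real => ('d => real) => 'd => real) => nat => nat => real => 'w => real" where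
  "forcing \<Phi> k l s w = indicator {0..T} s * coef (\<Phi> l s (u s w)) k"

definition density :: "(nat => real => ('d => real) => 'd => real) => nat => real => ennreal" where
  "density \<Phi> k s = (\<Sum>l. E2 M (forcing \<Phi> k l s))"

lemma forcing_measurable:
  assumes "admissible \<sigma> \<Lambda> L \<Phi>"
  shows "(\<lambda>(s, w). forcing \<Phi> k l s w) \<in> borel_measurable (lborel \<Otimes>\<^sub>M M)"
proof -
  have "(\<lambda>(s, w). coef (u s w) k) \<in> borel_measurable (restrict_space lborel {0..T} \<Otimes>\<^sub>M M)" for k
    using mild phi_L2 by (auto simp: mild_solution_def)
  then have "(\<lambda>(s, w). coef (\<Phi> l s (u s w)) k) \<in> borel_measurable (restrict_space lborel {0..T} \<Otimes>\<^sub>M M)"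
    by (intro admissible_measurable[OF \<Lambda> assms u_Hs])
  then show ?thesis unfolding forcing_def by (rule measurable_restrict_pair) simp
qed

lemma forcing_measurable_section:
  assumes "admissible \<sigma> \<Lambda> L \<Phi>"
  shows "forcing \<Phi> k l s \<in> borel_measurable M"
  using measurable_Pair2[OF forcing_measurable[OF assms, of k l], of s] by simp

lemma forcing_moment_measurable:
  assumes "admissible \<sigma> \<Lambda> L \<Phi>"
  shows "(\<lambda>s. E2 M (forcing \<Phi> k l s)) \<in> borel_measurable lborel"
  by (rule borel_measurable_nn_integral) (use forcing_measurable[OF assms, of k l] in \<open>simp add: case_prod_beta\<close>)

lemma density_measurable:
  assumes "admissible \<sigma> \<Lambda> L \<Phi>"
  shows "density \<Phi> k \<in> borel_measurable lborel"
  unfolding density_def using forcing_moment_measurable[OF assms] by measurable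

definition "force_bound = L\<^sup>2 * (2 + 2 * Cu)"

lemma force_bound_nonneg: "0 \<le> force_bound"
  using Cu by (simp add: force_bound_def)

lemma density_bound:
  assumes A: "admissible \<sigma> \<Lambda> L \<Phi>"
  shows "(\<Sum>k. ennreal (lam k powr \<sigma>) * density \<Phi> k s) \<le> ennreal force_bound"
proof (cases "s \<in> {0..T}")
  case False
  then show ?thesis by (simp add: density_def forcing_def)
next
  case True
  note [measurable] = forcing_measurable_section[OF A]
  have L0: "L \<ge> 0" using A by (simp add: admissible_def)
  have "(\<Sum>k. ennreal (lam k powr \<sigma>) * density \<Phi> k s) = (\<Sum>k. \<Sum>l. ennreal (lam k powr \<sigma>) * E2 M (forcing \<Phi> k l s))"
    by (simp add: density_def)
  also have "\<dots> = (\<Sum>l. \<Sum>k. ennreal (lam k powr \<sigma>) * E2 M (forcing \<Phi> k l s))"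
    by (rule ennreal_suminf_swap)
  also have "\<dots> = (\<Sum>l. \<Sum>k. \<integral>\<^sup>+w. ennreal (lam k powr \<sigma> * (forcing \<Phi> k l s w)^2) \<partial>M)"
    by (simp add: nn_integral_cmult ennreal_mult)
  also have "\<dots> = (\<integral>\<^sup>+w. (\<Sum>l. \<Sum>k. ennreal (lam k powr \<sigma> * (forcing \<Phi> k l s w)^2)) \<partial>M)"
    by (simp add: nn_integral_suminf)
  also have "\<dots> \<le> (\<integral>\<^sup>+w. ennreal (2 * L\<^sup>2) * (1 + Hs_norm2 D lam \<phi> \<sigma> (u s w)) \<partial>M)"
  proof (intro nn_integral_mono)
    fix w assume w: "w \<in> space M"
    note uH = u_Hs[OF True w]
    define n where "n = L2_norm D (\<Lambda> (u s w))"
    have sums: "(\<lambda>k. lam k powr \<sigma> * (coef (u s w) k)^2) sums n\<^sup>2"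
      using \<Lambda> uH by (simp add: weighted_norm_def n_def)
    have nH: "Hs_norm2 D lam \<phi> \<sigma> (u s w) = ennreal (n\<^sup>2)"
      unfolding Hs_norm2_def using sums by (intro sums_unique[symmetric]) (subst sums_ennreal, auto)
    have "(\<Sum>l. \<Sum>k. ennreal (lam k powr \<sigma> * (forcing \<Phi> k l s w)^2)) = (\<Sum>l. \<Sum>k. ennreal (lam k powr \<sigma> * (coef (\<Phi> l s (u s w)) k)^2))"
      using True by (simp add: forcing_def)
    also have "\<dots> \<le> ennreal ((L * (1 + n))^2)" using A uH by (simp add: admissible_def n_def)
    also have "\<dots> \<le> ennreal (2 * L\<^sup>2 * (1 + n\<^sup>2))"
    proof (rule ennreal_leI)
      have "(1 + n)^2 \<le> 2 * (1 + n\<^sup>2)" using square_diff2[of 1 "- n"] by simp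
      then have "L\<^sup>2 * (1 + n)^2 \<le> L\<^sup>2 * (2 * (1 + n\<^sup>2))" by (intro mult_left_mono) auto
      moreover have "2 * L\<^sup>2 * (1 + n\<^sup>2) = L\<^sup>2 * (2 * (1 + n\<^sup>2))" by simp
      ultimately show "(L * (1 + n))^2 \<le> 2 * L\<^sup>2 * (1 + n\<^sup>2)" by (simp only: power_mult_distrib)
    qed
    also have "\<dots> = ennreal (2 * L\<^sup>2) * (1 + Hs_norm2 D lam \<phi> \<sigma> (u s w))"
      unfolding nH by (subst ennreal_mult) (auto simp: ennreal_plus)
    finally show "(\<Sum>l. \<Sum>k. ennreal (lam k powr \<sigma> * (forcing \<Phi> k l s w)^2)) \<le> ennreal (2 * L\<^sup>2) * (1 + Hs_norm2 D lam \<phi> \<sigma> (u s w))" .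
  qed
  also have "\<dots> = ennreal (2 * L\<^sup>2) * (1 + second_moment D lam \<phi> M \<sigma> (u s))"
  proof -
    note [measurable] = random_Hs_coef[OF u_random[OF True]]
    have [measurable]: "(\<lambda>w. Hs_norm2 D lam \<phi> \<sigma> (u s w)) \<in> borel_measurable M"
      unfolding Hs_norm2_def by measurable
    show ?thesis by (simp add: nn_integral_cmult nn_integral_add second_moment_def emeasure_space_1)
  qed
  also have "\<dots> \<le> ennreal (2 * L\<^sup>2) * (1 + ennreal Cu)"
    by (intro mult_left_mono add_left_mono u_moment True) simp
  also have "\<dots> = ennreal force_bound"
    using Cu by (simp add: force_bound_def ennreal_mult[symmetric] ennreal_plus[symmetric] algebra_simps flip: ennreal_1 del: ennreal_plus)
  finally show ?thesis .
qed

lemma forcing_le_density: "E2 M (forcing \<Phi> k l s) \<le> density \<Phi> k s"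
  unfolding density_def by (rule ennreal_term_le_suminf)

lemma forcing_bound:
  assumes A: "admissible \<sigma> \<Lambda> L \<Phi>"
  shows "E2 M (forcing \<Phi> k l s) \<le> ennreal (force_bound / lam k powr \<sigma>)"
proof -
  have p: "lam k powr \<sigma> > 0" using lam_pos'[of k] by simp
  have "ennreal (lam k powr \<sigma>) * E2 M (forcing \<Phi> k l s) \<le> ennreal (lam k powr \<sigma>) * density \<Phi> k s"
    by (intro mult_left_mono forcing_le_density) simp
  also have "\<dots> \<le> ennreal force_bound"
    by (rule order_trans[OF ennreal_term_le_suminf density_bound[OF A]])
  finally have *: "ennreal (lam k powr \<sigma>) * E2 M (forcing \<Phi> k l s) \<le> ennreal force_bound" .
  show ?thesis by (rule ennreal_le_divideI[OF * force_bound_nonneg p])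
qed

text \<open>What remains of \<open>u\<^sub>k(t)\<close> after the contribution of the initial data has been removed.\<close>

definition memory :: "nat => real => 'w => real" where
  "memory k t w = coef (u t w) k - T_kernel \<alpha> \<beta> \<nu> (lam k) t * coef (a w) k - R_kernel \<alpha> \<beta> \<nu> (lam k) t * coef (b w) k"

lemma coef_u_measurable: "t \<in> {0..T} ==> (\<lambda>w. coef (u t w) k) \<in> borel_measurable M"
  using u_random by (rule random_Hs_coef)

lemma coef_a_measurable: "(\<lambda>w. coef (a w) k) \<in> borel_measurable M"
  and coef_b_measurable: "(\<lambda>w. coef (b w) k) \<in> borel_measurable M"
  by (rule random_Hs_coef[OF a(1)], rule random_Hs_coef[OF b(1)])

lemma memory_measurable: "t \<in> {0..T} ==> memory k t \<in> borel_measurable M"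
  unfolding memory_def by (intro borel_measurable_diff borel_measurable_times borel_measurable_const coef_u_measurable coef_a_measurable coef_b_measurable)

lemma memory_decomposition:
  assumes t: "t \<in> {0..T}"
  shows "\<exists>J Z Z'.
    (\<forall>k l. has_ito_integral M F (\<xi> l) t
       (\<lambda>s w. S_kernel \<alpha> \<beta> \<nu> (lam k) (t - s) * coef (diffusion l s (u s w)) k * \<kappa> l s) (J k l)) \<and>
    noise_sums D lam \<phi> M J Z \<and>
    noise_sums D lam \<phi> M (\<lambda>k l. I l (\<lambda>s w. indicator {0..t} s *
       (S_kernel \<alpha> \<beta> \<nu> (lam k) (t - s) * coef (fractional_diffusion l s (u s w)) k * \<rho> l s))) Z' \<and>
    (\<forall>k. AE w in M. memory k t w =
       (LINT s:{0..t}|lborel. S_kernel \<alpha> \<beta> \<nu> (lam k) (t - s) * coef (drift 0 s (u s w)) k) + coef (Z w) k + coef (Z' w) k)"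
proof -
  obtain p q z J J' Z Z' where
    AE: "AE w in M.
           L2_sums D \<phi> (\<lambda>k. T_kernel \<alpha> \<beta> \<nu> (lam k) t * L2_inner D (a w) (\<phi> k)) (p w) \<and>
           L2_sums D \<phi> (\<lambda>k. R_kernel \<alpha> \<beta> \<nu> (lam k) t * L2_inner D (b w) (\<phi> k)) (q w) \<and>
           L2_sums D \<phi> (\<lambda>k. LINT s:{0..t}|lborel.
             S_kernel \<alpha> \<beta> \<nu> (lam k) (t - s) * L2_inner D (f s (u s w)) (\<phi> k)) (z w)"
    and J: "\<forall>k l. has_ito_integral M F (\<xi> l) t
           (\<lambda>s w. S_kernel \<alpha> \<beta> \<nu> (lam k) (t - s) * L2_inner D (g s (u s w) (e l)) (\<phi> k) * \<kappa> l s)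
           (J k l)" "noise_sums D lam \<phi> M J Z"
    and J': "\<forall>k l. J' k l = I l (\<lambda>s w. indicator {0..t} s *
           (S_kernel \<alpha> \<beta> \<nu> (lam k) (t - s) * L2_inner D (h s (u s w) (e l)) (\<phi> k) * \<rho> l s))"
        "noise_sums D lam \<phi> M J' Z'"
    and eq: "AE w in M. L2_eq D (u t w) (\<lambda>x. p w x + q w x + z w x + Z w x + Z' w x)"
    using mild[unfolded mild_solution_def, THEN conjunct2, THEN conjunct2, rule_format, OF t] by (elim exE conjE) blast
  have J'eq: "J' = (\<lambda>k l. I l (\<lambda>s w. indicator {0..t} s *
           (S_kernel \<alpha> \<beta> \<nu> (lam k) (t - s) * L2_inner D (h s (u s w) (e l)) (\<phi> k) * \<rho> l s)))"
    using J'(1) by (intro ext) simp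
  have ZL: "Z w \<in> L2 D" "Z' w \<in> L2 D" if "w \<in> space M" for w
    using J(2) J'(2) that Hs_zero by (auto simp: noise_sums_def random_Hs_def)
  have "AE w in M. memory k t w =
       (LINT s:{0..t}|lborel. S_kernel \<alpha> \<beta> \<nu> (lam k) (t - s) * coef (drift 0 s (u s w)) k) + coef (Z w) k + coef (Z' w) k" for k
    using AE eq AE_space
  proof eventually_elim
    fix w
    assume s: "L2_sums D \<phi> (\<lambda>k. T_kernel \<alpha> \<beta> \<nu> (lam k) t * L2_inner D (a w) (\<phi> k)) (p w) \<and>
           L2_sums D \<phi> (\<lambda>k. R_kernel \<alpha> \<beta> \<nu> (lam k) t * L2_inner D (b w) (\<phi> k)) (q w) \<and>
           L2_sums D \<phi> (\<lambda>k. LINT s:{0..t}|lborel.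
             S_kernel \<alpha> \<beta> \<nu> (lam k) (t - s) * L2_inner D (f s (u s w)) (\<phi> k)) (z w)"
      and eq: "L2_eq D (u t w) (\<lambda>x. p w x + q w x + z w x + Z w x + Z' w x)" and w: "w \<in> space M"
    have pL: "p w \<in> L2 D" "q w \<in> L2 D" "z w \<in> L2 D" using s by (auto simp: L2_sums_def)
    note L = L2_add[OF pL(1,2)] L2_add[OF L2_add[OF pL(1,2)] pL(3)] L2_add[OF L2_add[OF L2_add[OF pL(1,2)] pL(3)] ZL(1)[OF w]]
    have uL: "u t w \<in> L2 D" using u_Hs[OF t w] by (rule Hs_L2)
    have "coef (u t w) k = coef (\<lambda>x. p w x + q w x + z w x + Z w x + Z' w x) k"
      unfolding L2_inner_def
    proof (rule integral_cong_AE)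
      show "AE x in N. u t w x * \<phi> k x = (p w x + q w x + z w x + Z w x + Z' w x) * \<phi> k x"
        using eq unfolding L2_eq_def by eventually_elim simp
    qed (intro borel_measurable_times L2_measurable uL phi_L2 L2_add[OF L(3) ZL(2)[OF w]])+
    also have "\<dots> = coef (p w) k + coef (q w) k + coef (z w) k + coef (Z w) k + coef (Z' w) k"
      using pL ZL[OF w] L phi_L2[of k] by (simp add: L2_inner_add)
    finally show "memory k t w =
       (LINT s:{0..t}|lborel. S_kernel \<alpha> \<beta> \<nu> (lam k) (t - s) * coef (drift 0 s (u s w)) k) + coef (Z w) k + coef (Z' w) k"
      using s[THEN conjunct1, THEN L2_sums_coef, of k] s[THEN conjunct2, THEN conjunct1, THEN L2_sums_coef, of k]
        s[THEN conjunct2, THEN conjunct2, THEN L2_sums_coef, of k] by (simp add: memory_def)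
  qed
  then show ?thesis using J J'(2) unfolding J'eq by blast
qed

definition total_density :: "nat => real => ennreal" where
  "total_density k s = density drift k s + density diffusion k s + density fractional_diffusion k s"

lemma total_density_measurable [measurable]: "total_density k \<in> borel_measurable lborel"
  unfolding total_density_def
  by (intro borel_measurable_add density_measurable drift_admissible diffusion_admissible)

lemma total_density_bound: "(\<Sum>k. ennreal (lam k powr \<sigma>) * total_density k s) \<le> ennreal (3 * force_bound)"
proof -
  have "(\<Sum>k. ennreal (lam k powr \<sigma>) * total_density k s) =
     (\<Sum>k. ennreal (lam k powr \<sigma>) * density drift k s) + (\<Sum>k. ennreal (lam k powr \<sigma>) * density diffusion k s)
     + (\<Sum>k. ennreal (lam k powr \<sigma>) * density fractional_diffusion k s)"
    by (simp add: total_density_def distrib_left suminf_add[symmetric])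
  also have "\<dots> \<le> ennreal force_bound + ennreal force_bound + ennreal force_bound"
    by (intro add_mono density_bound drift_admissible diffusion_admissible)
  also have "\<dots> = ennreal (3 * force_bound)" using force_bound_nonneg by (simp add: ennreal_plus[symmetric] del: ennreal_plus)
  finally show ?thesis .
qed

lemma total_density_outside: "s \<notin> {0..T} ==> total_density k s = 0"
  by (simp add: total_density_def density_def forcing_def)

definition "memory_const = 3 * (T + 2 * (suminf wt)^2 * (4 + 2 * H * T powr (2 * H - 1)))"

lemma memory_const_nonneg: "0 \<le> memory_const"
  using T H by (simp add: memory_const_def)

text \<open>The central estimate. All stochastic information enters the sequel through it; everything
that follows is analysis of the deterministic kernel on the right-hand side.\<close>

lemma memory_combination_bound:
  fixes d t :: "nat => real"
  assumes t: "\<And>j. j < n ==> t j \<in> {0..T}"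
  shows "E2 M (\<lambda>w. \<Sum>j<n. d j * memory k (t j) w)
     \<le> ennreal memory_const * (\<integral>\<^sup>+s. ennreal ((\<Sum>j<n. d j * S_ext \<alpha> \<beta> \<nu> (lam k) (t j - s))^2) * total_density k s \<partial>lborel)"
proof -
  define W where "W s = ennreal ((\<Sum>j<n. d j * S_ext \<alpha> \<beta> \<nu> (lam k) (t j - s))^2)" for s
  have [measurable]: "S_ext \<alpha> \<beta> \<nu> (lam k) \<in> borel_measurable borel" using \<alpha>1 by (rule S_ext_measurable)
  have Wm[measurable]: "W \<in> borel_measurable lborel" unfolding W_def by measurable
  define z where "z = (\<lambda>t w. LINT s:{0..t}|lborel. S_kernel \<alpha> \<beta> \<nu> (lam k) (t - s) * coef (drift 0 s (u s w)) k)"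
  define Y where "Y = (\<lambda>t k l. I l (\<lambda>s w. indicator {0..t} s *
       (S_kernel \<alpha> \<beta> \<nu> (lam k) (t - s) * coef (fractional_diffusion l s (u s w)) k * \<rho> l s)))"
  have "\<forall>j\<in>{..<n}. \<exists>P.
    (\<forall>k l. has_ito_integral M F (\<xi> l) (t j)
       (\<lambda>s w. S_kernel \<alpha> \<beta> \<nu> (lam k) (t j - s) * coef (diffusion l s (u s w)) k * \<kappa> l s) (fst P k l)) \<and>
    noise_sums D lam \<phi> M (fst P) (fst (snd P)) \<and> noise_sums D lam \<phi> M (Y (t j)) (snd (snd P)) \<and>
    (AE w in M. memory k (t j) w = z (t j) w + coef (fst (snd P) w) k + coef (snd (snd P) w) k)"
    using memory_decomposition[OF t] unfolding Y_def z_def by fastforce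
  from bchoice[OF this] obtain P where P:
    "\<And>j l. j < n ==> has_ito_integral M F (\<xi> l) (t j)
       (\<lambda>s w. S_kernel \<alpha> \<beta> \<nu> (lam k) (t j - s) * coef (diffusion l s (u s w)) k * \<kappa> l s) (fst (P j) k l)"
    "\<And>j. j < n ==> noise_sums D lam \<phi> M (fst (P j)) (fst (snd (P j)))"
    "\<And>j. j < n ==> noise_sums D lam \<phi> M (Y (t j)) (snd (snd (P j)))"
    "\<And>j. j < n ==> AE w in M. memory k (t j) w = z (t j) w + coef (fst (snd (P j)) w) k + coef (snd (snd (P j)) w) k"
    by auto
  define Z where "Z j w = coef (fst (snd (P j)) w) k" for j w
  define Z' where "Z' j w = coef (snd (snd (P j)) w) k" for j w
  have Zm: "Z j \<in> borel_measurable M" "Z' j \<in> borel_measurable M" if "j < n" for j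
    using P(2,3)[OF that] unfolding Z_def Z'_def by (auto simp: noise_sums_def intro: random_Hs_coef)
  define S where "S = 2 * (suminf wt)^2"
  have S0: "S \<ge> 0" by (simp add: S_def)
  define R where "R = 2 * H * T powr (2 * H - 1)"
  have R0: "R \<ge> 0" using H by (simp add: R_def)
  note fm = forcing_measurable[unfolded forcing_def] and fb = forcing_bound[unfolded forcing_def]
  have term_sum: "(\<Sum>l. c * (\<integral>\<^sup>+s. W s * E2 M (forcing \<Phi> k l s) \<partial>lborel)) = c * (\<integral>\<^sup>+s. W s * density \<Phi> k s \<partial>lborel)"
    if "admissible \<sigma> \<Lambda> L \<Phi>" for c \<Phi>
  proof -
    note [measurable] = forcing_moment_measurable[OF that]
    have "(\<Sum>l. \<integral>\<^sup>+s. W s * E2 M (forcing \<Phi> k l s) \<partial>lborel) = (\<integral>\<^sup>+s. W s * density \<Phi> k s \<partial>lborel)"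
      by (subst nn_integral_suminf[symmetric]) (auto simp: density_def)
    then show ?thesis by simp
  qed
  have z: "z (t j) \<in> borel_measurable M" if "j < n" for j
    unfolding z_def
    by (rule drift_term_bound(1)[OF prob_space_axioms T \<alpha>1 fm[OF drift_admissible, where k = k and l = 0] fb[OF drift_admissible, where k = k and l = 0] t that])
  have "E2 M (\<lambda>w. \<Sum>j<n. d j * z (t j) w) \<le> ennreal T * (\<integral>\<^sup>+s. W s * E2 M (forcing drift k 0 s) \<partial>lborel)"
    unfolding z_def W_def forcing_def
    by (rule drift_term_bound(2)[OF prob_space_axioms T \<alpha>1 fm[OF drift_admissible, where k = k and l = 0] fb[OF drift_admissible, where k = k and l = 0] t])
  also have "\<dots> \<le> ennreal T * (\<integral>\<^sup>+s. W s * density drift k s \<partial>lborel)"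
    by (intro mult_left_mono nn_integral_mono forcing_le_density) auto
  finally have zb: "E2 M (\<lambda>w. \<Sum>j<n. d j * z (t j) w) \<le> ennreal T * (\<integral>\<^sup>+s. W s * density drift k s \<partial>lborel)" .
  have "E2 M (\<lambda>w. \<Sum>j<n. d j * Z j w) \<le> ennreal S * (\<Sum>l. 4 * (\<integral>\<^sup>+s. W s * E2 M (forcing diffusion k l s) \<partial>lborel))"
    unfolding Z_def S_def
  proof (rule noise_combination_bound[OF P(2) _ wt])
    fix l
    show "fst (P j) k l \<in> borel_measurable M" if "j < n" for j using P(1)[OF that] by (auto simp: has_ito_integral_def)
    show "E2 M (\<lambda>w. \<Sum>j<n. d j * fst (P j) k l w) \<le> ennreal ((wt l)^2) * (4 * (\<integral>\<^sup>+s. W s * E2 M (forcing diffusion k l s) \<partial>lborel))"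
      unfolding W_def forcing_def
      by (rule ito_term_bound[OF brownian \<alpha>1 fm[OF diffusion_admissible(1)] \<kappa> t P(1)])
  qed
  then have Zb: "E2 M (\<lambda>w. \<Sum>j<n. d j * Z j w) \<le> ennreal S * (4 * (\<integral>\<^sup>+s. W s * density diffusion k s \<partial>lborel))"
    by (simp only: term_sum[OF diffusion_admissible(1)])
  have "E2 M (\<lambda>w. \<Sum>j<n. d j * Z' j w) \<le> ennreal S * (\<Sum>l. ennreal R * (\<integral>\<^sup>+s. W s * E2 M (forcing fractional_diffusion k l s) \<partial>lborel))"
    unfolding Z'_def S_def
  proof (rule noise_combination_bound[OF P(3) _ wt])
    fix l
    show "Y (t j) k l \<in> borel_measurable M" if "j < n" for j
      unfolding Y_def
      by (rule fbm_term_bound(1)[OF prob_space_axioms H T fbm \<alpha>1 fm[OF diffusion_admissible(2)] fb[OF diffusion_admissible(2)] \<rho>_continuous \<rho> t that])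
    show "E2 M (\<lambda>w. \<Sum>j<n. d j * Y (t j) k l w) \<le> ennreal ((wt l)^2) * (ennreal R * (\<integral>\<^sup>+s. W s * E2 M (forcing fractional_diffusion k l s) \<partial>lborel))"
      unfolding W_def forcing_def Y_def R_def
      by (rule fbm_term_bound(2)[OF prob_space_axioms H T fbm \<alpha>1 fm[OF diffusion_admissible(2)] fb[OF diffusion_admissible(2)] \<rho>_continuous \<rho> t])
  qed
  then have Zb': "E2 M (\<lambda>w. \<Sum>j<n. d j * Z' j w) \<le> ennreal S * (ennreal R * (\<integral>\<^sup>+s. W s * density fractional_diffusion k s \<partial>lborel))"
    by (simp only: term_sum[OF diffusion_admissible(2)])
  have AE: "AE w in M. \<forall>j\<in>{..<n}. memory k (t j) w = z (t j) w + Z j w + Z' j w"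
    using P(4) unfolding Z_def Z'_def by (intro AE_finite_allI) auto
  define C where "C = T + S * (4 + R)"
  have "E2 M (\<lambda>w. \<Sum>j<n. d j * memory k (t j) w)
    = E2 M (\<lambda>w. (\<Sum>j<n. d j * z (t j) w) + (\<Sum>j<n. d j * Z j w) + (\<Sum>j<n. d j * Z' j w))"
    by (rule nn_integral_cong_AE, use AE in eventually_elim) (simp add: distrib_left sum.distrib)
  also have "\<dots> \<le> 3 * (E2 M (\<lambda>w. \<Sum>j<n. d j * z (t j) w) + E2 M (\<lambda>w. \<Sum>j<n. d j * Z j w) + E2 M (\<lambda>w. \<Sum>j<n. d j * Z' j w))"
    by (rule E2_sum3; intro borel_measurable_sum borel_measurable_times borel_measurable_const) (auto intro: z Zm)
  also have "\<dots> \<le> 3 * (ennreal C * (\<integral>\<^sup>+s. W s * density drift k s \<partial>lborel) + ennreal C * (\<integral>\<^sup>+s. W s * density diffusion k s \<partial>lborel)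
      + ennreal C * (\<integral>\<^sup>+s. W s * density fractional_diffusion k s \<partial>lborel))"
  proof (intro mult_left_mono add_mono)
    have c: "T \<le> C" "S * 4 \<le> C" "S * R \<le> C" using T S0 R0 by (auto simp: C_def distrib_left)
    show "E2 M (\<lambda>w. \<Sum>j<n. d j * z (t j) w) \<le> ennreal C * (\<integral>\<^sup>+s. W s * density drift k s \<partial>lborel)"
      by (rule order_trans[OF zb]) (intro mult_right_mono ennreal_leI c, simp)
    show "E2 M (\<lambda>w. \<Sum>j<n. d j * Z j w) \<le> ennreal C * (\<integral>\<^sup>+s. W s * density diffusion k s \<partial>lborel)"
    proof (rule order_trans[OF Zb])
      have "ennreal S * 4 \<le> ennreal C" using ennreal_leI[OF c(2)] S0 by (simp add: ennreal_mult)
      then show "ennreal S * (4 * (\<integral>\<^sup>+s. W s * density diffusion k s \<partial>lborel)) \<le> ennreal C * (\<integral>\<^sup>+s. W s * density diffusion k s \<partial>lborel)"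
        unfolding mult.assoc[symmetric] by (rule mult_right_mono) simp
    qed
    show "E2 M (\<lambda>w. \<Sum>j<n. d j * Z' j w) \<le> ennreal C * (\<integral>\<^sup>+s. W s * density fractional_diffusion k s \<partial>lborel)"
    proof (rule order_trans[OF Zb'])
      have "ennreal S * ennreal R \<le> ennreal C" using ennreal_leI[OF c(3)] S0 R0 by (simp add: ennreal_mult)
      then show "ennreal S * (ennreal R * (\<integral>\<^sup>+s. W s * density fractional_diffusion k s \<partial>lborel)) \<le> ennreal C * (\<integral>\<^sup>+s. W s * density fractional_diffusion k s \<partial>lborel)"
        unfolding mult.assoc[symmetric] by (rule mult_right_mono) simp
    qed
  qed simp
  also have "\<dots> = ennreal (3 * C) * (\<integral>\<^sup>+s. W s * total_density k s \<partial>lborel)"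
  proof -
    note [measurable] = density_measurable[OF drift_admissible] density_measurable[OF diffusion_admissible(1)] density_measurable[OF diffusion_admissible(2)]
    have "(\<integral>\<^sup>+s. W s * total_density k s \<partial>lborel) = (\<integral>\<^sup>+s. W s * density drift k s \<partial>lborel) + (\<integral>\<^sup>+s. W s * density diffusion k s \<partial>lborel) + (\<integral>\<^sup>+s. W s * density fractional_diffusion k s \<partial>lborel)"
      unfolding total_density_def distrib_left by (subst nn_integral_add, measurable)+
    moreover have "C \<ge> 0" using T S0 R0 by (simp add: C_def)
    ultimately show ?thesis by (simp add: ennreal_mult distrib_left mult.assoc)
  qed
  finally show ?thesis unfolding W_def memory_const_def C_def S_def R_def .
qed

end

section \<open>Difference quotients of the memory part\<close>

lemma suminf_tendsto_0_dominated:
  fixes f :: "nat => nat => ennreal"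
  assumes "\<And>n k. f n k \<le> g k" "(\<Sum>k. g k) < \<infinity>" "\<And>k. (\<lambda>n. f n k) \<longlonglongrightarrow> 0"
  shows "(\<lambda>n. \<Sum>k. f n k) \<longlonglongrightarrow> 0"
proof -
  have "(\<lambda>n. \<integral>\<^sup>+k. f n k \<partial>count_space UNIV) \<longlonglongrightarrow> (\<integral>\<^sup>+k. 0 \<partial>count_space (UNIV :: nat set))"
    by (rule nn_integral_dominated_convergence[where w = g])
       (use assms in \<open>auto simp: nn_integral_count_space_nat\<close>)
  then show ?thesis by (simp add: nn_integral_count_space_nat)
qed

context mild_regularity
begin

text \<open>The weighted second moment: the square of the norm of \<open>L\<^sup>2(\<Omega>; \<^bold>H\<^sup>\<sigma>)\<close> in terms of coefficients.\<close>

definition wsm :: "(nat => 'w => real) => ennreal" where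
  "wsm q = (\<Sum>k. ennreal (lam k powr \<sigma>) * E2 M (q k))"

lemma wsm_triangle:
  assumes "\<And>k. X k \<in> borel_measurable M" "\<And>k. Y k \<in> borel_measurable M" "\<And>k. Z k \<in> borel_measurable M"
  shows "wsm (\<lambda>k w. X k w - Z k w) \<le> 2 * wsm (\<lambda>k w. X k w - Y k w) + 2 * wsm (\<lambda>k w. Y k w - Z k w)"
proof -
  have "wsm (\<lambda>k w. X k w - Z k w) \<le> (\<Sum>k. 2 * (ennreal (lam k powr \<sigma>) * E2 M (\<lambda>w. X k w - Y k w)) + 2 * (ennreal (lam k powr \<sigma>) * E2 M (\<lambda>w. Y k w - Z k w)))"
    unfolding wsm_def
  proof (intro suminf_le allI summableI)
    fix k
    have "ennreal (lam k powr \<sigma>) * E2 M (\<lambda>w. X k w - Z k w) \<le> ennreal (lam k powr \<sigma>) * (2 * E2 M (\<lambda>w. X k w - Y k w) + 2 * E2 M (\<lambda>w. Y k w - Z k w))"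
      by (intro mult_left_mono E2_triangle assms) simp
    then show "ennreal (lam k powr \<sigma>) * E2 M (\<lambda>w. X k w - Z k w) \<le> 2 * (ennreal (lam k powr \<sigma>) * E2 M (\<lambda>w. X k w - Y k w)) + 2 * (ennreal (lam k powr \<sigma>) * E2 M (\<lambda>w. Y k w - Z k w))"
      by (simp add: distrib_left mult.left_commute)
  qed
  also have "\<dots> = 2 * wsm (\<lambda>k w. X k w - Y k w) + 2 * wsm (\<lambda>k w. Y k w - Z k w)"
    by (simp add: wsm_def suminf_add[symmetric])
  finally show ?thesis .
qed

lemma wsm_sum3:
  assumes "\<And>k. X k \<in> borel_measurable M" "\<And>k. Y k \<in> borel_measurable M" "\<And>k. Z k \<in> borel_measurable M"
  shows "wsm (\<lambda>k w. X k w + Y k w + Z k w) \<le> 3 * (wsm X + wsm Y + wsm Z)"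
proof -
  have "wsm (\<lambda>k w. X k w + Y k w + Z k w) \<le> (\<Sum>k. 3 * (ennreal (lam k powr \<sigma>) * E2 M (X k) + ennreal (lam k powr \<sigma>) * E2 M (Y k) + ennreal (lam k powr \<sigma>) * E2 M (Z k)))"
    unfolding wsm_def
  proof (intro suminf_le allI summableI)
    fix k
    have "ennreal (lam k powr \<sigma>) * E2 M (\<lambda>w. X k w + Y k w + Z k w) \<le> ennreal (lam k powr \<sigma>) * (3 * (E2 M (X k) + E2 M (Y k) + E2 M (Z k)))"
      by (intro mult_left_mono E2_sum3 assms) simp
    then show "ennreal (lam k powr \<sigma>) * E2 M (\<lambda>w. X k w + Y k w + Z k w) \<le> 3 * (ennreal (lam k powr \<sigma>) * E2 M (X k) + ennreal (lam k powr \<sigma>) * E2 M (Y k) + ennreal (lam k powr \<sigma>) * E2 M (Z k))"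
      by (simp add: distrib_left mult.left_commute)
  qed
  also have "\<dots> = 3 * (wsm X + wsm Y + wsm Z)"
    by (simp add: wsm_def suminf_add[symmetric])
  finally show ?thesis .
qed

definition K :: real where
  "K = (SOME K. K \<ge> 0 \<and>
     (\<forall>c x y. x \<le> T \<longrightarrow> y \<le> T \<longrightarrow> \<bar>S_ext \<alpha> \<beta> \<nu> c x - S_ext \<alpha> \<beta> \<nu> c y\<bar> \<le> K * (\<bar>x - y\<bar> * max x y powr (\<alpha> - 2))) \<and>
     (\<forall>c\<ge>lam 0. \<forall>x\<in>{0..T}. \<forall>y\<in>{0..T}. \<bar>T_kernel \<alpha> \<beta> \<nu> c x - T_kernel \<alpha> \<beta> \<nu> c y\<bar> \<le> K * c powr (\<beta> / \<alpha>) * \<bar>x - y\<bar>) \<and>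
     (\<forall>c\<ge>lam 0. \<forall>x\<in>{0..T}. \<forall>y\<in>{0..T}. \<bar>R_kernel \<alpha> \<beta> \<nu> c x - R_kernel \<alpha> \<beta> \<nu> c y\<bar> \<le> K * \<bar>x - y\<bar>))"

lemma K: "K \<ge> 0"
  "x \<le> T ==> y \<le> T ==> \<bar>S_ext \<alpha> \<beta> \<nu> c x - S_ext \<alpha> \<beta> \<nu> c y\<bar> \<le> K * (\<bar>x - y\<bar> * max x y powr (\<alpha> - 2))"
  "lam 0 \<le> c ==> x \<in> {0..T} ==> y \<in> {0..T} ==> \<bar>T_kernel \<alpha> \<beta> \<nu> c x - T_kernel \<alpha> \<beta> \<nu> c y\<bar> \<le> K * c powr (\<beta> / \<alpha>) * \<bar>x - y\<bar>"
  "lam 0 \<le> c ==> x \<in> {0..T} ==> y \<in> {0..T} ==> \<bar>R_kernel \<alpha> \<beta> \<nu> c x - R_kernel \<alpha> \<beta> \<nu> c y\<bar> \<le> K * \<bar>x - y\<bar>"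
proof -
  have "\<exists>K\<ge>0.
     (\<forall>c x y. x \<le> T \<longrightarrow> y \<le> T \<longrightarrow> \<bar>S_ext \<alpha> \<beta> \<nu> c x - S_ext \<alpha> \<beta> \<nu> c y\<bar> \<le> K * (\<bar>x - y\<bar> * max x y powr (\<alpha> - 2))) \<and>
     (\<forall>c\<ge>lam 0. \<forall>x\<in>{0..T}. \<forall>y\<in>{0..T}. \<bar>T_kernel \<alpha> \<beta> \<nu> c x - T_kernel \<alpha> \<beta> \<nu> c y\<bar> \<le> K * c powr (\<beta> / \<alpha>) * \<bar>x - y\<bar>) \<and>
     (\<forall>c\<ge>lam 0. \<forall>x\<in>{0..T}. \<forall>y\<in>{0..T}. \<bar>R_kernel \<alpha> \<beta> \<nu> c x - R_kernel \<alpha> \<beta> \<nu> c y\<bar> \<le> K * \<bar>x - y\<bar>)"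
  proof (rule kernel_bounds[OF \<alpha>1 \<alpha>(2) \<nu> T \<beta> lam_pos], goal_cases)
    case (1 K)
    then show ?case by (intro exI[of _ K] conjI allI impI ballI) blast+
  qed
  from someI_ex[OF this, folded K_def] show "K \<ge> 0"
    "x \<le> T ==> y \<le> T ==> \<bar>S_ext \<alpha> \<beta> \<nu> c x - S_ext \<alpha> \<beta> \<nu> c y\<bar> \<le> K * (\<bar>x - y\<bar> * max x y powr (\<alpha> - 2))"
    "lam 0 \<le> c ==> x \<in> {0..T} ==> y \<in> {0..T} ==> \<bar>T_kernel \<alpha> \<beta> \<nu> c x - T_kernel \<alpha> \<beta> \<nu> c y\<bar> \<le> K * c powr (\<beta> / \<alpha>) * \<bar>x - y\<bar>"
    "lam 0 \<le> c ==> x \<in> {0..T} ==> y \<in> {0..T} ==> \<bar>R_kernel \<alpha> \<beta> \<nu> c x - R_kernel \<alpha> \<beta> \<nu> c y\<bar> \<le> K * \<bar>x - y\<bar>"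
    by blast+
qed

definition kernel_quotient :: "nat => real => real => real => real" where
  "kernel_quotient k t r s = (S_ext \<alpha> \<beta> \<nu> (lam k) (r - s) - S_ext \<alpha> \<beta> \<nu> (lam k) (t - s)) / (r - t)"

definition memory_quotient :: "nat => real => real => 'w => real" where
  "memory_quotient k t r w = (memory k r w - memory k t w) / (r - t)"

lemma kernel_quotient_measurable [measurable]: "kernel_quotient k t r \<in> borel_measurable borel"
proof -
  have [measurable]: "S_ext \<alpha> \<beta> \<nu> (lam k) \<in> borel_measurable borel" using \<alpha>1 by (rule S_ext_measurable)
  show ?thesis unfolding kernel_quotient_def by measurable
qed

lemma memory_quotient_measurable: "t \<in> {0..T} ==> r \<in> {0..T} ==> memory_quotient k t r \<in> borel_measurable M"
  unfolding memory_quotient_def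
  by (intro borel_measurable_divide borel_measurable_diff borel_measurable_const memory_measurable)

text \<open>The singularity sits at the later of the two times. The square of \<open>powr (\<alpha> - 2)\<close> is integrable there
because of \<open>2 * \<alpha> - 4 > - 1\<close>.\<close>

lemma kernel_quotient_square_bound:
  assumes "t \<in> {0..T}" "r \<in> {0..T}" "r \<noteq> t" "0 \<le> s"
  shows "(kernel_quotient k t r s)^2 \<le> K\<^sup>2 * (indicator {0..<max r t} s * (max r t - s) powr (2 * \<alpha> - 4))"
proof (cases "s < max r t")
  case False
  then show ?thesis by (simp add: kernel_quotient_def S_ext_def less_max_iff_disj)
next
  case True
  have "\<bar>S_ext \<alpha> \<beta> \<nu> (lam k) (r - s) - S_ext \<alpha> \<beta> \<nu> (lam k) (t - s)\<bar> \<le> K * (\<bar>(r - s) - (t - s)\<bar> * max (r - s) (t - s) powr (\<alpha> - 2))"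
    using assms by (intro K) auto
  moreover have "max (r - s) (t - s) = max r t - s" by (simp add: max_def)
  ultimately have "\<bar>S_ext \<alpha> \<beta> \<nu> (lam k) (r - s) - S_ext \<alpha> \<beta> \<nu> (lam k) (t - s)\<bar> \<le> (K * (max r t - s) powr (\<alpha> - 2)) * \<bar>r - t\<bar>"
    by (simp add: mult.commute mult.left_commute)
  then have "\<bar>kernel_quotient k t r s\<bar> \<le> K * (max r t - s) powr (\<alpha> - 2)"
    using assms(3) by (simp add: kernel_quotient_def abs_divide pos_divide_le_eq)
  then have "\<bar>kernel_quotient k t r s\<bar>\<^sup>2 \<le> (K * (max r t - s) powr (\<alpha> - 2))^2"
    by (rule power_mono) simp
  also have "\<dots> = K\<^sup>2 * (max r t - s) powr (2 * \<alpha> - 4)"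
    using True by (simp add: power_mult_distrib powr_power algebra_simps)
  finally show ?thesis using True assms(4) by simp
qed

lemma memory_quotient_diff_bound:
  assumes "t \<in> {0..T}" "x \<in> {0..T}" "y \<in> {0..T}"
  shows "E2 M (\<lambda>w. memory_quotient k t x w - memory_quotient k t y w)
    \<le> ennreal memory_const * (\<integral>\<^sup>+s. ennreal ((kernel_quotient k t x s - kernel_quotient k t y s)^2) * total_density k s \<partial>lborel)"
proof -
  \<comment> \<open>The difference of two quotients as a combination of four values of the memory part.\<close>
  define d where "d j = (if j = 0 then 1 / (x - t) else if j = 1 then - 1 / (x - t) else if j = 2 then - 1 / (y - t) else 1 / (y - t))" for j :: nat
  define p where "p j = (if j = 0 then x else if j = 1 then t else if j = 2 then y else t)" for j :: nat
  have s4: "(\<Sum>j<4. c j) = c 0 + c 1 + c 2 + c 3" for c :: "nat => real"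
    by (simp add: eval_nat_numeral)
  have "E2 M (\<lambda>w. \<Sum>j<4. d j * memory k (p j) w)
     \<le> ennreal memory_const * (\<integral>\<^sup>+s. ennreal ((\<Sum>j<4. d j * S_ext \<alpha> \<beta> \<nu> (lam k) (p j - s))^2) * total_density k s \<partial>lborel)"
    by (rule memory_combination_bound) (use assms in \<open>auto simp: p_def\<close>)
  moreover have "(\<Sum>j<4. d j * memory k (p j) w) = memory_quotient k t x w - memory_quotient k t y w" for w
    unfolding s4 by (simp add: d_def p_def memory_quotient_def diff_divide_distrib)
  moreover have "(\<Sum>j<4. d j * S_ext \<alpha> \<beta> \<nu> (lam k) (p j - s)) = kernel_quotient k t x s - kernel_quotient k t y s" for s
    unfolding s4 by (simp add: d_def p_def kernel_quotient_def diff_divide_distrib)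
  ultimately show ?thesis by simp
qed

lemma memory_quotient_self: "memory_quotient k t t w = 0" "kernel_quotient k t t s = 0"
  by (simp_all add: memory_quotient_def kernel_quotient_def)

lemma wsm_memory:
  assumes "\<And>k. E2 M (q k) \<le> ennreal memory_const * (\<integral>\<^sup>+s. \<Phi> k s * total_density k s \<partial>lborel)"
    and [measurable]: "\<And>k. \<Phi> k \<in> borel_measurable lborel"
  shows "wsm q \<le> ennreal memory_const * (\<integral>\<^sup>+s. (\<Sum>k. ennreal (lam k powr \<sigma>) * (\<Phi> k s * total_density k s)) \<partial>lborel)"
proof -
  have "wsm q \<le> (\<Sum>k. ennreal memory_const * (\<integral>\<^sup>+s. ennreal (lam k powr \<sigma>) * (\<Phi> k s * total_density k s) \<partial>lborel))"
    unfolding wsm_def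
  proof (intro suminf_le allI summableI)
    fix k
    have "ennreal (lam k powr \<sigma>) * E2 M (q k) \<le> ennreal (lam k powr \<sigma>) * (ennreal memory_const * (\<integral>\<^sup>+s. \<Phi> k s * total_density k s \<partial>lborel))"
      by (intro mult_left_mono assms) simp
    also have "\<dots> = ennreal memory_const * (ennreal (lam k powr \<sigma>) * (\<integral>\<^sup>+s. \<Phi> k s * total_density k s \<partial>lborel))"
      by (rule mult.left_commute)
    also have "ennreal (lam k powr \<sigma>) * (\<integral>\<^sup>+s. \<Phi> k s * total_density k s \<partial>lborel) = (\<integral>\<^sup>+s. ennreal (lam k powr \<sigma>) * (\<Phi> k s * total_density k s) \<partial>lborel)"
      by (rule nn_integral_cmult[symmetric]) measurable
    finally show "ennreal (lam k powr \<sigma>) * E2 M (q k) \<le> ennreal memory_const * (\<integral>\<^sup>+s. ennreal (lam k powr \<sigma>) * (\<Phi> k s * total_density k s) \<partial>lborel)" .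
  qed
  also have "\<dots> = ennreal memory_const * (\<integral>\<^sup>+s. (\<Sum>k. ennreal (lam k powr \<sigma>) * (\<Phi> k s * total_density k s)) \<partial>lborel)"
    by (simp add: nn_integral_suminf)
  finally show ?thesis .
qed

lemma weighted_density_bound:
  assumes "\<And>k. s \<in> {0..T} ==> \<Phi> k \<le> ennreal c"
  shows "(\<Sum>k. ennreal (lam k powr \<sigma>) * (\<Phi> k * total_density k s)) \<le> ennreal c * ennreal (3 * force_bound)"
proof (cases "s \<in> {0..T}")
  case True
  have "(\<Sum>k. ennreal (lam k powr \<sigma>) * (\<Phi> k * total_density k s)) \<le> (\<Sum>k. ennreal c * (ennreal (lam k powr \<sigma>) * total_density k s))"
  proof (intro suminf_le allI summableI)
    fix k
    have "ennreal (lam k powr \<sigma>) * (\<Phi> k * total_density k s) \<le> ennreal (lam k powr \<sigma>) * (ennreal c * total_density k s)"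
      by (intro mult_left_mono mult_right_mono assms True) auto
    then show "ennreal (lam k powr \<sigma>) * (\<Phi> k * total_density k s) \<le> ennreal c * (ennreal (lam k powr \<sigma>) * total_density k s)"
      by (simp add: mult.left_commute)
  qed
  also have "\<dots> = ennreal c * (\<Sum>k. ennreal (lam k powr \<sigma>) * total_density k s)" by simp
  also have "\<dots> \<le> ennreal c * ennreal (3 * force_bound)" by (intro mult_left_mono total_density_bound) simp
  finally show ?thesis .
qed (simp add: total_density_outside)

definition "quotient_const = memory_const * (K\<^sup>2 * (T powr (2 * \<alpha> - 3) / (2 * \<alpha> - 3)) * (3 * force_bound))"

lemma tail_bound:
  assumes "r \<le> m"
  shows "(\<integral>\<^sup>+s. ennreal (K\<^sup>2 * (indicator {r..<m} s * (m - s) powr (2 * \<alpha> - 4))) \<partial>lborel) \<le> ennreal (K\<^sup>2 * ((m - r) powr (2 * \<alpha> - 3) / (2 * \<alpha> - 3)))"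
proof -
  have "(\<integral>\<^sup>+s. ennreal (K\<^sup>2 * (indicator {r..<m} s * (m - s) powr (2 * \<alpha> - 4))) \<partial>lborel)
     = ennreal (K\<^sup>2) * (\<integral>\<^sup>+s. ennreal (indicator {r..<m} s * (m - s) powr (2 * \<alpha> - 4)) \<partial>lborel)"
    by (subst nn_integral_cmult[symmetric]) (auto simp: ennreal_mult)
  also have "\<dots> \<le> ennreal (K\<^sup>2) * ennreal ((m - r) powr ((2 * \<alpha> - 4) + 1) / ((2 * \<alpha> - 4) + 1))"
    using \<alpha> by (intro mult_left_mono powr_tail_integral assms) auto
  also have "\<dots> = ennreal (K\<^sup>2 * ((m - r) powr (2 * \<alpha> - 3) / (2 * \<alpha> - 3)))"
    using \<alpha> by (subst ennreal_mult[symmetric]) auto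
  finally show ?thesis .
qed

lemma memory_quotient_bound:
  assumes t: "t \<in> {0..T}" and r: "r \<in> {0..T}" and ne: "r \<noteq> t"
  shows "wsm (\<lambda>k. memory_quotient k t r) \<le> ennreal quotient_const"
proof -
  define B where "B s = K\<^sup>2 * (indicator {0..<max r t} s * (max r t - s) powr (2 * \<alpha> - 4))" for s
  have "wsm (\<lambda>k. memory_quotient k t r) \<le> ennreal memory_const * (\<integral>\<^sup>+s. (\<Sum>k. ennreal (lam k powr \<sigma>) * (ennreal ((kernel_quotient k t r s)^2) * total_density k s)) \<partial>lborel)"
    by (rule wsm_memory) (use memory_quotient_diff_bound[OF t r t] in \<open>simp add: memory_quotient_self\<close>, measurable)
  also have "\<dots> \<le> ennreal memory_const * (\<integral>\<^sup>+s. ennreal (B s) * ennreal (3 * force_bound) \<partial>lborel)"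
    unfolding B_def
    by (intro mult_left_mono nn_integral_mono weighted_density_bound ennreal_leI kernel_quotient_square_bound t r ne) auto
  also have "\<dots> = ennreal memory_const * ((\<integral>\<^sup>+s. ennreal (B s) \<partial>lborel) * ennreal (3 * force_bound))"
    by (subst nn_integral_multc) (auto simp: B_def)
  also have "\<dots> \<le> ennreal memory_const * (ennreal (K\<^sup>2 * (T powr (2 * \<alpha> - 3) / (2 * \<alpha> - 3))) * ennreal (3 * force_bound))"
  proof (intro mult_left_mono mult_right_mono)
    have "(\<integral>\<^sup>+s. ennreal (B s) \<partial>lborel) \<le> ennreal (K\<^sup>2 * ((max r t - 0) powr (2 * \<alpha> - 3) / (2 * \<alpha> - 3)))"
      unfolding B_def by (rule tail_bound) (use t in auto)
    also have "\<dots> \<le> ennreal (K\<^sup>2 * (T powr (2 * \<alpha> - 3) / (2 * \<alpha> - 3)))"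
      using \<alpha> t r by (intro ennreal_leI mult_left_mono divide_right_mono powr_mono2) auto
    finally show "(\<integral>\<^sup>+s. ennreal (B s) \<partial>lborel) \<le> ennreal (K\<^sup>2 * (T powr (2 * \<alpha> - 3) / (2 * \<alpha> - 3)))" .
  qed auto
  also have "\<dots> = ennreal quotient_const"
  proof -
    have n: "0 \<le> K\<^sup>2 * (T powr (2 * \<alpha> - 3) / (2 * \<alpha> - 3))" "0 \<le> 3 * force_bound"
      using force_bound_nonneg \<alpha> by auto
    show ?thesis
      unfolding quotient_const_def
      by (simp only: ennreal_mult[symmetric, OF n] ennreal_mult[symmetric, OF memory_const_nonneg mult_nonneg_nonneg[OF n]])
  qed
  finally show ?thesis .
qed

text \<open>The region \<open>s < t\<close> is handled by dominated convergence, first in \<open>k\<close> for fixed \<open>s\<close> and then in \<open>s\<close>: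
the kernel quotients converge to the derivative of the kernel at \<open>t - s\<close>, and \<open>(t - s) powr (2 * \<alpha> - 4)\<close>
dominates their squares. In the region \<open>t \<le> s\<close> there is no common dominating function, as the singularity
moves with the quotient; but there the integral is of order \<open>(r - t) powr (2 * \<alpha> - 3)\<close> and tends to \<open>0\<close>.\<close>

lemma memory_quotient_Cauchy:
  assumes t: "t \<in> {0..T}"
    and X: "\<And>n. X n \<in> {0..T}" "\<And>n. X n \<noteq> t" "X \<longlonglongrightarrow> t"
    and Y: "\<And>n. Y n \<in> {0..T}" "\<And>n. Y n \<noteq> t" "Y \<longlonglongrightarrow> t"
  shows "(\<lambda>n. wsm (\<lambda>k w. memory_quotient k t (X n) w - memory_quotient k t (Y n) w)) \<longlonglongrightarrow> 0"
proof -
  define \<Phi> where "\<Phi> n k s = ennreal ((kernel_quotient k t (X n) s - kernel_quotient k t (Y n) s)^2)" for n k s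
  have [measurable]: "\<Phi> n k \<in> borel_measurable lborel" for n k unfolding \<Phi>_def by measurable
  define G where "G n s = (\<Sum>k. ennreal (lam k powr \<sigma>) * (\<Phi> n k s * total_density k s))" for n s
  have [measurable]: "G n \<in> borel_measurable lborel" for n unfolding G_def by measurable
  have le: "wsm (\<lambda>k w. memory_quotient k t (X n) w - memory_quotient k t (Y n) w) \<le> ennreal memory_const * (\<integral>\<^sup>+s. G n s \<partial>lborel)" for n
    unfolding G_def
    by (rule wsm_memory) (use memory_quotient_diff_bound[OF t X(1) Y(1)] in \<open>simp add: \<Phi>_def\<close>, measurable)
  define c where "c = 3 * force_bound"
  have c0: "c \<ge> 0" using force_bound_nonneg by (simp add: c_def)
  have sq: "\<Phi> n k s \<le> ennreal (2 * (kernel_quotient k t (X n) s)^2 + 2 * (kernel_quotient k t (Y n) s)^2)" for n k s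
    unfolding \<Phi>_def by (intro ennreal_leI square_diff2)
  define dom where "dom s = 4 * (K\<^sup>2 * (indicator {0..<t} s * (t - s) powr (2 * \<alpha> - 4)))" for s
  \<comment> \<open>For \<open>s < t\<close> the later time is at least \<open>t\<close>, and a negative power decreases.\<close>
  have quot_before: "(kernel_quotient k t r s)^2 \<le> K\<^sup>2 * (indicator {0..<t} s * (t - s) powr (2 * \<alpha> - 4))"
    if "r \<in> {0..T}" "r \<noteq> t" "0 \<le> s" "s < t" for k r s
  proof -
    have "(kernel_quotient k t r s)^2 \<le> K\<^sup>2 * (indicator {0..<max r t} s * (max r t - s) powr (2 * \<alpha> - 4))"
      using that by (intro kernel_quotient_square_bound t) auto
    also have "\<dots> \<le> K\<^sup>2 * (indicator {0..<t} s * (t - s) powr (2 * \<alpha> - 4))"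
      using that \<alpha> by (intro mult_left_mono) (auto intro!: powr_mono2')
    finally show ?thesis .
  qed
  have before: "G n s * indicator {..<t} s \<le> ennreal (dom s) * ennreal c" for n s
  proof (cases "s < t")
    case True
    have "\<Phi> n k s \<le> ennreal (dom s)" if "s \<in> {0..T}" for k
    proof (rule order_trans[OF sq ennreal_leI])
      show "2 * (kernel_quotient k t (X n) s)^2 + 2 * (kernel_quotient k t (Y n) s)^2 \<le> dom s"
        using quot_before[OF X(1,2), of s k n] quot_before[OF Y(1,2), of s k n] that True by (simp add: dom_def)
    qed
    then have "G n s \<le> ennreal (dom s) * ennreal c" unfolding G_def c_def by (rule weighted_density_bound)
    then show ?thesis using True by simp
  qed simp
  define after where "after x s = K\<^sup>2 * (indicator {t..<max x t} s * (max x t - s) powr (2 * \<alpha> - 4))" for x s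
  have am[measurable]: "after x \<in> borel_measurable lborel" for x unfolding after_def by measurable
  have a0: "after x s \<ge> 0" for x s by (simp add: after_def)
  have quot_after: "(kernel_quotient k t r s)^2 \<le> after r s"
    if "r \<in> {0..T}" "r \<noteq> t" "t \<le> s" for k r s
  proof -
    have "(kernel_quotient k t r s)^2 \<le> K\<^sup>2 * (indicator {0..<max r t} s * (max r t - s) powr (2 * \<alpha> - 4))"
      using that t by (intro kernel_quotient_square_bound t) auto
    then show ?thesis using that t by (simp add: after_def indicator_def)
  qed
  have after_le: "G n s * indicator {t..} s \<le> ennreal (2 * after (X n) s + 2 * after (Y n) s) * ennreal c" for n s
  proof (cases "t \<le> s")
    case True
    have "\<Phi> n k s \<le> ennreal (2 * after (X n) s + 2 * after (Y n) s)" for k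
      by (rule order_trans[OF sq ennreal_leI])
         (use quot_after[OF X(1,2) True] quot_after[OF Y(1,2) True] in \<open>auto intro!: add_mono\<close>)
    then have "G n s \<le> ennreal (2 * after (X n) s + 2 * after (Y n) s) * ennreal c" unfolding G_def c_def by (rule weighted_density_bound)
    then show ?thesis using True by simp
  qed simp
  have pointwise: "(\<lambda>n. G n s * indicator {..<t} s) \<longlonglongrightarrow> 0" for s
  proof (cases "s \<in> {0..<t}")
    case False
    then show ?thesis
      using t by (cases "s < t") (auto simp: G_def total_density_outside)
  next
    case True
    have "(\<lambda>n. G n s) \<longlonglongrightarrow> 0"
      unfolding G_def
    proof (rule suminf_tendsto_0_dominated)
      show "ennreal (lam k powr \<sigma>) * (\<Phi> n k s * total_density k s) \<le> ennreal (dom s) * (ennreal (lam k powr \<sigma>) * total_density k s)" for n k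
      proof -
        have "\<Phi> n k s \<le> ennreal (dom s)"
        proof (rule order_trans[OF sq ennreal_leI])
          show "2 * (kernel_quotient k t (X n) s)^2 + 2 * (kernel_quotient k t (Y n) s)^2 \<le> dom s"
            using quot_before[OF X(1,2), of s k n] quot_before[OF Y(1,2), of s k n] True by (simp add: dom_def)
        qed
        then have "ennreal (lam k powr \<sigma>) * (\<Phi> n k s * total_density k s) \<le> ennreal (lam k powr \<sigma>) * (ennreal (dom s) * total_density k s)"
          by (intro mult_left_mono mult_right_mono) auto
        then show ?thesis by (simp add: mult.left_commute)
      qed
      show "(\<Sum>k. ennreal (dom s) * (ennreal (lam k powr \<sigma>) * total_density k s)) < \<infinity>"
        using le_less_trans[OF total_density_bound[of s] ennreal_less_top] by (simp add: ennreal_mult_less_top)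
      fix k
      have "t - s \<noteq> 0" using True by auto
      from S_ext_differentiable[OF \<alpha>1 this] obtain d where d: "(S_ext \<alpha> \<beta> \<nu> (lam k) has_real_derivative d) (at (t - s))"
        by blast
      have "((\<lambda>r. S_ext \<alpha> \<beta> \<nu> (lam k) (r - s)) has_real_derivative d) (at t)"
      proof -
        have "((\<lambda>r. r - s) has_real_derivative 1) (at t)" by (auto intro!: derivative_eq_intros)
        from DERIV_chain2[where g = "\<lambda>r. r - s" and x = t, OF d this] show ?thesis by simp
      qed
      then have lim: "((\<lambda>r. kernel_quotient k t r s) \<longlongrightarrow> d) (at t)"
        unfolding kernel_quotient_def by (simp add: has_field_derivative_iff)
      have "(\<lambda>n. kernel_quotient k t (Z n) s) \<longlonglongrightarrow> d" if "\<And>n. Z n \<noteq> t" "Z \<longlonglongrightarrow> t" for Z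
        by (rule filterlim_compose[OF lim]) (use that in \<open>auto simp: filterlim_at\<close>)
      from tendsto_diff[OF this[OF X(2,3)] this[OF Y(2,3)]]
      have "(\<lambda>n. (kernel_quotient k t (X n) s - kernel_quotient k t (Y n) s)^2) \<longlonglongrightarrow> 0\<^sup>2"
        by (intro tendsto_power) simp
      then have "(\<lambda>n. \<Phi> n k s) \<longlonglongrightarrow> ennreal (0\<^sup>2)" unfolding \<Phi>_def by (rule tendsto_ennrealI)
      then have "(\<lambda>n. \<Phi> n k s) \<longlonglongrightarrow> 0" by simp
      moreover have "ennreal (lam k powr \<sigma>) * total_density k s < \<top>"
        using le_less_trans[OF order_trans[OF ennreal_term_le_suminf[of "\<lambda>k. ennreal (lam k powr \<sigma>) * total_density k s" k] total_density_bound[of s]] ennreal_less_top] .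
      ultimately have "(\<lambda>n. (ennreal (lam k powr \<sigma>) * total_density k s) * \<Phi> n k s) \<longlonglongrightarrow> (ennreal (lam k powr \<sigma>) * total_density k s) * 0"
        by (intro ennreal_tendsto_cmult)
      then show "(\<lambda>n. ennreal (lam k powr \<sigma>) * (\<Phi> n k s * total_density k s)) \<longlonglongrightarrow> 0"
        by (simp add: mult.assoc mult.commute[of "total_density k s"])
    qed
    then show ?thesis using True by simp
  qed
  have lim1: "(\<lambda>n. \<integral>\<^sup>+s. G n s * indicator {..<t} s \<partial>lborel) \<longlonglongrightarrow> (\<integral>\<^sup>+s. 0 \<partial>(lborel :: real measure))"
  proof (rule nn_integral_dominated_convergence[where w = "\<lambda>s. ennreal (dom s) * ennreal c"])
    have "(\<integral>\<^sup>+s. ennreal (dom s) * ennreal c \<partial>lborel) = ennreal 4 * (\<integral>\<^sup>+s. ennreal (K\<^sup>2 * (indicator {0..<t} s * (t - s) powr (2 * \<alpha> - 4))) \<partial>lborel) * ennreal c"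
      by (subst nn_integral_multc, simp add: dom_def) (subst nn_integral_cmult[symmetric], auto simp: dom_def ennreal_mult)
    also have "\<dots> \<le> ennreal 4 * ennreal (K\<^sup>2 * ((t - 0) powr (2 * \<alpha> - 3) / (2 * \<alpha> - 3))) * ennreal c"
      using t by (intro mult_left_mono mult_right_mono tail_bound) auto
    also have "\<dots> < \<infinity>" by (simp add: ennreal_mult_less_top)
    finally show "(\<integral>\<^sup>+s. ennreal (dom s) * ennreal c \<partial>lborel) < \<infinity>" .
    show "(\<lambda>s. ennreal (dom s) * ennreal c) \<in> borel_measurable lborel" unfolding dom_def by measurable
  qed (use before pointwise in auto)
  define tl where "tl x = K\<^sup>2 * ((max x t - t) powr (2 * \<alpha> - 3) / (2 * \<alpha> - 3))" for x
  have tl0: "tl x \<ge> 0" for x using \<alpha> by (simp add: tl_def)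
  have after_int: "(\<integral>\<^sup>+s. ennreal (after x s) \<partial>lborel) \<le> ennreal (tl x)" for x
    unfolding after_def tl_def by (rule tail_bound) simp
  have bound2: "(\<integral>\<^sup>+s. G n s * indicator {t..} s \<partial>lborel) \<le> ennreal ((2 * tl (X n) + 2 * tl (Y n)) * c)" for n
  proof -
    have "(\<integral>\<^sup>+s. G n s * indicator {t..} s \<partial>lborel) \<le> (\<integral>\<^sup>+s. (2 * ennreal (after (X n) s) + 2 * ennreal (after (Y n) s)) * ennreal c \<partial>lborel)"
      by (intro nn_integral_mono order_trans[OF after_le]) (simp add: a0 ennreal_mult)
    also have "\<dots> = (2 * (\<integral>\<^sup>+s. ennreal (after (X n) s) \<partial>lborel) + 2 * (\<integral>\<^sup>+s. ennreal (after (Y n) s) \<partial>lborel)) * ennreal c"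
      by (simp add: nn_integral_multc nn_integral_add nn_integral_cmult)
    also have "\<dots> \<le> (2 * ennreal (tl (X n)) + 2 * ennreal (tl (Y n))) * ennreal c"
      by (intro mult_right_mono add_mono mult_left_mono after_int) auto
    also have "\<dots> = ennreal ((2 * tl (X n) + 2 * tl (Y n)) * c)"
      using tl0 c0 by (simp add: ennreal_mult)
    finally show ?thesis .
  qed
  have tlim: "(\<lambda>n. tl (Z n)) \<longlonglongrightarrow> 0" if "Z \<longlonglongrightarrow> t" for Z
  proof -
    have "(\<lambda>n. max (Z n) t - t) \<longlonglongrightarrow> max t t - t" by (intro tendsto_intros that)
    then have "(\<lambda>n. (max (Z n) t - t) powr (2 * \<alpha> - 3)) \<longlonglongrightarrow> 0"
      using \<alpha> by (intro tendsto_zero_powrI[OF _ tendsto_const]) auto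
    then have "(\<lambda>n. K\<^sup>2 * ((max (Z n) t - t) powr (2 * \<alpha> - 3) / (2 * \<alpha> - 3))) \<longlonglongrightarrow> K\<^sup>2 * (0 / (2 * \<alpha> - 3))"
      using \<alpha> by (intro tendsto_intros) auto
    then show ?thesis by (simp add: tl_def)
  qed
  have "(\<lambda>n. (2 * tl (X n) + 2 * tl (Y n)) * c) \<longlonglongrightarrow> (2 * 0 + 2 * 0) * c"
    by (intro tendsto_intros tlim X Y)
  then have lim2: "(\<lambda>n. ennreal ((2 * tl (X n) + 2 * tl (Y n)) * c)) \<longlonglongrightarrow> 0"
    using tendsto_ennrealI by fastforce
  have split: "(\<integral>\<^sup>+s. G n s \<partial>lborel) \<le> (\<integral>\<^sup>+s. G n s * indicator {..<t} s \<partial>lborel) + ennreal ((2 * tl (X n) + 2 * tl (Y n)) * c)" for n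
  proof -
    have "(\<integral>\<^sup>+s. G n s \<partial>lborel) = (\<integral>\<^sup>+s. G n s * indicator {..<t} s + G n s * indicator {t..} s \<partial>lborel)"
      by (intro nn_integral_cong) (simp add: indicator_def)
    also have "\<dots> = (\<integral>\<^sup>+s. G n s * indicator {..<t} s \<partial>lborel) + (\<integral>\<^sup>+s. G n s * indicator {t..} s \<partial>lborel)"
      by (rule nn_integral_add) measurable
    finally show ?thesis using bound2[of n] by (simp add: add_left_mono)
  qed
  have "(\<lambda>n. ennreal memory_const * ((\<integral>\<^sup>+s. G n s * indicator {..<t} s \<partial>lborel) + ennreal ((2 * tl (X n) + 2 * tl (Y n)) * c))) \<longlonglongrightarrow> ennreal memory_const * (0 + 0)"
    using lim1 lim2 by (intro ennreal_tendsto_cmult tendsto_add) auto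
  then have lim: "(\<lambda>n. ennreal memory_const * ((\<integral>\<^sup>+s. G n s * indicator {..<t} s \<partial>lborel) + ennreal ((2 * tl (X n) + 2 * tl (Y n)) * c))) \<longlonglongrightarrow> 0"
    by simp
  have le2: "wsm (\<lambda>k w. memory_quotient k t (X n) w - memory_quotient k t (Y n) w) \<le> ennreal memory_const * ((\<integral>\<^sup>+s. G n s * indicator {..<t} s \<partial>lborel) + ennreal ((2 * tl (X n) + 2 * tl (Y n)) * c))" for n
    by (rule order_trans[OF le mult_left_mono[OF split]]) simp
  show ?thesis
    by (rule tendsto_0_of_le[OF le2 lim])
qed

end

section \<open>The time derivative\<close>

context mild_regularity
begin

definition difference_quotient :: "nat => real => real => 'w => real" where
  "difference_quotient k t r w = (coef (u r w) k - coef (u t w) k) / (r - t)"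

definition T_quotient :: "nat => real => real => real" where
  "T_quotient k t r = (T_kernel \<alpha> \<beta> \<nu> (lam k) r - T_kernel \<alpha> \<beta> \<nu> (lam k) t) / (r - t)"

definition R_quotient :: "nat => real => real => real" where
  "R_quotient k t r = (R_kernel \<alpha> \<beta> \<nu> (lam k) r - R_kernel \<alpha> \<beta> \<nu> (lam k) t) / (r - t)"

lemma quotient_eq:
  "difference_quotient k t r w = T_quotient k t r * coef (a w) k + R_quotient k t r * coef (b w) k + memory_quotient k t r w"
  by (simp add: difference_quotient_def T_quotient_def R_quotient_def memory_quotient_def memory_def diff_divide_distrib add_divide_distrib left_diff_distrib)

lemma quotient_measurable: "t \<in> {0..T} ==> r \<in> {0..T} ==> difference_quotient k t r \<in> borel_measurable M"
  unfolding difference_quotient_def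
  by (intro borel_measurable_divide borel_measurable_diff borel_measurable_const coef_u_measurable)

lemma T_quotient_bound:
  assumes "t \<in> {0..T}" "r \<in> {0..T}" "r \<noteq> t"
  shows "\<bar>T_quotient k t r\<bar> \<le> K * lam k powr (\<beta> / \<alpha>)"
  using K(3)[OF lam_mono assms(2,1), of k] assms(3) by (simp add: T_quotient_def abs_divide pos_divide_le_eq)

lemma R_quotient_bound:
  assumes "t \<in> {0..T}" "r \<in> {0..T}" "r \<noteq> t"
  shows "\<bar>R_quotient k t r\<bar> \<le> K * lam k powr 0"
  using K(4)[OF lam_mono assms(2,1), of k] assms(3) lam_pos'[of k] by (simp add: R_quotient_def abs_divide pos_divide_le_eq)

lemma within_sequence:
  assumes "(G \<longlongrightarrow> d) (at t within {0..})" "\<And>n. X n \<in> {0..T}" "\<And>n. X n \<noteq> t" "X \<longlonglongrightarrow> t"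
  shows "(\<lambda>n. G (X n)) \<longlonglongrightarrow> (d::real)"
  by (rule filterlim_compose[OF assms(1)]) (use assms(2-) in \<open>auto simp: filterlim_at\<close>)

lemma T_quotient_tendsto:
  assumes "t \<in> {0..T}" "\<And>n. X n \<in> {0..T}" "\<And>n. X n \<noteq> t" "X \<longlonglongrightarrow> t"
    "\<And>n. Y n \<in> {0..T}" "\<And>n. Y n \<noteq> t" "Y \<longlonglongrightarrow> t"
  shows "(\<lambda>n. T_quotient k t (X n) - T_quotient k t (Y n)) \<longlonglongrightarrow> 0"
    and "(\<lambda>n. R_quotient k t (X n) - R_quotient k t (Y n)) \<longlonglongrightarrow> 0"
proof -
  have t0: "t \<ge> 0" using assms(1) by simp
  obtain d where "(T_kernel \<alpha> \<beta> \<nu> (lam k) has_real_derivative d) (at t within {0..})"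
    using T_kernel_differentiable[OF \<alpha>1 t0] by blast
  then have d: "((\<lambda>r. T_quotient k t r) \<longlongrightarrow> d) (at t within {0..})"
    by (simp add: T_quotient_def has_field_derivative_iff)
  show "(\<lambda>n. T_quotient k t (X n) - T_quotient k t (Y n)) \<longlonglongrightarrow> 0"
    using tendsto_diff[OF within_sequence[OF d assms(2-4)] within_sequence[OF d assms(5-7)]] by simp
  obtain d' where "(R_kernel \<alpha> \<beta> \<nu> (lam k) has_real_derivative d') (at t within {0..})"
    using R_kernel_differentiable[OF \<alpha>1 t0] by blast
  then have d': "((\<lambda>r. R_quotient k t r) \<longlongrightarrow> d') (at t within {0..})"
    by (simp add: R_quotient_def has_field_derivative_iff)
  show "(\<lambda>n. R_quotient k t (X n) - R_quotient k t (Y n)) \<longlonglongrightarrow> 0"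
    using tendsto_diff[OF within_sequence[OF d' assms(2-4)] within_sequence[OF d' assms(5-7)]] by simp
qed

lemma multiplier_term:
  assumes A: "A k \<in> borel_measurable M" and \<delta>: "\<bar>\<delta>\<bar> \<le> c * lam k powr \<theta>"
  shows "ennreal (lam k powr \<sigma>) * E2 M (\<lambda>w. \<delta> * A k w) \<le> ennreal (c\<^sup>2) * (ennreal (lam k powr (\<sigma> + 2 * \<theta>)) * E2 M (A k))"
proof -
  have "\<delta>\<^sup>2 \<le> (c * lam k powr \<theta>)^2" using \<delta> by (metis abs_ge_zero power2_abs power_mono)
  then have "lam k powr \<sigma> * \<delta>\<^sup>2 \<le> lam k powr \<sigma> * (c * lam k powr \<theta>)^2" by (intro mult_left_mono) auto
  also have "\<dots> = c\<^sup>2 * lam k powr (\<sigma> + 2 * \<theta>)"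
    using lam_pos'[of k] by (simp add: power_mult_distrib powr_add powr_power mult.commute mult.left_commute)
  finally have "ennreal (lam k powr \<sigma> * \<delta>\<^sup>2) * E2 M (A k) \<le> ennreal (c\<^sup>2 * lam k powr (\<sigma> + 2 * \<theta>)) * E2 M (A k)"
    by (intro mult_right_mono ennreal_leI) auto
  then show ?thesis using A by (simp add: E2_cmult ennreal_mult mult.assoc)
qed

lemma multiplier_bound:
  assumes "\<And>k. A k \<in> borel_measurable M" "\<And>k. \<bar>\<delta> k\<bar> \<le> c * lam k powr \<theta>"
  shows "wsm (\<lambda>k w. \<delta> k * A k w) \<le> ennreal (c\<^sup>2) * (\<Sum>k. ennreal (lam k powr (\<sigma> + 2 * \<theta>)) * E2 M (A k))"
proof -
  have "wsm (\<lambda>k w. \<delta> k * A k w) \<le> (\<Sum>k. ennreal (c\<^sup>2) * (ennreal (lam k powr (\<sigma> + 2 * \<theta>)) * E2 M (A k)))"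
    unfolding wsm_def by (intro suminf_le allI summableI multiplier_term assms)
  then show ?thesis by simp
qed

text \<open>Dominated convergence in \<open>k\<close> for the terms that stem from the initial data.\<close>

lemma multiplier_tendsto:
  assumes A: "\<And>k. A k \<in> borel_measurable M" and \<delta>: "\<And>n k. \<bar>\<delta> n k\<bar> \<le> c * lam k powr \<theta>"
    and lim: "\<And>k. (\<lambda>n. \<delta> n k) \<longlonglongrightarrow> 0" and fin: "(\<Sum>k. ennreal (lam k powr (\<sigma> + 2 * \<theta>)) * E2 M (A k)) < \<infinity>"
  shows "(\<lambda>n. wsm (\<lambda>k w. \<delta> n k * A k w)) \<longlonglongrightarrow> 0"
  unfolding wsm_def
proof (rule suminf_tendsto_0_dominated)
  show "ennreal (lam k powr \<sigma>) * E2 M (\<lambda>w. \<delta> n k * A k w) \<le> ennreal (c\<^sup>2) * (ennreal (lam k powr (\<sigma> + 2 * \<theta>)) * E2 M (A k))" for n k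
    by (rule multiplier_term[OF A \<delta>])
  show "(\<Sum>k. ennreal (c\<^sup>2) * (ennreal (lam k powr (\<sigma> + 2 * \<theta>)) * E2 M (A k))) < \<infinity>"
    using fin by (simp add: ennreal_mult_less_top)
  fix k
  have E: "E2 M (A k) < \<top>"
  proof -
    have "ennreal (lam k powr (\<sigma> + 2 * \<theta>)) * E2 M (A k) < \<infinity>"
      using ennreal_term_le_suminf[of "\<lambda>k. ennreal (lam k powr (\<sigma> + 2 * \<theta>)) * E2 M (A k)" k] fin by (rule le_less_trans)
    then show ?thesis using lam_pos'[of k] by (auto simp: ennreal_mult_less_top)
  qed
  have "(\<lambda>n. lam k powr \<sigma> * (\<delta> n k)^2) \<longlonglongrightarrow> lam k powr \<sigma> * 0\<^sup>2" by (intro tendsto_intros lim)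
  then have "(\<lambda>n. ennreal (lam k powr \<sigma> * (\<delta> n k)^2)) \<longlonglongrightarrow> ennreal (lam k powr \<sigma> * 0\<^sup>2)" by (rule tendsto_ennrealI)
  then have "(\<lambda>n. E2 M (A k) * ennreal (lam k powr \<sigma> * (\<delta> n k)^2)) \<longlonglongrightarrow> E2 M (A k) * ennreal (lam k powr \<sigma> * 0\<^sup>2)"
    by (intro ennreal_tendsto_cmult E)
  then show "(\<lambda>n. ennreal (lam k powr \<sigma>) * E2 M (\<lambda>w. \<delta> n k * A k w)) \<longlonglongrightarrow> 0"
    by (simp add: E2_cmult[OF A] ennreal_mult mult.assoc mult.commute[of "E2 M (A k)"])
qed

lemma initial_data:
  "(\<Sum>k. ennreal (lam k powr (\<sigma> + 2 * (\<beta> / \<alpha>))) * E2 M (\<lambda>w. coef (a w) k)) < \<infinity>"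
  "(\<Sum>k. ennreal (lam k powr (\<sigma> + 2 * 0)) * E2 M (\<lambda>w. coef (b w) k)) < \<infinity>"
  using a(2) b(2) second_moment_coef[of a, OF coef_a_measurable] second_moment_coef[of b, OF coef_b_measurable] by simp_all

lemma quotient_bounded:
  obtains C where "C \<ge> 0" "\<And>t r. t \<in> {0..T} ==> r \<in> {0..T} ==> r \<noteq> t ==> wsm (\<lambda>k. difference_quotient k t r) \<le> ennreal C"
proof -
  define Q where "Q = 3 * (ennreal (K\<^sup>2) * (\<Sum>k. ennreal (lam k powr (\<sigma> + 2 * (\<beta> / \<alpha>))) * E2 M (\<lambda>w. coef (a w) k))
    + ennreal (K\<^sup>2) * (\<Sum>k. ennreal (lam k powr (\<sigma> + 2 * 0)) * E2 M (\<lambda>w. coef (b w) k)) + ennreal quotient_const)"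
  have Q: "Q < \<top>" unfolding Q_def using initial_data by (simp add: ennreal_mult_less_top)
  have "wsm (\<lambda>k. difference_quotient k t r) \<le> Q" if t: "t \<in> {0..T}" and r: "r \<in> {0..T}" "r \<noteq> t" for t r
  proof -
    have "wsm (\<lambda>k. difference_quotient k t r) \<le> 3 * (wsm (\<lambda>k w. T_quotient k t r * coef (a w) k) + wsm (\<lambda>k w. R_quotient k t r * coef (b w) k) + wsm (\<lambda>k. memory_quotient k t r))"
      unfolding quotient_eq
      by (intro wsm_sum3 borel_measurable_times borel_measurable_const coef_a_measurable coef_b_measurable memory_quotient_measurable t r)
    also have "\<dots> \<le> Q"
      unfolding Q_def
      by (intro mult_left_mono add_mono multiplier_bound coef_a_measurable coef_b_measurable T_quotient_bound R_quotient_bound memory_quotient_bound t r) simp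
    finally show ?thesis .
  qed
  then show thesis using Q by (intro that[of "enn2real Q"]) auto
qed

lemma quotient_Cauchy:
  assumes t: "t \<in> {0..T}"
    and X: "\<And>n. X n \<in> {0..T}" "\<And>n. X n \<noteq> t" "X \<longlonglongrightarrow> t"
    and Y: "\<And>n. Y n \<in> {0..T}" "\<And>n. Y n \<noteq> t" "Y \<longlonglongrightarrow> t"
  shows "(\<lambda>n. wsm (\<lambda>k w. difference_quotient k t (X n) w - difference_quotient k t (Y n) w)) \<longlonglongrightarrow> 0"
proof -
  define A where "A n = wsm (\<lambda>k w. (T_quotient k t (X n) - T_quotient k t (Y n)) * coef (a w) k)" for n
  define B where "B n = wsm (\<lambda>k w. (R_quotient k t (X n) - R_quotient k t (Y n)) * coef (b w) k)" for n
  define C where "C n = wsm (\<lambda>k w. memory_quotient k t (X n) w - memory_quotient k t (Y n) w)" for n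
  have A: "A \<longlonglongrightarrow> 0"
    unfolding A_def
  proof (rule multiplier_tendsto[OF coef_a_measurable _ _ initial_data(1)])
    show "\<bar>T_quotient k t (X n) - T_quotient k t (Y n)\<bar> \<le> (2 * K) * lam k powr (\<beta> / \<alpha>)" for n k
      using T_quotient_bound[OF t X(1,2), of k n] T_quotient_bound[OF t Y(1,2), of k n] by linarith
    show "(\<lambda>n. T_quotient k t (X n) - T_quotient k t (Y n)) \<longlonglongrightarrow> 0" for k
      by (rule T_quotient_tendsto(1)[OF t X Y])
  qed
  have B: "B \<longlonglongrightarrow> 0"
    unfolding B_def
  proof (rule multiplier_tendsto[OF coef_b_measurable _ _ initial_data(2)])
    show "\<bar>R_quotient k t (X n) - R_quotient k t (Y n)\<bar> \<le> (2 * K) * lam k powr 0" for n k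
      using R_quotient_bound[OF t X(1,2), of k n] R_quotient_bound[OF t Y(1,2), of k n] by linarith
    show "(\<lambda>n. R_quotient k t (X n) - R_quotient k t (Y n)) \<longlonglongrightarrow> 0" for k
      by (rule T_quotient_tendsto(2)[OF t X Y])
  qed
  have C: "C \<longlonglongrightarrow> 0" unfolding C_def by (rule memory_quotient_Cauchy[OF t X Y])
  have "(\<lambda>n. 3 * (A n + B n + C n)) \<longlonglongrightarrow> 3 * (0 + 0 + 0)"
    by (intro ennreal_tendsto_cmult tendsto_add A B C) simp
  then have lim: "(\<lambda>n. 3 * (A n + B n + C n)) \<longlonglongrightarrow> 0" by simp
  have eq: "difference_quotient k t (X n) w - difference_quotient k t (Y n) w = (T_quotient k t (X n) - T_quotient k t (Y n)) * coef (a w) k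
     + (R_quotient k t (X n) - R_quotient k t (Y n)) * coef (b w) k + (memory_quotient k t (X n) w - memory_quotient k t (Y n) w)" for n k w
    unfolding quotient_eq by (simp add: algebra_simps)
  have le: "wsm (\<lambda>k w. difference_quotient k t (X n) w - difference_quotient k t (Y n) w) \<le> 3 * (A n + B n + C n)" for n
    unfolding eq A_def B_def C_def
    by (intro wsm_sum3 borel_measurable_times borel_measurable_diff borel_measurable_const coef_a_measurable coef_b_measurable memory_quotient_measurable t X Y)
  show ?thesis
    by (rule tendsto_0_of_le[OF le lim])
qed

text \<open>The Cauchy property is known for pairs of sequences tending to \<open>t\<close>. This gives a Cauchy sequence for one
choice of times, and comparing with that choice shows that every other sequence has the same limit.\<close>

lemma derivative_coefficients:
  assumes t: "t \<in> {0..T}" and C: "\<And>r. r \<in> {0..T} ==> r \<noteq> t ==> wsm (\<lambda>k. difference_quotient k t r) \<le> ennreal C"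
  shows "\<exists>v. (\<forall>k. v k \<in> borel_measurable M) \<and> wsm v \<le> 2 * ennreal C \<and>
    (\<forall>X. (\<forall>n. X n \<in> {0..T} \<and> X n \<noteq> t) \<longrightarrow> X \<longlonglongrightarrow> t \<longrightarrow> (\<lambda>n. wsm (\<lambda>k w. difference_quotient k t (X n) w - v k w)) \<longlonglongrightarrow> 0)"
proof -
  have "t islimpt {0..T}" using t T by (intro connected_imp_perfect) auto
  then obtain r where r: "\<And>n. r n \<in> {0..T} - {t}" "r \<longlonglongrightarrow> t" by (auto simp: islimpt_sequential)
  have r1: "r n \<in> {0..T}" "r n \<noteq> t" for n using r(1)[of n] by auto
  note qm = quotient_measurable[OF t]
  have "\<exists>v. (\<forall>k. v k \<in> borel_measurable M) \<and> (\<lambda>n. \<Sum>k. ennreal (lam k powr \<sigma>) * E2 M (\<lambda>w. difference_quotient k t (r n) w - v k w)) \<longlonglongrightarrow> 0"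
  proof (rule weighted_L2_complete[where q = "\<lambda>n k. difference_quotient k t (r n)"])
    show "(\<Sum>k. ennreal (lam k powr \<sigma>) * E2 M (difference_quotient k t (r n))) < \<infinity>" for n
      using le_less_trans[OF C[OF r1] ennreal_less_top] unfolding wsm_def by simp
    show "lam k powr \<sigma> > 0" for k using lam_pos'[of k] by simp
    fix \<epsilon> :: real assume \<epsilon>: "\<epsilon> > 0"
    show "\<exists>K. \<forall>m\<ge>K. \<forall>n\<ge>K. (\<Sum>k. ennreal (lam k powr \<sigma>) * E2 M (\<lambda>w. difference_quotient k t (r m) w - difference_quotient k t (r n) w)) \<le> ennreal \<epsilon>"
    proof (rule ccontr)
      assume "\<not> ?thesis"
      then have "\<forall>K. \<exists>p. fst p \<ge> K \<and> snd p \<ge> K \<and> ennreal \<epsilon> < wsm (\<lambda>k w. difference_quotient k t (r (fst p)) w - difference_quotient k t (r (snd p)) w)"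
        unfolding wsm_def by (auto simp: not_le)
      from choice[OF this] obtain p where p: "\<And>K. fst (p K) \<ge> K" "\<And>K. snd (p K) \<ge> K"
        "\<And>K. ennreal \<epsilon> < wsm (\<lambda>k w. difference_quotient k t (r (fst (p K))) w - difference_quotient k t (r (snd (p K))) w)" by auto
      have sub: "(\<lambda>K. r (m K)) \<longlonglongrightarrow> t" if "\<And>K. m K \<ge> K" for m :: "nat => nat"
        by (rule filterlim_compose[OF r(2)]) (rule filterlim_at_top_mono[OF filterlim_ident], use that in auto)
      have "(\<lambda>K. wsm (\<lambda>k w. difference_quotient k t (r (fst (p K))) w - difference_quotient k t (r (snd (p K))) w)) \<longlonglongrightarrow> 0"
        by (rule quotient_Cauchy[OF t r1 sub r1 sub]) (rule p)+
      then have "eventually (\<lambda>K. wsm (\<lambda>k w. difference_quotient k t (r (fst (p K))) w - difference_quotient k t (r (snd (p K))) w) < ennreal \<epsilon>) sequentially"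
        using \<epsilon> by (intro order_tendstoD) auto
      then show False using p(3) by (auto simp: eventually_sequentially dest: less_asym)
    qed
  qed (use r1 qm finite_measure_axioms in auto)
  then obtain v where v: "\<And>k. v k \<in> borel_measurable M" "(\<lambda>n. wsm (\<lambda>k w. difference_quotient k t (r n) w - v k w)) \<longlonglongrightarrow> 0"
    unfolding wsm_def by blast
  have "wsm v \<le> 2 * ennreal C"
  proof (rule LIMSEQ_le_const)
    have "(\<lambda>n. 2 * wsm (\<lambda>k w. difference_quotient k t (r n) w - v k w) + 2 * ennreal C) \<longlonglongrightarrow> 2 * 0 + 2 * ennreal C"
      by (intro tendsto_add ennreal_tendsto_cmult v tendsto_const) simp
    then show "(\<lambda>n. 2 * wsm (\<lambda>k w. difference_quotient k t (r n) w - v k w) + 2 * ennreal C) \<longlonglongrightarrow> 2 * ennreal C" by simp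
    have "wsm v \<le> 2 * wsm (\<lambda>k w. difference_quotient k t (r n) w - v k w) + 2 * ennreal C" for n
    proof -
      have "wsm (\<lambda>k w. 0 - v k w) \<le> 2 * wsm (\<lambda>k w. 0 - difference_quotient k t (r n) w) + 2 * wsm (\<lambda>k w. difference_quotient k t (r n) w - v k w)"
        by (rule wsm_triangle) (use v qm r1 in auto)
      then have "wsm v \<le> 2 * wsm (\<lambda>k. difference_quotient k t (r n)) + 2 * wsm (\<lambda>k w. difference_quotient k t (r n) w - v k w)"
        by (simp add: wsm_def)
      also have "\<dots> \<le> 2 * ennreal C + 2 * wsm (\<lambda>k w. difference_quotient k t (r n) w - v k w)"
        by (intro add_right_mono mult_left_mono C r1) simp
      finally show ?thesis by (simp add: add.commute)
    qed
    then show "\<exists>N. \<forall>n\<ge>N. wsm v \<le> 2 * wsm (\<lambda>k w. difference_quotient k t (r n) w - v k w) + 2 * ennreal C" by blast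
  qed
  moreover have "(\<lambda>n. wsm (\<lambda>k w. difference_quotient k t (X n) w - v k w)) \<longlonglongrightarrow> 0"
    if X: "\<forall>n. X n \<in> {0..T} \<and> X n \<noteq> t" "X \<longlonglongrightarrow> t" for X
  proof -
    have X1: "X n \<in> {0..T}" "X n \<noteq> t" for n using X(1) by auto
    have "(\<lambda>n. 2 * wsm (\<lambda>k w. difference_quotient k t (X n) w - difference_quotient k t (r n) w) + 2 * wsm (\<lambda>k w. difference_quotient k t (r n) w - v k w)) \<longlonglongrightarrow> 2 * 0 + 2 * 0"
      by (intro tendsto_add ennreal_tendsto_cmult v quotient_Cauchy[OF t X1 X(2) r1 r(2)]) auto
    then have lim: "(\<lambda>n. 2 * wsm (\<lambda>k w. difference_quotient k t (X n) w - difference_quotient k t (r n) w) + 2 * wsm (\<lambda>k w. difference_quotient k t (r n) w - v k w)) \<longlonglongrightarrow> 0" by simp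
    have le: "wsm (\<lambda>k w. difference_quotient k t (X n) w - v k w) \<le> 2 * wsm (\<lambda>k w. difference_quotient k t (X n) w - difference_quotient k t (r n) w) + 2 * wsm (\<lambda>k w. difference_quotient k t (r n) w - v k w)" for n
      by (intro wsm_triangle v qm r1 X1)
    show ?thesis
      by (rule tendsto_0_of_le[OF le lim])
  qed
  ultimately show ?thesis using v(1) by blast
qed

lemma weight_zero_le:
  "(\<Sum>k. E2 M (q k)) \<le> ennreal (1 / lam 0 powr \<sigma>) * wsm q"
proof -
  have p: "lam 0 powr \<sigma> > 0" using lam_pos by simp
  have "E2 M (q k) \<le> ennreal (1 / lam 0 powr \<sigma>) * (ennreal (lam k powr \<sigma>) * E2 M (q k))" for k
  proof -
    have "lam 0 powr \<sigma> \<le> lam k powr \<sigma>" using lam_pos lam_mono[of k] \<sigma> by (intro powr_mono2) auto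
    then have "1 \<le> 1 / lam 0 powr \<sigma> * lam k powr \<sigma>" using p by (simp add: field_simps)
    then have "ennreal 1 * E2 M (q k) \<le> ennreal (1 / lam 0 powr \<sigma> * lam k powr \<sigma>) * E2 M (q k)"
      by (intro mult_right_mono ennreal_leI) auto
    then show ?thesis using p by (simp add: ennreal_mult mult.assoc del: times_divide_eq_left)
  qed
  then have "(\<Sum>k. E2 M (q k)) \<le> (\<Sum>k. ennreal (1 / lam 0 powr \<sigma>) * (ennreal (lam k powr \<sigma>) * E2 M (q k)))"
    by (intro suminf_le summableI allI)
  then show ?thesis by (simp add: wsm_def)
qed

text \<open>Random coefficients are assembled into a random element by Riesz--Fischer, with the value \<open>0\<close> on the null set
on which the coefficients are not square summable.\<close>

lemma realize_coefficients:
  assumes v[measurable]: "\<And>k. v k \<in> borel_measurable M" and fin: "wsm v < \<infinity>"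
  shows "\<exists>V. random_Hs D lam \<phi> M 0 V \<and> (AE w in M. \<forall>k. coef (V w) k = v k w)"
proof -
  define good where "good w \<longleftrightarrow> (\<Sum>k. ennreal ((v k w)^2)) \<noteq> \<infinity>" for w
  define V where "V w = (if good w then (SOME y. L2_sums D \<phi> (\<lambda>k. v k w) y) else (\<lambda>x. 0))" for w
  have sums: "L2_sums D \<phi> (\<lambda>k. v k w) (V w)" if "good w" for w
  proof -
    have "summable (\<lambda>k. (v k w)^2)"
      using that by (intro summable_suminf_not_top) (auto simp: good_def)
    from someI_ex[OF Riesz_Fischer[OF this]] show ?thesis using that by (simp add: V_def)
  qed
  have VL: "V w \<in> L2 D" for w
    using sums[of w] L2_zero by (cases "good w") (auto simp: V_def L2_sums_def)
  have coefV: "coef (V w) k = (if good w then v k w else 0)" for w k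
    using sums[of w] L2_sums_coef[of "\<lambda>k. v k w" "V w" k] by (auto simp: V_def L2_inner_def)
  have [measurable]: "Measurable.pred M good" unfolding good_def by measurable
  have cm[measurable]: "(\<lambda>w. coef (V w) k) \<in> borel_measurable M" for k
    unfolding coefV by measurable
  have "(\<lambda>w. L2_inner D (V w) y) \<in> borel_measurable M" if y: "y \<in> L2 D" for y
  proof -
    have "L2_inner D (V w) y = (\<Sum>k. coef (V w) k * coef y k)" for w
      using Parseval_inner[OF VL y] by (rule sums_unique)
    then show ?thesis by simp
  qed
  then have "random_Hs D lam \<phi> M 0 V" using VL by (auto simp: random_Hs_def Hs_zero)
  moreover have "AE w in M. \<forall>k. coef (V w) k = v k w"
  proof -
    have "(\<integral>\<^sup>+w. (\<Sum>k. ennreal ((v k w)^2)) \<partial>M) = (\<Sum>k. E2 M (v k))" by (rule nn_integral_suminf) measurable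
    also have "\<dots> \<le> ennreal (1 / lam 0 powr \<sigma>) * wsm v" by (rule weight_zero_le)
    also have "\<dots> < \<infinity>" using fin by (simp add: ennreal_mult_less_top)
    finally have "AE w in M. (\<Sum>k. ennreal ((v k w)^2)) \<noteq> \<infinity>" by (intro nn_integral_PInf_AE) auto
    then show ?thesis by eventually_elim (simp add: coefV good_def)
  qed
  ultimately show ?thesis by blast
qed

text \<open>The difference quotients converge in the norm with weight \<open>\<sigma> \<ge> 0\<close>, which is stronger than
convergence in \<open>L\<^sup>2(\<Omega>; L\<^sup>2(D))\<close> because the eigenvalues are bounded below by \<open>lam 0 > 0\<close>.\<close>

theorem time_derivative_bound:
  "\<exists>v. has_time_derivative D lam \<phi> M T u v \<and>
     (\<exists>C::real. (SUP t\<in>{0..T}. second_moment D lam \<phi> M \<sigma> (v t)) \<le> ennreal C)"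
proof -
  obtain C where C: "C \<ge> 0" "\<And>t r. t \<in> {0..T} ==> r \<in> {0..T} ==> r \<noteq> t ==> wsm (\<lambda>k. difference_quotient k t r) \<le> ennreal C"
    using quotient_bounded by metis
  have "\<exists>V. random_Hs D lam \<phi> M 0 V \<and> second_moment D lam \<phi> M \<sigma> V \<le> 2 * ennreal C \<and>
     (\<forall>X. (\<forall>n. X n \<in> {0..T} \<and> X n \<noteq> t) \<longrightarrow> X \<longlonglongrightarrow> t \<longrightarrow> (\<lambda>n. wsm (\<lambda>k w. difference_quotient k t (X n) w - coef (V w) k)) \<longlonglongrightarrow> 0)"
    if t: "t \<in> {0..T}" for t
  proof -
    obtain v where v: "\<And>k. v k \<in> borel_measurable M" "wsm v \<le> 2 * ennreal C"
      "\<And>X. (\<forall>n. X n \<in> {0..T} \<and> X n \<noteq> t) ==> X \<longlonglongrightarrow> t ==> (\<lambda>n. wsm (\<lambda>k w. difference_quotient k t (X n) w - v k w)) \<longlonglongrightarrow> 0"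
      using derivative_coefficients[OF t C(2)[OF t]] by blast
    have "wsm v < \<infinity>" using v(2) by (rule le_less_trans) (simp add: ennreal_mult_less_top)
    from realize_coefficients[OF v(1) this] obtain V where
      V: "random_Hs D lam \<phi> M 0 V" "AE w in M. \<forall>k. coef (V w) k = v k w" by blast
    have e1: "E2 M (\<lambda>w. coef (V w) k) = E2 M (v k)" for k
      by (rule nn_integral_cong_AE, use V(2) in eventually_elim) simp
    have e2: "E2 M (\<lambda>w. difference_quotient k t r w - coef (V w) k) = E2 M (\<lambda>w. difference_quotient k t r w - v k w)" for k r
      by (rule nn_integral_cong_AE, use V(2) in eventually_elim) simp
    have "second_moment D lam \<phi> M \<sigma> V \<le> 2 * ennreal C"
      using v(2) by (simp add: second_moment_coef[OF random_Hs_coef[OF V(1)]] e1 wsm_def)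
    moreover have "(\<lambda>n. wsm (\<lambda>k w. difference_quotient k t (X n) w - coef (V w) k)) \<longlonglongrightarrow> 0"
      if "\<forall>n. X n \<in> {0..T} \<and> X n \<noteq> t" "X \<longlonglongrightarrow> t" for X
      using v(3)[OF that] by (simp add: wsm_def e2)
    ultimately show ?thesis using V(1) by blast
  qed
  then have "\<forall>t\<in>{0..T}. \<exists>V. random_Hs D lam \<phi> M 0 V \<and> second_moment D lam \<phi> M \<sigma> V \<le> 2 * ennreal C \<and>
     (\<forall>X. (\<forall>n. X n \<in> {0..T} \<and> X n \<noteq> t) \<longrightarrow> X \<longlonglongrightarrow> t \<longrightarrow> (\<lambda>n. wsm (\<lambda>k w. difference_quotient k t (X n) w - coef (V w) k)) \<longlonglongrightarrow> 0)" by blast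
  from bchoice[OF this] obtain v where v: "\<And>t. t \<in> {0..T} ==> random_Hs D lam \<phi> M 0 (v t)"
     "\<And>t. t \<in> {0..T} ==> second_moment D lam \<phi> M \<sigma> (v t) \<le> 2 * ennreal C"
     "\<And>t X. t \<in> {0..T} ==> (\<forall>n. X n \<in> {0..T} \<and> X n \<noteq> t) ==> X \<longlonglongrightarrow> t ==> (\<lambda>n. wsm (\<lambda>k w. difference_quotient k t (X n) w - coef (v t w) k)) \<longlonglongrightarrow> 0"
    by blast
  have weight0: "second_moment D lam \<phi> M 0 Z \<le> ennreal (1 / lam 0 powr \<sigma>) * wsm (\<lambda>k w. coef (Z w) k)"
    if "\<And>k. (\<lambda>w. coef (Z w) k) \<in> borel_measurable M" for Z
    unfolding second_moment_coef[of Z, OF that] using weight_zero_le[of "\<lambda>k w. coef (Z w) k"] lam_pos' by (simp add: less_imp_neq[symmetric])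
  have deriv: "has_time_derivative D lam \<phi> M T u v"
    unfolding has_time_derivative_def
  proof (intro ballI conjI)
    fix t assume t: "t \<in> {0..T}"
    note vm = random_Hs_coef[OF v(1)[OF t]]
    have vL: "v t w \<in> L2 D" if "w \<in> space M" for w
      using v(1)[OF t] that by (auto simp: random_Hs_def Hs_zero)
    show "random_Hs D lam \<phi> M 0 (v t)" by (rule v(1)[OF t])
    have "second_moment D lam \<phi> M 0 (v t) \<le> ennreal (1 / lam 0 powr \<sigma>) * second_moment D lam \<phi> M \<sigma> (v t)"
      using weight0[OF vm] by (simp add: second_moment_coef[OF vm] wsm_def)
    also have "\<dots> \<le> ennreal (1 / lam 0 powr \<sigma>) * (2 * ennreal C)" by (intro mult_left_mono v(2) t) simp
    also have "\<dots> < \<infinity>" by (simp add: ennreal_mult_less_top)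
    finally show "second_moment D lam \<phi> M 0 (v t) < \<infinity>" .
    show "((\<lambda>r. second_moment D lam \<phi> M 0 (\<lambda>w x. (u r w x - u t w x) / (r - t) - v t w x)) \<longlongrightarrow> 0) (at t within {0..T})"
      unfolding tendsto_at_iff_sequentially comp_def
    proof (intro allI impI)
      fix X :: "nat => real" assume X: "\<forall>n. X n \<in> {0..T} - {t}" "X \<longlonglongrightarrow> t"
      have X1: "X n \<in> {0..T}" "X n \<noteq> t" for n using X(1) by auto
      have coef_eq: "coef (\<lambda>x. (u (X n) w x - u t w x) / (X n - t) - v t w x) k = difference_quotient k t (X n) w - coef (v t w) k"
        if w: "w \<in> space M" for n w k
      proof -
        have uL: "u (X n) w \<in> L2 D" "u t w \<in> L2 D" using u_Hs[OF X1(1) w] u_Hs[OF t w] by (auto dest: Hs_L2)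
        have "(\<lambda>x. (u (X n) w x - u t w x) / (X n - t) - v t w x) = (\<lambda>x. (1 / (X n - t)) * (u (X n) w x - u t w x) - v t w x)" by simp
        then show ?thesis
          using uL vL[OF w] phi_L2[of k]
          by (simp only: L2_inner_diff L2_inner_cmult L2_cmult L2_diff difference_quotient_def) simp
      qed
      have mm: "(\<lambda>w. coef (\<lambda>x. (u (X n) w x - u t w x) / (X n - t) - v t w x) k) \<in> borel_measurable M" for n k
      proof -
        have "(\<lambda>w. difference_quotient k t (X n) w - coef (v t w) k) \<in> borel_measurable M"
          by (intro borel_measurable_diff quotient_measurable t X1 vm)
        then show ?thesis by (subst measurable_cong[OF coef_eq])
      qed
      have "second_moment D lam \<phi> M 0 (\<lambda>w x. (u (X n) w x - u t w x) / (X n - t) - v t w x)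
         \<le> ennreal (1 / lam 0 powr \<sigma>) * wsm (\<lambda>k w. difference_quotient k t (X n) w - coef (v t w) k)" for n
      proof -
        have "wsm (\<lambda>k w. coef (\<lambda>x. (u (X n) w x - u t w x) / (X n - t) - v t w x) k) = wsm (\<lambda>k w. difference_quotient k t (X n) w - coef (v t w) k)"
          unfolding wsm_def by (intro suminf_cong arg_cong[where f = "\<lambda>x. _ * x"] nn_integral_cong) (simp only: coef_eq)
        then show ?thesis using weight0[OF mm, of n] by (simp only:)
      qed
      note le = this
      have "(\<lambda>n. ennreal (1 / lam 0 powr \<sigma>) * wsm (\<lambda>k w. difference_quotient k t (X n) w - coef (v t w) k)) \<longlonglongrightarrow> ennreal (1 / lam 0 powr \<sigma>) * 0"
        by (intro ennreal_tendsto_cmult v(3) t X) (use X1 in auto)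
      then have lim: "(\<lambda>n. ennreal (1 / lam 0 powr \<sigma>) * wsm (\<lambda>k w. difference_quotient k t (X n) w - coef (v t w) k)) \<longlonglongrightarrow> 0" by simp
      show "(\<lambda>n. second_moment D lam \<phi> M 0 (\<lambda>w x. (u (X n) w x - u t w x) / (X n - t) - v t w x)) \<longlonglongrightarrow> 0"
        by (rule tendsto_0_of_le[OF le lim])
    qed
  qed
  have "(SUP t\<in>{0..T}. second_moment D lam \<phi> M \<sigma> (v t)) \<le> 2 * ennreal C"
    by (intro SUP_least v(2))
  also have "\<dots> = ennreal (2 * C)" using C(1) by (simp add: ennreal_mult)
  finally show ?thesis using deriv by blast
qed

end

section \<open>The regularity estimate\<close>

context dirichlet_basis
begin

lemma weight_mono:
  assumes "s \<le> s'"
  shows "lam k powr s \<le> lam 0 powr (s - s') * lam k powr s'"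
proof -
  have "lam k powr (s - s') \<le> lam 0 powr (s - s')"
    using assms lam_pos lam_mono[of k] by (intro powr_mono2') auto
  then have "lam k powr (s - s') * lam k powr s' \<le> lam 0 powr (s - s') * lam k powr s'"
    by (rule mult_right_mono) simp
  then show ?thesis by (simp add: powr_add[symmetric])
qed

lemma Hs_mono:
  assumes "s \<le> s'"
  shows "Hs D lam \<phi> s' \<subseteq> Hs D lam \<phi> s"
proof
  fix v assume v: "v \<in> Hs D lam \<phi> s'"
  have "summable (\<lambda>k. lam k powr s * (coef v k)^2)"
  proof (rule summable_comparison_test)
    show "summable (\<lambda>k. lam 0 powr (s - s') * (lam k powr s' * (coef v k)^2))"
      by (intro summable_mult Hs_summable v)
    show "\<exists>K. \<forall>k\<ge>K. norm (lam k powr s * (coef v k)^2) \<le> lam 0 powr (s - s') * (lam k powr s' * (coef v k)^2)"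
      using weight_mono[OF assms] by (auto simp: mult.assoc[symmetric] intro!: mult_right_mono)
  qed
  then show "v \<in> Hs D lam \<phi> s" using v by (auto simp: Hs_def)
qed

lemma second_moment_mono:
  assumes "s \<le> s'"
    and m: "\<And>k. (\<lambda>w. coef (X w) k) \<in> borel_measurable M"
  shows "second_moment D lam \<phi> M s X \<le> ennreal (lam 0 powr (s - s')) * second_moment D lam \<phi> M s' X"
proof -
  have "second_moment D lam \<phi> M s X \<le> (\<Sum>k. ennreal (lam 0 powr (s - s')) * (ennreal (lam k powr s') * E2 M (\<lambda>w. coef (X w) k)))"
    unfolding second_moment_coef[of X, OF m]
  proof (intro suminf_le allI summableI)
    fix k
    have "ennreal (lam k powr s) \<le> ennreal (lam 0 powr (s - s')) * ennreal (lam k powr s')"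
      using ennreal_leI[OF weight_mono[OF assms(1), of k]] by (simp add: ennreal_mult)
    then show "ennreal (lam k powr s) * E2 M (\<lambda>w. coef (X w) k) \<le> ennreal (lam 0 powr (s - s')) * (ennreal (lam k powr s') * E2 M (\<lambda>w. coef (X w) k))"
      unfolding mult.assoc[symmetric] by (rule mult_right_mono) simp
  qed
  then show ?thesis by (simp add: second_moment_coef[of X, OF m])
qed

lemma random_Hs_0: "random_Hs D lam \<phi> M s X ==> random_Hs D lam \<phi> M 0 X"
  using Hs_L2 by (auto simp: random_Hs_def Hs_zero)

lemma second_moment_triangle:
  assumes X: "random_Hs D lam \<phi> M 0 X" and Y: "random_Hs D lam \<phi> M 0 Y"
  shows "second_moment D lam \<phi> M s X \<le> 2 * second_moment D lam \<phi> M s (\<lambda>w x. X w x - Y w x) + 2 * second_moment D lam \<phi> M s Y"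
proof -
  note Xm = random_Hs_coef[OF X] and Ym = random_Hs_coef[OF Y]
  have eq: "coef (\<lambda>x. X w x - Y w x) k = coef (X w) k - coef (Y w) k" if "w \<in> space M" for w k
    using X Y that phi_L2[of k] by (intro L2_inner_diff) (auto simp: random_Hs_def Hs_zero)
  have Zm: "(\<lambda>w. coef (\<lambda>x. X w x - Y w x) k) \<in> borel_measurable M" for k
  proof -
    have "(\<lambda>w. coef (X w) k - coef (Y w) k) \<in> borel_measurable M" by (intro borel_measurable_diff Xm Ym)
    then show ?thesis by (subst measurable_cong[OF eq])
  qed
  have E: "E2 M (\<lambda>w. coef (\<lambda>x. X w x - Y w x) k) = E2 M (\<lambda>w. coef (X w) k - coef (Y w) k)" for k
    by (intro nn_integral_cong) (simp add: eq)
  have "second_moment D lam \<phi> M s X \<le> (\<Sum>k. 2 * (ennreal (lam k powr s) * E2 M (\<lambda>w. coef (\<lambda>x. X w x - Y w x) k)) + 2 * (ennreal (lam k powr s) * E2 M (\<lambda>w. coef (Y w) k)))"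
    unfolding second_moment_coef[of X, OF Xm]
  proof (intro suminf_le allI summableI)
    fix k
    have "E2 M (\<lambda>w. coef (X w) k - 0) \<le> 2 * E2 M (\<lambda>w. coef (X w) k - coef (Y w) k) + 2 * E2 M (\<lambda>w. coef (Y w) k - 0)"
      by (intro E2_triangle Xm Ym) simp
    then have "ennreal (lam k powr s) * E2 M (\<lambda>w. coef (X w) k)
       \<le> ennreal (lam k powr s) * (2 * E2 M (\<lambda>w. coef (X w) k - coef (Y w) k) + 2 * E2 M (\<lambda>w. coef (Y w) k))"
      by (intro mult_left_mono) simp_all
    then show "ennreal (lam k powr s) * E2 M (\<lambda>w. coef (X w) k) \<le> 2 * (ennreal (lam k powr s) * E2 M (\<lambda>w. coef (\<lambda>x. X w x - Y w x) k)) + 2 * (ennreal (lam k powr s) * E2 M (\<lambda>w. coef (Y w) k))"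
      by (simp add: E distrib_left mult.left_commute)
  qed
  also have "\<dots> = 2 * second_moment D lam \<phi> M s (\<lambda>w x. X w x - Y w x) + 2 * second_moment D lam \<phi> M s Y"
    unfolding second_moment_coef[of Y, OF Ym] second_moment_coef[of "\<lambda>w x. X w x - Y w x", OF Zm]
    by (simp add: suminf_add[symmetric])
  finally show ?thesis .
qed

text \<open>Mean-square continuity bounds the second moments near each time, and \<open>[0,T]\<close> is compact.\<close>

lemma ms_continuous_bounded:
  assumes ms: "ms_continuous D lam \<phi> M T s u"
  obtains C where "C \<ge> 0" "\<And>t. t \<in> {0..T} ==> second_moment D lam \<phi> M s (u t) \<le> ennreal C"
proof -
  have local: "\<exists>\<delta>>0. \<exists>C. \<forall>r\<in>{0..T}. dist r t < \<delta> \<longrightarrow> second_moment D lam \<phi> M s (u r) \<le> ennreal C" if t: "t \<in> {0..T}" for t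
  proof -
    have ran: "random_Hs D lam \<phi> M 0 (u r)" if "r \<in> {0..T}" for r
      using ms that by (intro random_Hs_0[of M s]) (auto simp: ms_continuous_def)
    have fin: "second_moment D lam \<phi> M s (u t) < \<infinity>"
      and lim: "((\<lambda>r. second_moment D lam \<phi> M s (\<lambda>w x. u r w x - u t w x)) \<longlongrightarrow> 0) (at t within {0..T})"
      using ms t by (auto simp: ms_continuous_def)
    have "eventually (\<lambda>r. second_moment D lam \<phi> M s (\<lambda>w x. u r w x - u t w x) < 1) (at t within {0..T})"
      by (rule order_tendstoD(2)[OF lim]) simp
    then obtain \<delta> where \<delta>: "\<delta> > 0"
      "\<And>r. r \<in> {0..T} ==> r \<noteq> t ==> dist r t < \<delta> ==> second_moment D lam \<phi> M s (\<lambda>w x. u r w x - u t w x) < 1"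
      by (auto simp: eventually_at)
    define B where "B = 2 * 1 + 2 * second_moment D lam \<phi> M s (u t)"
    have B: "B < \<top>" using fin by (simp add: B_def ennreal_mult_less_top)
    have "second_moment D lam \<phi> M s (u r) \<le> B" if r: "r \<in> {0..T}" "dist r t < \<delta>" for r
    proof (cases "r = t")
      case True
      have "1 * second_moment D lam \<phi> M s (u t) \<le> 2 * second_moment D lam \<phi> M s (u t)" by (intro mult_right_mono) auto
      then show ?thesis unfolding True B_def by (intro add_increasing) auto
    next
      case False
      have "second_moment D lam \<phi> M s (u r) \<le> 2 * second_moment D lam \<phi> M s (\<lambda>w x. u r w x - u t w x) + 2 * second_moment D lam \<phi> M s (u t)"
        by (intro second_moment_triangle ran r t)
      also have "\<dots> \<le> B" unfolding B_def using \<delta>(2)[OF r(1) False r(2)] by (intro add_right_mono mult_left_mono) auto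
      finally show ?thesis .
    qed
    then show ?thesis using \<delta>(1) B by (intro exI[of _ \<delta>] conjI exI[of _ "enn2real B"]) auto
  qed
  have "\<exists>n::nat. \<forall>t\<in>{0..T}. second_moment D lam \<phi> M s (u t) \<le> ennreal (real n)"
  proof (rule ccontr)
    assume "\<not> ?thesis"
    then have "\<forall>n. \<exists>t. t \<in> {0..T} \<and> ennreal (real n) < second_moment D lam \<phi> M s (u t)" by (meson not_le)
    from choice[OF this] obtain x where
      "\<forall>n. x n \<in> {0..T} \<and> ennreal (real n) < second_moment D lam \<phi> M s (u (x n))" ..
    then have x: "\<And>n. x n \<in> {0..T}" "\<And>n. ennreal (real n) < second_moment D lam \<phi> M s (u (x n))" by blast+
    obtain t r where t: "t \<in> {0..T}" and r: "strict_mono r" "(x \<circ> r) \<longlonglongrightarrow> t"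
      using compact_Icc[of 0 T, unfolded compact_def, rule_format, of x] x(1) by blast
    obtain \<delta> C where \<delta>: "\<delta> > 0" "\<And>y. y \<in> {0..T} ==> dist y t < \<delta> ==> second_moment D lam \<phi> M s (u y) \<le> ennreal C"
      using local[OF t] by blast
    have "eventually (\<lambda>n. dist ((x \<circ> r) n) t < \<delta>) sequentially" using r(2) \<delta>(1) by (rule tendstoD)
    moreover have "eventually (\<lambda>n. C < real n) sequentially" by real_asymp
    ultimately have "eventually (\<lambda>n. False) sequentially"
    proof eventually_elim
      fix n assume n: "dist ((x \<circ> r) n) t < \<delta>" "C < real n"
      have "ennreal (real n) \<le> ennreal (real (r n))" using seq_suble[OF r(1), of n] by (intro ennreal_leI) simp
      also have "\<dots> < second_moment D lam \<phi> M s (u (x (r n)))" by (rule x)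
      also have "\<dots> \<le> ennreal C" using n(1) by (intro \<delta>(2) x) simp
      finally show False using n(2) by (simp add: ennreal_less_iff not_less)
    qed
    then show False by simp
  qed
  then obtain n :: nat where "\<forall>t\<in>{0..T}. second_moment D lam \<phi> M s (u t) \<le> ennreal (real n)" ..
  then show thesis by (intro that[of "real n"]) auto
qed

end

lemma random_Hs_subalgebra:
  assumes "subalgebra M F" "random_Hs D lam \<phi> F s X"
  shows "random_Hs D lam \<phi> M s X"
  unfolding random_Hs_def
proof (intro conjI ballI)
  show "X w \<in> Hs D lam \<phi> s" if "w \<in> space M" for w
    using assms that by (auto simp: random_Hs_def subalgebra_def)
  show "(\<lambda>w. L2_inner D (X w) v) \<in> borel_measurable M" if "v \<in> L2 D" for v
    using assms(2) that by (intro measurable_from_subalg[OF assms(1)]) (auto simp: random_Hs_def)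
qed

text \<open>Adding a geometric sequence makes the common bound strictly positive, so that it can be divided by.\<close>

lemma condition_A2_weights:
  assumes A2: "condition_A2 T \<kappa> \<rho>" and T: "T > 0"
  obtains wt where "\<And>l. wt l > 0" "summable wt"
    "\<And>l s. s \<in> {0..T} ==> \<bar>\<kappa> l s\<bar> \<le> wt l" "\<And>l s. s \<in> {0..T} ==> \<bar>\<rho> l s\<bar> \<le> wt l"
    "\<And>l. continuous_on {0..T} (\<rho> l)"
proof -
  obtain \<mu> \<mu>' where \<mu>: "summable \<mu>" "summable \<mu>'" "\<And>k. continuous_on {0..T} (\<rho> k)"
    "\<And>k t. t \<in> {0..T} ==> \<bar>\<kappa> k t\<bar> \<le> \<mu> k \<and> \<bar>\<rho> k t\<bar> \<le> \<mu>' k"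
    using A2 unfolding condition_A2_def by blast
  have nn: "0 \<le> \<mu> k" "0 \<le> \<mu>' k" for k using \<mu>(4)[of 0 k] T by auto
  have sm: "summable (\<lambda>k. (1 / 2 :: real) ^ k)" by (rule summable_geometric) simp
  show thesis
  proof (rule that[of "\<lambda>k. \<mu> k + \<mu>' k + (1 / 2) ^ k"])
    show "0 < \<mu> l + \<mu>' l + (1 / 2) ^ l" for l using nn[of l] by (simp add: add_nonneg_pos)
    show "summable (\<lambda>k. \<mu> k + \<mu>' k + (1 / 2) ^ k)" by (intro summable_add \<mu> sm)
    show "\<bar>\<kappa> l s\<bar> \<le> \<mu> l + \<mu>' l + (1 / 2) ^ l" "\<bar>\<rho> l s\<bar> \<le> \<mu> l + \<mu>' l + (1 / 2) ^ l" if "s \<in> {0..T}" for l s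
      using \<mu>(4)[OF that, of l] nn[of l] zero_le_power[of "1 / 2 :: real" l] by linarith+
  qed (rule \<mu>)
qed

theorem theorem2:
  fixes D :: "'d::euclidean_space set"
    and lam :: "nat \<Rightarrow> real" and \<phi> :: "nat \<Rightarrow> 'd \<Rightarrow> real"
    and e :: "nat \<Rightarrow> 'u::{real_inner, complete_space}"
    and M :: "'w measure" and F :: "real \<Rightarrow> 'w measure"
    and T \<alpha> \<beta> \<gamma> \<gamma>t \<nu> H :: real
    and \<xi> \<xi>H :: "nat \<Rightarrow> real \<Rightarrow> 'w \<Rightarrow> real"
    and I :: "nat \<Rightarrow> (real \<Rightarrow> 'w \<Rightarrow> real) \<Rightarrow> 'w \<Rightarrow> real"
    and \<kappa> \<rho> :: "nat \<Rightarrow> real \<Rightarrow> real"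
    and f :: "real \<Rightarrow> ('d \<Rightarrow> real) \<Rightarrow> ('d \<Rightarrow> real)"
    and g h :: "real \<Rightarrow> ('d \<Rightarrow> real) \<Rightarrow> 'u \<Rightarrow> ('d \<Rightarrow> real)"
    and a b :: "'w \<Rightarrow> 'd \<Rightarrow> real"
    and u :: "real \<Rightarrow> 'w \<Rightarrow> 'd \<Rightarrow> real"
  assumes "DIM('d) \<in> {1, 2, 3}" and "convex_polygonal_domain D" and "T > 0"
    and "dirichlet_eigenbasis D lam \<phi>" and "hilbert_basis e"
    and "complete_filtered_prob_space M F"
    and "\<And>k. brownian_motion M F (\<xi> k)" and "indep_processes M \<xi>"
    and "\<And>k. fractional_brownian_motion M H (\<xi>H k)" and "indep_processes M \<xi>H"
    and "\<And>k. fbm_integral M T H (\<xi>H k) (I k)"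
    and "3 / 2 < \<alpha>" and "\<alpha> < 2" and "1 / 2 < \<beta>" and "\<beta> \<le> 1" and "\<nu> > 0"
    and "1 / 2 < H" and "H < 1"
    and "\<gamma> \<ge> 0" and "condition_A1 D lam \<phi> e \<alpha> \<beta> \<gamma> f g h" and "condition_A2 T \<kappa> \<rho>"
    and "\<gamma>t = max \<gamma> (\<beta> / \<alpha>)"
    and "random_Hs D lam \<phi> (F 0) (2 * \<gamma>t) a"
    and "random_Hs D lam \<phi> (F 0) (2 * \<gamma>t - 2 * \<beta> / \<alpha>) b"
    and "second_moment D lam \<phi> M (2 * \<gamma>t) a < \<infinity>"
    and "second_moment D lam \<phi> M (2 * \<gamma>t - 2 * \<beta> / \<alpha>) b < \<infinity>"
    and "ms_continuous D lam \<phi> M T (2 * \<gamma>t) u"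
    and "mild_solution D lam \<phi> e M F T \<xi> I \<kappa> \<rho> \<alpha> \<beta> \<nu> f g h a b u"
  shows "\<exists>v. has_time_derivative D lam \<phi> M T u v \<and>
           (\<exists>C::real. (SUP t\<in>{0..T}. second_moment D lam \<phi> M (2 * \<gamma>t - 2 * \<beta> / \<alpha>) (v t)) \<le> ennreal C)"
proof -
  interpret dirichlet_basis D lam \<phi>
    by unfold_locales fact+
  have sub: "subalgebra M (F 0)" and M: "prob_space M"
    using \<open>complete_filtered_prob_space M F\<close> by (auto simp: complete_filtered_prob_space_def)
  interpret prob_space M by fact
  define \<sigma> where "\<sigma> = 2 * \<gamma>t - 2 * \<beta> / \<alpha>"
  have pos: "\<beta> > 0" "\<alpha> > 0" using \<open>1 / 2 < \<beta>\<close> \<open>3 / 2 < \<alpha>\<close> by auto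
  have \<sigma>: "\<sigma> \<ge> 0" "\<sigma> \<le> 2 * \<gamma>t" "\<sigma> + 2 * \<beta> / \<alpha> = 2 * \<gamma>t"
    using \<open>\<gamma>t = max \<gamma> (\<beta> / \<alpha>)\<close> pos by (auto simp: \<sigma>_def)
  obtain \<Lambda> L where \<Lambda>: "weighted_norm \<sigma> \<Lambda>"
    "admissible \<sigma> \<Lambda> L (\<lambda>l t v. if l = 0 then f t v else (\<lambda>x. 0))"
    "admissible \<sigma> \<Lambda> L (\<lambda>l t v. g t v (e l))" "admissible \<sigma> \<Lambda> L (\<lambda>l t v. h t v (e l))"
    using condition_A1_admissible[OF \<open>condition_A1 D lam \<phi> e \<alpha> \<beta> \<gamma> f g h\<close> \<open>\<gamma> \<ge> 0\<close>, of \<sigma>]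
      \<open>\<gamma>t = max \<gamma> (\<beta> / \<alpha>)\<close> \<sigma>_def by metis
  obtain wt where wt: "\<And>l. wt l > 0" "summable wt"
    "\<And>l s. s \<in> {0..T} ==> \<bar>\<kappa> l s\<bar> \<le> wt l" "\<And>l s. s \<in> {0..T} ==> \<bar>\<rho> l s\<bar> \<le> wt l"
    "\<And>l. continuous_on {0..T} (\<rho> l)"
    using condition_A2_weights[OF \<open>condition_A2 T \<kappa> \<rho>\<close> \<open>T > 0\<close>] by metis
  note ms = \<open>ms_continuous D lam \<phi> M T (2 * \<gamma>t) u\<close>
  have u_random: "random_Hs D lam \<phi> M (2 * \<gamma>t) (u s)" if "s \<in> {0..T}" for s
    using ms that by (auto simp: ms_continuous_def)
  obtain C where C: "C \<ge> 0" "\<And>t. t \<in> {0..T} ==> second_moment D lam \<phi> M (2 * \<gamma>t) (u t) \<le> ennreal C"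
    using ms_continuous_bounded[OF ms] by metis
  define Cu where "Cu = lam 0 powr (\<sigma> - 2 * \<gamma>t) * C"
  have u_moment: "second_moment D lam \<phi> M \<sigma> (u s) \<le> ennreal Cu" if "s \<in> {0..T}" for s
  proof -
    have "second_moment D lam \<phi> M \<sigma> (u s) \<le> ennreal (lam 0 powr (\<sigma> - 2 * \<gamma>t)) * second_moment D lam \<phi> M (2 * \<gamma>t) (u s)"
      by (intro second_moment_mono \<sigma> random_Hs_coef[OF u_random[OF that]])
    also have "\<dots> \<le> ennreal (lam 0 powr (\<sigma> - 2 * \<gamma>t)) * ennreal C" by (intro mult_left_mono C that) simp
    finally show ?thesis using C(1) by (simp add: Cu_def ennreal_mult)
  qed
  interpret mild_regularity D lam \<phi> M F e T \<alpha> \<beta> \<nu> H \<sigma> L Cu \<xi> \<xi>H I \<kappa> \<rho> wt \<Lambda> f g h a b u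
  proof unfold_locales
    show "u s w \<in> Hs D lam \<phi> \<sigma>" if "s \<in> {0..T}" "w \<in> space M" for s w
      using u_random[OF that(1)] that(2) Hs_mono[OF \<sigma>(2)] by (auto simp: random_Hs_def)
    show "random_Hs D lam \<phi> M 0 (u s)" if "s \<in> {0..T}" for s
      by (rule random_Hs_0[OF u_random[OF that]])
    show "random_Hs D lam \<phi> M 0 a" "random_Hs D lam \<phi> M 0 b"
      using random_Hs_0[OF random_Hs_subalgebra[OF sub]] assms by blast+
    show "second_moment D lam \<phi> M (\<sigma> + 2 * \<beta> / \<alpha>) a < \<infinity>" "second_moment D lam \<phi> M \<sigma> b < \<infinity>"
      using assms unfolding \<sigma>(3) by (auto simp: \<sigma>_def)
    show "Cu \<ge> 0" using C(1) by (simp add: Cu_def)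
  qed (use assms \<Lambda> wt \<sigma> pos u_moment in \<open>auto\<close>)
  show ?thesis using time_derivative_bound unfolding \<sigma>_def .
qed

end
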